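(* Let $F=\mathbb F_q$ be a finite field of characteristic different from $2$ and $3$, let $B/F$ be a finite étale cubic $F$-algebra, and let $T_B(F)=\{h\in B^\times:\operatorname{Norm}_{B/F}(h)=1\}$. Let $H\subset T_B(F)$ be a subgroup of index $m$, let $g\in T_B(F)$, let $\gamma\in B^\times$, and let $s\in F$ satisfy $s^3\neq 27\operatorname{Norm}_{B/F}(\gamma)$. Define \[ N_{gH,B}(s;\gamma)=\#\{h\in gH:\operatorname{Tr}_{B/F}(\gamma h)=s\}. \] Then \[ N_{gH,B}(s;\gamma)=\frac1m N_B\bigl(s,\operatorname{Norm}_{B/F}(\gamma)\bigr)+E_{gH,B}(s;\gamma),\qquad |E_{gH,B}(s;\gamma)|\le 3\Bigl(1-\frac1m\Bigr)\sqrt q<3\sqrt q, \] where $E_{gH,B}(s;\gamma)$ is defined by the displayed identity.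
   Context: For $s\in F$ and $n\in F^\times$, $N_B(s,n)=\#\{x\in B^\times:\operatorname{Tr}_{B/F}(x)=s,\ \operatorname{Norm}_{B/F}(x)=n\}$ (the affine prescribed trace/norm count). *)

theory Defs
  imports
    "HOL-Analysis.Analysis"
    "HOL-Algebra.Algebra"
    "HOL-Algebra.Algebraic_Closure_Type"
begin

locale field_algebra = vector_space smul
  for smul :: "'f::field \<Rightarrow> 'b::comm_ring_1 \<Rightarrow> 'b" +
  assumes smul_mult_left: "smul c x * y = smul c (x * y)"


text \<open>A finite separable extension of \<open>F\<close>, realised inside the algebraic closure of \<open>F\<close>.\<close>

definition finite_separable_extension :: "'f::field alg_closure set \<Rightarrow> bool" where
  "finite_separable_extension K \<longleftrightarrow>
     subfield K ring_of_type_algebra \<and>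
     range to_ac \<subseteq> K \<and>
     (\<exists>S. finite S \<and> K = module.span (\<lambda>c x. to_ac c * x) S) \<and>
     (\<forall>x\<in>K. \<exists>p :: 'f poly. Factorial_Ring.irreducible p \<and> poly (map_poly to_ac p) x = 0
                           \<and> rsquarefree (map_poly to_ac p))"

text \<open>A finite etale algebra over a field is one isomorphic to a finite product of finite
  separable field extensions.  Every such extension embeds into the algebraic closure, so
  letting the factors range over subfields of the closure loses no generality.\<close>

definition finite_etale_algebra :: "('f::field \<Rightarrow> 'b::comm_ring_1 \<Rightarrow> 'b) \<Rightarrow> bool" where
  "finite_etale_algebra smul \<longleftrightarrow>
     field_algebra smul \<and>
     (\<exists>(n::nat) (K :: nat \<Rightarrow> 'f alg_closure set) (\<phi> :: 'b \<Rightarrow> nat \<Rightarrow> 'f alg_closure).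
        (\<forall>i<n. finite_separable_extension (K i)) \<and>
        bij_betw \<phi> UNIV (PiE {..<n} K) \<and>
        (\<forall>i<n. \<phi> 1 i = 1 \<and>
           (\<forall>x y. \<phi> (x + y) i = \<phi> x i + \<phi> y i) \<and>
           (\<forall>x y. \<phi> (x * y) i = \<phi> x i * \<phi> y i) \<and>
           (\<forall>c x. \<phi> (smul c x) i = to_ac c * \<phi> x i)))"

definition finite_etale_cubic_algebra :: "('f::field \<Rightarrow> 'b::comm_ring_1 \<Rightarrow> 'b) \<Rightarrow> bool" where
  "finite_etale_cubic_algebra smul \<longleftrightarrow>
     finite_etale_algebra smul \<and> vector_space.dim smul (UNIV :: 'b set) = 3"


definition indexed_basis ::
    "('f::field \<Rightarrow> 'b::comm_ring_1 \<Rightarrow> 'b) \<Rightarrow> ('n::finite \<Rightarrow> 'b) \<Rightarrow> bool" where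
  "indexed_basis smul v \<longleftrightarrow>
     inj v \<and> \<not> module.dependent smul (range v) \<and> module.span smul (range v) = UNIV"

text \<open>The matrix of multiplication by \<open>x\<close>: column \<open>j\<close> holds the coordinates of \<open>x * v j\<close>.\<close>

definition mult_matrix ::
    "('f::field \<Rightarrow> 'b::comm_ring_1 \<Rightarrow> 'b) \<Rightarrow> ('n::finite \<Rightarrow> 'b) \<Rightarrow> 'b \<Rightarrow> 'f^'n^'n" where
  "mult_matrix smul v x = (\<chi> i j. module.representation smul (range v) (x * v j) (v i))"

text \<open>Trace and norm of a three-dimensional algebra are the trace and determinant of
  multiplication by \<open>x\<close>; \<open>cubic_trace_eq\<close> and \<open>cubic_norm_eq\<close> below show that
  the choice of basis is immaterial.\<close>

definition cubic_trace :: "('f::field \<Rightarrow> 'b::comm_ring_1 \<Rightarrow> 'b) \<Rightarrow> 'b \<Rightarrow> 'f" where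
  "cubic_trace smul x =
     trace (mult_matrix smul (SOME v :: 3 \<Rightarrow> 'b. indexed_basis smul v) x)"

definition cubic_norm :: "('f::field \<Rightarrow> 'b::comm_ring_1 \<Rightarrow> 'b) \<Rightarrow> 'b \<Rightarrow> 'f" where
  "cubic_norm smul x =
     det (mult_matrix smul (SOME v :: 3 \<Rightarrow> 'b. indexed_basis smul v) x)"

definition norm_one_group ::
    "('f::field \<Rightarrow> 'b::comm_ring_1 \<Rightarrow> 'b) \<Rightarrow> 'b monoid" where
  "norm_one_group smul =
     \<lparr>carrier = {h. h dvd 1 \<and> cubic_norm smul h = 1}, mult = (*), one = 1\<rparr>"

definition trace_norm_count ::
    "('f::field \<Rightarrow> 'b::comm_ring_1 \<Rightarrow> 'b) \<Rightarrow> 'f \<Rightarrow> 'f \<Rightarrow> nat" where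
  "trace_norm_count smul s n =
     card {x. x dvd 1 \<and> cubic_trace smul x = s \<and> cubic_norm smul x = n}"

definition coset_trace_count ::
    "('f::field \<Rightarrow> 'b::comm_ring_1 \<Rightarrow> 'b) \<Rightarrow> 'b set \<Rightarrow> 'f \<Rightarrow> 'b \<Rightarrow> nat" where
  "coset_trace_count smul C s \<gamma> = card {h \<in> C. cubic_trace smul (\<gamma> * h) = s}"

definition coset_trace_error ::
    "('f::field \<Rightarrow> 'b::comm_ring_1 \<Rightarrow> 'b) \<Rightarrow> 'b \<Rightarrow> 'b set \<Rightarrow> 'f \<Rightarrow> 'b \<Rightarrow> real" where
  "coset_trace_error smul g H s \<gamma> =
     real (coset_trace_count smul (g <#\<^bsub>norm_one_group smul\<^esub> H) s \<gamma>)
     - 1 / real (card (rcosets\<^bsub>norm_one_group smul\<^esub> H))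
       * real (trace_norm_count smul s (cubic_norm smul \<gamma>))"


context field_algebra
begin

lemma basis_expansion:
  fixes v :: "'n::finite \<Rightarrow> 'b"
  assumes "indexed_basis smul v"
  shows "(\<Sum>i\<in>UNIV. smul (representation (range v) y (v i)) (v i)) = y"
proof -
  have inj: "inj v" and ind: "independent (range v)" and sp: "span (range v) = UNIV"
    using assms by (auto simp: indexed_basis_def)
  have "(\<Sum>b\<in>range v. smul (representation (range v) y b) b) = y"
    using ind sp by (intro sum_representation_eq) auto
  thus ?thesis using inj by (simp add: sum.reindex)
qed

lemma basis_coeff_unique:
  fixes v :: "'n::finite \<Rightarrow> 'b"
  assumes B: "indexed_basis smul v"
    and eq: "(\<Sum>i\<in>UNIV. smul (a i) (v i)) = y"
  shows "representation (range v) y (v i) = a i"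
proof -
  have inj: "inj v" and ind: "independent (range v)"
    using B by (auto simp: indexed_basis_def)
  define g where "g b = representation (range v) y b - a (inv_into UNIV v b)" for b
  have "(\<Sum>b\<in>range v. smul (g b) b) = 0"
    using inj eq basis_expansion[OF B, of y]
    by (simp add: sum.reindex g_def scale_left_diff_distrib sum_subtractf)
  hence "g (v i) = 0"
    using independentD[OF ind, of "range v" g "v i"] by auto
  thus ?thesis using inj by (simp add: g_def)
qed

lemma mult_matrix_change_basis:
  fixes v w :: "'n::finite \<Rightarrow> 'b"
  assumes v: "indexed_basis smul v" and w: "indexed_basis smul w"
  obtains P Q where "P ** Q = mat 1" "Q ** P = mat 1"
    "\<And>x. mult_matrix smul w x = P ** mult_matrix smul v x ** Q"
proof -
  let ?c = "\<lambda>(v :: 'n \<Rightarrow> 'b) y i. representation (range v) y (v i)"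
  have swap: "(\<Sum>i\<in>UNIV. smul (\<Sum>k\<in>UNIV. a k i * b k) (w i))
      = (\<Sum>k\<in>UNIV. smul (b k) (\<Sum>i\<in>UNIV. smul (a k i) (w i)))"
    for a :: "'n \<Rightarrow> 'n \<Rightarrow> 'f" and b :: "'n \<Rightarrow> 'f" and w :: "'n \<Rightarrow> 'b"
  proof -
    have "(\<Sum>i\<in>UNIV. smul (\<Sum>k\<in>UNIV. a k i * b k) (w i))
        = (\<Sum>i\<in>UNIV. \<Sum>k\<in>UNIV. smul (b k) (smul (a k i) (w i)))"
      by (simp add: scale_sum_left mult.commute)
    also have "\<dots> = (\<Sum>k\<in>UNIV. \<Sum>i\<in>UNIV. smul (b k) (smul (a k i) (w i)))"
      by (rule sum.swap)
    finally show ?thesis by (simp only: scale_sum_right)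
  qed
  have trans: "(\<Sum>k\<in>UNIV. ?c w (u k) i * ?c u y k) = ?c w y i"
    if "indexed_basis smul w" "indexed_basis smul u" for u w :: "'n \<Rightarrow> 'b" and y i
  proof -
    have "(\<Sum>i\<in>UNIV. smul (\<Sum>k\<in>UNIV. ?c w (u k) i * ?c u y k) (w i))
        = (\<Sum>k\<in>UNIV. smul (?c u y k) (\<Sum>i\<in>UNIV. smul (?c w (u k) i) (w i)))"
      by (rule swap)
    also have "\<dots> = y"
      by (simp add: basis_expansion that)
    finally show ?thesis
      by (intro basis_coeff_unique[OF that(1), symmetric])
  qed
  have self: "?c u (u k) i = (if i = k then 1 else 0)"
    if "indexed_basis smul u" for u :: "'n \<Rightarrow> 'b" and k i
  proof (rule basis_coeff_unique[OF that])
    have "(\<Sum>i\<in>UNIV. smul (if i = k then 1 else 0) (u i)) = (\<Sum>i\<in>UNIV. if i = k then u i else 0)"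
      by (intro sum.cong) auto
    thus "(\<Sum>i\<in>UNIV. smul (if i = k then 1 else 0) (u i)) = u k"
      by simp
  qed
  define P :: "'f^'n^'n" where "P = (\<chi> i j. ?c w (v j) i)"
  define Q :: "'f^'n^'n" where "Q = (\<chi> i j. ?c v (w j) i)"
  have PQ: "P ** Q = mat 1"
    by (simp add: P_def Q_def matrix_matrix_mult_def trans[OF w v] self[OF w] mat_def)
  have QP: "Q ** P = mat 1"
    by (simp add: P_def Q_def matrix_matrix_mult_def trans[OF v w] self[OF v] mat_def)
  have main: "mult_matrix smul w x = P ** mult_matrix smul v x ** Q" for x
  proof -
    have "P ** mult_matrix smul v x = mult_matrix smul w x ** P"
    proof -
      have "(\<Sum>k\<in>UNIV. ?c w (x * w k) i * ?c w (v j) k) = ?c w (x * v j) i" for i j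
      proof -
        have "(\<Sum>i\<in>UNIV. smul (\<Sum>k\<in>UNIV. ?c w (x * w k) i * ?c w (v j) k) (w i))
            = (\<Sum>k\<in>UNIV. smul (?c w (v j) k) (\<Sum>i\<in>UNIV. smul (?c w (x * w k) i) (w i)))"
          by (rule swap)
        also have "\<dots> = (\<Sum>k\<in>UNIV. smul (?c w (v j) k) (w k * x))"
          by (simp only: basis_expansion[OF w] mult.commute[of x])
        also have "\<dots> = (\<Sum>k\<in>UNIV. smul (?c w (v j) k) (w k)) * x"
          by (simp only: sum_distrib_right smul_mult_left)
        also have "\<dots> = x * v j"
          unfolding basis_expansion[OF w] by (rule mult.commute)
        finally show ?thesis
          by (intro basis_coeff_unique[OF w, symmetric])
      qed
      thus ?thesis
        by (simp add: P_def mult_matrix_def matrix_matrix_mult_def trans[OF w v])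
    qed
    hence "P ** mult_matrix smul v x ** Q = mult_matrix smul w x ** (P ** Q)"
      by (simp add: matrix_mul_assoc)
    thus ?thesis by (simp add: PQ)
  qed
  show thesis by (rule that[OF PQ QP main])
qed

lemma trace_mult_matrix_eq:
  fixes v w :: "'n::finite \<Rightarrow> 'b"
  assumes "indexed_basis smul v" "indexed_basis smul w"
  shows "trace (mult_matrix smul v x) = trace (mult_matrix smul w x)"
proof -
  obtain P Q where "P ** Q = mat 1" and PQ: "Q ** P = mat 1"
    "\<And>x. mult_matrix smul w x = P ** mult_matrix smul v x ** Q"
    by (rule mult_matrix_change_basis[OF assms]) (rule that)
  have "trace (mult_matrix smul w x) = trace (Q ** (P ** mult_matrix smul v x))"
    unfolding PQ(2) by (rule trace_mul_sym)
  also have "Q ** (P ** mult_matrix smul v x) = mult_matrix smul v x"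
    by (simp add: matrix_mul_assoc PQ(1))
  finally show ?thesis by simp
qed

lemma det_mult_matrix_eq:
  fixes v w :: "'n::finite \<Rightarrow> 'b"
  assumes "indexed_basis smul v" "indexed_basis smul w"
  shows "det (mult_matrix smul v x) = det (mult_matrix smul w x)"
proof -
  obtain P Q where PQ: "P ** Q = mat 1" and "Q ** P = mat 1"
    and eq: "\<And>x. mult_matrix smul w x = P ** mult_matrix smul v x ** Q"
    by (rule mult_matrix_change_basis[OF assms]) (rule that)
  have "det P * det Q = 1" using det_mul[of P Q] by (simp add: PQ)
  moreover have "det (mult_matrix smul w x) = det P * det Q * det (mult_matrix smul v x)"
    by (simp add: eq det_mul)
  ultimately show ?thesis by simp
qed

lemma cubic_trace_eq:
  assumes "indexed_basis smul (v :: 3 \<Rightarrow> 'b)"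
  shows "cubic_trace smul x = trace (mult_matrix smul v x)"
  unfolding cubic_trace_def
  by (rule trace_mult_matrix_eq[OF someI[where P = "indexed_basis smul", OF assms] assms])

lemma cubic_norm_eq:
  assumes "indexed_basis smul (v :: 3 \<Rightarrow> 'b)"
  shows "cubic_norm smul x = det (mult_matrix smul v x)"
  unfolding cubic_norm_def
  by (rule det_mult_matrix_eq[OF someI[where P = "indexed_basis smul", OF assms] assms])

lemma indexed_basis_exists:
  assumes "dim (UNIV :: 'b set) = 3"
  obtains v :: "3 \<Rightarrow> 'b" where "indexed_basis smul v"
proof -
  obtain B :: "'b set"
    where B: "independent B" "UNIV \<subseteq> span B" "card B = dim (UNIV :: 'b set)"
    by (rule basis_exists[of UNIV]) blast
  have cB: "card B = 3" by (simp only: B(3) assms)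
  have fB: "finite B" by (rule card_ge_0_finite) (simp add: cB)
  have "CARD(3) = card B" by (simp add: cB)
  with fB obtain v :: "3 \<Rightarrow> 'b" where "bij_betw v UNIV B"
    using finite_same_card_bij[OF finite_class.finite_UNIV] by blast
  hence "indexed_basis smul v"
    using B by (auto simp: indexed_basis_def bij_betw_def)
  thus thesis by (rule that)
qed

end

end

theory Submission
  imports Defs
begin

text \<open>
  Over the algebraic closure the algebra becomes a product of three lines on which Frobenius acts by
  \<open>v \<mapsto> (v\<^sub>\<rho>\<^sub>(\<^sub>i\<^sub>)\<^sup>q)\<close> for a permutation \<open>\<rho>\<close>, and the elements of trace \<open>s\<close> and norm \<open>n\<close> are
  the rational points of the smooth affine cubic \<open>x + y + z = s\<close>, \<open>x y z = n\<close>. Detecting the coset by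
  characters of the unit group reduces the claim to the bound \<open>3 \<surd>q\<close> for each character sum that is
  nontrivial on the norm one torus. Such a sum has an L-function, a sum over Frobenius-stable effective
  divisors; by Riemann-Roch on the cubic, relative to functions with leading coefficient one in
  all three branches at infinity, it is a polynomial of degree at most three. Stepanov's method
  bounds the points of the Kummer covers that trivialise the character over the extensions of degree
  \<open>6 j\<close>, and this growth estimate forces the inverse roots to have absolute value at most \<open>\<surd>q\<close>.
\<close>

text \<open>Stepanov's method bounds points only from above, only over fields with a large square
  number of elements, and with a constant depending on the cover. The L-function removes the
  constant, since power sums along the exponents \<open>6 * j\<close> already control the inverse
  roots. Multiples of 6 appear because \<rho> permutes three indices: after them Frobenius is a
  plain power and the torus is split. Upper bounds suffice, because the cubic and its quadratic
  twist together have a known number of points and the covers have a known average. The degree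
  three, hence the 3 in the bound, is 2g - 2 + 3 for genus g = 1 and three points at infinity, at
  each of which one leading coefficient is prescribed. The coordinates are units on the affine
  curve, so Weil reciprocity makes the character constant on the divisors of normalised functions.
  That the character separates divisors of equal degree, which the vanishing of the higher
  coefficients requires, follows from the point counts again: otherwise the character sum would be
  as large as the curve.\<close>

hide_const (open) up_ring.monom up_ring.coeff Module.smult Divisibility.prime Divisibility.irreducible
  Polynomials.degree Polynomials.lead_coeff

unbundle no vec_syntax

section \<open>Linear algebra and power series\<close>

text \<open>Stated for families instead of sets, so that a repeated vector also counts as a
  relation.\<close>

lemma (in vector_space) family_dependent:
  assumes "finite I" "finite S" "\<And>i. i \<in> I \<Longrightarrow> x i \<in> span S" "card S < card I"
  shows "\<exists>c. (\<exists>i\<in>I. c i \<noteq> 0) \<and> (\<Sum>i\<in>I. scale (c i) (x i)) = 0"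
proof (cases "inj_on x I")
  case True
  have "dependent (x ` I)"
    using independent_span_bound[OF assms(2), of "x ` I"] assms card_image[OF True] by auto
  then obtain u v where "v \<in> x ` I" "u v \<noteq> 0" "(\<Sum>v\<in>x`I. scale (u v) v) = 0"
    using dependent_finite[of "x ` I"] assms(1) by auto
  thus ?thesis using True by (intro exI[of _ "u \<circ> x"]) (auto simp: sum.reindex)
next
  case False
  then obtain i j where ij: "i \<in> I" "j \<in> I" "i \<noteq> j" "x i = x j" by (auto simp: inj_on_def)
  let ?c = "\<lambda>a. if a = i then 1 else if a = j then -1 else (0::'a)"
  have "(\<Sum>a\<in>I. scale (?c a) (x a)) = (\<Sum>a\<in>{i,j}. scale (?c a) (x a))"
    by (rule sum.mono_neutral_right) (use ij assms in auto)
  also have "\<dots> = 0" using ij by simp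
  finally show ?thesis using ij by (intro exI[of _ ?c]) auto
qed

text \<open>Bivariate polynomials are polynomials over polynomials. The two instances used below
  keep the inner variable formal, as a power series, or put a field element in its place.\<close>

locale coeff_hom =
  fixes h :: "'a::comm_ring_1 \<Rightarrow> 'b::comm_ring_1"
  assumes hom_0 [simp]: "h 0 = 0" and hom_1 [simp]: "h 1 = 1"
    and hom_add: "h (a + b) = h a + h b" and hom_mult: "h (a * b) = h a * h b"
begin

definition ev :: "'b \<Rightarrow> 'a poly \<Rightarrow> 'b" where
  "ev x p = poly (map_poly h p) x"

lemma ev_0 [simp]: "ev x 0 = 0"
  by (simp add: ev_def)

lemma ev_pCons [simp]: "ev x (pCons a p) = h a + x * ev x p"
  by (simp add: ev_def map_poly_pCons)

lemma ev_1 [simp]: "ev x 1 = 1"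
  by (simp add: ev_def)

lemma ev_add: "ev x (p + q) = ev x p + ev x q"
  by (induction p q rule: poly_induct2) (simp_all add: hom_add algebra_simps)

lemma ev_smult: "ev x (smult a p) = h a * ev x p"
  by (induction p) (simp_all add: hom_mult algebra_simps)

lemma ev_mult: "ev x (p * q) = ev x p * ev x q"
  by (induction p) (simp_all add: ev_add ev_smult algebra_simps)

lemma ev_power: "ev x (p ^ n) = ev x p ^ n"
  by (induction n) (simp_all add: ev_mult)

lemma ev_sum: "ev x (sum f A) = (\<Sum>a\<in>A. ev x (f a))"
  by (induction A rule: infinite_finite_induct) (simp_all add: ev_add)

lemma ev_prod: "ev x (prod f A) = (\<Prod>a\<in>A. ev x (f a))"
  by (induction A rule: infinite_finite_induct) (simp_all add: ev_mult)

lemma ev_monom: "ev x (monom a i) = h a * x ^ i"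
  by (simp add: ev_def map_poly_monom poly_monom)

lemma ev_dvd_eq_0: "p dvd q \<Longrightarrow> ev x p = 0 \<Longrightarrow> ev x q = 0"
  by (auto simp: ev_mult elim!: dvdE)

end

lemma poly_taylor_order_2:
  fixes p :: "'a::idom poly"
  shows "\<exists>r. poly p (a + d) = poly p a + d * poly (pderiv p) a + d\<^sup>2 * r"
proof (induction p)
  case (pCons c p)
  then obtain r where r: "poly p (a + d) = poly p a + d * poly (pderiv p) a + d\<^sup>2 * r" by blast
  have "poly (pCons c p) (a + d) = poly (pCons c p) a + d * poly (pderiv (pCons c p)) a
      + d\<^sup>2 * (poly (pderiv p) a + (a + d) * r)"
    by (simp add: r pderiv_pCons algebra_simps power2_eq_square)
  thus ?case by blast
qed auto

text \<open>Newton lifting, one coefficient at a time, from a simple root modulo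
  \<open>fps_X\<close>.\<close>

lemma fps_hensel:
  fixes p :: "'a::field fps poly"
  assumes z: "poly p (fps_const x0) $ 0 = 0" and nz: "poly (pderiv p) (fps_const x0) $ 0 \<noteq> 0"
  shows "\<exists>y. poly p y = 0 \<and> y $ 0 = x0"
proof -
  have dv: "\<exists>r. poly u (a + d) = poly u a + d * r" for u :: "'a fps poly" and a d
  proof -
    obtain r where "poly u (a + d) = poly u a + d * poly (pderiv u) a + d\<^sup>2 * r"
      using poly_taylor_order_2 by blast
    hence "poly u (a + d) = poly u a + d * (poly (pderiv u) a + d * r)"
      by (simp add: algebra_simps power2_eq_square)
    thus ?thesis by blast
  qed
  have nz': "poly (pderiv p) f $ 0 \<noteq> 0" if "f $ 0 = x0" for f
  proof -
    obtain r where "poly (pderiv p) (fps_const x0 + (f - fps_const x0))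
        = poly (pderiv p) (fps_const x0) + (f - fps_const x0) * r"
      using dv by blast
    hence "poly (pderiv p) f $ 0 = poly (pderiv p) (fps_const x0) $ 0"
      using that by simp
    thus ?thesis using nz by simp
  qed
  define Q where "Q n f \<longleftrightarrow> f $ 0 = x0 \<and> (\<forall>i\<le>n. poly p f $ i = 0)" for n f
  have step: "\<exists>f'. Q (Suc n) f' \<and> (\<exists>c. f' = f + fps_const c * fps_X ^ Suc n)" if "Q n f" for n f
  proof -
    \<comment> \<open>The new coefficient cancels coefficient \<open>Suc n\<close> of the value; the
      quadratic Taylor term starts only at order \<open>2 * Suc n\<close>.\<close>
    define c where "c = - (poly p f $ Suc n) / (poly (pderiv p) f $ 0)"
    define d where "d = fps_const c * fps_X ^ Suc n"
    obtain r where r: "poly p (f + d) = poly p f + d * poly (pderiv p) f + d\<^sup>2 * r"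
      using poly_taylor_order_2 by blast
    have d2: "d\<^sup>2 * r = fps_X ^ (Suc n * 2) * (fps_const c * (fps_const c * r))"
      unfolding d_def power_mult power_mult_distrib power2_eq_square by (simp only: mult_ac)
    have d1: "d * u = fps_X ^ Suc n * (fps_const c * u)" for u
      by (simp add: d_def algebra_simps)
    have "poly p (f + d) $ i = 0" if i: "i \<le> Suc n" for i
    proof -
      have s: "(d\<^sup>2 * r) $ i = 0" unfolding d2 using i by (subst fps_X_power_mult_nth) simp
      have t: "(d * poly (pderiv p) f) $ i = (if i = Suc n then c * poly (pderiv p) f $ 0 else 0)"
        unfolding d1 using i by (subst fps_X_power_mult_nth) auto
      show ?thesis
      proof (cases "i = Suc n")
        case True
        thus ?thesis using nz'[of f] \<open>Q n f\<close> unfolding r fps_add_nth s t by (simp add: Q_def c_def)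
      next
        case False
        thus ?thesis using \<open>Q n f\<close> i unfolding r fps_add_nth s t by (simp add: Q_def)
      qed
    qed
    hence "Q (Suc n) (f + d)" using \<open>Q n f\<close> by (simp add: Q_def d_def)
    thus ?thesis unfolding d_def by blast
  qed
  have "Q 0 (fps_const x0)" using z by (simp add: Q_def)
  hence "\<exists>f. \<forall>n. Q n (f n) \<and> (\<exists>c. f (Suc n) = f n + fps_const c * fps_X ^ Suc n)"
    by (intro dependent_nat_choice) (use step in blast)+
  then obtain F where F: "\<And>n. Q n (F n)" "\<And>n. \<exists>c. F (Suc n) = F n + fps_const c * fps_X ^ Suc n"
    by blast
  have stab: "F (i + k) $ i = F i $ i" for i k
  proof (induction k)
    case (Suc k)
    obtain c where "F (Suc (i + k)) = F (i + k) + fps_const c * fps_X ^ Suc (i + k)" using F(2) by blast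
    thus ?case using Suc by simp arith
  qed simp
  \<comment> \<open>Later approximations leave coefficient \<open>n\<close> unchanged, so the
    diagonal is the limit.\<close>
  define y where "y = Abs_fps (\<lambda>n. F n $ n)"
  have "poly p y $ n = 0" for n
  proof -
    have "(y - F n) $ i = 0" if "i < Suc n" for i
      using stab[of i "n - i"] that by (simp add: y_def)
    hence "y - F n = fps_shift (Suc n) (y - F n) * fps_X ^ Suc n"
      by (intro fps_ext) (auto simp: fps_X_power_mult_right_nth simp del: fps_sub_nth power_Suc)
    then obtain e where e: "y - F n = e * fps_X ^ Suc n" by blast
    obtain r where "poly p (F n + (y - F n)) = poly p (F n) + (y - F n) * r" using dv by blast
    hence "poly p y = poly p (F n) + (y - F n) * r" by simp
    hence "poly p y = poly p (F n) + fps_X ^ Suc n * (e * r)" unfolding e by (simp only: mult_ac)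
    hence "poly p y $ n = poly p (F n) $ n" by (simp add: fps_X_power_mult_nth del: power_Suc)
    thus ?thesis using F(1)[of n] by (simp add: Q_def)
  qed
  moreover have "y $ 0 = x0" using F(1)[of 0] by (simp add: y_def Q_def)
  ultimately show ?thesis by (intro exI[of _ y]) (simp add: fps_eq_iff)
qed

interpretation fpsv: vector_space "\<lambda>(c::'k::field) f. fps_const c * f"
  by standard (simp_all add: algebra_simps flip: fps_const_add fps_const_mult)

lemma CHAR_fps_eq: "CHAR('k::field fps) = CHAR('k)"
proof (rule CHAR_eqI)
  have "of_nat n = (0 :: 'k fps) \<longleftrightarrow> of_nat n = (0::'k)" for n
    by (metis fps_const_eq_0_iff fps_of_nat)
  thus "of_nat CHAR('k) = (0 :: 'k fps)" "\<And>n. of_nat n = (0 :: 'k fps) \<Longrightarrow> CHAR('k) dvd n"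
    by (simp_all add: of_nat_eq_0_iff_char_dvd)
qed

text \<open>Divide all \<open>H i\<close> by their common power of \<open>fps_X\<close>, so that
  some constant term survives. Since \<open>R\<close> is a power of the characteristic, the constant
  terms split off and give a combination of the \<open>g i\<close> that vanishes to order
  \<open>R\<close>; by \<open>ord\<close> it is zero, and by \<open>ind\<close> so are the constant
  terms.\<close>

lemma power_family_independent:
  fixes g H :: "'i \<Rightarrow> 'k::field fps"
  assumes fin: "finite I" and p: "prime CHAR('k)" and R: "R = CHAR('k) ^ \<nu>"
    and ind: "\<And>c. (\<Sum>i\<in>I. fps_const (c i) * g i) = 0 \<Longrightarrow> (\<forall>i\<in>I. c i = 0)"
    and ord: "\<And>c. (\<Sum>i\<in>I. fps_const (c i) * g i) \<noteq> 0 \<Longrightarrow>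
                  subdegree (\<Sum>i\<in>I. fps_const (c i) * g i) < R"
    and rel: "(\<Sum>i\<in>I. g i * H i ^ R) = 0"
  shows "\<forall>i\<in>I. H i = 0"
proof (rule ccontr)
  assume neg: "\<not> (\<forall>i\<in>I. H i = 0)"
  define J where "J = {i\<in>I. H i \<noteq> 0}"
  have J: "finite J" "J \<noteq> {}" using neg fin by (auto simp: J_def)
  define r where "r = Min ((\<lambda>i. subdegree (H i)) ` J)"
  have r_le: "r \<le> subdegree (H i)" if "i \<in> J" for i
    unfolding r_def using J that by (intro Min_le) auto
  have "r \<in> (\<lambda>i. subdegree (H i)) ` J" unfolding r_def using J by (intro Min_in) auto
  then obtain i0 where i0: "i0 \<in> J" "subdegree (H i0) = r" by auto
  define H' where "H' i = fps_shift r (H i)" for i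
  have H': "H i = H' i * fps_X ^ r" if "i \<in> I" for i
  proof (cases "H i = 0")
    case False
    thus ?thesis using subdegree_decompose'[of r "H i"] r_le[of i] that by (simp add: H'_def J_def)
  qed (simp add: H'_def)
  have "(\<Sum>i\<in>I. g i * H i ^ R) = (\<Sum>i\<in>I. g i * H' i ^ R) * fps_X ^ (r * R)"
    unfolding sum_distrib_right
    by (intro sum.cong refl) (simp only: H' power_mult_distrib power_mult mult.assoc)
  hence rel': "(\<Sum>i\<in>I. g i * H' i ^ R) = 0" using rel by simp
  define h where "h i = fps_shift 1 (H' i)" for i
  have H'_split: "H' i ^ R = fps_const ((H' i $ 0) ^ R) + fps_X ^ R * h i ^ R" for i
  proof -
    have "H' i = fps_const (H' i $ 0) + fps_X * h i"
      by (rule fps_ext) (auto simp: h_def fps_X_mult_nth)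
    hence "H' i ^ R = (fps_const (H' i $ 0) + fps_X * h i) ^ R" by simp
    also have "\<dots> = fps_const (H' i $ 0) ^ R + (fps_X * h i) ^ R"
      using freshmans_dream'[where 'a = "'k fps", of R \<nu>] p by (simp add: CHAR_fps_eq R)
    finally show ?thesis by (simp add: power_mult_distrib fps_const_power)
  qed
  define c where "c i = (H' i $ 0) ^ R" for i
  define S where "S = (\<Sum>i\<in>I. fps_const (c i) * g i)"
  have S: "S = - (fps_X ^ R * (\<Sum>i\<in>I. g i * h i ^ R))"
  proof -
    have "0 = S + fps_X ^ R * (\<Sum>i\<in>I. g i * h i ^ R)"
      unfolding rel'[symmetric] S_def sum_distrib_left sum.distrib[symmetric]
      by (intro sum.cong) (auto simp: H'_split c_def algebra_simps)
    thus ?thesis by (simp add: eq_neg_iff_add_eq_0)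
  qed
  have "S = 0"
  proof (rule ccontr)
    assume "S \<noteq> 0"
    have "S $ i = 0" if "i < R" for i using that by (simp add: S fps_X_power_mult_nth)
    hence "R \<le> subdegree S" using \<open>S \<noteq> 0\<close> by (intro subdegree_geI) auto
    thus False using ord[of c] \<open>S \<noteq> 0\<close> by (simp add: S_def)
  qed
  hence "c i0 = 0" using ind[of c] i0(1) by (simp add: S_def J_def)
  moreover have "H' i0 $ 0 \<noteq> 0" using i0 by (auto simp: H'_def J_def)
  ultimately show False by (simp add: c_def)
qed

section \<open>Points on plane curves over finite fields\<close>

interpretation fh: coeff_hom "fps_of_poly :: 'k::field poly \<Rightarrow> 'k fps"
  by standard (simp_all add: fps_of_poly_add fps_of_poly_mult)

interpretation ph: coeff_hom "\<lambda>a. poly a (y::'k::field)" for y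
  by standard simp_all

text \<open>Despite the name this bounds the total degree in the outer variable X and the inner
  variable Y.\<close>

definition bidegree_le :: "nat \<Rightarrow> 'k::field poly poly set" where
  "bidegree_le M = {p. \<forall>i j. M < i + j \<longrightarrow> coeff (coeff p i) j = 0}"

lemma bidegree_le_mult:
  assumes "p \<in> bidegree_le M" "q \<in> bidegree_le N"
  shows "p * q \<in> bidegree_le (M + N)"
proof -
  have "coeff (coeff (p * q) i) j = 0" if "M + N < i + j" for i j
  proof -
    have "coeff (coeff p a) b * coeff (coeff q (i - a)) (j - b) = 0" if "a \<le> i" "b \<le> j" for a b
    proof (cases "M < a + b")
      case False
      hence "N < (i - a) + (j - b)" using that \<open>M + N < i + j\<close> by linarith
      thus ?thesis using assms by (simp add: bidegree_le_def)
    qed (use assms in \<open>simp add: bidegree_le_def\<close>)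
    thus ?thesis unfolding coeff_mult coeff_sum by (intro sum.neutral ballI) auto
  qed
  thus ?thesis by (simp add: bidegree_le_def)
qed

lemma bidegree_le_sum: "(\<And>a. a \<in> A \<Longrightarrow> f a \<in> bidegree_le M) \<Longrightarrow> sum f A \<in> bidegree_le M"
  by (simp add: bidegree_le_def coeff_sum sum.neutral)

lemma bidegree_le_mono: "p \<in> bidegree_le M \<Longrightarrow> M \<le> N \<Longrightarrow> p \<in> bidegree_le N"
  by (simp add: bidegree_le_def)

lemma bidegree_le_1: "1 \<in> bidegree_le M"
  by (auto simp: bidegree_le_def)

lemma bidegree_le_power: "p \<in> bidegree_le M \<Longrightarrow> p ^ n \<in> bidegree_le (n * M)"
  by (induction n) (auto simp: bidegree_le_1 intro: bidegree_le_mult)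

lemma bidegree_le_prod:
  "finite A \<Longrightarrow> (\<And>a. a \<in> A \<Longrightarrow> f a \<in> bidegree_le 1) \<Longrightarrow> prod f A \<in> bidegree_le (card A)"
proof (induction A rule: finite_induct)
  case (insert a A)
  thus ?case using bidegree_le_mult[of "f a" 1 "prod f A" "card A"] by simp
qed (simp add: bidegree_le_1)

definition bimonom :: "nat \<times> nat \<Rightarrow> 'k::field poly poly" where
  "bimonom t = monom (monom 1 (snd t)) (fst t)"

lemma bidegree_le_smult_bimonom:
  "fst t + snd t \<le> M \<Longrightarrow> smult [:c:] (bimonom t) \<in> bidegree_le M"
  by (auto simp: bidegree_le_def bimonom_def)

lemma bidegree_le_bimonom: "fst t + snd t \<le> M \<Longrightarrow> bimonom t \<in> bidegree_le M"
  using bidegree_le_smult_bimonom[of t M 1] by (simp flip: one_pCons)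

lemma ev_bimonom: "ph.ev y x (bimonom t) = x ^ fst t * y ^ snd t"
  by (simp add: bimonom_def ph.ev_monom poly_monom)

text \<open>A product of vertical and horizontal lines, one through each other point of
  \<open>Z\<close> and none through \<open>z\<close>.\<close>

lemma separating_poly:
  fixes Z :: "('k::field \<times> 'k) set"
  assumes "finite Z" "z \<in> Z"
  obtains e where "e \<in> bidegree_le (card Z)" "ph.ev (snd z) (fst z) e \<noteq> 0"
    "\<And>w. w \<in> Z \<Longrightarrow> w \<noteq> z \<Longrightarrow> ph.ev (snd w) (fst w) e = 0"
proof -
  define l where "l w = (if fst w \<noteq> fst z then [:[:- fst w:], 1:] else [:[:- snd w, 1:]:])"
    for w :: "'k \<times> 'k"
  have l: "l w \<in> bidegree_le 1" for w
    by (auto simp: l_def bidegree_le_def coeff_pCons split: nat.splits)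
  define e where "e = (\<Prod>w\<in>Z-{z}. l w)"
  have "e \<in> bidegree_le (card (Z - {z}))" unfolding e_def
    by (rule bidegree_le_prod) (use assms l in auto)
  hence 1: "e \<in> bidegree_le (card Z)"
    by (rule bidegree_le_mono) (use assms in \<open>auto intro: card_mono\<close>)
  have 2: "ph.ev (snd w) (fst w) e = 0" if "w \<in> Z" "w \<noteq> z" for w
  proof -
    have "ph.ev (snd w) (fst w) (l w) = 0" by (auto simp: l_def)
    thus ?thesis using that assms by (auto simp: e_def ph.ev_prod)
  qed
  have "ph.ev (snd z) (fst z) (l w) \<noteq> 0" if "w \<noteq> z" for w
    using that by (auto simp: l_def prod_eq_iff)
  hence "ph.ev (snd z) (fst z) e \<noteq> 0" using assms by (auto simp: e_def ph.ev_prod)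
  thus thesis using that 1 2 by blast
qed

text \<open>The series \<open>x\<close> is a branch of the curve above Y = 0. Expansion along it,
  written \<open>emb\<close> below, takes the place of the function field and of its valuation at
  one point.\<close>

locale plane_curve =
  fixes P :: "'k::{alg_closed_field,euclidean_ring_gcd,semiring_gcd_mult_normalize} poly poly"
    and D :: nat and x :: "'k fps"
  assumes D_pos: "D > 0" and degree_P: "degree P = D" and monic_P: "lead_coeff P = 1"
    and P_bidegree: "P \<in> bidegree_le D" and prime_P: "prime_elem P"
    and root: "fh.ev x P = 0"
begin

abbreviation emb :: "'k poly poly \<Rightarrow> 'k fps" where "emb \<equiv> fh.ev x"

lemma P_nz: "P \<noteq> 0" using degree_P D_pos by auto

text \<open>A nonzero relation \<open>r\<close> of least degree divides a multiple of
  \<open>P\<close>, by pseudo-division. Primality of \<open>P\<close> then makes \<open>r\<close> a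
  polynomial in the inner variable alone, and such a polynomial is its own expansion.\<close>

lemma emb_eq_0_low_degree:
  assumes "emb r = 0" "degree r < D"
  shows "r = 0"
proof (rule ccontr)
  assume "r \<noteq> 0"
  define Z where "Z = {r. r \<noteq> 0 \<and> emb r = 0 \<and> degree r < D}"
  have "r \<in> Z" using \<open>r \<noteq> 0\<close> assms by (simp add: Z_def)
  obtain r where r: "r \<in> Z" and min: "\<And>u. u \<in> Z \<Longrightarrow> degree r \<le> degree u"
    using arg_min_nat_lemma[of "\<lambda>u. u \<in> Z" r degree] \<open>r \<in> Z\<close> by blast
  have nz: "r \<noteq> 0" and z: "emb r = 0" and d: "degree r < D" using r by (auto simp: Z_def)
  obtain a b where ab: "a \<noteq> 0" "smult a P = r * b + pseudo_mod P r"
    using pseudo_mod(1)[OF nz, of P] by blast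
  have "emb (pseudo_mod P r) = 0"
    using arg_cong[OF ab(2), of emb] z root by (simp add: fh.ev_add fh.ev_mult fh.ev_smult)
  hence "pseudo_mod P r = 0"
    using pseudo_mod(2)[OF nz, of P] min[of "pseudo_mod P r"] d by (force simp: Z_def)
  hence eq: "smult a P = r * b" using ab by simp
  have "P dvd r * b" unfolding eq[symmetric] by (simp add: dvd_smult)
  hence "P dvd r \<or> P dvd b" using prime_P by (simp add: prime_elem_dvd_mult_iff)
  moreover have "\<not> P dvd r" using dvd_imp_degree_le[of P r] nz d degree_P by auto
  ultimately obtain b' where "b = P * b'" by (auto elim: dvdE)
  hence "P * [:a:] = P * (r * b')" using eq by (simp add: mult_ac)
  hence eq': "[:a:] = r * b'" using P_nz mult_left_cancel by blast
  hence "degree (r * b') = 0" by (metis degree_pCons_0)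
  hence "degree r = 0" using eq' ab(1) nz by (subst (asm) degree_mult_eq) auto
  then obtain r0 where "r = [:r0:]" by (rule degree_eq_zeroE)
  thus False using z nz fps_of_poly_eq_iff[of r0 0] by simp
qed

lemma emb_eq_0:
  assumes "emb p = 0"
  shows "P dvd p"
proof -
  obtain a b where ab: "a \<noteq> 0" "smult a p = P * b + pseudo_mod p P"
    using pseudo_mod(1)[OF P_nz, of p] by blast
  have "emb (pseudo_mod p P) = 0"
    using arg_cong[OF ab(2), of emb] assms root by (simp add: fh.ev_add fh.ev_mult fh.ev_smult)
  moreover have "degree (pseudo_mod p P) < D"
    using pseudo_mod(2)[OF P_nz, of p] D_pos degree_P by auto
  ultimately have "smult a p = P * b" using emb_eq_0_low_degree ab(2) by simp
  hence "P dvd [:a:] * p" by simp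
  hence "P dvd [:a:] \<or> P dvd p" using prime_P prime_elem_dvd_mult_iff by blast
  moreover have "\<not> P dvd [:a:]"
    using dvd_imp_degree_le[of P "[:a:]"] ab(1) degree_P D_pos by auto
  ultimately show ?thesis by blast
qed

definition mon :: "nat \<times> nat \<Rightarrow> 'k fps" where
  "mon t = x ^ fst t * fps_X ^ snd t"

text \<open>Exponents of the reduced monomials of degree at most \<open>M\<close>: the power
  \<open>x ^ D\<close> is eliminated by the equation. They index a basis of the functions of that
  degree.\<close>

definition T :: "nat \<Rightarrow> (nat \<times> nat) set" where
  "T M = {(i, j). i < D \<and> i + j \<le> M}"

lemma emb_bimonom: "emb (bimonom t) = mon t"
  by (simp add: bimonom_def mon_def fh.ev_monom fps_of_poly_monom' mult_ac)

lemma finite_T: "finite (T M)"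
  by (rule finite_subset[of _ "{..<D} \<times> {..M}"]) (auto simp: T_def)

lemma card_T:
  assumes "D \<le> M"
  shows "card (T M) = (\<Sum>i<D. Suc M - i)"
proof -
  have "T M = Sigma {..<D} (\<lambda>i. {..M - i})" using assms by (auto simp: T_def)
  thus ?thesis using assms by (simp add: Suc_diff_le)
qed

lemma card_T_add:
  assumes "D \<le> M"
  shows "card (T (M + j)) = card (T M) + D * j"
proof -
  have "card (T (M + j)) = (\<Sum>i<D. Suc (M + j) - i)" using assms by (simp add: card_T)
  also have "\<dots> = (\<Sum>i<D. (Suc M - i) + j)" by (intro sum.cong) (use assms in auto)
  also have "\<dots> = card (T M) + D * j" using assms by (simp only: sum.distrib card_T) simp
  finally show ?thesis .
qed

lemma card_T_bounds:
  assumes "D \<le> M"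
  shows "D * Suc M - D * D \<le> card (T M)" "card (T M) \<le> D * Suc M"
proof -
  have "(\<Sum>i<D. Suc M - D) \<le> (\<Sum>i<D. Suc M - i)" by (intro sum_mono) auto
  thus "D * Suc M - D * D \<le> card (T M)" using assms by (simp add: card_T diff_mult_distrib2)
  have "(\<Sum>i<D. Suc M - i) \<le> (\<Sum>i<D. Suc M)" by (intro sum_mono) auto
  thus "card (T M) \<le> D * Suc M" using assms by (simp add: card_T)
qed

lemma mon_independent:
  assumes "(\<Sum>t\<in>T M. fps_const (c t) * mon t) = 0" "t \<in> T M"
  shows "c t = 0"
proof -
  define r where "r = (\<Sum>t\<in>T M. smult [:c t:] (bimonom t))"
  have "emb r = 0"
    using assms(1) by (simp add: r_def fh.ev_sum fh.ev_smult emb_bimonom fps_of_poly_const)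
  moreover have "degree r < D"
  proof -
    have "degree (smult [:c t:] (bimonom t)) \<le> D - 1" if "t \<in> T M" for t
    proof -
      have "degree (smult [:c t:] (bimonom t)) \<le> degree (bimonom t :: 'k poly poly)"
        by (rule degree_smult_le)
      also have "\<dots> \<le> fst t" unfolding bimonom_def by (rule degree_monom_le)
      finally show ?thesis using that by (auto simp: T_def)
    qed
    hence "degree r \<le> D - 1" unfolding r_def by (intro degree_sum_le finite_T) auto
    thus ?thesis using D_pos by simp
  qed
  ultimately have "r = 0" by (rule emb_eq_0_low_degree)
  have "coeff (coeff r (fst t)) (snd t) = (\<Sum>u\<in>T M. if u = t then c t else 0)"
    unfolding r_def coeff_sum by (intro sum.cong) (auto simp: bimonom_def prod_eq_iff)
  also have "\<dots> = c t" using assms(2) finite_T by simp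
  finally show ?thesis using \<open>r = 0\<close> by simp
qed

definition V :: "nat \<Rightarrow> 'k fps set" where
  "V M = fpsv.span (mon ` T M)"

lemma V_mono: "M \<le> N \<Longrightarrow> V M \<subseteq> V N"
  unfolding V_def by (intro fpsv.span_mono image_mono) (auto simp: T_def)

lemma x_power_D: "x ^ D = - (\<Sum>i<D. \<Sum>l\<le>degree (coeff P i). fps_const (coeff (coeff P i) l) * mon (i, l))"
proof -
  have exp: "fps_of_poly a = (\<Sum>l\<le>degree a. fps_const (coeff a l) * fps_X ^ l)" for a :: "'k poly"
    by (subst poly_as_sum_of_monoms[of a, symmetric], simp only: fps_of_poly_sum fps_of_poly_monom)
  have "0 = (\<Sum>i\<le>D. fps_of_poly (coeff P i) * x ^ i)"
    using root degree_P fps_of_poly_eq_iff[of _ 0]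
    by (simp add: fh.ev_def poly_altdef coeff_map_poly degree_map_poly)
  also have "\<dots> = (\<Sum>i<D. fps_of_poly (coeff P i) * x ^ i) + x ^ D"
    using monic_P degree_P by (simp flip: lessThan_Suc_atMost)
  finally have "x ^ D = - (\<Sum>i<D. fps_of_poly (coeff P i) * x ^ i)"
    by (metis add_eq_0_iff)
  thus ?thesis unfolding exp by (simp add: sum_distrib_left sum_distrib_right mon_def mult_ac)
qed

text \<open>Replacing \<open>x ^ D\<close> by means of the equation does not raise the degree,
  because \<open>P\<close> has total degree \<open>D\<close>.\<close>

lemma mon_in_V: "mon (i, j) \<in> V (i + j)"
proof (induction i arbitrary: j rule: less_induct)
  case (less i)
  show ?case
  proof (cases "i < D")
    case True
    thus ?thesis unfolding V_def by (intro fpsv.span_base) (auto simp: T_def)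
  next
    case False
    define r where "r = i - D"
    have i: "i = r + D" using False by (simp add: r_def)
    have "mon (i, j) = x ^ r * fps_X ^ j * x ^ D" by (simp add: mon_def i power_add mult_ac)
    also have "\<dots> = - (\<Sum>a<D. \<Sum>l\<le>degree (coeff P a).
        fps_const (coeff (coeff P a) l) * mon (r + a, j + l))"
      by (simp add: x_power_D sum_distrib_left mon_def power_add mult_ac)
    also have "\<dots> \<in> V (i + j)"
    proof -
      have "fps_const (coeff (coeff P a) l) * mon (r + a, j + l) \<in> V (i + j)" if "a < D" for a l
      proof (cases "coeff (coeff P a) l = 0")
        case True
        thus ?thesis by (simp add: V_def fpsv.span_zero)
      next
        case False
        hence "a + l \<le> D" using P_bidegree by (force simp: bidegree_le_def)
        hence "V (r + a + (j + l)) \<subseteq> V (i + j)" by (intro V_mono) (simp add: i)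
        moreover have "mon (r + a, j + l) \<in> V (r + a + (j + l))"
          by (rule less.IH) (use that i in simp)
        ultimately show ?thesis unfolding V_def by (blast intro: fpsv.span_scale)
      qed
      thus ?thesis unfolding V_def by (intro fpsv.span_neg fpsv.span_sum) auto
    qed
    finally show ?thesis .
  qed
qed

lemma mon_in_V': "fst t + snd t \<le> M \<Longrightarrow> mon t \<in> V M"
  using mon_in_V[of "fst t" "snd t"] V_mono by (metis prod.collapse subset_iff)

lemma emb_in_V:
  assumes "p \<in> bidegree_le M"
  shows "emb p \<in> V M"
proof -
  have "p = (\<Sum>i\<le>degree p. monom (coeff p i) i)" by (simp add: poly_as_sum_of_monoms)
  also have "\<dots> = (\<Sum>i\<le>degree p. \<Sum>j\<le>degree (coeff p i). smult [:coeff (coeff p i) j:] (bimonom (i, j)))"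
  proof (intro sum.cong refl)
    fix i
    have "monom (coeff p i) i = monom (\<Sum>j\<le>degree (coeff p i). monom (coeff (coeff p i) j) j) i"
      by (simp add: poly_as_sum_of_monoms)
    also have "\<dots> = (\<Sum>j\<le>degree (coeff p i). monom (monom (coeff (coeff p i) j) j) i)"
      by (rule poly_eqI) (simp add: coeff_sum)
    finally show "monom (coeff p i) i
        = (\<Sum>j\<le>degree (coeff p i). smult [:coeff (coeff p i) j:] (bimonom (i, j)))"
      by (simp add: bimonom_def smult_monom)
  qed
  finally have eq: "emb p = (\<Sum>i\<le>degree p. \<Sum>j\<le>degree (coeff p i).
      fps_const (coeff (coeff p i) j) * mon (i, j))"
    by (metis (no_types, lifting) emb_bimonom fh.ev_smult fh.ev_sum fps_of_poly_const sum.cong)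
  have "fps_const (coeff (coeff p i) j) * mon (i, j) \<in> V M" for i j
  proof (cases "coeff (coeff p i) j = 0")
    case False
    hence "i + j \<le> M" using assms by (force simp: bidegree_le_def)
    hence "mon (i, j) \<in> V M" by (intro mon_in_V') simp
    thus ?thesis unfolding V_def by (rule fpsv.span_scale)
  qed (simp add: V_def fpsv.span_zero)
  thus ?thesis unfolding eq V_def by (intro fpsv.span_sum) auto
qed

definition on_curve :: "'k \<times> 'k \<Rightarrow> bool" where
  "on_curve z \<longleftrightarrow> ph.ev (snd z) (fst z) P = 0"

lemma emb_eq_0_ev:
  assumes "emb p = 0" "on_curve z"
  shows "ph.ev (snd z) (fst z) p = 0"
  using ph.ev_dvd_eq_0[OF emb_eq_0[OF assms(1)]] assms(2) by (simp add: on_curve_def)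

text \<open>The multiples of \<open>p\<close> by \<open>V i\<close> meet the span of the separating functions trivially, so
  both fit side by side into \<open>V (i + j)\<close>; the same count bounds the order of vanishing below.\<close>

lemma dependent_multiples:
  fixes y :: "'i \<Rightarrow> 'k poly poly"
  assumes "p \<in> bidegree_le j" "finite Z" "D \<le> i" "D * j < card Z"
    and "\<And>z. z \<in> Z \<Longrightarrow> y z \<in> bidegree_le (i + j)"
  obtains a b where "(\<exists>t\<in>T i. a t \<noteq> 0) \<or> (\<exists>z\<in>Z. b z \<noteq> 0)"
    "emb (p * (\<Sum>t\<in>T i. smult [:a t:] (bimonom t)) + (\<Sum>z\<in>Z. smult [:b z:] (y z))) = 0"
proof -
  define u where "u w = (case w of Inl t \<Rightarrow> p * bimonom t | Inr z \<Rightarrow> y z)" for w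
  have u: "emb (u w) \<in> fpsv.span (mon ` T (i + j))" if "w \<in> T i <+> Z" for w
  proof -
    have "u w \<in> bidegree_le (i + j)"
      using that assms(5) bidegree_le_mult[OF assms(1) bidegree_le_bimonom, of _ i]
      by (auto simp: u_def T_def add.commute)
    thus ?thesis using emb_in_V[of "u w" "i + j"] by (simp add: V_def)
  qed
  have "card (mon ` T (i + j)) \<le> card (T (i + j))" by (rule card_image_le[OF finite_T])
  also have "\<dots> < card (T i <+> Z)"
    using assms finite_T by (simp add: card_T_add card_Plus)
  finally have lt: "card (mon ` T (i + j)) < card (T i <+> Z)" .
  have "\<exists>c. (\<exists>w\<in>T i <+> Z. c w \<noteq> 0) \<and> (\<Sum>w\<in>T i <+> Z. fps_const (c w) * emb (u w)) = 0"
    by (rule fpsv.family_dependent[OF _ _ u lt]) (use finite_T assms(2) in auto)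
  then obtain c where c: "\<exists>w\<in>T i <+> Z. c w \<noteq> 0"
      "(\<Sum>w\<in>T i <+> Z. fps_const (c w) * emb (u w)) = 0"
    by blast
  have "(\<Sum>w\<in>T i <+> Z. fps_const (c w) * emb (u w))
      = (\<Sum>t\<in>T i. fps_const (c (Inl t)) * emb (u (Inl t))) + (\<Sum>z\<in>Z. fps_const (c (Inr z)) * emb (u (Inr z)))"
    using finite_T assms(2) by (subst sum.Plus) (auto simp: o_def)
  also have "\<dots> = emb (p * (\<Sum>t\<in>T i. smult [:c (Inl t):] (bimonom t)) + (\<Sum>z\<in>Z. smult [:c (Inr z):] (y z)))"
    by (simp add: u_def fh.ev_add fh.ev_mult fh.ev_sum fh.ev_smult fps_of_poly_const
        sum_distrib_left mult_ac)
  finally have "emb (p * (\<Sum>t\<in>T i. smult [:c (Inl t):] (bimonom t))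
      + (\<Sum>z\<in>Z. smult [:c (Inr z):] (y z))) = 0" using c(2) by simp
  moreover have "(\<exists>t\<in>T i. c (Inl t) \<noteq> 0) \<or> (\<exists>z\<in>Z. c (Inr z) \<noteq> 0)" using c(1) by blast
  ultimately show thesis using that[of "\<lambda>t. c (Inl t)" "\<lambda>z. c (Inr z)"] by simp
qed

lemma multiple_eq_0:
  assumes "emb (p * (\<Sum>t\<in>T i. smult [:a t:] (bimonom t))) = 0" "emb p \<noteq> 0" "t \<in> T i"
  shows "a t = 0"
proof -
  have "(\<Sum>t\<in>T i. fps_const (a t) * mon t) = 0"
    using assms(1,2) by (simp add: fh.ev_mult fh.ev_sum fh.ev_smult emb_bimonom fps_of_poly_const)
  thus ?thesis using assms(3) by (rule mon_independent)
qed

text \<open>An elementary form of Bezout. With more than \<open>D * j\<close> zeros there is a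
  relation between multiples of \<open>p\<close> and separating functions; evaluating it at a zero
  isolates one coefficient \<open>b z\<close>, so only a vanishing multiple of \<open>p\<close>
  remains.\<close>

lemma card_zeros_le:
  assumes p: "p \<in> bidegree_le j" "emb p \<noteq> 0" and Z: "finite Z"
    and on: "\<And>z. z \<in> Z \<Longrightarrow> on_curve z" and zero: "\<And>z. z \<in> Z \<Longrightarrow> ph.ev (snd z) (fst z) p = 0"
  shows "card Z \<le> D * j"
proof (rule ccontr)
  assume neg: "\<not> card Z \<le> D * j"
  define i where "i = D + card Z"
  have "\<exists>e. e \<in> bidegree_le (card Z) \<and> ph.ev (snd z) (fst z) e \<noteq> 0 \<and>
      (\<forall>w\<in>Z. w \<noteq> z \<longrightarrow> ph.ev (snd w) (fst w) e = 0)" if "z \<in> Z" for z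
    using separating_poly[OF Z that] by metis
  then obtain e where e: "\<And>z. z \<in> Z \<Longrightarrow> e z \<in> bidegree_le (card Z)"
      "\<And>z. z \<in> Z \<Longrightarrow> ph.ev (snd z) (fst z) (e z) \<noteq> 0"
      "\<And>z w. z \<in> Z \<Longrightarrow> w \<in> Z \<Longrightarrow> w \<noteq> z \<Longrightarrow> ph.ev (snd w) (fst w) (e z) = 0"
    by metis
  have e': "e z \<in> bidegree_le (i + j)" if "z \<in> Z" for z
    using e(1)[OF that] by (rule bidegree_le_mono) (simp add: i_def)
  obtain a b where ab: "(\<exists>t\<in>T i. a t \<noteq> 0) \<or> (\<exists>z\<in>Z. b z \<noteq> 0)"
    "emb (p * (\<Sum>t\<in>T i. smult [:a t:] (bimonom t)) + (\<Sum>z\<in>Z. smult [:b z:] (e z))) = 0"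
    by (rule dependent_multiples[OF p(1) Z, of i e]) (use neg e' in \<open>auto simp: i_def\<close>)
  have b: "b z = 0" if "z \<in> Z" for z
  proof -
    have "(\<Sum>w\<in>Z. b w * ph.ev (snd z) (fst z) (e w)) = 0"
      using emb_eq_0_ev[OF ab(2) on[OF that]] zero[OF that]
      by (simp add: ph.ev_add ph.ev_mult ph.ev_sum ph.ev_smult)
    also have "(\<Sum>w\<in>Z. b w * ph.ev (snd z) (fst z) (e w))
        = (\<Sum>w\<in>Z. if w = z then b z * ph.ev (snd z) (fst z) (e z) else 0)"
      by (intro sum.cong) (use e(3) that in auto)
    finally show ?thesis using e(2)[OF that] Z that by simp
  qed
  hence "emb (p * (\<Sum>t\<in>T i. smult [:a t:] (bimonom t))) = 0" using ab(2) by simp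
  hence "\<forall>t\<in>T i. a t = 0" using multiple_eq_0 p(2) by blast
  thus False using ab(1) b by blast
qed

text \<open>The argument for zeros, with the powers of the inner variable below the order of
  vanishing as separating functions.\<close>

lemma subdegree_emb_le:
  assumes p: "p \<in> bidegree_le j" "emb p \<noteq> 0"
  shows "subdegree (emb p) \<le> D * j"
proof (rule ccontr)
  assume neg: "\<not> subdegree (emb p) \<le> D * j"
  define r where "r = subdegree (emb p)"
  define i where "i = D + r"
  have y: "bimonom (0, z) \<in> bidegree_le (i + j)" if "z < r" for z
    by (rule bidegree_le_bimonom) (use that in \<open>simp add: i_def\<close>)
  obtain a b where ab: "(\<exists>t\<in>T i. a t \<noteq> 0) \<or> (\<exists>z\<in>{..<r}. b z \<noteq> 0)"
    "emb (p * (\<Sum>t\<in>T i. smult [:a t:] (bimonom t)) + (\<Sum>z\<in>{..<r}. smult [:b z:] (bimonom (0, z)))) = 0"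
    by (rule dependent_multiples[OF p(1), of "{..<r}" i "\<lambda>z. bimonom (0, z)"])
       (use neg y in \<open>auto simp: i_def r_def\<close>)
  define s where "s = emb (\<Sum>t\<in>T i. smult [:a t:] (bimonom t))"
  have eq: "emb p * s + (\<Sum>z<r. fps_const (b z) * fps_X ^ z) = 0"
    using ab(2) by (simp add: s_def fh.ev_add fh.ev_mult fh.ev_sum fh.ev_smult emb_bimonom mon_def fps_of_poly_const)
  have b: "b z = 0" if "z < r" for z
  proof -
    have "(emb p * s) $ z = 0"
    proof (cases "s = 0")
      case False
      have "z < subdegree (emb p * s)" using p(2) False that by (simp add: r_def)
      thus ?thesis by (rule nth_less_subdegree_zero)
    qed simp
    moreover have "(\<Sum>w<r. fps_const (b w) * fps_X ^ w) $ z = b z"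
    proof -
      have "(\<Sum>w<r. fps_const (b w) * fps_X ^ w) $ z = (\<Sum>w<r. if w = z then b z else 0)"
        unfolding fps_sum_nth by (intro sum.cong) (auto simp: fps_X_power_nth)
      thus ?thesis using that by simp
    qed
    ultimately show ?thesis using arg_cong[OF eq, of "\<lambda>f. f $ z"] by simp
  qed
  hence "emb (p * (\<Sum>t\<in>T i. smult [:a t:] (bimonom t))) = 0" using ab(2) by simp
  hence "\<forall>t\<in>T i. a t = 0" using multiple_eq_0 p(2) by blast
  thus False using ab(1) b by blast
qed

end

lemma bidegree_le_smult: "p \<in> bidegree_le M \<Longrightarrow> smult [:c:] p \<in> bidegree_le M"
  by (simp add: bidegree_le_def)

text \<open>Parameters of the auxiliary function. \<open>D * n < R\<close> keeps orders of vanishing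
  below \<open>R\<close>; the excess \<open>3 * D\<close> in \<open>m\<close> makes the unknown
  coefficients outnumber the dimension of the target space; and the zero count is still
  \<open>R * R\<close> up to a multiple of \<open>R\<close>.\<close>

lemma stepanov_degree_choice:
  fixes D R :: nat
  assumes "D > 0" "2 * (D * D) + 5 \<le> R"
  defines "n \<equiv> (R - 1) div D" and "m \<equiv> R div D + 3 * D"
  shows "D \<le> n" "D \<le> m" "D * n < R" "D * (n + m * R) \<le> R * R + (3 * (D * D) + 1) * R"
    and "D * Suc (n * R + m) < (D * Suc n - D * D) * (D * Suc m - D * D)"
proof -
  have "D * D \<le> R - 1" using assms by linarith
  thus "D \<le> n" unfolding n_def using assms by (simp add: less_eq_div_iff_mult_less_eq)
  show "D \<le> m" by (simp add: m_def)
  have n1: "D * n \<le> R - 1" unfolding n_def by (rule times_div_less_eq_dividend)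
  thus n2: "D * n < R" using assms by linarith
  have "R - 1 < D * Suc n" unfolding n_def using dividend_less_times_div[OF assms(1), of "R - 1"] by simp
  hence n3: "R \<le> D * Suc n" by linarith
  have "D * (R div D) \<le> R" by (rule times_div_less_eq_dividend)
  hence m1: "D * m \<le> R + 3 * (D * D)" by (simp add: m_def algebra_simps)
  have "R < D * Suc (R div D)" using dividend_less_times_div[OF assms(1), of R] by simp
  hence m2: "R + 3 * (D * D) \<le> D * Suc m" by (simp add: m_def algebra_simps)
  have "D * (n + m * R) = D * n + (D * m) * R" by (simp add: algebra_simps)
  also have "\<dots> \<le> R + (R + 3 * (D * D)) * R"
    using n2 m1 by (intro add_mono mult_right_mono) auto
  finally show "D * (n + m * R) \<le> R * R + (3 * (D * D) + 1) * R" by (simp add: algebra_simps)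
  \<comment> \<open>In these terms the claim reduces to \<open>d * d + 3 * d + D < r * d\<close>,
    which follows from \<open>d + 5 \<le> r\<close>. This is the origin of the threshold
    \<open>2 * (D * D) + 5\<close>.\<close>
  define d r where "d = D * D" and "r = R - d"
  have r: "R = r + d" "d + 5 \<le> r" using assms by (auto simp: d_def r_def)
  have dD: "D \<le> d" using assms by (simp add: d_def)
  have "D * Suc (n * R + m) = (D * n) * R + D * m + D" by (simp add: algebra_simps)
  also have "\<dots> \<le> (R - 1) * R + (R + 3 * d) + D"
    using n1 m1 by (intro add_mono mult_right_mono) (auto simp: d_def)
  also have "\<dots> = Suc (R - 1) * R + 3 * d + D" by simp
  also have "\<dots> = R * R + 3 * d + D"
  proof -
    have "Suc (R - 1) = R" using r by linarith
    thus ?thesis by (simp only:)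
  qed
  also have "\<dots> < r * (r + 3 * d)"
  proof -
    have "(d + 5) * d \<le> r * d" using r by (intro mult_right_mono) auto
    thus ?thesis using dD assms(1) by (simp add: r(1) algebra_simps)
  qed
  also have "\<dots> \<le> (D * Suc n - D * D) * (D * Suc m - D * D)"
    using n3 m2 r by (intro mult_mono) (auto simp: d_def)
  finally show "D * Suc (n * R + m) < (D * Suc n - D * D) * (D * Suc m - D * D)" .
qed

lemma finite_power_eq_self: "1 < (n::nat) \<Longrightarrow> finite {x::'a::idom. x ^ n = x}"
proof -
  assume n: "1 < n"
  have "coeff (monom 1 n - monom 1 1 :: 'a poly) n = 1" using n by simp
  hence "monom 1 n - monom 1 1 \<noteq> (0 :: 'a poly)" by (metis coeff_0 zero_neq_one)
  hence "finite {x. poly (monom 1 n - monom 1 1 :: 'a poly) x = 0}" by (rule poly_roots_finite)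
  thus ?thesis by (simp add: poly_monom)
qed

context plane_curve
begin

text \<open>Stepanov's method without derivatives.  A relation \<open>\<Sum> c t\<^sup>R u = 0\<close> between monomials
  forces \<open>G = \<Sum> c\<^sup>1\<^sup>/\<^sup>R t u\<^sup>R\<close> to vanish at every point fixed by the \<open>R\<^sup>2\<close>-Frobenius, because there
  \<open>G\<^sup>R = \<Sum> c t\<^sup>R u\<close>.\<close>

theorem card_rational_points_le:
  assumes p: "prime CHAR('k)" and R: "R = CHAR('k) ^ \<nu>" and big: "2 * (D * D) + 5 \<le> R"
  defines "Zs \<equiv> {z. on_curve z \<and> fst z ^ (R * R) = fst z \<and> snd z ^ (R * R) = snd z}"
  shows "finite Zs \<and> card Zs \<le> R * R + (3 * (D * D) + 1) * R"
proof -
  have R1: "1 < R" using big by linarith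
  hence "1 < R * R" by (rule less_1_mult[OF _ R1])
  hence "finite ({x::'k. x ^ (R * R) = x} \<times> {x::'k. x ^ (R * R) = x})"
    by (intro finite_cartesian_product finite_power_eq_self)
  hence fin: "finite Zs" by (rule rev_finite_subset) (auto simp: Zs_def)
  define n m where "n = (R - 1) div D" and "m = R div D + 3 * D"
  note nm = stepanov_degree_choice[OF D_pos big, folded n_def m_def]
  define I where "I = T n \<times> T m"
  have finI: "finite I" by (simp add: I_def finite_T)
  define u :: "(nat \<times> nat) \<times> (nat \<times> nat) \<Rightarrow> 'k poly poly"
    where "u w = bimonom (fst w) ^ R * bimonom (snd w)" for w
  have "u w \<in> bidegree_le (R * n + m)" if "w \<in> I" for w
    unfolding u_def using that
    by (intro bidegree_le_mult bidegree_le_power bidegree_le_bimonom) (auto simp: I_def T_def)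
  hence u: "emb (u w) \<in> fpsv.span (mon ` T (R * n + m))" if "w \<in> I" for w
    using emb_in_V that by (simp add: V_def)
  have "card (mon ` T (R * n + m)) \<le> card (T (R * n + m))" by (rule card_image_le[OF finite_T])
  also have "\<dots> \<le> D * Suc (R * n + m)" by (rule card_T_bounds) (use nm(2) in simp)
  also have "\<dots> < (D * Suc n - D * D) * (D * Suc m - D * D)" using nm(5) by (simp add: mult.commute)
  also have "\<dots> \<le> card I"
    unfolding I_def card_cartesian_product by (intro mult_mono card_T_bounds nm) auto
  finally have lt: "card (mon ` T (R * n + m)) < card I" .
  have "\<exists>c. (\<exists>w\<in>I. c w \<noteq> 0) \<and> (\<Sum>w\<in>I. fps_const (c w) * emb (u w)) = 0"
    by (rule fpsv.family_dependent[OF finI _ u lt]) (simp add: finite_T)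
  then obtain c where c: "\<exists>w\<in>I. c w \<noteq> 0" "(\<Sum>w\<in>I. fps_const (c w) * emb (u w)) = 0"
    by blast
  have "\<exists>y. y ^ R = a" for a :: 'k using R1 by (intro nth_root_exists) auto
  then obtain rt where rt: "\<And>a. rt a ^ R = (a :: 'k)" by metis
  define G where "G = (\<Sum>w\<in>I. smult [:rt (c w):] (bimonom (fst w) * bimonom (snd w) ^ R))"
  have G_deg: "G \<in> bidegree_le (n + R * m)"
  proof -
    have "bimonom (fst w) * bimonom (snd w) ^ R \<in> bidegree_le (n + R * m)" if "w \<in> I" for w
      using that by (intro bidegree_le_mult bidegree_le_power bidegree_le_bimonom) (auto simp: I_def T_def)
    hence "smult [:rt (c w):] (bimonom (fst w) * bimonom (snd w) ^ R) \<in> bidegree_le (n + R * m)" if "w \<in> I" for w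
      using that by (intro bidegree_le_smult)
    thus ?thesis unfolding G_def by (rule bidegree_le_sum)
  qed
  have G_zero: "ph.ev (snd z) (fst z) G = 0" if "z \<in> Zs" for z
  proof -
    let ?e = "\<lambda>t. ph.ev (snd z) (fst z) (bimonom t)"
    have e: "?e t ^ (R * R) = ?e t" for t
    proof -
      have "?e t ^ (R * R) = (fst z ^ (R * R)) ^ fst t * (snd z ^ (R * R)) ^ snd t"
        by (simp add: ev_bimonom power_mult_distrib mult.commute flip: power_mult)
      thus ?thesis using that by (simp add: Zs_def ev_bimonom)
    qed
    have "ph.ev (snd z) (fst z) G = (\<Sum>w\<in>I. rt (c w) * (?e (fst w) * ?e (snd w) ^ R))"
      by (simp add: G_def ph.ev_sum ph.ev_smult ph.ev_mult ph.ev_power)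
    hence "ph.ev (snd z) (fst z) G ^ R = (\<Sum>w\<in>I. (rt (c w) * (?e (fst w) * ?e (snd w) ^ R)) ^ R)"
      using freshmans_dream_sum'[OF p R] by simp
    also have "\<dots> = (\<Sum>w\<in>I. c w * (?e (fst w) ^ R * ?e (snd w)))"
      by (simp add: power_mult_distrib rt e flip: power_mult)
    also have "\<dots> = ph.ev (snd z) (fst z) (\<Sum>w\<in>I. smult [:c w:] (u w))"
      by (simp add: u_def ph.ev_sum ph.ev_smult ph.ev_mult ph.ev_power)
    also have "\<dots> = 0"
    proof (rule emb_eq_0_ev)
      show "emb (\<Sum>w\<in>I. smult [:c w:] (u w)) = 0"
        using c(2) by (simp add: fh.ev_sum fh.ev_smult fps_of_poly_const)
      show "on_curve z" using that by (simp add: Zs_def)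
    qed
    finally show ?thesis using R1 by simp
  qed
  have G_nz: "emb G \<noteq> 0"
  proof
    assume z: "emb G = 0"
    \<comment> \<open>A second root is taken so that \<open>h t ^ R\<close> carries exactly the
      coefficients \<open>rt (c w)\<close> of \<open>G\<close>.\<close>
    define h where "h t = (\<Sum>s\<in>T m. fps_const (rt (rt (c (t, s)))) * mon s)" for t
    have hR: "h t ^ R = (\<Sum>s\<in>T m. fps_const (rt (c (t, s))) * mon s ^ R)" for t
    proof -
      have "h t ^ R = (\<Sum>s\<in>T m. (fps_const (rt (rt (c (t, s)))) * mon s) ^ R)"
        unfolding h_def by (rule freshmans_dream_sum'[of R \<nu>]) (use p R in \<open>simp_all add: CHAR_fps_eq\<close>)
      thus ?thesis by (simp add: power_mult_distrib fps_const_power rt)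
    qed
    have "(\<Sum>t\<in>T n. mon t * h t ^ R) = (\<Sum>w\<in>I. fps_const (rt (c w)) * (mon (fst w) * mon (snd w) ^ R))"
      unfolding hR I_def sum.cartesian_product' sum_distrib_left by (simp add: mult_ac)
    also have "\<dots> = emb G"
      by (simp add: G_def fh.ev_sum fh.ev_smult fh.ev_mult fh.ev_power emb_bimonom fps_of_poly_const)
    finally have rel: "(\<Sum>t\<in>T n. mon t * h t ^ R) = 0" using z by simp
    \<comment> \<open>By \<open>subdegree_emb_le\<close> and \<open>D * n < R\<close>, nonzero
      combinations over \<open>T n\<close> have order below \<open>R\<close>, as the independence
      criterion demands.\<close>
    have "\<forall>t\<in>T n. h t = 0"
    proof (rule power_family_independent[OF finite_T p R _ _ rel])
      fix a :: "nat \<times> nat \<Rightarrow> 'k"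
      show "\<forall>t\<in>T n. a t = 0" if "(\<Sum>t\<in>T n. fps_const (a t) * mon t) = 0"
        using mon_independent[OF that] by blast
      define q where "q = (\<Sum>t\<in>T n. smult [:a t:] (bimonom t))"
      have q: "(\<Sum>t\<in>T n. fps_const (a t) * mon t) = emb q"
        by (simp add: q_def fh.ev_sum fh.ev_smult emb_bimonom fps_of_poly_const)
      have "q \<in> bidegree_le n" unfolding q_def
        by (intro bidegree_le_sum bidegree_le_smult_bimonom) (auto simp: T_def)
      thus "subdegree (\<Sum>t\<in>T n. fps_const (a t) * mon t) < R"
        if "(\<Sum>t\<in>T n. fps_const (a t) * mon t) \<noteq> 0"
        using subdegree_emb_le[of q n] nm(3) that unfolding q by linarith
    qed
    hence "rt (rt (c (t, s))) = 0" if "t \<in> T n" "s \<in> T m" for t s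
      using mon_independent[of "\<lambda>s. rt (rt (c (t, s)))" m s] that by (simp add: h_def)
    moreover have "rt a = 0 \<Longrightarrow> a = 0" for a using rt[of a] R1 by (simp add: power_0_left)
    ultimately have "\<forall>w\<in>I. c w = 0" by (auto simp: I_def)
    thus False using c(1) by blast
  qed
  have "card Zs \<le> D * (n + R * m)"
    by (rule card_zeros_le[OF G_deg G_nz fin]) (use G_zero in \<open>auto simp: Zs_def\<close>)
  also have "\<dots> \<le> R * R + (3 * (D * D) + 1) * R" using nm(4) by (simp add: mult.commute)
  finally show ?thesis using fin by simp
qed

end

section \<open>Two irreducible plane curves\<close>

text \<open>With \<open>m = e div gcd i e\<close>, a root \<open>y\<close> of 1 + X + ... + X^(m-1)
  differs from 1 because \<open>m\<close> is nonzero in the field; a root of \<open>y\<close> of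
  order \<open>gcd i e\<close> is the witness.\<close>

lemma root_of_unity_separates:
  fixes e i :: nat
  assumes "of_nat e \<noteq> (0::'k::alg_closed_field)" "\<not> e dvd i"
  shows "\<exists>z::'k. z ^ e = 1 \<and> z ^ i \<noteq> 1"
proof -
  have "e \<noteq> 0" using assms(1) by (cases e) auto
  hence "gcd i e \<noteq> 0" by simp
  define g where "g = gcd i e"
  obtain i' m where im: "i = i' * g" "e = m * g" "coprime i' m"
    using gcd_coprime_exists[OF \<open>gcd i e \<noteq> 0\<close>] unfolding g_def by blast
  have m: "m \<noteq> 0" "m \<noteq> 1" using im assms \<open>e \<noteq> 0\<close> by auto
  have "of_nat m \<noteq> (0::'k)" using assms(1) im by auto
  define p :: "'k poly" where "p = (\<Sum>j<m. monom 1 j)"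
  have "coeff p (m - 1) = 1" using m by (simp add: p_def coeff_sum)
  hence "m - 1 \<le> degree p" by (intro le_degree) simp
  hence "degree p > 0" using m by linarith
  then obtain y where y: "poly p y = 0" using alg_closed_imp_poly_has_root by blast
  have py: "(\<Sum>j<m. y ^ j) = 0" using y by (simp add: p_def poly_sum poly_monom)
  hence y1: "y \<noteq> 1" using \<open>of_nat m \<noteq> (0::'k)\<close> by auto
  have ym: "y ^ m = 1" using py power_diff_1_eq[of y m] by simp
  obtain z where z: "z ^ g = y" using nth_root_exists[of g y] \<open>gcd i e \<noteq> 0\<close> by (auto simp: g_def)
  have "z ^ e = 1" using z ym by (simp add: im(2) mult.commute[of m] power_mult)
  moreover have "z ^ i \<noteq> 1"
  proof
    assume "z ^ i = 1"
    hence yi: "y ^ i' = 1" using z by (simp add: im(1) mult.commute[of i'] power_mult)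
    have "i' \<noteq> 0" using im(1) assms(2) by (intro notI) simp
    then obtain a b where "i' * a = m * b + gcd i' m" using bezout_nat[of i' m] by blast
    hence ab: "i' * a = m * b + 1" using im(3) by simp
    have "(y ^ i') ^ a = (y ^ m) ^ b * y" unfolding power_mult[symmetric] ab by simp
    thus False using yi ym y1 by simp
  qed
  ultimately show ?thesis by blast
qed

text \<open>In each factor take, among the terms of top total degree, the one with the largest outer
  exponent. The product of these two terms cannot be cancelled, so total degrees add up and neither
  factor can exceed its own outer degree.\<close>

lemma bidegree_le_factor:
  fixes p q :: "'k::field poly poly"
  assumes pq: "p * q \<in> bidegree_le (degree p + degree q)"
    and lead: "lead_coeff p = 1" "lead_coeff q = 1"
  shows "p \<in> bidegree_le (degree p)"
proof -
  have top: "\<exists>d i. (\<forall>a b. coeff (coeff r a) b \<noteq> 0 \<longrightarrow> a + b \<le> d \<and> (a + b = d \<longrightarrow> a \<le> i)) \<and>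
      i \<le> d \<and> coeff (coeff r i) (d - i) \<noteq> 0 \<and> degree r \<le> d"
    if "lead_coeff r = 1" for r :: "'k poly poly"
  proof -
    define S where "S = {t. coeff (coeff r (fst t)) (snd t) \<noteq> 0}"
    have "S \<subseteq> (SIGMA a:{..degree r}. {..degree (coeff r a)})"
      by (auto simp: S_def intro!: le_degree)
    hence fS: "finite S" by (rule finite_subset) auto
    have ne: "(degree r, 0) \<in> S" using that by (simp add: S_def)
    define d where "d = Max ((\<lambda>t. fst t + snd t) ` S)"
    have d: "fst t + snd t \<le> d" if "t \<in> S" for t unfolding d_def using fS that by simp
    define S' where "S' = {t\<in>S. fst t + snd t = d}"
    have "d \<in> (\<lambda>t. fst t + snd t) ` S" unfolding d_def using fS ne by (intro Max_in) auto
    hence "S' \<noteq> {}" unfolding S'_def by blast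
    have fS': "finite S'" using fS by (simp add: S'_def)
    define i where "i = Max (fst ` S')"
    have i: "fst t \<le> i" if "t \<in> S'" for t unfolding i_def using fS' that by simp
    have "i \<in> fst ` S'" unfolding i_def using fS' \<open>S' \<noteq> {}\<close> by (intro Max_in) auto
    then obtain t where t: "t \<in> S'" "fst t = i" by auto
    have snd_t: "snd t = d - i" "i \<le> d" using t by (auto simp: S'_def)
    have "coeff (coeff r i) (d - i) \<noteq> 0" using t snd_t by (auto simp: S'_def S_def)
    moreover have "\<forall>a b. coeff (coeff r a) b \<noteq> 0 \<longrightarrow> a + b \<le> d \<and> (a + b = d \<longrightarrow> a \<le> i)"
      using d i by (force simp: S_def S'_def)
    moreover have "degree r \<le> d" using d[OF ne] by simp
    ultimately show ?thesis using snd_t by blast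
  qed
  obtain d i where p: "\<And>a b. coeff (coeff p a) b \<noteq> 0 \<Longrightarrow> a + b \<le> d \<and> (a + b = d \<longrightarrow> a \<le> i)"
      "i \<le> d" "coeff (coeff p i) (d - i) \<noteq> 0" "degree p \<le> d"
    using top[OF lead(1)] by blast
  obtain d' i' where q: "\<And>a b. coeff (coeff q a) b \<noteq> 0 \<Longrightarrow> a + b \<le> d' \<and> (a + b = d' \<longrightarrow> a \<le> i')"
      "i' \<le> d'" "coeff (coeff q i') (d' - i') \<noteq> 0" "degree q \<le> d'"
    using top[OF lead(2)] by blast
  define I J where "I = i + i'" and "J = (d - i) + (d' - i')"
  have "coeff (coeff (p * q) I) J
      = (\<Sum>a\<le>I. \<Sum>b\<le>J. coeff (coeff p a) b * coeff (coeff q (I - a)) (J - b))"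
    by (simp add: coeff_mult coeff_sum)
  also have "\<dots> = (\<Sum>a\<le>I. \<Sum>b\<le>J. if a = i \<and> b = d - i then coeff (coeff p i) (d - i) * coeff (coeff q i') (d' - i') else 0)"
  proof (intro sum.cong refl)
    fix a b assume ab: "a \<in> {..I}" "b \<in> {..J}"
    show "coeff (coeff p a) b * coeff (coeff q (I - a)) (J - b)
        = (if a = i \<and> b = d - i then coeff (coeff p i) (d - i) * coeff (coeff q i') (d' - i') else 0)"
    proof (cases "coeff (coeff p a) b = 0 \<or> coeff (coeff q (I - a)) (J - b) = 0")
      case True
      thus ?thesis using p(3) q(3) by (auto simp: I_def J_def)
    next
      case False
      hence 1: "a + b \<le> d \<and> (a + b = d \<longrightarrow> a \<le> i)"
        and 2: "(I - a) + (J - b) \<le> d' \<and> ((I - a) + (J - b) = d' \<longrightarrow> I - a \<le> i')"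
        using p(1)[of a b] q(1)[of "I - a" "J - b"] by auto
      have "a = i \<and> b = d - i"
        using 1 2 ab p(2) q(2) unfolding I_def J_def atMost_iff by linarith
      thus ?thesis by (simp add: I_def J_def)
    qed
  qed
  also have "\<dots> = (\<Sum>a\<le>I. if a = i then coeff (coeff p i) (d - i) * coeff (coeff q i') (d' - i') else 0)"
    by (intro sum.cong refl) (simp add: J_def)
  also have "\<dots> = coeff (coeff p i) (d - i) * coeff (coeff q i') (d' - i')"
    by (simp add: I_def)
  finally have "coeff (coeff (p * q) I) J \<noteq> 0" using p(3) q(3) by simp
  hence "I + J \<le> degree p + degree q" using pq by (force simp: bidegree_le_def)
  hence "d = degree p" using p(2,4) q(2,4) by (simp add: I_def J_def)
  thus ?thesis using p(1) by (force simp: bidegree_le_def)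
qed

text \<open>The affine cubic U^3 - s U V + b V^3 + c of Hesse type, pulled back along U = X^e and V
  = Y^e.\<close>

definition dwork_poly :: "nat \<Rightarrow> 'k::field \<Rightarrow> 'k \<Rightarrow> 'k \<Rightarrow> 'k poly poly" where
  "dwork_poly e s b c = monom 1 (3 * e) - monom (monom s e) e + [:monom b (3 * e) + [:c:]:]"

lemma dwork_poly_ev:
  "ph.ev y x (dwork_poly e s b c) = x ^ (3 * e) - s * y ^ e * x ^ e + b * y ^ (3 * e) + c"
proof -
  have "dwork_poly e s b c = monom 1 (3 * e) + (monom (monom (- s) e) e + [:monom b (3 * e) + [:c:]:])"
    by (simp add: dwork_poly_def flip: minus_monom)
  thus ?thesis by (simp only: ph.ev_add ph.ev_monom ph.ev_pCons ph.ev_0) (simp add: poly_monom)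
qed

lemma dwork_poly_props:
  assumes "e > 0"
  shows "degree (dwork_poly e s b c) = 3 * e" "lead_coeff (dwork_poly e s b c) = 1"
    "dwork_poly e s b c \<in> bidegree_le (3 * e)"
    "coeff (dwork_poly e s b c) 0 = monom b (3 * e) + [:c:]"
proof -
  have c: "coeff (dwork_poly e s b c) i = (if i = 3 * e then 1 else if i = e then - monom s e
      else if i = 0 then monom b (3 * e) + [:c:] else 0)" for i
    using assms by (auto simp: dwork_poly_def coeff_pCons split: nat.splits)
  show d: "degree (dwork_poly e s b c) = 3 * e"
    by (rule antisym[OF degree_le le_degree]) (use assms in \<open>auto simp: c\<close>)
  show "lead_coeff (dwork_poly e s b c) = 1" unfolding d by (simp add: c)
  show "dwork_poly e s b c \<in> bidegree_le (3 * e)"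
    using assms by (auto simp: bidegree_le_def c coeff_pCons split: nat.splits)
  show "coeff (dwork_poly e s b c) 0 = monom b (3 * e) + [:c:]" using assms by (simp add: c)
qed

definition rescale :: "'k::field \<Rightarrow> 'k \<Rightarrow> 'k poly poly \<Rightarrow> 'k poly poly" where
  "rescale z t p = pcompose (map_poly (\<lambda>a. pcompose a [:0, t:]) p) [:0, [:z:]:]"

lemma coeff_rescale: "coeff (coeff (rescale z t p) i) j = z ^ i * t ^ j * coeff (coeff p i) j"
proof -
  have "coeff (rescale z t p) i = [:z:] ^ i * pcompose (coeff p i) [:0, t:]"
    by (simp add: rescale_def coeff_pcompose_linear coeff_map_poly)
  also have "[:z:] ^ i = [:z ^ i:]" by (induction i) (auto simp: one_pCons)
  finally show ?thesis by (simp add: coeff_pcompose_linear)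
qed

lemma rescale_mult: "rescale z t (p * q) = rescale z t p * rescale z t q"
proof -
  have "coeff (coeff (rescale z t (p * q)) i) j = coeff (coeff (rescale z t p * rescale z t q) i) j" for i j
  proof -
    have "coeff (coeff (rescale z t p * rescale z t q) i) j = (\<Sum>a\<le>i. \<Sum>b\<le>j.
        z ^ a * t ^ b * coeff (coeff p a) b * (z ^ (i - a) * t ^ (j - b) * coeff (coeff q (i - a)) (j - b)))"
      by (simp add: coeff_mult coeff_sum coeff_rescale)
    also have "\<dots> = (\<Sum>a\<le>i. \<Sum>b\<le>j. z ^ i * t ^ j * (coeff (coeff p a) b * coeff (coeff q (i - a)) (j - b)))"
    proof (intro sum.cong refl)
      fix a b assume "a \<in> {..i}" "b \<in> {..j}"
      hence "z ^ i = z ^ a * z ^ (i - a)" "t ^ j = t ^ b * t ^ (j - b)"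
        by (simp_all flip: power_add)
      thus "z ^ a * t ^ b * coeff (coeff p a) b * (z ^ (i - a) * t ^ (j - b) * coeff (coeff q (i - a)) (j - b))
          = z ^ i * t ^ j * (coeff (coeff p a) b * coeff (coeff q (i - a)) (j - b))"
        by (simp only: mult_ac)
    qed
    also have "\<dots> = coeff (coeff (rescale z t (p * q)) i) j"
      by (simp add: coeff_rescale coeff_mult coeff_sum sum_distrib_left)
    finally show ?thesis by simp
  qed
  thus ?thesis by (intro poly_eqI)
qed

lemma rescale_dwork_poly:
  assumes "z ^ e = 1" "t ^ e = 1"
  shows "rescale z t (dwork_poly e s b c) = dwork_poly e s b c"
proof -
  have "z ^ i * t ^ j * coeff (coeff (dwork_poly e s b c) i) j = coeff (coeff (dwork_poly e s b c) i) j" for i j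
  proof (cases "coeff (coeff (dwork_poly e s b c) i) j = 0")
    case False
    hence "i \<in> {3 * e, e, 0} \<and> j \<in> {3 * e, e, 0}"
      by (auto simp: dwork_poly_def coeff_pCons split: nat.splits if_splits)
    moreover have "z ^ (3 * e) = 1" "t ^ (3 * e) = 1" using assms by (simp_all add: mult.commute[of 3] power_mult)
    ultimately show ?thesis using assms by auto
  qed simp
  thus ?thesis by (intro poly_eqI) (simp add: coeff_rescale)
qed

text \<open>A root of a repeated factor is a root of the derivative, hence 0, since \<open>n\<close>
  is invertible in the field; but 0 is not a root of the binomial.\<close>

lemma no_square_factor:
  fixes b c :: "'k::alg_closed_field"
  assumes "b \<noteq> 0" "c \<noteq> 0" "of_nat n \<noteq> (0::'k)" "degree r > 0"
  shows "\<not> r * r dvd monom b n + [:c:]"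
proof
  assume "r * r dvd monom b n + [:c:]"
  then obtain w where w: "monom b n + [:c:] = r * r * w" by (elim dvdE)
  obtain y where y: "poly r y = 0" using alg_closed_imp_poly_has_root[OF assms(4)] by blast
  have n: "n > 0" using assms(3) by (cases n) auto
  have "poly (pderiv (monom b n + [:c:])) y = 0" unfolding w using y by (simp add: pderiv_mult)
  hence "y = 0" using assms n by (auto simp: pderiv_add pderiv_monom pderiv_pCons poly_monom)
  moreover have "poly (monom b n + [:c:]) y = 0" unfolding w using y by simp
  ultimately show False using assms(2) n by (simp add: poly_monom power_0_left)
qed

lemma poly_eq_0_alg_closed:
  fixes p :: "'k::alg_closed_field poly"
  assumes "\<And>x. poly p x = 0"
  shows "p = 0"
proof (rule ccontr)
  assume "p \<noteq> 0"
  have "degree p > 0"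
  proof (rule ccontr)
    assume "\<not> degree p > 0"
    hence "degree p = 0" by simp
    then obtain a where "p = [:a:]" by (rule degree_eq_zeroE)
    thus False using assms \<open>p \<noteq> 0\<close> by auto
  qed
  hence "degree (p + 1) > 0" by (simp add: degree_add_eq_left)
  then obtain x where "poly (p + 1) x = 0" using alg_closed_imp_poly_has_root by blast
  thus False using assms by simp
qed

lemma monic_factorization:
  fixes a b :: "'k::field poly poly"
  assumes "lead_coeff (a * b) = 1"
  obtains u v where "u * v = 1" "lead_coeff (smult v a) = 1" "lead_coeff (smult u b) = 1"
    "smult v a * smult u b = a * b"
proof -
  define u v where "u = lead_coeff a" and "v = lead_coeff b"
  have uv: "u * v = 1" using assms by (simp add: lead_coeff_mult u_def v_def)
  hence "v * u = 1" by (simp add: mult.commute)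
  have 1: "lead_coeff (smult v a) = 1" using \<open>v * u = 1\<close> by (auto simp: lead_coeff_smult u_def)
  have 2: "lead_coeff (smult u b) = 1" using uv by (auto simp: lead_coeff_smult v_def)
  have 3: "smult v a * smult u b = a * b" using uv \<open>v * u = 1\<close> by simp
  show thesis by (rule that[OF uv 1 2 3])
qed

lemma monic_degree_0: "lead_coeff p = 1 \<Longrightarrow> degree p = 0 \<Longrightarrow> p = (1 :: 'a::comm_semiring_1 poly)"
  by (metis degree_eq_zeroE lead_coeff_pCons(2) one_pCons)

text \<open>A prime factor meets the lines \<open>X = 0\<close> and \<open>Y = 0\<close>, where the curve has only simple points,
  so it is stable under \<open>X \<mapsto> zX\<close> and \<open>Y \<mapsto> tY\<close> for \<open>e\<close>-th roots of unity \<open>z\<close>, \<open>t\<close>, hence a polynomial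
  in \<open>X\<^sup>e\<close> and \<open>Y\<^sup>e\<close>.  A proper factorization would then contain a line of the cubic
  \<open>U\<^sup>3 - s U V + b V\<^sup>3 + c\<close>, forcing \<open>s\<^sup>3 = 27 b c\<close>.\<close>

lemma prime_elem_dwork_poly:
  fixes s b c :: "'k::{alg_closed_field,euclidean_ring_gcd,semiring_gcd_mult_normalize}"
  assumes e: "of_nat (3 * e) \<noteq> (0::'k)" and bc: "b \<noteq> 0" "c \<noteq> 0" and s: "s ^ 3 \<noteq> 27 * b * c"
  shows "prime_elem (dwork_poly e s b c)"
proof -
  define P where "P = dwork_poly e s b c"
  have e0: "e > 0" using e by (cases e) auto
  have e1: "of_nat e \<noteq> (0::'k)" using e by simp
  note P = dwork_poly_props[OF e0, of s b c, folded P_def]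
  have nu: "\<not> P dvd 1" using dvd_imp_degree_le[of P 1] P(1) e0 by auto
  have "P \<noteq> 0" using P(1) e0 by auto
  then obtain F0 where F0: "F0 dvd P" "prime F0" using prime_divisor_exists nu by blast
  then obtain G0 where PFG: "P = F0 * G0" by (elim dvdE)
  have "lead_coeff (F0 * G0) = 1" using P(2) PFG by simp
  then obtain u v where uv: "u * v = 1" "lead_coeff (smult v F0) = 1" "lead_coeff (smult u G0) = 1"
    "smult v F0 * smult u G0 = F0 * G0" by (rule monic_factorization)
  define F G where "F = smult v F0" and "G = smult u G0"
  have FG: "F * G = P" and lF: "lead_coeff F = 1" and lG: "lead_coeff G = 1"
    using uv PFG by (simp_all add: F_def G_def)
  have "[:v:] * [:u:] = 1" using uv(1) by (simp add: one_pCons mult.commute)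
  hence "is_unit [:v:]" by (metis dvd_triv_left)
  hence "prime_elem ([:v:] * F0)" using F0(2) by (simp only: prime_elem_mult_unit_left prime_imp_prime_elem)
  hence pF: "prime_elem F" by (simp add: F_def)
  define f g where "f = degree F" and "g = degree G"
  have nz: "F \<noteq> 0" "G \<noteq> 0" using lF lG by auto
  have fg: "f + g = 3 * e" using P(1) nz unfolding f_def g_def FG[symmetric] by (simp add: degree_mult_eq)
  have f0: "f > 0"
  proof (rule ccontr)
    assume "\<not> f > 0"
    hence "F = 1" using monic_degree_0[OF lF] by (simp add: f_def)
    thus False using pF by simp
  qed
  have "g = 0"
  proof (rule ccontr)
    assume "g \<noteq> 0"
    have bF: "F \<in> bidegree_le f" unfolding f_def
      by (rule bidegree_le_factor[OF _ lF lG]) (use fg P(3) in \<open>simp add: FG f_def g_def\<close>)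
    have bG: "G \<in> bidegree_le g" unfolding g_def
      by (rule bidegree_le_factor[OF _ lG lF]) (use fg P(3) in \<open>simp add: FG[symmetric] f_def g_def mult.commute add.commute\<close>)
    have c0: "coeff F 0 * coeff G 0 = monom b (3 * e) + [:c:]"
      using P(4) unfolding FG[symmetric] by (simp add: coeff_mult_0)
    have "degree (coeff F 0) \<le> f" using bF by (intro degree_le) (auto simp: bidegree_le_def)
    moreover have "degree (coeff G 0) \<le> g" using bG by (intro degree_le) (auto simp: bidegree_le_def)
    moreover have "degree (coeff F 0) + degree (coeff G 0) = 3 * e"
    proof -
      have d: "degree (monom b (3 * e) + [:c:]) = 3 * e"
        using bc e0 by (subst degree_add_eq_left) (auto simp: degree_monom_eq)
      hence "monom b (3 * e) + [:c:] \<noteq> 0" using e0 by (metis degree_0 mult_pos_pos zero_less_numeral less_irrefl)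
      hence "coeff F 0 \<noteq> 0" "coeff G 0 \<noteq> 0" unfolding c0[symmetric] by auto
      thus ?thesis using d unfolding c0[symmetric] by (simp add: degree_mult_eq)
    qed
    ultimately have dF0: "degree (coeff F 0) = f" using fg by linarith
    \<comment> \<open>\<open>F\<close> divides its own rescaling or that of \<open>G\<close>. In the
      second case \<open>P\<close> is divisible by \<open>F\<close> times the rescaled
      \<open>F\<close>. These agree on X = 0 if \<open>t = 1\<close> and on Y = 0 if
      \<open>z = 1\<close>, so a restriction of \<open>P\<close> would have a square factor. In the
      first case comparison of leading coefficients gives the weight \<open>z ^ f\<close>.\<close>
    have inv: "z ^ i * t ^ j = z ^ f"
      if zt: "z ^ e = 1" "t ^ e = 1" "z = 1 \<or> t = 1" and nzc: "coeff (coeff F i) j \<noteq> 0" for z t :: 'k and i j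
    proof -
      have "F dvd rescale z t F * rescale z t G"
        using rescale_dwork_poly[OF zt(1,2), of s b c] FG
        unfolding rescale_mult[symmetric] by (simp add: P_def[symmetric]) (metis dvd_triv_left)
      hence "F dvd rescale z t F \<or> F dvd rescale z t G" using pF prime_elem_dvd_mult_iff by blast
      moreover have "\<not> F dvd rescale z t G"
      proof
        assume "F dvd rescale z t G"
        then obtain W where W: "rescale z t G = F * W" by (elim dvdE)
        have PW: "P = rescale z t F * (F * W)"
          using rescale_dwork_poly[OF zt(1,2), of s b c] FG W
          by (metis P_def rescale_mult)
        show False
        proof (cases "t = 1")
          case True
          have "coeff (rescale z t F) 0 = coeff F 0"
            by (rule poly_eqI) (simp add: coeff_rescale True)
          hence "monom b (3 * e) + [:c:] = coeff F 0 * coeff F 0 * coeff W 0"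
            using P(4) unfolding PW by (simp add: coeff_mult_0 mult.assoc)
          thus False using no_square_factor[OF bc e, of "coeff F 0"] dF0 f0 by (metis dvd_triv_left)
        next
          case False
          hence z1: "z = 1" using zt by simp
          define r where "r p = map_poly (\<lambda>a. poly a 0) p" for p :: "'k poly poly"
          have r_coeff: "coeff (r p) i = coeff (coeff p i) 0" for p i
            by (simp add: r_def coeff_map_poly poly_0_coeff_0)
          have r_mult: "r (p * q) = r p * r q" for p q
            by (rule poly_eqI) (simp add: r_coeff coeff_mult coeff_sum coeff_mult_0)
          have "r (rescale z t F) = r F"
            by (rule poly_eqI) (simp add: r_coeff coeff_rescale z1)
          hence "r P = r F * r F * r W" unfolding PW by (simp add: r_mult mult_ac)
          moreover have "r P = monom 1 (3 * e) + [:c:]"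
            using e0 by (intro poly_eqI) (auto simp: r_coeff P_def dwork_poly_def coeff_pCons split: nat.splits)
          moreover have "degree (r F) > 0"
          proof -
            have "coeff (r F) f = 1" using lF by (simp add: r_coeff f_def)
            hence "f \<le> degree (r F)" by (intro le_degree) simp
            thus ?thesis using f0 by simp
          qed
          ultimately show False using no_square_factor[of 1 c "3 * e" "r F"] bc e by (metis dvd_triv_left zero_neq_one)
        qed
      qed
      ultimately obtain w where w: "rescale z t F = F * w" by (auto elim: dvdE)
      have "z \<noteq> 0" "t \<noteq> 0" using zt e0 by (auto simp: power_0_left)
      have lead: "coeff (rescale z t F) f = [:z ^ f:]"
        using lF by (intro poly_eqI) (auto simp: coeff_rescale f_def coeff_pCons split: nat.splits)
      have "rescale z t F \<noteq> 0" using lead \<open>z \<noteq> 0\<close> by (intro notI) simp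
      hence "w \<noteq> 0" using w by auto
      have "degree (rescale z t F) \<le> f"
        by (rule degree_le) (auto simp: f_def coeff_eq_0 coeff_rescale poly_eq_iff)
      hence "degree w = 0" using nz \<open>w \<noteq> 0\<close> unfolding w by (simp add: degree_mult_eq f_def)
      then obtain w0 where w0: "w = [:w0:]" by (rule degree_eq_zeroE)
      have "w0 = [:z ^ f:]" using lead lF unfolding w w0 by (simp add: f_def)
      hence "coeff (coeff (rescale z t F) i) j = z ^ f * coeff (coeff F i) j" by (simp add: w w0)
      thus ?thesis using nzc by (simp add: coeff_rescale)
    qed
    have cf: "coeff (coeff F 0) f \<noteq> 0" using dF0 f0 by (metis degree_0 leading_coeff_0_iff less_irrefl)
    have zf: "z ^ f = 1" if "z ^ e = 1" for z :: 'k using inv[OF that _ _ cf, of 1] by simp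
    have ef: "e dvd f" using root_of_unity_separates[OF e1, of f] zf by blast
    have divs: "e dvd i \<and> e dvd j"
      if H: "\<And>z t. z ^ e = 1 \<Longrightarrow> t ^ e = 1 \<Longrightarrow> z = 1 \<or> t = 1 \<Longrightarrow> z ^ i * t ^ j = (1::'k)" for i j
      using root_of_unity_separates[OF e1, of i] root_of_unity_separates[OF e1, of j] H[of _ 1] H[of 1]
      by auto
    have dF: "e dvd i \<and> e dvd j" if "coeff (coeff F i) j \<noteq> 0" for i j
      by (rule divs) (use inv[OF _ _ _ that] zf in auto)
    have dG: "e dvd i \<and> e dvd j" if nzc: "coeff (coeff G i) j \<noteq> 0" for i j
    proof (rule divs)
      fix z t :: 'k assume zt: "z ^ e = 1" "t ^ e = 1" "z = 1 \<or> t = 1"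
      have "z ^ i * t ^ j * coeff (coeff F i) j = coeff (coeff F i) j" for i j
        using inv[OF zt, of i j] zf[OF zt(1)] by (cases "coeff (coeff F i) j = 0") auto
      hence "rescale z t F = F" by (intro poly_eqI) (simp add: coeff_rescale)
      hence "F * rescale z t G = F * G"
        using rescale_dwork_poly[OF zt(1,2), of s b c] FG by (metis P_def rescale_mult)
      hence "rescale z t G = G" using nz by simp
      hence "z ^ i * t ^ j * coeff (coeff G i) j = coeff (coeff G i) j" by (metis coeff_rescale)
      thus "z ^ i * t ^ j = 1" using nzc by simp
    qed
    \<comment> \<open>Two positive multiples of \<open>e\<close> with sum \<open>3 * e\<close>: one
      of them is \<open>e\<close>, and that factor is linear in the \<open>e\<close>-th
      powers.\<close>
    have "f = e \<or> g = e"
    proof -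
      obtain k where k: "f = e * k" using ef by (elim dvdE)
      have "e * k < e * 3" using fg \<open>g \<noteq> 0\<close> k by linarith
      moreover have "0 < e * k" using f0 k by simp
      ultimately have "k = 1 \<or> k = 2" by auto
      thus ?thesis using k fg by auto
    qed
    then obtain L where L: "L dvd P" "lead_coeff L = 1" "degree L = e" "L \<in> bidegree_le e"
      "\<And>i j. coeff (coeff L i) j \<noteq> 0 \<Longrightarrow> e dvd i \<and> e dvd j"
    proof
      assume "f = e"
      thus thesis using that[of F] FG lF bF dF by (auto simp: f_def)
    next
      assume "g = e"
      thus thesis using that[of G] FG lG bG dG by (auto simp: g_def)
    qed
    define \<alpha> \<gamma> where "\<alpha> = coeff (coeff L 0) e" and "\<gamma> = coeff (coeff L 0) 0"
    have Leq: "L = monom 1 e + [:monom \<alpha> e + [:\<gamma>:]:]"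
    proof (intro poly_eqI)
      fix i j
      have "coeff (coeff L i) j = 0" if "i \<noteq> e" "i \<noteq> 0"
      proof (cases "e < i")
        case True
        thus ?thesis using L(3) by (simp add: coeff_eq_0)
      next
        case False
        show ?thesis
        proof (rule ccontr)
          assume "coeff (coeff L i) j \<noteq> 0"
          hence "e dvd i" using L(5) by blast
          thus False using dvd_imp_le[of e i] that False by simp
        qed
      qed
      moreover have "coeff L e = 1" using L(2,3) by simp
      moreover have "coeff (coeff L 0) j = 0" if "j \<noteq> e" "j \<noteq> 0"
      proof (cases "e < j")
        case True
        thus ?thesis using L(4) by (simp add: bidegree_le_def)
      next
        case False
        show ?thesis
        proof (rule ccontr)
          assume "coeff (coeff L 0) j \<noteq> 0"
          hence "e dvd j" using L(5) by blast
          thus False using dvd_imp_le[of e j] that False by simp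
        qed
      qed
      ultimately show "coeff (coeff L i) j = coeff (coeff (monom 1 e + [:monom \<alpha> e + [:\<gamma>:]:]) i) j"
        using e0 by (cases "i = e") (auto simp: \<alpha>_def \<gamma>_def coeff_pCons split: nat.splits)
    qed
    \<comment> \<open>The cubic restricted to the line U = - (\<alpha> V + \<gamma>), as a
      polynomial in V.\<close>
    define h where "h = [:c - \<gamma>^3, s * \<gamma> - 3 * \<alpha> * \<gamma>^2, s * \<alpha> - 3 * \<alpha>^2 * \<gamma>, b - \<alpha>^3:]"
    have "poly h V = 0" for V
    proof -
      obtain y where y: "y ^ e = V" using nth_root_exists[OF e0] by blast
      obtain x where x: "x ^ e = - (\<alpha> * V + \<gamma>)" using nth_root_exists[OF e0] by blast
      have "ph.ev y x L = 0"
        by (simp add: Leq ph.ev_add ph.ev_monom poly_monom x y)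
      hence "ph.ev y x P = 0" using L(1) ph.ev_dvd_eq_0 by blast
      hence "(x ^ e) ^ 3 - s * V * x ^ e + b * V ^ 3 + c = 0"
        unfolding P_def dwork_poly_ev by (simp add: y mult.commute[of 3] power_mult)
      thus ?thesis unfolding x h_def by (simp add: algebra_simps power2_eq_square power3_eq_cube)
    qed
    hence "h = 0" by (rule poly_eq_0_alg_closed)
    hence h: "c = \<gamma>^3" "s * \<gamma> = 3 * \<alpha> * \<gamma>^2" "b = \<alpha>^3" by (auto simp: h_def)
    hence "\<gamma> \<noteq> 0" using bc by auto
    hence "s = 3 * \<alpha> * \<gamma>" using h(2) by (simp add: power2_eq_square)
    hence "s ^ 3 = 27 * b * c" using h by (simp add: power_mult_distrib power3_eq_cube)
    thus False using s by simp
  qed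
  hence "G = 1" using monic_degree_0[OF lG] by (simp add: g_def)
  thus ?thesis using pF FG by (simp add: P_def)
qed

lemma map_poly_pderiv:
  assumes "coeff_hom (h :: 'a::idom \<Rightarrow> 'b::idom)"
  shows "map_poly h (pderiv p) = pderiv (map_poly h p)"
proof -
  interpret coeff_hom h by fact
  have add: "map_poly h (p + q) = map_poly h p + map_poly h q" for p q
    by (rule poly_eqI) (simp add: coeff_map_poly hom_add)
  show ?thesis by (induction p) (simp_all add: pderiv_pCons map_poly_pCons add)
qed

lemma fps_ev_nth_0: "fh.ev f P $ 0 = ph.ev 0 (f $ 0) P"
  by (induction P) (simp_all flip: poly_0_coeff_0)

text \<open>A simple point above Y = 0 lifts to a power series branch by
  \<open>fps_hensel\<close>.\<close>

lemma plane_curve_exists: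
  fixes P :: "'k::{alg_closed_field,euclidean_ring_gcd,semiring_gcd_mult_normalize} poly poly"
  assumes "D > 0" "degree P = D" "lead_coeff P = 1" "P \<in> bidegree_le D" "prime_elem P"
    and "poly (map_poly (\<lambda>a. poly a 0) P) x0 = 0"
    and "poly (pderiv (map_poly (\<lambda>a. poly a 0) P)) x0 \<noteq> 0"
  shows "\<exists>x. plane_curve P D x"
proof -
  have "poly (map_poly fps_of_poly P) (fps_const x0) $ 0 = 0"
    using assms(6) fps_ev_nth_0[of "fps_const x0" P] by (simp add: fh.ev_def ph.ev_def)
  moreover have "poly (pderiv (map_poly fps_of_poly P)) (fps_const x0) $ 0 \<noteq> 0"
    using assms(7) fps_ev_nth_0[of "fps_const x0" "pderiv P"]
      map_poly_pderiv[OF fh.coeff_hom_axioms, of P] map_poly_pderiv[OF ph.coeff_hom_axioms, of 0 P]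
    by (simp add: fh.ev_def ph.ev_def)
  ultimately obtain y where "poly (map_poly fps_of_poly P) y = 0" using fps_hensel by blast
  hence "plane_curve P D y" using assms by unfold_locales (simp_all add: fh.ev_def)
  thus ?thesis by blast
qed

theorem card_dwork_points_le:
  fixes s b c :: "'k::{alg_closed_field,euclidean_ring_gcd,semiring_gcd_mult_normalize}"
  assumes e: "of_nat (3 * e) \<noteq> (0::'k)" and bc: "b \<noteq> 0" "c \<noteq> 0" and s: "s ^ 3 \<noteq> 27 * b * c"
    and p: "prime CHAR('k)" and R: "R = CHAR('k) ^ \<nu>" and big: "2 * ((3 * e) * (3 * e)) + 5 \<le> R"
  defines "Z \<equiv> {(x, y). x ^ (3 * e) - s * y ^ e * x ^ e + b * y ^ (3 * e) + c = 0
                   \<and> x ^ (R * R) = x \<and> y ^ (R * R) = y}"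
  shows "finite Z" "card Z \<le> R * R + (3 * ((3 * e) * (3 * e)) + 1) * R"
proof -
  have e0: "e > 0" using e by (cases e) auto
  note P = dwork_poly_props[OF e0, of s b c]
  have r: "map_poly (\<lambda>a. poly a 0) (dwork_poly e s b c) = monom 1 (3 * e) + [:c:]"
    using e0 by (intro poly_eqI)
      (auto simp: coeff_map_poly poly_0_coeff_0 dwork_poly_def coeff_pCons split: nat.splits)
  obtain x0 where x0: "x0 ^ (3 * e) = - c" using nth_root_exists[of "3 * e" "- c"] e0 by auto
  have "x0 \<noteq> 0" using x0 bc e0 by (auto simp: power_0_left)
  have "\<exists>x. plane_curve (dwork_poly e s b c) (3 * e) x"
  proof (rule plane_curve_exists[OF _ P(1,2,3) prime_elem_dwork_poly[OF e bc s]])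
    show "poly (map_poly (\<lambda>a. poly a 0) (dwork_poly e s b c)) x0 = 0"
      by (simp add: r poly_monom x0)
    show "poly (pderiv (map_poly (\<lambda>a. poly a 0) (dwork_poly e s b c))) x0 \<noteq> 0"
      using e \<open>x0 \<noteq> 0\<close> by (simp add: r pderiv_add pderiv_monom pderiv_pCons poly_monom)
  qed (use e0 in simp)
  then obtain x where "plane_curve (dwork_poly e s b c) (3 * e) x" by blast
  then interpret plane_curve "dwork_poly e s b c" "3 * e" x .
  have "Z = {z. on_curve z \<and> fst z ^ (R * R) = fst z \<and> snd z ^ (R * R) = snd z}"
    by (auto simp: Z_def on_curve_def dwork_poly_ev)
  thus "finite Z" "card Z \<le> R * R + (3 * ((3 * e) * (3 * e)) + 1) * R"
    using card_rational_points_le[OF p R big] by auto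
qed

text \<open>The discriminant condition: a double root \<open>x\<close> of (1 - s x)^2 - 4 n x^3
  satisfies \<open>s = 3 * n * x\<^sup>2\<close> and \<open>n * x ^ 3 = 1\<close>, hence
  \<open>s ^ 3 = 27 * n\<close>.\<close>

lemma weierstrass_simple_root:
  fixes s n x :: "'k::field"
  assumes "(2::'k) \<noteq> 0" "n \<noteq> 0" "s ^ 3 \<noteq> 27 * n" and three: "(3::'k) \<noteq> 0"
    and 1: "(1 - s * x)\<^sup>2 = 4 * n * x ^ 3" and 2: "- s * (1 - s * x) = 6 * n * x\<^sup>2"
  shows False
proof -
  have "x \<noteq> 0" using 1 by auto
  have "s\<^sup>2 * (1 - s * x)\<^sup>2 = (- s * (1 - s * x))\<^sup>2" by (simp add: power_mult_distrib)
  hence "s\<^sup>2 * (4 * n * x ^ 3) = (6 * n * x\<^sup>2)\<^sup>2" by (simp only: 1 2)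
  hence "(4 * n * x ^ 3) * s\<^sup>2 = (4 * n * x ^ 3) * (9 * n * x)"
    by (simp add: power2_eq_square power3_eq_cube algebra_simps)
  moreover have "(4::'k) \<noteq> 0" using assms(1) by (metis mult_eq_0_iff numeral_Bit0_eq_double)
  moreover have "4 * n * x ^ 3 \<noteq> 0" using \<open>(4::'k) \<noteq> 0\<close> assms(2) \<open>x \<noteq> 0\<close> by simp
  ultimately have s2: "s\<^sup>2 = 9 * n * x" using mult_left_cancel by blast
  have "s = s\<^sup>2 * x - 6 * n * x\<^sup>2" using 2 by (simp add: algebra_simps power2_eq_square)
  hence "s = 9 * n * x * x - 6 * n * x\<^sup>2" by (simp only: s2)
  also have "\<dots> = 3 * n * x\<^sup>2" by Groebner_Basis.algebra
  finally have s1: "s = 3 * n * x\<^sup>2" .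
  have "(9 * n * x) * 1 = (9 * n * x) * (n * x ^ 3)"
    using s2 unfolding s1 by (simp add: power2_eq_square power3_eq_cube algebra_simps)
  moreover have "9 * n * x \<noteq> 0"
  proof -
    have "(9::'k) = 3 * 3" by simp
    hence "(9::'k) \<noteq> 0" using three by (metis mult_eq_0_iff)
    thus ?thesis using assms(2) \<open>x \<noteq> 0\<close> by simp
  qed
  ultimately have "n * x ^ 3 = 1" by (metis mult_left_cancel)
  moreover have "s ^ 3 = 27 * n * (n * (n * x ^ 3) * x ^ 3)"
    unfolding s1 by (simp add: power2_eq_square power3_eq_cube algebra_simps)
  ultimately show False using assms(3) by simp
qed

text \<open>The factor \<nu> covers the curve and its quadratic twist at once. The constants 23 and
  28 are \<open>2 * (D * D) + 5\<close> and \<open>3 * (D * D) + 1\<close> for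
  \<open>D = 3\<close>.\<close>

theorem card_weierstrass_points_le:
  fixes s n \<nu> :: "'k::{alg_closed_field,euclidean_ring_gcd,semiring_gcd_mult_normalize}"
  assumes two: "(2::'k) \<noteq> 0" and three: "(3::'k) \<noteq> 0" and n: "n \<noteq> 0" and s: "s ^ 3 \<noteq> 27 * n" and \<nu>: "\<nu> \<noteq> 0"
    and p: "prime CHAR('k)" and R: "R = CHAR('k) ^ r" and big: "23 \<le> R"
  defines "Z \<equiv> {(x, y). \<nu> * y\<^sup>2 = (1 - s * x)\<^sup>2 - 4 * n * x ^ 3 \<and> x ^ (R * R) = x \<and> y ^ (R * R) = y}"
  shows "finite Z" "card Z \<le> R * R + 28 * R"
proof -
  have four: "4 * n \<noteq> 0" using two n by (metis mult_eq_0_iff numeral_Bit0_eq_double)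
  \<comment> \<open>Division by \<open>4 * n\<close> makes the equation monic in x, which is taken
    as the outer variable.\<close>
  define a where "a = 1 / (4 * n)"
  have a: "4 * n * a = 1" "a \<noteq> 0" using four by (simp_all add: a_def)
  define P where "P = [:[:- a, 0, \<nu> * a:], [:2 * s * a:], [:- (s\<^sup>2 * a):], 1:]"
  have dP: "degree P = 3" and lP: "lead_coeff P = 1" by (simp_all add: P_def)
  have bP: "P \<in> bidegree_le 3"
    by (auto simp: P_def bidegree_le_def coeff_pCons split: nat.splits)
  \<comment> \<open>A monic cubic without linear factor is irreducible. For nonconstant
    \<open>r\<close> the cube has a degree reached by no other term; for constant \<open>r\<close>
    the square of the inner variable cannot cancel.\<close>
  have noroot: "poly P r \<noteq> 0" for r
  proof
    assume "poly P r = 0"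
    hence eq: "r ^ 3 = smult (s\<^sup>2 * a) (r ^ 2) - smult (2 * s * a) r - [:- a, 0, \<nu> * a:]"
      by (simp add: P_def power2_eq_square power3_eq_cube algebra_simps)
    show False
    proof (cases "degree r = 0")
      case True
      then obtain r0 where "r = [:r0:]" by (rule degree_eq_zeroE)
      hence "coeff (r ^ 3) 2 = 0" "coeff (r ^ 2) 2 = 0" "coeff r 2 = 0"
        by (simp_all add: power2_eq_square power3_eq_cube numeral_2_eq_2)
      thus False using arg_cong[OF eq, of "\<lambda>p. coeff p 2"] \<nu> a by (simp add: numeral_2_eq_2)
    next
      case False
      define d where "d = degree r"
      have d: "d \<ge> 1" using False by (simp add: d_def)
      have "r \<noteq> 0" using False by auto
      hence "coeff (r ^ 3) (3 * d) \<noteq> 0"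
        using degree_power_eq[OF \<open>r \<noteq> 0\<close>, of 3] by (metis d_def leading_coeff_0_iff power_not_zero)
      moreover have "coeff (r ^ 2) (3 * d) = 0"
        using degree_power_eq[OF \<open>r \<noteq> 0\<close>, of 2] d by (intro coeff_eq_0) (simp add: d_def)
      moreover have "coeff r (3 * d) = 0" using d by (intro coeff_eq_0) (simp add: d_def)
      moreover have "coeff [:- a, 0, \<nu> * a:] (3 * d) = 0"
        using d by (intro coeff_eq_0) (use le_trans[OF degree_pCons_le] in \<open>auto simp: degree_pCons_eq_if\<close>)
      ultimately show False using arg_cong[OF eq, of "\<lambda>p. coeff p (3 * d)"] by simp
    qed
  qed
  have prime: "prime_elem P"
  proof (rule irreducible_imp_prime_elem, rule Factorial_Ring.irreducibleI)
    show "P \<noteq> 0" using dP by auto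
    show "\<not> P dvd 1" using dvd_imp_degree_le[of P 1] dP by auto
    fix A B assume AB: "P = A * B"
    have "lead_coeff (A * B) = 1" using lP AB by simp
    then obtain u v where uv: "u * v = 1" "lead_coeff (smult v A) = 1" "lead_coeff (smult u B) = 1"
      "smult v A * smult u B = A * B" by (rule monic_factorization)
    have "degree (smult v A) + degree (smult u B) = 3"
    proof -
      have "smult v A \<noteq> 0" "smult u B \<noteq> 0" using uv by auto
      hence "degree (smult v A * smult u B) = degree (smult v A) + degree (smult u B)"
        by (rule degree_mult_eq)
      thus ?thesis by (simp only: uv(4) AB[symmetric] dP)
    qed
    moreover have "degree L \<noteq> 1" if "lead_coeff L = 1" "L dvd P" for L
    proof
      assume "degree L = 1"
      hence "L = [:coeff L 0, 1:]"
        using that(1) by (intro poly_eqI) (auto simp: coeff_pCons coeff_eq_0 split: nat.splits)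
      hence "[:- (- coeff L 0), 1:] dvd P" using that(2) by simp
      hence "poly P (- coeff L 0) = 0" by (simp only: poly_eq_0_iff_dvd)
      thus False using noroot by blast
    qed
    moreover have "smult v A dvd P" "smult u B dvd P"
      using uv(4) AB by (metis dvd_triv_left, metis dvd_triv_right)
    ultimately have "degree (smult v A) = 0 \<or> degree (smult u B) = 0" using uv(2,3)
      by (metis add_cancel_right_left add_is_1 numeral_3_eq_3 One_nat_def Suc_eq_plus1 add_Suc_right nat.inject not0_implies_Suc)
    hence "smult v A = 1 \<or> smult u B = 1" using monic_degree_0 uv(2,3) by blast
    hence "A * [:v:] = 1 \<or> B * [:u:] = 1" by simp
    thus "A dvd 1 \<or> B dvd 1" by (metis dvd_triv_left)
  qed
  have r: "map_poly (\<lambda>a. poly a 0) P = [:- a, 2 * s * a, - (s\<^sup>2 * a), 1:]"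
    by (simp add: P_def map_poly_pCons)
  have "degree [:- a, 2 * s * a, - (s\<^sup>2 * a), 1:] > 0" by simp
  then obtain x0 where x0: "poly [:- a, 2 * s * a, - (s\<^sup>2 * a), 1:] x0 = 0"
    using alg_closed_imp_poly_has_root by blast
  have x1: "(1 - s * x0)\<^sup>2 = 4 * n * x0 ^ 3"
  proof -
    have "4 * n * (- a + 2 * s * a * x0 - s\<^sup>2 * a * x0\<^sup>2 + x0 ^ 3) = 0"
      using x0 by (simp add: algebra_simps power2_eq_square power3_eq_cube)
    hence "(4 * n * a) * (- 1 + 2 * s * x0 - s\<^sup>2 * x0\<^sup>2) + 4 * n * x0 ^ 3 = 0"
      by (simp add: algebra_simps)
    thus ?thesis unfolding a(1) by (simp add: algebra_simps power2_eq_square)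
  qed
  have "\<exists>x. plane_curve P 3 x"
  proof (rule plane_curve_exists[OF _ dP lP bP prime])
    show "poly (map_poly (\<lambda>a. poly a 0) P) x0 = 0" unfolding r by (rule x0)
    show "poly (pderiv (map_poly (\<lambda>a. poly a 0) P)) x0 \<noteq> 0"
    proof
      assume "poly (pderiv (map_poly (\<lambda>a. poly a 0) P)) x0 = 0"
      hence "2 * s * a - 2 * (s\<^sup>2 * a) * x0 + 3 * x0\<^sup>2 = 0"
        unfolding r by (simp add: pderiv_pCons algebra_simps power2_eq_square)
      hence "4 * n * (2 * s * a - 2 * (s\<^sup>2 * a) * x0 + 3 * x0\<^sup>2) = 0" by simp
      hence "(4 * n * a) * (2 * s - 2 * s\<^sup>2 * x0) + 12 * n * x0\<^sup>2 = 0" by (simp add: algebra_simps)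
      hence "2 * (s - s\<^sup>2 * x0 + 6 * n * x0\<^sup>2) = 0" unfolding a(1) by (simp add: algebra_simps)
      hence "s - s\<^sup>2 * x0 + 6 * n * x0\<^sup>2 = 0" using two by (simp only: mult_eq_0_iff) simp
      hence "- s * (1 - s * x0) = 6 * n * x0\<^sup>2"
        by (simp add: algebra_simps power2_eq_square eq_neg_iff_add_eq_0)
      thus False using weierstrass_simple_root[OF two n s three x1] by blast
    qed
  qed simp
  then obtain x where "plane_curve P 3 x" by blast
  then interpret plane_curve P 3 x .
  have "ph.ev y x P = 0 \<longleftrightarrow> \<nu> * y\<^sup>2 = (1 - s * x)\<^sup>2 - 4 * n * x ^ 3" for x y
  proof -
    have "4 * n * ph.ev y x P = (4 * n * a) * (\<nu> * y\<^sup>2 - 1 + 2 * s * x - s\<^sup>2 * x\<^sup>2) + 4 * n * x ^ 3"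
      by (simp add: P_def algebra_simps power2_eq_square power3_eq_cube)
    also have "\<dots> = \<nu> * y\<^sup>2 - ((1 - s * x)\<^sup>2 - 4 * n * x ^ 3)"
      unfolding a(1) by (simp add: algebra_simps power2_eq_square)
    finally show ?thesis using four by (metis eq_iff_diff_eq_0 mult_eq_0_iff)
  qed
  hence "Z = {z. on_curve z \<and> fst z ^ (R * R) = fst z \<and> snd z ^ (R * R) = snd z}"
    by (auto simp: Z_def on_curve_def)
  moreover have "2 * (3 * 3) + 5 \<le> R" using big by simp
  ultimately show "finite Z" "card Z \<le> R * R + 28 * R"
    using card_rational_points_le[OF p R] by auto
qed

section \<open>The cubic curve with its twisted Frobenius\<close>

lemma card_roots_eq_degree:
  fixes p :: "'k::alg_closed_field poly"
  assumes "p \<noteq> 0" "\<And>x. poly p x = 0 \<Longrightarrow> poly (pderiv p) x \<noteq> 0"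
  shows "card {x. poly p x = 0} = degree p"
  using assms
proof (induction "degree p" arbitrary: p)
  case 0
  then obtain c where "p = [:c:]" by (metis degree_eq_zeroE)
  thus ?case using 0 by auto
next
  case (Suc m)
  then obtain a where a: "poly p a = 0" using alg_closed_imp_poly_has_root[of p] by force
  then obtain r where r: "p = [:-a, 1:] * r" by (auto simp: poly_eq_0_iff_dvd elim: dvdE)
  have dp: "pderiv p = r + [:-a, 1:] * pderiv r"
    unfolding r pderiv_mult by (simp add: pderiv_pCons algebra_simps)
  have "r \<noteq> 0" using r Suc.prems by auto
  have deg: "degree p = Suc (degree r)" unfolding r using \<open>r \<noteq> 0\<close> by (subst degree_mult_eq) auto
  have ra: "poly r a \<noteq> 0" using Suc.prems(2)[OF a] by (simp add: dp)
  have "card {x. poly r x = 0} = degree r"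
  proof (rule Suc.hyps(1))
    fix x assume x: "poly r x = 0"
    hence "poly (pderiv p) x = (x - a) * poly (pderiv r) x" by (simp add: dp algebra_simps)
    thus "poly (pderiv r) x \<noteq> 0" using Suc.prems(2)[of x] x by (auto simp: r)
  qed (use deg Suc.hyps \<open>r \<noteq> 0\<close> in auto)
  moreover have "{x. poly p x = 0} = insert a {x. poly r x = 0}" by (auto simp: r)
  ultimately show ?case using ra poly_roots_finite[OF \<open>r \<noteq> 0\<close>] by (simp add: deg)
qed

text \<open>X^Q - X has derivative -1, so its roots are simple.\<close>

lemma card_frobenius_fixed:
  assumes "prime CHAR('k::alg_closed_field)" "Q = CHAR('k) ^ m" "m > 0"
  shows "card {x::'k. x ^ Q = x} = Q"
proof -
  define p :: "'k poly" where "p = monom 1 Q - monom 1 1"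
  have "CHAR('k) > 1" using assms(1) prime_gt_1_nat by blast
  hence Q1: "Q > 1" unfolding assms(2) using assms(3) by (intro one_less_power)
  have "coeff p Q = 1" using Q1 by (simp add: p_def)
  hence d: "degree p = Q"
    using Q1 by (intro antisym degree_le le_degree) (auto simp: p_def)
  have "of_nat Q = (0::'k)" using assms by (simp add: of_nat_eq_0_iff_char_dvd)
  hence "pderiv p = - 1" by (simp add: p_def pderiv_diff pderiv_monom)
  hence "card {x. poly p x = 0} = Q" using card_roots_eq_degree[of p] d Q1 by force
  thus ?thesis by (simp add: p_def poly_monom)
qed

text \<open>The symmetric group on three letters has exponent 6; this fixes the extension degrees
  \<open>6 * j\<close>.\<close>

lemma bij_3_power_6:
  fixes \<rho> :: "3 \<Rightarrow> 3"
  assumes "bij \<rho>"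
  shows "(\<rho> ^^ 6) i = i"
proof -
  have inj: "\<rho> 1 \<noteq> \<rho> 2" "\<rho> 1 \<noteq> \<rho> 3" "\<rho> 2 \<noteq> \<rho> 3"
    using assms by (auto simp: bij_def inj_eq)
  have 6: "(\<rho> ^^ 6) i = \<rho> (\<rho> (\<rho> (\<rho> (\<rho> (\<rho> i)))))" by (simp add: numeral_eq_Suc)
  show ?thesis unfolding 6
    using inj exhaust_3[of "\<rho> 1"] exhaust_3[of "\<rho> 2"] exhaust_3[of "\<rho> 3"] exhaust_3[of i]
    by (elim disjE) simp_all
qed

lemma prod_3: "prod f (UNIV :: 3 set) = f 1 * f 2 * f 3"
  unfolding UNIV_3 by (simp add: mult.assoc)

text \<open>\<rho> records how Frobenius permutes the three geometric coordinates: the identity for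
  a split algebra, a transposition for a line times a quadratic field, a 3-cycle for a cubic field.
  \<open>algebraic\<close> says that every scalar lies in a finite field.\<close>

locale twisted_cubic =
  fixes q fe :: nat and \<rho> :: "3 \<Rightarrow> 3"
    and s n :: "'k::{alg_closed_field,euclidean_ring_gcd,semiring_gcd_mult_normalize}"
  assumes char_prime: "prime CHAR('k)" and q_eq: "q = CHAR('k) ^ fe" and a_pos: "fe > 0"
    and bij: "bij \<rho>" and two: "(2::'k) \<noteq> 0" and three: "(3::'k) \<noteq> 0" and n_nz: "n \<noteq> 0"
    and s_cond: "s ^ 3 \<noteq> 27 * n" and s_fix: "s ^ q = s" and n_fix: "n ^ q = n"
    and algebraic: "\<And>c::'k. \<exists>N>0. c ^ (q ^ N) = c"
begin

definition Fr :: "(3 \<Rightarrow> 'k) \<Rightarrow> 3 \<Rightarrow> 'k" where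
  "Fr v i = v (\<rho> i) ^ q"

definition vm :: "(3 \<Rightarrow> 'k) \<Rightarrow> (3 \<Rightarrow> 'k) \<Rightarrow> 3 \<Rightarrow> 'k" where
  "vm u v i = u i * v i"

definition C :: "(3 \<Rightarrow> 'k) set" where
  "C = {v. sum v UNIV = s \<and> prod v UNIV = n}"

definition U :: "(3 \<Rightarrow> 'k) set" where
  "U = {v. Fr v = v \<and> (\<forall>i. v i \<noteq> 0)}"

text \<open>The norm of the torus from the extension of degree \<open>k\<close>, through which
  characters of \<open>U\<close> are lifted to the points of \<open>Ck k\<close>.\<close>

definition Nm :: "nat \<Rightarrow> (3 \<Rightarrow> 'k) \<Rightarrow> 3 \<Rightarrow> 'k" where
  "Nm k v i = (\<Prod>j<k. (Fr ^^ j) v i)"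

definition Ck :: "nat \<Rightarrow> (3 \<Rightarrow> 'k) set" where
  "Ck k = {v \<in> C. (Fr ^^ k) v = v}"

lemma q_gt_1: "q > 1"
  unfolding q_eq using prime_gt_1_nat[OF char_prime] a_pos by (intro one_less_power)

lemma q_power: "q ^ m = CHAR('k) ^ (fe * m)"
  by (simp add: q_eq power_mult)

lemma frob_add: "(x + y :: 'k) ^ (q ^ m) = x ^ (q ^ m) + y ^ (q ^ m)"
  by (rule freshmans_dream'[OF char_prime q_power])

lemma frob_sum: "(sum g A :: 'k) ^ (q ^ m) = (\<Sum>i\<in>A. g i ^ (q ^ m))"
  by (rule freshmans_dream_sum'[OF char_prime q_power])

lemma frob_minus: "(- x :: 'k) ^ (q ^ m) = - (x ^ (q ^ m))"
proof -
  have "0 = (x + - x) ^ (q ^ m)" using q_gt_1 by (simp add: power_0_left)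
  also have "\<dots> = x ^ (q ^ m) + (- x) ^ (q ^ m)" by (rule frob_add)
  finally show ?thesis by (simp add: eq_neg_iff_add_eq_0 add.commute)
qed

lemma frob_diff: "(x - y :: 'k) ^ (q ^ m) = x ^ (q ^ m) - y ^ (q ^ m)"
  using frob_add[of x "- y" m] by (simp add: frob_minus)

lemma frob_inj: "(x::'k) ^ (q ^ m) = y ^ (q ^ m) \<Longrightarrow> x = y"
  using frob_diff[of x y m] by simp

lemma frob_of_nat: "(of_nat b :: 'k) ^ (q ^ m) = of_nat b"
  by (induction b) (use q_gt_1 in \<open>auto simp: frob_add power_0_left\<close>)

lemma frob_numeral: "(numeral b :: 'k) ^ (q ^ m) = numeral b"
  using frob_of_nat[of "numeral b" m] by simp

lemma frob_fix_pow: "(x::'k) ^ q = x \<Longrightarrow> x ^ (q ^ m) = x"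
  by (induction m) (auto simp: power_mult mult.commute[of q])

lemma Fr_pow: "(Fr ^^ k) v i = v ((\<rho> ^^ k) i) ^ (q ^ k)"
proof (induction k arbitrary: i)
  case (Suc k)
  have "(Fr ^^ Suc k) v i = ((Fr ^^ k) v (\<rho> i)) ^ q" by (simp add: Fr_def)
  also have "\<dots> = v ((\<rho> ^^ k) (\<rho> i)) ^ (q ^ Suc k)"
    unfolding Suc by (simp add: mult.commute flip: power_mult)
  finally show ?case by (simp add: funpow_swap1)
qed simp

lemma rho_6: "(\<rho> ^^ (6 * j)) i = i"
proof (induction j)
  case (Suc j)
  have "(\<rho> ^^ (6 * Suc j)) i = (\<rho> ^^ 6) ((\<rho> ^^ (6 * j)) i)"
    by (simp add: funpow_add)
  thus ?case using Suc bij_3_power_6[OF bij] by simp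
qed simp

lemma Fr_6: "(Fr ^^ (6 * j)) v i = v i ^ (q ^ (6 * j))"
  by (simp add: Fr_pow rho_6)

lemma Fr_inj: "Fr u = Fr v \<Longrightarrow> u = v"
proof
  fix i assume "Fr u = Fr v"
  obtain j where "\<rho> j = i" using bij by (metis bij_pointE)
  hence "u i ^ q ^ 1 = v i ^ q ^ 1" using fun_cong[OF \<open>Fr u = Fr v\<close>, of j] by (simp add: Fr_def)
  thus "u i = v i" by (rule frob_inj)
qed

lemma Fr_vm: "Fr (vm u v) = vm (Fr u) (Fr v)"
  by (rule ext) (simp add: Fr_def vm_def power_mult_distrib)

lemma Frk_vm: "(Fr ^^ k) (vm u v) = vm ((Fr ^^ k) u) ((Fr ^^ k) v)"
  by (rule ext) (simp add: Fr_pow vm_def power_mult_distrib)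

lemma Nm_vm: "Nm k (vm u v) = vm (Nm k u) (Nm k v)"
  by (rule ext) (simp add: Nm_def Frk_vm vm_def prod.distrib)

lemma Fr_in_C: "v \<in> C \<Longrightarrow> Fr v \<in> C"
proof -
  assume v: "v \<in> C"
  have "sum (Fr v) UNIV = (\<Sum>i\<in>UNIV. v (\<rho> i)) ^ q"
    using frob_sum[of "\<lambda>i. v (\<rho> i)" UNIV 1] by (simp add: Fr_def)
  also have "(\<Sum>i\<in>UNIV. v (\<rho> i)) = sum v UNIV" using bij by (rule sum.reindex_bij_betw)
  finally have 1: "sum (Fr v) UNIV = s" using v s_fix by (simp add: C_def)
  have "prod (Fr v) UNIV = (\<Prod>i\<in>UNIV. v (\<rho> i)) ^ q" by (simp add: Fr_def prod_power_distrib)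
  also have "(\<Prod>i\<in>UNIV. v (\<rho> i)) = prod v UNIV" using bij by (rule prod.reindex_bij_betw)
  finally show ?thesis using v n_fix 1 by (simp add: C_def)
qed

lemma Frk_in_C: "v \<in> C \<Longrightarrow> (Fr ^^ k) v \<in> C"
  by (induction k) (auto intro: Fr_in_C)

lemma C_nz: "v \<in> C \<Longrightarrow> v i \<noteq> 0"
  using n_nz by (auto simp: C_def)

lemma Nm_in_U:
  assumes "(Fr ^^ k) v = v" "\<And>i. v i \<noteq> 0"
  shows "Nm k v \<in> U"
proof -
  have nz: "(Fr ^^ j) v i \<noteq> 0" for j i using assms(2) by (simp add: Fr_pow)
  have "Fr (Nm k v) i = Nm k v i" for i
  proof -
    have "Fr (Nm k v) i = (\<Prod>j<k. (Fr ^^ Suc j) v i)"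
      by (simp add: Fr_def Nm_def prod_power_distrib)
    moreover have "(\<Prod>j<k. (Fr ^^ Suc j) v i) * v i = (\<Prod>j<k. (Fr ^^ j) v i) * (Fr ^^ k) v i"
    proof -
      have "(\<Prod>j<Suc k. (Fr ^^ j) v i) = v i * (\<Prod>j<k. (Fr ^^ Suc j) v i)"
        by (subst prod.lessThan_Suc_shift) simp
      moreover have "(\<Prod>j<Suc k. (Fr ^^ j) v i) = (\<Prod>j<k. (Fr ^^ j) v i) * (Fr ^^ k) v i" by simp
      ultimately show ?thesis by (metis mult.commute)
    qed
    ultimately show ?thesis using assms by (simp add: Nm_def)
  qed
  moreover have "Nm k v i \<noteq> 0" for i using nz by (simp add: Nm_def)
  ultimately show ?thesis by (auto simp: U_def)
qed

lemma U_one: "(\<lambda>_. 1) \<in> U"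
  by (auto simp: U_def Fr_def)

lemma U_vm: "u \<in> U \<Longrightarrow> v \<in> U \<Longrightarrow> vm u v \<in> U"
  by (simp add: U_def Fr_vm vm_def)

lemma U_power: "u \<in> U \<Longrightarrow> u i ^ (q ^ 6 - 1) = 1"
proof -
  assume u: "u \<in> U"
  have "(Fr ^^ k) u = u" for k using u by (induction k) (auto simp: U_def)
  hence "u i ^ (q ^ 6) = u i" using Fr_6[of 1 u i] by simp
  moreover have "u i ^ (q ^ 6) = u i * u i ^ (q ^ 6 - 1)" using q_gt_1 by (simp flip: power_Suc)
  moreover have "u i \<noteq> 0" using u by (simp add: U_def)
  ultimately show ?thesis by simp
qed

lemma finite_fixed: "k > 0 \<Longrightarrow> finite {v. (Fr ^^ k) v = v}"
proof -
  assume k: "k > 0"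
  define Fx where "Fx = {x::'k. x ^ (q ^ (6 * k)) = x}"
  have "1 < q ^ (6 * k)" using q_gt_1 k by (intro one_less_power) auto
  hence "finite Fx" unfolding Fx_def by (rule finite_power_eq_self)
  hence "finite (PiE (UNIV::3 set) (\<lambda>_. Fx))" by (intro finite_PiE) auto
  moreover have "{v. (Fr ^^ k) v = v} \<subseteq> PiE UNIV (\<lambda>_. Fx)"
  proof
    fix v assume "v \<in> {v. (Fr ^^ k) v = v}"
    hence "((Fr ^^ k) ^^ 6) v = v" by (simp add: numeral_eq_Suc)
    hence "(Fr ^^ (6 * k)) v = v" by (simp add: funpow_mult mult.commute)
    hence "v i ^ (q ^ (6 * k)) = v i" for i using Fr_6[of k v i] by simp
    thus "v \<in> PiE UNIV (\<lambda>_. Fx)" by (simp add: Fx_def PiE_iff)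
  qed
  ultimately show ?thesis by (rule rev_finite_subset)
qed

lemma finite_Ck: "k > 0 \<Longrightarrow> finite (Ck k)"
  using finite_fixed[of k] by (rule rev_finite_subset) (auto simp: Ck_def)

lemma Ck_6: "Ck (6 * j) = {v \<in> C. \<forall>i. v i ^ (q ^ (6 * j)) = v i}"
  by (auto simp: Ck_def Fr_6 fun_eq_iff)

end

section \<open>Lower bound for the number of points of the cubic\<close>

context twisted_cubic
begin

lemma frob_pow: "((x::'k) ^ m) ^ (q ^ j) = (x ^ (q ^ j)) ^ m"
  by (simp add: mult.commute flip: power_mult)

lemma frob_fixed_pow_pred: "(x::'k) \<noteq> 0 \<Longrightarrow> x ^ (q ^ j) = x \<longleftrightarrow> x ^ (q ^ j - 1) = 1"
proof -
  assume "x \<noteq> 0"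
  have "x ^ (q ^ j) = x * x ^ (q ^ j - 1)" using q_gt_1 by (simp flip: power_Suc)
  thus ?thesis using \<open>x \<noteq> 0\<close> by auto
qed

lemma odd_q_power: "odd (q ^ m)"
proof -
  have "CHAR('k) \<noteq> 2"
    using two of_nat_eq_0_iff_char_dvd[where 'a = 'k, of 2] by auto
  moreover have "CHAR('k) > 1" using char_prime by (rule prime_gt_1_nat)
  ultimately have "odd CHAR('k)" using prime_odd_nat[OF char_prime] by linarith
  thus ?thesis by (simp add: q_eq)
qed

text \<open>The fibre of \<open>C\<close> over \<open>v 1 = 1/x\<close> consists of the square roots of \<open>(1 - s x)\<^sup>2 - 4 n x\<^sup>3\<close>; the
  quadratic twist of this curve has at most \<open>Q + O(\<surd>Q)\<close> points, so \<open>C\<close> has at least \<open>Q - O(\<surd>Q)\<close>.\<close>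

lemma card_Ck_ge:
  assumes R: "23 \<le> q ^ (3 * j)"
  shows "q ^ (6 * j) \<le> card (Ck (6 * j)) + 28 * q ^ (3 * j) + 2"
proof -
  define Q where "Q = q ^ (6 * j)"
  have QR: "Q = q ^ (3 * j) * q ^ (3 * j)" by (simp add: Q_def flip: power_add)
  have j: "j > 0" using R by (cases j) auto
  define Fq where "Fq = {x::'k. x ^ Q = x}"
  have cF: "card Fq = Q" unfolding Fq_def
    by (rule card_frobenius_fixed[OF char_prime, of _ "fe * (6 * j)"]) (use j a_pos in \<open>auto simp: Q_def q_power\<close>)
  have Q0: "Q > 0" using q_gt_1 by (simp add: Q_def)
  have fF: "finite Fq" using cF Q0 by (intro card_ge_0_finite) simp
  define \<delta> where "\<delta> x = (1 - s * x)\<^sup>2 - 4 * n * x ^ 3" for x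
  have \<delta>F: "\<delta> x ^ Q = \<delta> x" if "x ^ Q = x" for x
    using that frob_fix_pow[OF s_fix, of "6 * j"] frob_fix_pow[OF n_fix, of "6 * j"]
    unfolding \<delta>_def Q_def by (simp add: frob_diff power_mult_distrib frob_pow frob_numeral)
  define Z where "Z \<nu> = {(x, y). \<nu> * y\<^sup>2 = \<delta> x \<and> x ^ Q = x \<and> y ^ Q = y}" for \<nu>
  have Z: "finite (Z \<nu>)" "card (Z \<nu>) \<le> Q + 28 * q ^ (3 * j)" if "\<nu> \<noteq> 0" for \<nu>
    using card_weierstrass_points_le[OF two three n_nz s_cond that char_prime q_power R]
    unfolding Z_def \<delta>_def QR by auto
  define h where "h = (Q - 1) div 2"
  have h: "2 * h = Q - 1" using odd_q_power[of "6 * j"] by (simp add: h_def Q_def)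
  have "h > 0"
  proof -
    have "23 * 1 \<le> q ^ (3 * j) * q ^ (3 * j)" using R by (intro mult_mono) auto
    thus ?thesis using h QR by linarith
  qed
  \<comment> \<open>A nonresidue: its \<open>h\<close>-th power is -1, where \<open>h\<close> is
    half of \<open>Q - 1\<close>.\<close>
  obtain \<nu> :: 'k where \<nu>: "\<nu> ^ h = - 1" using nth_root_exists[OF \<open>h > 0\<close>] by blast
  have \<nu>0: "\<nu> \<noteq> 0" using \<nu> \<open>h > 0\<close> by (auto simp: power_0_left)
  have Zfib: "Z \<nu> = Sigma Fq (\<lambda>x. {y. (x, y) \<in> Z \<nu>})" for \<nu>
    by (auto simp: Z_def Fq_def)
  have fib_fin: "finite {y. (x, y) \<in> Z \<nu>}" for x \<nu>
    using fF by (rule rev_finite_subset) (auto simp: Z_def Fq_def)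
  have root: "2 \<le> card {y. (x, y) \<in> Z \<mu>}"
    if "x \<in> Fq" "\<mu> \<noteq> 0" "\<delta> x \<noteq> 0" "(\<delta> x / \<mu>) ^ h = 1" for x \<mu>
  proof -
    obtain y where y: "y ^ 2 = \<delta> x / \<mu>" using nth_root_exists[of 2 "\<delta> x / \<mu>"] by auto
    have "y \<noteq> 0" using y that by auto
    have "y ^ (Q - 1) = 1" unfolding h[symmetric] power_mult y by (rule that)
    hence yQ: "y ^ Q = y" using frob_fixed_pow_pred[OF \<open>y \<noteq> 0\<close>, of "6 * j"] by (simp add: Q_def)
    have "y \<noteq> - y" using \<open>y \<noteq> 0\<close> two by (metis add_eq_0_iff mult_2 mult_eq_0_iff)
    moreover have "(- y) ^ Q = - y" using yQ by (simp add: Q_def frob_minus)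
    hence "{y, - y} \<subseteq> {y. (x, y) \<in> Z \<mu>}"
      using yQ y that by (auto simp: Z_def Fq_def field_simps)
    hence "card {y, - y} \<le> card {y. (x, y) \<in> Z \<mu>}" by (intro card_mono fib_fin)
    ultimately show ?thesis by simp
  qed
  \<comment> \<open>The quotient of \<open>\<delta> x\<close> by 1 or by \<nu> is a square of the
    field, so the curve and its twist together have two points above every \<open>x\<close>, in the
    branch case one on each.\<close>
  have two_roots: "2 \<le> card {y. (x, y) \<in> Z 1} + card {y. (x, y) \<in> Z \<nu>}" if x: "x \<in> Fq" for x
  proof (cases "\<delta> x = 0")
    case True
    have "card {0::'k} \<le> card {y. (x, y) \<in> Z \<mu>}" for \<mu>
      by (intro card_mono fib_fin) (use x True Q0 in \<open>auto simp: Z_def Fq_def power_0_left\<close>)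
    hence "1 \<le> card {y. (x, y) \<in> Z 1}" "1 \<le> card {y. (x, y) \<in> Z \<nu>}" by simp_all
    thus ?thesis by linarith
  next
    case False
    have "\<delta> x ^ (Q - 1) = 1"
      using \<delta>F[of x] x frob_fixed_pow_pred[OF False, of "6 * j"] by (simp add: Fq_def Q_def)
    hence "(\<delta> x ^ h)\<^sup>2 = 1" by (metis h mult.commute power_mult)
    hence "\<delta> x ^ h = 1 \<or> \<delta> x ^ h = - 1" by (simp add: power2_eq_1_iff)
    thus ?thesis
    proof
      assume "\<delta> x ^ h = 1"
      thus ?thesis using root[OF x, of 1] False by simp
    next
      assume "\<delta> x ^ h = - 1"
      thus ?thesis using root[OF x \<nu>0 False] \<nu> by (simp add: power_divide)
    qed
  qed
  have "2 * Q = (\<Sum>x\<in>Fq. 2)" by (simp add: cF)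
  also have "\<dots> \<le> (\<Sum>x\<in>Fq. card {y. (x, y) \<in> Z 1} + card {y. (x, y) \<in> Z \<nu>})"
    by (intro sum_mono two_roots)
  also have "\<dots> = card (Z 1) + card (Z \<nu>)"
    using fF fib_fin by (subst (3) Zfib, subst (4) Zfib) (simp add: sum.distrib)
  finally have Q1: "Q \<le> card (Z 1) + 28 * q ^ (3 * j)" using Z(2)[OF \<nu>0] by linarith
  \<comment> \<open>The points (0, 1) and (0, -1) correspond to points at infinity of the cubic;
    they account for the summand 2.\<close>
  define Z' where "Z' = {z \<in> Z 1. fst z \<noteq> 0}"
  have fZ': "finite Z'" using Z(1)[of 1] by (simp add: Z'_def)
  have "Z 1 \<subseteq> Z' \<union> {(0, 1), (0, - 1)}"
    by (auto simp: Z_def Z'_def \<delta>_def power2_eq_1_iff)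
  hence "card (Z 1) \<le> card (Z' \<union> {(0, 1), (0, - 1)})" using fZ' by (intro card_mono) auto
  also have "\<dots> \<le> card Z' + card {(0::'k, 1::'k), (0, - 1)}" by (rule card_Un_le)
  also have "card {(0::'k, 1::'k), (0, - 1)} \<le> 2" by (simp add: card_insert_if)
  finally have c1: "card (Z 1) \<le> card Z' + 2" by simp
  \<comment> \<open>Inverse of x = 1 / v 1, y = (v 2 - v 3) / v 1: the last two coordinates have sum
    s - 1 / x and difference y / x.\<close>
  define g where "g z i = (case z of (x, y) \<Rightarrow> if i = (1::3) then 1 / x
      else if i = 2 then (s - 1 / x + y / x) / 2 else (s - 1 / x - y / x) / 2)" for z i
  have g: "g (x, y) 1 = 1 / x" "g (x, y) 2 = (s - 1 / x + y / x) / 2" "g (x, y) 3 = (s - 1 / x - y / x) / 2" for x y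
    by (simp_all add: g_def)
  have half: "(u + w) / 2 - (u - w) / 2 = w" for u w :: 'k
  proof -
    have "(u + w) / 2 - (u - w) / 2 = (2 * w) / 2" by (simp flip: diff_divide_distrib)
    thus ?thesis using two by simp
  qed
  have halves: "((u + w) / 2) * ((u - w) / 2) = (u\<^sup>2 - w\<^sup>2) / 4" for u w :: 'k
    by (simp add: power2_eq_square algebra_simps)
  have "inj_on g Z'"
  proof (rule inj_onI)
    fix z w assume zw: "z \<in> Z'" "w \<in> Z'" "g z = g w"
    obtain x y x' y' where xy: "z = (x, y)" "w = (x', y')" by fastforce
    have "x \<noteq> 0" "x' \<noteq> 0" using zw xy by (auto simp: Z'_def)
    have 1: "x = x'" using fun_cong[OF zw(3), of 1] \<open>x \<noteq> 0\<close> \<open>x' \<noteq> 0\<close> by (simp add: xy g)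
    have "g z 2 - g z 3 = y / x" "g w 2 - g w 3 = y' / x'"
      by (simp_all only: xy g half)
    hence "y = y'" using zw(3) 1 \<open>x \<noteq> 0\<close> by simp
    thus "z = w" using 1 xy by simp
  qed
  moreover have "g ` Z' \<subseteq> Ck (6 * j)"
  proof safe
    fix x y assume z: "(x, y) \<in> Z'"
    hence x0: "x \<noteq> 0" and eq: "y\<^sup>2 = \<delta> x" and xF: "x ^ Q = x" "y ^ Q = y"
      by (auto simp: Z'_def Z_def)
    have sQ: "s ^ Q = s" unfolding Q_def by (rule frob_fix_pow[OF s_fix])
    have "g (x, y) i ^ Q = g (x, y) i" for i
      using exhaust_3[of i] xF sQ
      by (auto simp: g Q_def power_divide frob_diff frob_add frob_numeral)
    moreover have "sum (g (x, y)) UNIV = s"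
    proof -
      have "(s - 1 / x + y / x) / 2 + (s - 1 / x - y / x) / 2 = (2 * (s - 1 / x)) / 2"
        by (simp add: add_divide_distrib[symmetric])
      also have "\<dots> = s - 1 / x" using two by simp
      finally show ?thesis by (simp add: sum_3 g add.assoc)
    qed
    moreover have "prod (g (x, y)) UNIV = n"
    proof -
      have 4: "(4::'k) \<noteq> 0" using two by (metis mult_eq_0_iff numeral_Bit0_eq_double)
      have "prod (g (x, y)) UNIV = (1 / x) * ((s - 1 / x)\<^sup>2 - y\<^sup>2 / x\<^sup>2) / 4"
        unfolding prod_3 g mult.assoc halves by (simp add: power_divide)
      also have "\<dots> = (1 / x) * ((1 - s * x)\<^sup>2 - y\<^sup>2) / (4 * x\<^sup>2)"
        using x0 by (simp add: field_simps power2_eq_square)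
      also have "(1 - s * x)\<^sup>2 - y\<^sup>2 = 4 * n * x ^ 3" by (simp add: eq \<delta>_def)
      also have "(1 / x) * (4 * n * x ^ 3) / (4 * x\<^sup>2) = n"
        using x0 4 by (simp add: power2_eq_square power3_eq_cube)
      finally show ?thesis .
    qed
    ultimately show "g (x, y) \<in> Ck (6 * j)" by (simp add: Ck_6 C_def Q_def)
  qed
  ultimately have "card Z' \<le> card (Ck (6 * j))"
    using j by (intro card_inj_on_le[of g]) (auto intro: finite_Ck)
  thus ?thesis using Q1 c1 by (simp add: Q_def)
qed

end

text \<open>Nontriviality is demanded on the norm one torus, because a character that factors
  through the product of the coordinates is constant on the cubic.\<close>

locale twisted_character = twisted_cubic +
  fixes ch :: "(3 \<Rightarrow> 'a) \<Rightarrow> complex"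
  assumes ch_one: "ch (\<lambda>_. 1) = 1"
    and ch_vm: "u \<in> U \<Longrightarrow> v \<in> U \<Longrightarrow> ch (vm u v) = ch u * ch v"
    and ch_nontrivial: "\<exists>t\<in>U. prod t UNIV = 1 \<and> ch t \<noteq> 1"
begin

lemma vm_one: "vm u (\<lambda>_. 1) = u"
  by (simp add: vm_def fun_eq_iff)

lemma ch_norm: "u \<in> U \<Longrightarrow> norm (ch u) = 1"
proof -
  assume u: "u \<in> U"
  define vp where "vp m i = u i ^ m" for m :: nat and i
  have vp: "vp m \<in> U \<and> ch (vp m) = ch u ^ m" for m
  proof (induction m)
    case 0
    have "vp 0 = (\<lambda>_. 1)" by (simp add: vp_def fun_eq_iff)
    thus ?case using U_one ch_one by simp
  next
    case (Suc m)
    have "vp (Suc m) = vm u (vp m)" by (simp add: vp_def vm_def fun_eq_iff)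
    thus ?case using Suc u U_vm ch_vm by simp
  qed
  have "vp (q ^ 6 - 1) = (\<lambda>_. 1)" using U_power[OF u] by (simp add: vp_def fun_eq_iff)
  hence "ch u ^ (q ^ 6 - 1) = 1" using vp[of "q ^ 6 - 1"] ch_one by simp
  hence "norm (ch u) ^ (q ^ 6 - 1) = 1 ^ (q ^ 6 - 1)" by (metis norm_one norm_power power_one)
  moreover have "q ^ 6 - 1 > 0" using one_less_power[OF q_gt_1, of 6] by simp
  ultimately show ?thesis by (meson norm_ge_zero power_eq_imp_eq_base zero_le_one)
qed

definition S :: "nat \<Rightarrow> complex" where
  "S k = (\<Sum>v\<in>Ck k. ch (Nm k v))"

text \<open>Lang's theorem for the torus: \<open>t\<close> is the norm of \<open>Fr u / u\<close>, where \<open>Fr\<^sup>k u = t u\<close>.\<close>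

lemma Nm_surj:
  assumes t: "t \<in> U" "prod t UNIV = 1" and j: "j > 0"
  obtains w where "\<forall>i. w i \<noteq> 0" "\<forall>i. w i ^ (q ^ (6 * j)) = w i" "prod w UNIV = 1" "Nm (6 * j) w = t"
proof -
  define Q where "Q = q ^ (6 * j)"
  have "Q > 1" using q_gt_1 j unfolding Q_def by (intro one_less_power) auto
  then obtain P where P: "Q = Suc P" and Q1: "P > 0" by (cases Q) auto
  obtain u1 where u1: "u1 ^ P = t 1" using nth_root_exists[OF Q1] by blast
  obtain u2 where u2: "u2 ^ P = t 2" using nth_root_exists[OF Q1] by blast
  have tnz: "t i \<noteq> 0" for i using t by (simp add: U_def)
  have unz: "u1 \<noteq> 0" "u2 \<noteq> 0" using u1 u2 tnz[of 1] tnz[of 2] Q1 by (auto simp: power_0_left)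
  \<comment> \<open>The third coordinate makes the product 1; that it is a root of
    \<open>t 3\<close> as well follows from \<open>prod t UNIV = 1\<close>.\<close>
  define u where "u i = (if i = (1::3) then u1 else if i = 2 then u2 else 1 / (u1 * u2))" for i
  have u: "u 1 = u1" "u 2 = u2" "u 3 = 1 / (u1 * u2)" by (simp_all add: u_def)
  have "t 3 = 1 / (t 1 * t 2)" using t(2) tnz by (simp add: prod_3 field_simps)
  hence "u 3 ^ P = t 3" by (simp add: u power_divide power_mult_distrib u1 u2)
  hence uQ1: "u i ^ P = t i" for i using exhaust_3[of i] u1 u2 by (auto simp: u)
  have nz: "u i \<noteq> 0" for i using unz by (simp add: u_def)
  have uQ: "u i ^ Q = t i * u i" for i
    by (simp add: P uQ1)
  have pu: "prod u UNIV = 1" using unz by (simp add: prod_3 u)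
  define w where "w i = Fr u i / u i" for i
  have Fnz: "(Fr ^^ k) u i \<noteq> 0" for k i using nz by (simp add: Fr_pow)
  have 1: "w i \<noteq> 0" for i using nz Fnz[of 1 i] by (simp add: w_def)
  have Ft: "t (\<rho> i) ^ q = t i" for i using t(1) by (auto simp: U_def Fr_def dest: fun_cong[of _ _ i])
  have 2: "w i ^ Q = w i" for i
  proof -
    have "Fr u i ^ Q = (u (\<rho> i) ^ Q) ^ q" unfolding Fr_def by (simp add: mult.commute flip: power_mult)
    also have "\<dots> = t i * Fr u i" by (simp add: uQ power_mult_distrib Ft Fr_def)
    finally show ?thesis using nz tnz[of i] by (simp add: w_def power_divide uQ)
  qed
  have 3: "prod w UNIV = 1"
  proof -
    have "prod (Fr u) UNIV = (\<Prod>i\<in>UNIV. u (\<rho> i)) ^ q" by (simp add: Fr_def prod_power_distrib)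
    also have "(\<Prod>i\<in>UNIV. u (\<rho> i)) = prod u UNIV" using bij by (rule prod.reindex_bij_betw)
    finally show ?thesis using pu by (simp add: w_def prod_dividef)
  qed
  have Fw: "(Fr ^^ k) w i = (Fr ^^ Suc k) u i / (Fr ^^ k) u i" for k i
    by (simp add: Fr_pow w_def Fr_def power_divide funpow_swap1 mult.commute flip: power_mult)
  have tel: "Nm k w i = (Fr ^^ k) u i / u i" for k i
  proof (induction k)
    case (Suc k)
    have "Nm (Suc k) w i = Nm k w i * (Fr ^^ k) w i" by (simp add: Nm_def)
    thus ?case using Suc Fw[of k i] Fnz[of k i] by simp
  qed (use nz in \<open>simp add: Nm_def\<close>)
  have "Nm (6 * j) w = t"
  proof
    fix i
    have "(Fr ^^ (6 * j)) u i = t i * u i" using uQ by (simp add: Fr_6 Q_def)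
    thus "Nm (6 * j) w i = t i" using nz by (simp add: tel)
  qed
  thus thesis using that[of w] 1 2 3 by (simp add: Q_def)
qed

text \<open>For \<open>e = q\<^sup>6 - 1\<close> the norms of \<open>e\<close>-th powers are trivial, so the sum can be averaged over
  the covers of \<open>C\<close> by the curves \<open>t\<^sub>1 X\<^sup>3\<^sup>e + t\<^sub>2 Y\<^sup>3\<^sup>e + t\<^sub>3 = s X\<^sup>e Y\<^sup>e\<close>.  Only upper bounds for
  these covers are needed, since the average of their cardinalities is known from below.\<close>

theorem character_sum_bound:
  defines "e \<equiv> q ^ 6 - 1"
  assumes R: "2 * ((3 * e) * (3 * e)) + 5 \<le> q ^ (3 * j)"
  shows "norm (S (6 * j)) \<le> real (3 * ((3 * e) * (3 * e)) + 31) * q ^ (3 * j)"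
proof -
  define Q k where "Q = q ^ (6 * j)" and "k = 6 * j"
  define R' where "R' = q ^ (3 * j)"
  have QR: "Q = R' * R'" by (simp add: Q_def R'_def flip: power_add)
  have e0: "e > 0" unfolding e_def using one_less_power[OF q_gt_1, of 6] by simp
  have "1 * 1 \<le> (3 * e) * (3 * e)" using e0 by (intro mult_mono) auto
  have "3 * 3 \<le> (3 * e) * (3 * e)" using e0 by (intro mult_mono) auto
  hence R23: "23 \<le> q ^ (3 * j)" using R by linarith
  have j: "j > 0" using R23 by (cases j) auto
  have e_nz: "of_nat (3 * e) \<noteq> (0::'a)"
  proof -
    have "of_nat e = (of_nat q :: 'a) ^ 6 - 1"
      using one_less_power[OF q_gt_1, of 6] by (simp add: e_def of_nat_diff)
    also have "of_nat q = (0::'a)" using a_pos by (simp add: q_eq of_nat_eq_0_iff_char_dvd)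
    finally show ?thesis using three by simp
  qed
  define Fs where "Fs = {x::'a. x ^ Q = x \<and> x \<noteq> 0}"
  have "1 < Q" using q_gt_1 j unfolding Q_def by (intro one_less_power) auto
  hence fF: "finite Fs" unfolding Fs_def
    by (intro finite_subset[OF _ finite_power_eq_self[of Q]]) auto
  have F1: "1 \<in> Fs" by (simp add: Fs_def)
  have Fmult: "x * y \<in> Fs" "x / y \<in> Fs" "x ^ m \<in> Fs" if "x \<in> Fs" "y \<in> Fs" for x y m
    using that by (auto simp: Fs_def power_mult_distrib power_divide mult.commute simp flip: power_mult)
       (metis power_mult)
  define A where "A = Fs \<times> Fs"
  have fA: "finite A" using fF by (simp add: A_def)
  define M where "M = card A"
  have M0: "M > 0" unfolding M_def using fA F1 by (subst card_gt_0_iff) (auto simp: A_def)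
  \<comment> \<open>A homomorphism from pairs (X, Y) to the norm one torus, chosen so that the trace
    condition on \<open>vm t (\<phi> z)\<close>, multiplied by X^e Y^e, becomes the equation of the
    cover.\<close>
  define y where "y z i = (if i = (1::3) then (fst z)\<^sup>2 / snd z else if i = 2 then (snd z)\<^sup>2 / fst z
      else 1 / (fst z * snd z))" for z :: "'a \<times> 'a" and i
  have y123: "y z 1 = (fst z)\<^sup>2 / snd z" "y z 2 = (snd z)\<^sup>2 / fst z" "y z 3 = 1 / (fst z * snd z)" for z
    by (simp_all add: y_def)
  define \<phi> where "\<phi> z i = y z i ^ e" for z i
  have yF: "y z i \<in> Fs" if "z \<in> A" for z i
    using that F1 unfolding y_def A_def by (auto intro!: Fmult)
  have \<phi>F: "\<phi> z i \<in> Fs" if "z \<in> A" for z i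
    unfolding \<phi>_def using yF[OF that] Fmult(3) by blast
  have \<phi>1: "prod (\<phi> z) UNIV = 1" if "z \<in> A" for z
  proof -
    have "prod (y z) UNIV = 1"
      using that by (auto simp: prod_3 y123 A_def Fs_def power2_eq_square)
    thus ?thesis unfolding \<phi>_def by (simp add: prod_power_distrib[symmetric])
  qed
  have N\<phi>: "Nm k (\<phi> z) = (\<lambda>_. 1)" if "z \<in> A" for z
  proof
    fix i
    have "(Fr ^^ k) (y z) = y z" using yF[OF that] by (auto simp: k_def Fr_6 Fs_def Q_def)
    hence "Nm k (y z) \<in> U" using yF[OF that] by (intro Nm_in_U) (auto simp: Fs_def)
    hence "Nm k (y z) i ^ e = 1" unfolding e_def by (rule U_power)
    moreover have "Nm k (\<phi> z) i = Nm k (y z) i ^ e"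
      unfolding Nm_def prod_power_distrib
      by (intro prod.cong) (auto simp: Fr_pow \<phi>_def mult.commute simp flip: power_mult)
    ultimately show "Nm k (\<phi> z) i = 1" by simp
  qed
  define Tn where "Tn = {t :: 3 \<Rightarrow> 'a. (\<forall>i. t i \<in> Fs) \<and> prod t UNIV = n}"
  have fT: "finite Tn"
  proof -
    have "finite (PiE (UNIV::3 set) (\<lambda>_. Fs))" using fF by (intro finite_PiE) auto
    thus ?thesis by (rule rev_finite_subset) (auto simp: Tn_def PiE_iff)
  qed
  have cT: "card Tn \<le> M" unfolding M_def
  proof (rule card_inj_on_le[OF _ _ fA])
    show "inj_on (\<lambda>t. (t 1, t 2)) Tn"
    proof (rule inj_onI)
      fix t t' assume t: "t \<in> Tn" "t' \<in> Tn" "(t 1, t 2) = (t' 1, t' 2)"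
      have "t 3 = t' 3" using t by (auto simp: Tn_def prod_3 Fs_def)
      hence "t i = t' i" for i using exhaust_3[of i] t(3) by auto
      thus "t = t'" by blast
    qed
  qed (auto simp: Tn_def A_def)
  define Nt where "Nt t = {z \<in> A. vm t (\<phi> z) \<in> C}" for t
  define B0 where "B0 = Q + (3 * ((3 * e) * (3 * e)) + 1) * R'"
  have Nt_le: "card (Nt t) \<le> B0" if t: "t \<in> Tn" for t
  proof -
    have tnz: "t i \<noteq> 0" for i using t by (auto simp: Tn_def Fs_def)
    have tn: "t 1 * t 2 * t 3 = n" using t by (simp add: Tn_def prod_3)
    define s' b c where "s' = s / t 1" and "b = t 2 / t 1" and "c = t 3 / t 1"
    have bc: "b \<noteq> 0" "c \<noteq> 0" using tnz by (auto simp: b_def c_def)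
    have "s' ^ 3 * t 1 ^ 3 = s ^ 3" using tnz[of 1] by (simp add: s'_def power_divide)
    moreover have "27 * b * c * t 1 ^ 3 = 27 * n"
      using tnz[of 1] by (simp add: b_def c_def tn[symmetric] power3_eq_cube field_simps)
    ultimately have s': "s' ^ 3 \<noteq> 27 * b * c" using s_cond by metis
    define Zt where "Zt = {(x, y). x ^ (3 * e) - s' * y ^ e * x ^ e + b * y ^ (3 * e) + c = 0
                   \<and> x ^ (R' * R') = x \<and> y ^ (R' * R') = y}"
    have Zt: "finite Zt" "card Zt \<le> R' * R' + (3 * ((3 * e) * (3 * e)) + 1) * R'"
      unfolding Zt_def using R
      by (intro card_dwork_points_le[OF e_nz bc s' char_prime, of R' "fe * (3 * j)"];
          simp add: R'_def q_power)+
    have "Nt t \<subseteq> Zt"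
    proof
      fix z assume z: "z \<in> Nt t"
      obtain x w where xw: "z = (x, w)" by (cases z)
      have x0: "x \<noteq> 0" "w \<noteq> 0" and xF: "x ^ Q = x" "w ^ Q = w"
        using z by (auto simp: Nt_def A_def Fs_def xw)
      have "t 1 * (x\<^sup>2 / w) ^ e + t 2 * (w\<^sup>2 / x) ^ e + t 3 * (1 / (x * w)) ^ e = s"
        using z by (simp add: Nt_def C_def sum_3 vm_def \<phi>_def y123 xw)
      moreover have "(x\<^sup>2 / w) ^ e = (x ^ e)\<^sup>2 / w ^ e" "(w\<^sup>2 / x) ^ e = (w ^ e)\<^sup>2 / x ^ e"
          "(1 / (x * w)) ^ e = 1 / (x ^ e * w ^ e)"
        by (simp_all add: power_divide power_mult_distrib mult.commute flip: power_mult)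
      ultimately have "t 1 * ((x ^ e)\<^sup>2 / w ^ e) + t 2 * ((w ^ e)\<^sup>2 / x ^ e) + t 3 * (1 / (x ^ e * w ^ e)) = s"
        by simp
      hence "t 1 * (x ^ e) ^ 3 + t 2 * (w ^ e) ^ 3 + t 3 = s * (x ^ e * w ^ e)"
        using x0 by (simp add: field_simps power2_eq_square power3_eq_cube)
      hence "(x ^ e) ^ 3 - s' * w ^ e * x ^ e + b * (w ^ e) ^ 3 + c = 0"
        using tnz[of 1] by (simp add: s'_def b_def c_def field_simps)
      thus "z \<in> Zt" using xF by (simp add: Zt_def xw QR mult.commute[of 3] power_mult)
    qed
    hence "card (Nt t) \<le> card Zt" using Zt(1) by (intro card_mono)
    thus ?thesis using Zt(2) by (simp add: B0_def QR)
  qed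
  have reindex: "(\<Sum>t\<in>{t \<in> Tn. vm t (\<phi> z) \<in> C}. g (vm t (\<phi> z))) = (\<Sum>v\<in>Ck k. g v)"
    if z: "z \<in> A" for z and g :: "(3 \<Rightarrow> 'a) \<Rightarrow> complex"
  proof (rule sum.reindex_bij_witness[where i = "\<lambda>v i. v i / \<phi> z i" and j = "\<lambda>t. vm t (\<phi> z)"])
    have \<phi>nz: "\<phi> z i \<noteq> 0" for i using \<phi>F[OF z] by (simp add: Fs_def)
    fix t assume t: "t \<in> {t \<in> Tn. vm t (\<phi> z) \<in> C}"
    show "(\<lambda>i. vm t (\<phi> z) i / \<phi> z i) = t" using \<phi>nz by (simp add: vm_def)
    have "vm t (\<phi> z) i \<in> Fs" for i unfolding vm_def using t \<phi>F[OF z] by (intro Fmult) (auto simp: Tn_def)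
    thus "vm t (\<phi> z) \<in> Ck k" using t by (auto simp: Ck_6 k_def Fs_def Q_def)
  next
    have \<phi>nz: "\<phi> z i \<noteq> 0" for i using \<phi>F[OF z] by (simp add: Fs_def)
    fix v assume v: "v \<in> Ck k"
    show *: "vm (\<lambda>i. v i / \<phi> z i) (\<phi> z) = v" using \<phi>nz by (simp add: vm_def fun_eq_iff)
    have vC: "v \<in> C" using v by (simp add: Ck_def)
    have "v i \<in> Fs" for i using v C_nz[OF vC] by (simp add: Ck_6 k_def Fs_def Q_def)
    hence "v i / \<phi> z i \<in> Fs" for i using \<phi>F[OF z] Fmult by blast
    moreover have "(\<Prod>i\<in>UNIV. v i / \<phi> z i) = n" using vC \<phi>1[OF z] by (simp add: prod_dividef C_def)
    ultimately show "(\<lambda>i. v i / \<phi> z i) \<in> {t \<in> Tn. vm t (\<phi> z) \<in> C}"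
      using vC * by (simp add: Tn_def)
  qed simp
  \<comment> \<open>Double counting of the pairs (t, z) with \<open>vm t (\<phi> z)\<close> on the
    cubic. Every point arises once for each \<open>z\<close>, and twisting by
    \<open>\<phi> z\<close> leaves the norm unchanged.\<close>
  have swap: "(\<Sum>t\<in>Tn. of_nat (card (Nt t)) * g (Nm k t)) = of_nat M * (\<Sum>v\<in>Ck k. g (Nm k v))"
    for g :: "(3 \<Rightarrow> 'a) \<Rightarrow> complex"
  proof -
    have "(\<Sum>t\<in>Tn. of_nat (card (Nt t)) * g (Nm k t)) = (\<Sum>t\<in>Tn. \<Sum>z\<in>{z \<in> A. vm t (\<phi> z) \<in> C}. g (Nm k t))"
      by (simp add: Nt_def)
    also have "\<dots> = (\<Sum>z\<in>A. \<Sum>t\<in>{t \<in> Tn. vm t (\<phi> z) \<in> C}. g (Nm k t))"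
      by (rule sum.swap_restrict[OF fT fA])
    also have "\<dots> = (\<Sum>z\<in>A. \<Sum>t\<in>{t \<in> Tn. vm t (\<phi> z) \<in> C}. g (Nm k (vm t (\<phi> z))))"
      by (intro sum.cong refl) (simp add: Nm_vm N\<phi> vm_one)
    also have "\<dots> = (\<Sum>z\<in>A. \<Sum>v\<in>Ck k. g (Nm k v))"
      by (intro sum.cong[OF refl]) (rule reindex[where g = "\<lambda>v. g (Nm k v)"])
    finally show ?thesis by (simp add: M_def)
  qed
  have card_sum: "(\<Sum>t\<in>Tn. card (Nt t)) = M * card (Ck k)"
  proof -
    have "complex_of_nat (\<Sum>t\<in>Tn. card (Nt t)) = of_nat (M * card (Ck k))"
      using swap[of "\<lambda>_. 1"] by simp
    thus ?thesis by (simp only: of_nat_eq_iff)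
  qed
  obtain t0 where t0: "t0 \<in> U" "prod t0 UNIV = 1" "ch t0 \<noteq> 1" using ch_nontrivial by blast
  obtain w where w: "\<forall>i. w i \<noteq> 0" "\<forall>i. w i ^ (q ^ (6 * j)) = w i" "prod w UNIV = 1" "Nm (6 * j) w = t0"
    by (rule Nm_surj[OF t0(1,2) j])
  have wF: "w i \<in> Fs" for i using w by (simp add: Fs_def Q_def)
  have NU: "Nm k t \<in> U" if "t \<in> Tn" for t
    using that by (intro Nm_in_U ext) (auto simp: k_def Fr_6 Tn_def Fs_def Q_def)
  \<comment> \<open>Translation by \<open>w\<close> permutes \<open>Tn\<close> and multiplies the
    sum by \<open>ch t0\<close>, which is not 1.\<close>
  have zero: "(\<Sum>t\<in>Tn. ch (Nm k t)) = 0"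
  proof -
    have "(\<Sum>t\<in>Tn. ch (Nm k t)) = (\<Sum>t\<in>Tn. ch (Nm k (vm t w)))"
    proof (rule sum.reindex_bij_witness[where i = "\<lambda>t. vm t w" and j = "\<lambda>t i. t i / w i"])
      fix t assume t: "t \<in> Tn"
      show "vm (\<lambda>i. t i / w i) w = t" using w(1) by (simp add: vm_def fun_eq_iff)
      thus "ch (Nm k (vm (\<lambda>i. t i / w i) w)) = ch (Nm k t)" by simp
      show "(\<lambda>i. t i / w i) \<in> Tn" using t wF w(3) Fmult by (simp add: Tn_def prod_dividef)
      show "(\<lambda>i. vm t w i / w i) = t" using w(1) by (simp add: vm_def)
      show "vm t w \<in> Tn" using t wF w(3) Fmult by (simp add: Tn_def vm_def prod.distrib)
    qed
    also have "\<dots> = (\<Sum>t\<in>Tn. ch (Nm k t)) * ch t0"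
      unfolding sum_distrib_right
      by (intro sum.cong refl) (use w(4) t0(1) NU in \<open>simp add: Nm_vm ch_vm k_def\<close>)
    finally show ?thesis using t0(3) by simp
  qed
  \<comment> \<open>Since the plain character sum over \<open>Tn\<close> is zero, the common upper
    bound \<open>B0\<close> may be subtracted from every count. All differences then have the same
    sign, and their total is known from the average: upper bounds for the covers become a two-sided
    estimate.\<close>
  have "of_nat M * S k = (\<Sum>t\<in>Tn. (of_nat (card (Nt t)) - of_nat B0) * ch (Nm k t))"
    using swap[of ch] zero by (simp add: S_def left_diff_distrib sum_subtractf flip: sum_distrib_left)
  hence "real M * norm (S k) = norm (\<Sum>t\<in>Tn. (of_nat (card (Nt t)) - of_nat B0) * ch (Nm k t))"
    by (metis norm_mult norm_of_nat)
  also have "\<dots> \<le> (\<Sum>t\<in>Tn. real B0 - real (card (Nt t)))"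
  proof (rule sum_norm_le)
    fix t assume t: "t \<in> Tn"
    have "norm ((of_nat (card (Nt t)) - of_nat B0) * ch (Nm k t))
        = norm (complex_of_real (real (card (Nt t)) - real B0))"
      using ch_norm[OF NU[OF t]] by (simp add: norm_mult)
    also have "\<dots> = \<bar>real (card (Nt t)) - real B0\<bar>" by (rule norm_of_real)
    also have "\<dots> = real B0 - real (card (Nt t))" using Nt_le[OF t] by simp
    finally show "norm ((of_nat (card (Nt t)) - of_nat B0) * ch (Nm k t)) \<le> real B0 - real (card (Nt t))"
      by simp
  qed
  also have "\<dots> = real (card Tn) * real B0 - real M * real (card (Ck k))"
    using card_sum by (simp add: sum_subtractf flip: of_nat_sum of_nat_mult)
  also have "\<dots> \<le> real M * real B0 - real M * real (card (Ck k))"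
    using cT by (intro diff_right_mono mult_right_mono) auto
  also have "\<dots> = real M * (real B0 - real (card (Ck k)))" by (simp add: right_diff_distrib)
  finally have "norm (S k) \<le> real B0 - real (card (Ck k))" using M0 by simp
  moreover have "Q \<le> card (Ck k) + 28 * R' + 2"
    using card_Ck_ge[OF R23] by (simp add: Q_def k_def R'_def)
  moreover have "2 \<le> 2 * R'" using R23 by (simp add: R'_def)
  \<comment> \<open>31 is 1 from the covers, 28 from the lower count of the cubic, and 2 for the
    additive constant.\<close>
  ultimately have "norm (S k) \<le> real ((3 * ((3 * e) * (3 * e)) + 31) * R')"
    unfolding B0_def by (simp add: algebra_simps)
  thus ?thesis by (simp add: k_def R'_def)
qed

end

section \<open>Regular functions on the cubic\<close>

text \<open>Regular functions are represented by their values, extended by 0 off the curve, so that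
  equality is pointwise and no quotient ring is formed.\<close>

typedef 'a pfun = "UNIV :: ((3 \<Rightarrow> 'a) \<Rightarrow> 'a) set"
  morphisms apf Pf ..

lemma at_Pf [simp]: "apf (Pf f) = f"
  by (simp add: Pf_inverse)

lemma pfun_eqI: "(\<And>v. apf f v = apf g v) \<Longrightarrow> f = g"
  by (metis apf_inject ext)

instantiation pfun :: (comm_ring_1) comm_ring_1
begin

definition "0 = Pf (\<lambda>_. 0)"
definition "1 = Pf (\<lambda>_. 1)"
definition "f + g = Pf (\<lambda>v. apf f v + apf g v)"
definition "f * g = Pf (\<lambda>v. apf f v * apf g v)"
definition "f - g = Pf (\<lambda>v. apf f v - apf g v)"
definition "- f = Pf (\<lambda>v. - apf f v)"

instance
  by standard
    (rule pfun_eqI, simp add: zero_pfun_def one_pfun_def plus_pfun_def times_pfun_def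
      minus_pfun_def uminus_pfun_def algebra_simps |
     metis at_Pf one_pfun_def zero_pfun_def zero_neq_one)+

end

lemma at_simps [simp]: "apf 0 v = 0" "apf 1 v = 1" "apf (f + g) v = apf f v + apf g v"
  "apf (f * g) v = apf f v * apf g v" "apf (f - g) v = apf f v - apf g v" "apf (- f) v = - apf f v"
  by (simp_all add: zero_pfun_def one_pfun_def plus_pfun_def times_pfun_def
      minus_pfun_def uminus_pfun_def)

definition sc :: "'a::comm_ring_1 \<Rightarrow> 'a pfun \<Rightarrow> 'a pfun" where
  "sc c f = Pf (\<lambda>v. c * apf f v)"

lemma at_sc [simp]: "apf (sc c f) v = c * apf f v"
  by (simp add: sc_def)

interpretation pv: vector_space "sc :: 'a::field \<Rightarrow> 'a pfun \<Rightarrow> 'a pfun"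
  by standard (rule pfun_eqI, simp add: algebra_simps)+

lemma sc_mult_left: "sc c f * g = sc c (f * g)" and sc_mult_right: "f * sc c g = sc c (f * g)"
  by (rule pfun_eqI, simp)+

lemma span_mult_in_subspace:
  assumes "f \<in> pv.span A" "g \<in> pv.span B" "pv.subspace V" "\<And>a b. a \<in> A \<Longrightarrow> b \<in> B \<Longrightarrow> a * b \<in> V"
  shows "f * g \<in> V"
proof -
  have "a * g \<in> V" if "a \<in> A" for a
    using assms(2)
  proof (induction rule: pv.span_induct_alt)
    case (step c b y)
    have "a * (sc c b + y) = sc c (a * b) + a * y" by (simp add: distrib_left sc_mult_right)
    thus ?case using step assms(3,4) that by (auto intro: pv.subspace_add pv.subspace_scale)
  qed (use assms(3) in \<open>simp add: pv.subspace_0\<close>)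
  note * = this
  show ?thesis using assms(1)
  proof (induction rule: pv.span_induct_alt)
    case (step c b y)
    have "(sc c b + y) * g = sc c (b * g) + y * g" by (simp add: distrib_right sc_mult_left)
    thus ?case using step assms(3) * by (auto intro: pv.subspace_add pv.subspace_scale)
  qed (use assms(3) in \<open>simp add: pv.subspace_0\<close>)
qed

text \<open>The product of two ideals; a linear span suffices, since the factors are closed under
  multiplication by regular functions.\<close>

definition IM :: "'a::field pfun set \<Rightarrow> 'a pfun set \<Rightarrow> 'a pfun set" where
  "IM A B = pv.span {a * b |a b. a \<in> A \<and> b \<in> B}"

lemma IM_I: "a \<in> A \<Longrightarrow> b \<in> B \<Longrightarrow> a * b \<in> IM A B"
  unfolding IM_def by (rule pv.span_base) blast

lemma IM_subspace: "pv.subspace (IM A B)"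
  by (simp add: IM_def)

lemma IM_subset:
  assumes "pv.subspace V" "\<And>a b. a \<in> A \<Longrightarrow> b \<in> B \<Longrightarrow> a * b \<in> V"
  shows "IM A B \<subseteq> V"
  unfolding IM_def using assms by (intro pv.span_minimal) auto

lemma IM_left_commute: "IM A (IM B J) = IM B (IM A J)"
proof -
  have "IM A (IM B J) \<subseteq> IM B (IM A J)" for A B J :: "'a::field pfun set"
  proof (rule IM_subset[OF IM_subspace])
    fix a u assume a: "a \<in> A" and u: "u \<in> IM B J"
    have "a * u \<in> IM B (IM A J)"
    proof (rule span_mult_in_subspace[OF pv.span_base u[unfolded IM_def] IM_subspace])
      show "a \<in> {a}" by simp
      fix a' b assume "a' \<in> {a}" "b \<in> {a * b |a b. a \<in> B \<and> b \<in> J}"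
      then obtain c d where "b = c * d" "c \<in> B" "d \<in> J" "a' = a" by auto
      thus "a' * b \<in> IM B (IM A J)" using IM_I[OF _ IM_I[OF a]] by (metis mult.left_commute)
    qed
    thus "a * u \<in> IM B (IM A J)" .
  qed
  thus ?thesis by blast
qed

context twisted_cubic
begin

text \<open>Because regular functions vanish off the curve, \<open>cst 1\<close> and not
  \<open>1\<close> is the unit of their ring.\<close>

definition cst :: "'k \<Rightarrow> 'k pfun" where
  "cst c = Pf (\<lambda>v. if v \<in> C then c else 0)"

definition co :: "3 \<Rightarrow> 'k pfun" where
  "co i = Pf (\<lambda>v. if v \<in> C then v i else 0)"

text \<open>The degree filtration on the coordinate ring. Geometrically it bounds the pole order by
  \<open>m\<close> at each of the three points at infinity, which is why the dimension below is
  \<open>3 * m\<close>.\<close>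

inductive am :: "nat \<Rightarrow> 'k pfun \<Rightarrow> bool" where
  am_cst: "am m (cst c)"
| am_co: "am m f \<Longrightarrow> am (Suc m) (f * co i)"
| am_add: "am m f \<Longrightarrow> am m g \<Longrightarrow> am m (f + g)"

lemma at_cst: "apf (cst c) v = (if v \<in> C then c else 0)" and at_co: "apf (co i) v = (if v \<in> C then v i else 0)"
  by (simp_all add: cst_def co_def)

lemma sc_cst: "sc c (cst d) = cst (c * d)" and cst_mult: "cst c * cst d = cst (c * d)"
  and cst_add: "cst c + cst d = cst (c + d)" and cst_0: "cst 0 = 0"
  by (rule pfun_eqI, simp add: at_cst)+

lemma am_outside: "am m f \<Longrightarrow> v \<notin> C \<Longrightarrow> apf f v = 0"
  by (induction rule: am.induct) (auto simp: at_cst)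

lemma am_eqI: "am m f \<Longrightarrow> am m' g \<Longrightarrow> (\<And>v. v \<in> C \<Longrightarrow> apf f v = apf g v) \<Longrightarrow> f = g"
  by (metis am_outside pfun_eqI)

lemma am_sc: "am m f \<Longrightarrow> am m (sc c f)"
proof (induction rule: am.induct)
  case (am_add m f g)
  thus ?case by (simp add: pv.scale_right_distrib am.am_add)
qed (auto simp: sc_cst sc_mult_left[symmetric] intro: am.intros)

lemma am_Suc: "am m f \<Longrightarrow> am (Suc m) f"
  by (induction rule: am.induct) (auto intro: am.intros)

lemma am_mono:
  assumes "am m f" "m \<le> m'"
  shows "am m' f"
  using assms(2,1) by (induction rule: dec_induct) (auto intro: am_Suc)

lemma cst_1_mult: "am m f \<Longrightarrow> cst 1 * f = f"
  by (rule pfun_eqI) (simp add: at_cst am_outside)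

lemma am_mult: "am m' g \<Longrightarrow> am m f \<Longrightarrow> am (m + m') (f * g)"
proof (induction rule: am.induct)
  case (am_cst m' c)
  have "f * cst c = sc c f" by (rule pfun_eqI) (simp add: at_cst am_outside[OF am_cst])
  thus ?case using am_mono[OF am_sc[OF am_cst]] by simp
next
  case (am_co m' g i)
  thus ?case using am.am_co[of "m + m'" "f * g" i] by (simp add: mult.assoc)
next
  case (am_add m' g h)
  thus ?case by (simp add: distrib_left am.am_add)
qed

definition Af :: "'k pfun set" where
  "Af = {f. \<exists>m. am m f}"

lemma am_subspace: "pv.subspace {f. am m f}"
  by (rule pv.subspaceI) (use am_cst[of m 0] in \<open>auto simp: cst_0 intro: am_add am_sc\<close>)

lemma Af_subspace: "pv.subspace Af"
proof (rule pv.subspaceI)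
  show "0 \<in> Af" using am_cst[of 0 0] by (auto simp: Af_def cst_0)
  fix f g assume "f \<in> Af" "g \<in> Af"
  then obtain m m' where "am m f" "am m' g" by (auto simp: Af_def)
  hence "am (max m m') f" "am (max m m') g" by (auto elim: am_mono)
  thus "f + g \<in> Af" by (auto simp: Af_def intro: am_add)
qed (auto simp: Af_def intro: am_sc)

lemma Af_mult: "f \<in> Af \<Longrightarrow> g \<in> Af \<Longrightarrow> f * g \<in> Af"
  by (auto simp: Af_def intro: am_mult)

lemma Af_cst: "cst c \<in> Af"
  by (auto simp: Af_def intro: am_cst)

lemma am_co': "am 1 (co i)"
proof -
  have "cst 1 * co i = co i" by (rule pfun_eqI) (simp add: at_cst at_co)
  thus ?thesis using am_co[OF am_cst[of 0 1], of i] by simp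
qed

lemma Af_co: "co i \<in> Af"
  using am_co' by (auto simp: Af_def)

lemmas Af_add = pv.subspace_add[OF Af_subspace] and Af_diff = pv.subspace_diff[OF Af_subspace]
  and Af_sc = pv.subspace_scale[OF Af_subspace] and Af_neg = pv.subspace_neg[OF Af_subspace]

lemma Af_outside: "f \<in> Af \<Longrightarrow> v \<notin> C \<Longrightarrow> apf f v = 0"
  by (auto simp: Af_def am_outside)

lemma Af_eqI: "f \<in> Af \<Longrightarrow> g \<in> Af \<Longrightarrow> (\<And>v. v \<in> C \<Longrightarrow> apf f v = apf g v) \<Longrightarrow> f = g"
  by (metis Af_outside pfun_eqI)

definition MP :: "(3 \<Rightarrow> 'k) \<Rightarrow> 'k pfun set" where
  "MP P = {f \<in> Af. apf f P = 0}"

text \<open>A product of maximal ideals, that is, vanishing along \<open>D\<close> with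
  multiplicity. The fold is independent of the order by \<open>IM_left_commute\<close>.\<close>

definition ID :: "(3 \<Rightarrow> 'k) multiset \<Rightarrow> 'k pfun set" where
  "ID D = fold_mset (\<lambda>P J. IM (MP P) J) Af D"

lemma ID_empty: "ID {#} = Af"
  by (simp add: ID_def)

lemma ID_add: "ID (add_mset P D) = IM (MP P) (ID D)"
proof -
  interpret comp_fun_commute "\<lambda>P J. IM (MP P) J"
    by standard (rule ext, simp only: comp_apply, rule IM_left_commute)
  show ?thesis by (simp add: ID_def)
qed

lemma ID_subspace: "pv.subspace (ID D)"
  by (cases D) (simp_all add: ID_empty ID_add Af_subspace IM_subspace)

lemma ID_ideal: "g \<in> Af \<Longrightarrow> f \<in> ID D \<Longrightarrow> f * g \<in> ID D"
proof (induction D arbitrary: f)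
  case (add P D)
  have "f \<in> pv.span {a * b |a b. a \<in> MP P \<and> b \<in> ID D}" using add.prems by (simp add: ID_add IM_def)
  hence "f * g \<in> ID (add_mset P D)"
  proof (rule span_mult_in_subspace[OF _ pv.span_base[of g "{g}"] ID_subspace])
    fix a b assume "a \<in> {a * b |a b. a \<in> MP P \<and> b \<in> ID D}" "b \<in> {g}"
    then obtain c d where cd: "a = c * d" "c \<in> MP P" "d \<in> ID D" "b = g" by auto
    have "c * (d * g) \<in> IM (MP P) (ID D)" using cd add by (intro IM_I) auto
    thus "a * b \<in> ID (add_mset P D)" by (simp add: cd ID_add mult.assoc)
  qed simp
  thus ?case .
qed (simp add: ID_empty Af_mult)

lemma ID_add_subset: "ID (add_mset P D) \<subseteq> ID D"
proof -
  have "a * b \<in> ID D" if "a \<in> MP P" "b \<in> ID D" for a b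
    using ID_ideal[of a b D] that by (simp add: MP_def mult.commute)
  thus ?thesis unfolding ID_add by (intro IM_subset ID_subspace)
qed

lemma ID_mono: "D \<subseteq># E \<Longrightarrow> ID E \<subseteq> ID D"
proof -
  assume "D \<subseteq># E"
  then obtain F where "E = D + F" by (auto simp: mset_subset_eq_exists_conv)
  moreover have "ID (D + F) \<subseteq> ID D"
    by (induction F) (use ID_add_subset in \<open>auto simp: subset_iff\<close>)
  ultimately show ?thesis by simp
qed

lemma ID_Af: "f \<in> ID D \<Longrightarrow> f \<in> Af"
  using ID_mono[of "{#}" D] by (auto simp: ID_empty)

lemma ID_MP: "P \<in># D \<Longrightarrow> ID D \<subseteq> MP P"
proof -
  assume "P \<in># D"
  then obtain E where E: "D = add_mset P E" by (rule mset_add)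
  have "pv.subspace (MP P)"
    by (rule pv.subspaceI) (auto simp: MP_def Af_add Af_sc pv.subspace_0[OF Af_subspace])
  thus ?thesis unfolding E ID_add
    by (rule IM_subset) (auto simp: MP_def intro: Af_mult ID_Af)
qed

text \<open>If \<open>P\<close> does not occur in \<open>D\<close>, a product of functions
  \<open>co i - cst (R i)\<close>, one for each point \<open>R\<close> of \<open>D\<close> and with
  \<open>i\<close> chosen to separate it from \<open>P\<close>, lies in \<open>ID D\<close> without
  vanishing at \<open>P\<close>.\<close>

lemma prime_ID:
  assumes "ID D \<subseteq> MP P" "P \<in> C" "set_mset D \<subseteq> C"
  shows "P \<in># D"
proof (rule ccontr)
  assume "P \<notin># D"
  have "\<exists>f\<in>ID E. apf f P \<noteq> 0" if "P \<notin># E" "set_mset E \<subseteq> C" for E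
    using that
  proof (induction E)
    case empty
    have "apf (cst 1) P \<noteq> 0" using assms(2) by (simp add: at_cst)
    thus ?case using Af_cst ID_empty by blast
  next
    case (add R E)
    then obtain f where f: "f \<in> ID E" "apf f P \<noteq> 0" by auto
    obtain i where i: "P i \<noteq> R i" using add.prems by auto
    have "co i - cst (R i) \<in> MP R" using add.prems
      by (auto simp: MP_def at_co at_cst Af_diff Af_co Af_cst)
    hence "(co i - cst (R i)) * f \<in> ID (add_mset R E)" unfolding ID_add using f by (intro IM_I)
    moreover have "apf ((co i - cst (R i)) * f) P \<noteq> 0" using f i assms(2) by (simp add: at_co at_cst)
    ultimately show ?case by blast
  qed
  thus False using assms \<open>P \<notin># D\<close> by (auto simp: MP_def)
qed

end

text \<open>The distinguished coordinate \<open>i\<close> presents the curve as a double cover of a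
  line. It stays variable because the product formula for divisors is required for all three
  coordinates.\<close>

locale cubic_coordinates = twisted_cubic +
  fixes i j l :: 3
  assumes ij: "i \<noteq> j" and il: "i \<noteq> l" and jl: "j \<noteq> l"
begin

lemma UNIV_ijl: "UNIV = {i, j, l}"
  by (rule sym, rule card_subset_eq) (use ij il jl in auto)

lemma index_cases: "b = i \<or> b = j \<or> b = l"
  using UNIV_ijl by auto

lemma C_iff: "v \<in> C \<longleftrightarrow> v i + v j + v l = s \<and> v i * v j * v l = n"
  using ij il jl by (simp add: C_def UNIV_ijl add.assoc mult.assoc)

definition \<delta> :: "'a poly" where "\<delta> = [:1, - 2 * s, s\<^sup>2, - 4 * n:]"

definition wc :: "(3 \<Rightarrow> 'a) \<Rightarrow> 'a" where "wc v = (v j - v l) / v i"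

text \<open>With t = 1 / v i and w = \<open>wc v\<close> the curve reads w^2 = \<delta>(t). At the
  point at infinity where \<open>v i\<close> tends to 0, t and w have their only poles, of orders 2
  and 3; the power of \<open>v i\<close> admits poles at the other two points at infinity.\<close>

definition XW :: "nat \<Rightarrow> 'a poly \<Rightarrow> 'a poly \<Rightarrow> 'a pfun" where
  "XW m a b = Pf (\<lambda>v. if v \<in> C then v i ^ m * (poly a (1 / v i) + poly b (1 / v i) * wc v) else 0)"

lemma four: "(4::'a) \<noteq> 0"
  using two by (metis mult_eq_0_iff numeral_Bit0_eq_double)

lemma degree_\<delta>: "degree \<delta> = 3" "\<delta> \<noteq> 0"
  using four n_nz by (simp_all add: \<delta>_def)

lemma wc_sq: "v \<in> C \<Longrightarrow> wc v * wc v = poly \<delta> (1 / v i)"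
proof -
  assume v: "v \<in> C"
  have nz: "v i \<noteq> 0" by (rule C_nz[OF v])
  have "v i * ((v j - v l) * (v j - v l)) = v i * (v j + v l)\<^sup>2 - 4 * (v i * v j * v l)"
    by (simp add: algebra_simps power2_eq_square)
  also have "v j + v l = s - v i" using v by (auto simp: C_iff)
  also have "v i * v j * v l = n" using v by (simp add: C_iff)
  finally have "v i * ((v j - v l) * (v j - v l)) = v i * (s - v i)\<^sup>2 - 4 * n" .
  thus ?thesis using nz by (simp add: wc_def \<delta>_def field_simps power2_eq_square)
qed

lemma point_exists:
  assumes "t \<noteq> 0" "\<omega> * \<omega> = poly \<delta> t"
  shows "\<exists>v\<in>C. v i = 1 / t \<and> wc v = \<omega>"
proof -
  define u where "u = s - 1 / t"
  define v where "v b = (if b = i then 1 / t else if b = j then (u + \<omega> / t) / 2 else (u - \<omega> / t) / 2)" for b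
  have v: "v i = 1 / t" "v j = (u + \<omega> / t) / 2" "v l = (u - \<omega> / t) / 2"
    using ij il jl by (auto simp: v_def)
  have "v j + v l = (2 * u) / 2" unfolding v by (simp flip: add_divide_distrib)
  hence "v j + v l = u" using two by simp
  hence 1: "v i + v j + v l = s" by (simp add: v(1) u_def add.assoc)
  have "v j - v l = (2 * (\<omega> / t)) / 2" unfolding v by (simp flip: diff_divide_distrib)
  hence 2: "wc v = \<omega>" using two assms(1) by (simp add: wc_def v(1))
  have "((u + y) / 2) * ((u - y) / 2) = (u\<^sup>2 - y\<^sup>2) / 4" for y
    by (simp add: power2_eq_square algebra_simps)
  hence "v j * v l = (u\<^sup>2 - (\<omega> / t)\<^sup>2) / 4" unfolding v(2,3) .
  hence "4 * (v j * v l) = u\<^sup>2 - \<omega> * \<omega> / t\<^sup>2" using four by (simp add: power_divide power2_eq_square mult.commute)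
  also have "\<dots> = 4 * (n * t)"
    unfolding assms(2) u_def \<delta>_def using assms(1) by (simp add: field_simps power2_eq_square)
  finally have "v j * v l = n * t" using four by simp
  hence "v i * v j * v l = n" using assms(1) by (simp add: v(1) mult.assoc)
  hence "v \<in> C" using 1 by (simp add: C_iff)
  thus ?thesis using 2 v(1) by blast
qed

lemma apf_XW: "v \<in> C \<Longrightarrow> apf (XW m a b) v = v i ^ m * (poly a (1 / v i) + poly b (1 / v i) * wc v)"
  and apf_XW_out: "v \<notin> C \<Longrightarrow> apf (XW m a b) v = 0"
  by (simp_all add: XW_def)

lemma XW_add: "XW m a b + XW m c d = XW m (a + c) (b + d)"
  by (rule pfun_eqI) (simp add: XW_def algebra_simps)

lemma XW_diff: "XW m a b - XW m c d = XW m (a - c) (b - d)"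
  by (rule pfun_eqI) (simp add: XW_def algebra_simps)

lemma XW_sc: "sc c (XW m a b) = XW m (smult c a) (smult c b)"
  by (rule pfun_eqI) (simp add: XW_def algebra_simps)

lemma XW_mult: "XW m a b * XW m' c d = XW (m + m') (a * c + b * d * \<delta>) (a * d + b * c)"
proof (rule pfun_eqI)
  fix v
  show "apf (XW m a b * XW m' c d) v = apf (XW (m + m') (a * c + b * d * \<delta>) (a * d + b * c)) v"
  proof (cases "v \<in> C")
    case True
    show ?thesis by (simp add: apf_XW[OF True] wc_sq[OF True, symmetric] power_add algebra_simps)
  qed (simp add: apf_XW_out)
qed

lemma XW_shift: "XW m a b = XW (m + k) (monom 1 k * a) (monom 1 k * b)"
proof (rule pfun_eqI)
  fix v
  show "apf (XW m a b) v = apf (XW (m + k) (monom 1 k * a) (monom 1 k * b)) v"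
  proof (cases "v \<in> C")
    case True
    thus ?thesis using C_nz[OF True] by (simp add: apf_XW power_add poly_monom power_divide field_simps)
  qed (simp add: apf_XW_out)
qed

text \<open>Both square roots of \<delta>(t) belong to points of the curve, so the even and the odd
  part vanish separately.\<close>

lemma XW_eq_0_iff: "XW m a b = 0 \<longleftrightarrow> a = 0 \<and> b = 0"
proof
  assume z: "XW m a b = 0"
  have *: "poly a t = 0 \<and> poly b t * poly \<delta> t = 0" if t: "t \<noteq> 0" for t
  proof -
    obtain \<omega> where \<omega>: "\<omega> ^ 2 = poly \<delta> t" using nth_root_exists[of 2 "poly \<delta> t"] by auto
    have "poly a t + poly b t * \<omega>' = 0" if sq: "\<omega>' * \<omega>' = poly \<delta> t" for \<omega>'
    proof -
      obtain v where v: "v \<in> C" "v i = 1 / t" "wc v = \<omega>'" using point_exists[OF t sq] by blast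
      have "apf (XW m a b) v = 0" by (simp add: z)
      thus ?thesis using v t by (simp add: apf_XW)
    qed
    note p = this
    have \<omega>2: "\<omega> * \<omega> = poly \<delta> t" "- \<omega> * - \<omega> = poly \<delta> t" using \<omega> by (simp_all add: power2_eq_square)
    have e: "poly a t + poly b t * \<omega> = 0" "poly a t - poly b t * \<omega> = 0"
      using p[OF \<omega>2(1)] p[OF \<omega>2(2)] by simp_all
    have "2 * poly a t = (poly a t + poly b t * \<omega>) + (poly a t - poly b t * \<omega>)" by simp
    also have "\<dots> = 0" by (simp only: e add_0)
    finally have a0: "poly a t = 0" using two by (simp only: mult_eq_0_iff) simp
    hence "poly b t * \<omega> = 0" using e(1) by simp
    hence "poly b t * (\<omega> * \<omega>) = 0" by auto
    hence "poly b t * poly \<delta> t = 0" by (simp only: \<omega>2(1))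
    thus ?thesis using a0 by blast
  qed
  \<comment> \<open>The factor X covers the value t = 0, which belongs to no affine point.\<close>
  have "[:0, 1:] * a = 0" "[:0, 1:] * (b * \<delta>) = 0"
    by (rule poly_eq_0_alg_closed; use * in fastforce)+
  thus "a = 0 \<and> b = 0" using degree_\<delta> by simp
next
  assume "a = 0 \<and> b = 0"
  thus "XW m a b = 0" by (intro pfun_eqI) (simp add: XW_def)
qed

lemma XW_eq_iff: "XW m a b = XW m c d \<longleftrightarrow> a = c \<and> b = d"
proof -
  have "XW m a b = XW m c d \<longleftrightarrow> XW m (a - c) (b - d) = 0" by (simp flip: XW_diff)
  thus ?thesis by (simp add: XW_eq_0_iff)
qed

lemma XW_eq_shift:
  assumes "XW m a b = XW m' c d"
  shows "monom 1 m' * a = monom 1 m * c" "monom 1 m' * b = monom 1 m * d"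
proof -
  have "XW (m + m') (monom 1 m' * a) (monom 1 m' * b) = XW (m' + m) (monom 1 m * c) (monom 1 m * d)"
    unfolding XW_shift[symmetric] by (rule assms)
  thus "monom 1 m' * a = monom 1 m * c" "monom 1 m' * b = monom 1 m * d"
    by (simp_all add: XW_eq_iff add.commute)
qed

text \<open>Pole order at most \<open>k\<close> of a + b w at the single pole of t; orders of the
  two parts differ in parity, so they cannot cancel.\<close>

definition LL :: "nat \<Rightarrow> 'a poly \<Rightarrow> 'a poly \<Rightarrow> bool" where
  "LL k a b \<longleftrightarrow> 2 * degree a \<le> k \<and> (b = 0 \<or> 2 * degree b + 3 \<le> k)"

lemma LL_add: "LL k a b \<Longrightarrow> LL k c d \<Longrightarrow> LL k (a + c) (b + d)"
proof -
  assume L: "LL k a b" "LL k c d"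
  have "degree (a + c) \<le> k div 2" using L by (intro degree_add_le) (auto simp: LL_def)
  moreover have "b + d = 0 \<or> 2 * degree (b + d) + 3 \<le> k"
  proof (cases "b = 0 \<or> d = 0")
    case False
    have "degree (b + d) \<le> (k - 3) div 2" using L False by (intro degree_add_le) (auto simp: LL_def)
    moreover have "3 \<le> k" using L False by (auto simp: LL_def)
    ultimately show ?thesis by linarith
  qed (use L in \<open>auto simp: LL_def\<close>)
  ultimately show ?thesis by (auto simp: LL_def)
qed

lemma LL_smult: "LL k a b \<Longrightarrow> LL k (smult c a) (smult c b)"
  by (auto simp: LL_def)

text \<open>On the curve v j and v l are v i (s t - 1 + w) / 2 and v i (s t - 1 - w) / 2.\<close>

lemma XW_co:
  defines "p \<equiv> [:- 1, s:]"
  shows "XW m a b * co i = XW (Suc m) a b"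
    and "XW m a b * co j = XW (Suc m) (smult (1/2) (a * p + b * \<delta>)) (smult (1/2) (a + b * p))"
    and "XW m a b * co l = XW (Suc m) (smult (1/2) (a * p - b * \<delta>)) (smult (1/2) (b * p - a))"
proof -
  show "XW m a b * co i = XW (Suc m) a b"
    by (rule pfun_eqI) (simp add: XW_def at_co)
  have v: "v j = v i * ((poly p (1 / v i) + wc v) / 2)" "v l = v i * ((poly p (1 / v i) - wc v) / 2)"
    if "v \<in> C" for v
  proof -
    have "v i * (poly p (1 / v i) + wc v) = s - v i + (v j - v l)"
      "v i * (poly p (1 / v i) - wc v) = s - v i - (v j - v l)"
      using C_nz[OF that, of i] by (simp_all add: p_def wc_def field_simps)
    moreover have "s - v i = v j + v l" using that by (auto simp: C_iff)
    ultimately have "v i * (poly p (1 / v i) + wc v) = 2 * v j" "v i * (poly p (1 / v i) - wc v) = 2 * v l"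
      by simp_all
    thus "v j = v i * ((poly p (1 / v i) + wc v) / 2)" "v l = v i * ((poly p (1 / v i) - wc v) / 2)"
      using two by (simp_all add: field_simps)
  qed
  show "XW m a b * co j = XW (Suc m) (smult (1/2) (a * p + b * \<delta>)) (smult (1/2) (a + b * p))"
  proof (rule pfun_eqI)
    fix y show "apf (XW m a b * co j) y = apf (XW (Suc m) (smult (1/2) (a * p + b * \<delta>)) (smult (1/2) (a + b * p))) y"
    proof (cases "y \<in> C")
      case True
      show ?thesis
        using two by (simp add: apf_XW[OF True] at_co True v(1)[OF True] wc_sq[OF True, symmetric] field_simps)
    qed (simp add: apf_XW_out)
  qed
  show "XW m a b * co l = XW (Suc m) (smult (1/2) (a * p - b * \<delta>)) (smult (1/2) (b * p - a))"
  proof (rule pfun_eqI)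
    fix y show "apf (XW m a b * co l) y = apf (XW (Suc m) (smult (1/2) (a * p - b * \<delta>)) (smult (1/2) (b * p - a))) y"
    proof (cases "y \<in> C")
      case True
      show ?thesis
        using two by (simp add: apf_XW[OF True] at_co True v(2)[OF True] wc_sq[OF True, symmetric] field_simps)
    qed (simp add: apf_XW_out)
  qed
qed

lemma XW_cst: "cst c = XW m (monom c m) 0"
  by (rule pfun_eqI) (auto simp: at_cst XW_def poly_monom C_nz power_divide)

lemma am_imp_XW: "am m f \<Longrightarrow> \<exists>a b. LL (3 * m) a b \<and> f = XW m a b"
proof (induction rule: am.induct)
  case (am_cst m c)
  have "LL (3 * m) (monom c m) 0" using degree_monom_le[of c m] by (simp add: LL_def)
  thus ?case using XW_cst by blast
next
  case (am_add m f g)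
  then obtain a b c d where "LL (3 * m) a b" "f = XW m a b" "LL (3 * m) c d" "g = XW m c d" by blast
  thus ?case using XW_add LL_add by blast
next
  case (am_co m f k)
  then obtain a b where ab: "LL (3 * m) a b" "f = XW m a b" by blast
  define p where "p = [:- 1, s:]"
  define N where "N = (3 * Suc m) div 2"
  have da: "degree a + 1 \<le> N" using ab(1) by (auto simp: LL_def N_def)
  have dp: "degree p \<le> 1" by (simp add: p_def)
  have "degree (a * p) \<le> degree a + degree p" by (rule degree_mult_le)
  hence ap: "degree (a * p) \<le> N" using da dp by linarith
  have bd: "degree (b * \<delta>) \<le> N"
  proof (cases "b = 0")
    case False
    have "degree (b * \<delta>) \<le> degree b + 3" using degree_mult_le[of b \<delta>] degree_\<delta> by simp
    thus ?thesis using ab(1) False by (auto simp: LL_def N_def)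
  qed simp
  have b': "degree (b * p) \<le> (3 * m) div 2" "degree a \<le> (3 * m) div 2"
  proof -
    show "degree (b * p) \<le> (3 * m) div 2"
    proof (cases "b = 0")
      case False
      have "degree (b * p) \<le> degree b + 1" using degree_mult_le[of b p] dp by simp
      thus ?thesis using ab(1) False by (auto simp: LL_def)
    qed simp
  qed (use ab(1) in \<open>auto simp: LL_def\<close>)
  have LLj: "LL (3 * Suc m) (smult (1/2) u) (smult (1/2) w)"
    if "degree u \<le> N" "degree w \<le> (3 * m) div 2" for u w
    using that two by (auto simp: LL_def N_def)
  have "LL (3 * Suc m) a b" using ab(1) by (auto simp: LL_def)
  moreover have "LL (3 * Suc m) (smult (1/2) (a * p + b * \<delta>)) (smult (1/2) (a + b * p))"
    by (rule LLj) (use ap bd b' in \<open>auto intro: degree_add_le\<close>)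
  moreover have "LL (3 * Suc m) (smult (1/2) (a * p - b * \<delta>)) (smult (1/2) (b * p - a))"
    by (rule LLj) (use ap bd b' in \<open>auto intro: degree_diff_le\<close>)
  ultimately show ?case using index_cases[of k] XW_co[of m a b] unfolding ab(2) p_def by metis
qed

text \<open>Negative powers of \<open>v i\<close> are polynomials on the curve: 1 / v i = v j v l /
  n, at the cost of two degrees each.\<close>

lemma am_XW_monom:
  assumes "M = (if k \<le> m then m - k else 2 * (k - m))"
  shows "am M (XW m (monom 1 k) 0)"
proof -
  have pow: "am (d * M) (cst 1 * f ^ M)" if "am d f" for d f M
  proof (induction M)
    case (Suc M)
    thus ?case using am_mult[OF that Suc] by (simp add: mult_ac add.commute)
  qed (use am_cst in simp)
  show ?thesis
  proof (cases "k \<le> m")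
    case True
    have "XW m (monom 1 k) 0 = cst 1 * co i ^ (m - k)"
    proof (rule pfun_eqI)
      fix v
      have p: "apf (f ^ M) v = apf f v ^ M" for f :: "'a pfun" and M by (induction M) simp_all
      show "apf (XW m (monom 1 k) 0) v = apf (cst 1 * co i ^ (m - k)) v"
        using True C_nz[of v i] by (simp add: XW_def at_cst at_co p poly_monom power_diff power_divide)
    qed
    thus ?thesis using pow[of 1 "co i" "m - k", OF am_co'] True assms by simp
  next
    case False
    have "XW m (monom 1 k) 0 = sc ((1 / n) ^ (k - m)) (cst 1 * (co j * co l) ^ (k - m))"
    proof (rule pfun_eqI)
      fix v
      have p: "apf (f ^ M) v = apf f v ^ M" for f :: "'a pfun" and M by (induction M) simp_all
      show "apf (XW m (monom 1 k) 0) v = apf (sc ((1 / n) ^ (k - m)) (cst 1 * (co j * co l) ^ (k - m))) v"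
      proof (cases "v \<in> C")
        case True
        have nz: "v i \<noteq> 0" by (rule C_nz[OF True])
        have "v j * v l / n = 1 / v i" using True n_nz nz by (auto simp: C_iff field_simps)
        hence "(v j * v l / n) ^ (k - m) = (1 / v i) ^ (k - m)" by simp
        moreover have "v i ^ m * (1 / v i) ^ k = (1 / v i) ^ (k - m)"
        proof -
          have "(1 / v i) ^ k = (1 / v i) ^ m * (1 / v i) ^ (k - m)" using False by (simp flip: power_add)
          thus ?thesis using nz by (simp add: power_divide)
        qed
        ultimately show ?thesis using True
          by (simp add: XW_def at_cst at_co p poly_monom power_divide power_mult_distrib)
      qed (simp add: XW_def at_cst p)
    qed
    moreover have "am 2 (co j * co l)" using am_mult[OF am_co' am_co', of j l] by (simp add: numeral_2_eq_2)
    ultimately show ?thesis using am_sc[OF pow[of 2 "co j * co l" "k - m"]] False assms by simp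
  qed
qed

lemma XW_imp_am:
  assumes "LL (3 * m) a b"
  shows "am m (XW m a b)"
proof -
  have 1: "am m (XW m (monom 1 k) 0)" if "2 * k \<le> 3 * m" for k
    by (rule am_mono[OF am_XW_monom[OF refl]]) (use that in auto)
  have 2: "am m (XW m 0 (monom 1 k))" if "2 * k + 3 \<le> 3 * m" for k
  proof -
    \<comment> \<open>w = (v j - v l) t, so w contributes one power of t and a linear form.\<close>
    have eq: "XW m 0 (monom 1 k) = XW m (monom 1 (Suc k)) 0 * (co j + sc (- 1) (co l))"
      by (rule pfun_eqI) (auto simp: XW_def at_co poly_monom wc_def)
    have am1: "am 1 (co j + sc (- 1) (co l))" by (intro am_add am_sc am_co')
    define M where "M = (if Suc k \<le> m then m - Suc k else 2 * (Suc k - m))"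
    have "am (M + 1) (XW m 0 (monom 1 k))"
      unfolding eq by (rule am_mult[OF am1 am_XW_monom[OF M_def]])
    thus ?thesis by (rule am_mono) (use that in \<open>auto simp: M_def\<close>)
  qed
  have "XW m a 0 = (\<Sum>k\<le>degree a. sc (coeff a k) (XW m (monom 1 k) 0))"
  proof -
    have "(\<Sum>k\<in>K. sc (coeff a k) (XW m (monom 1 k) 0)) = XW m (\<Sum>k\<in>K. monom (coeff a k) k) 0" for K
      by (induction K rule: infinite_finite_induct) (simp_all add: XW_eq_0_iff[THEN iffD2] XW_sc XW_add smult_monom)
    thus ?thesis by (simp add: poly_as_sum_of_monoms)
  qed
  also have "\<dots> \<in> {f. am m f}"
    by (intro pv.subspace_sum[OF am_subspace]) (use assms 1 am_sc in \<open>auto simp: LL_def\<close>)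
  finally have A: "am m (XW m a 0)" by simp
  have "am m (XW m 0 b)"
  proof (cases "b = 0")
    case True
    thus ?thesis using am_cst[of m 0] by (simp add: XW_eq_0_iff[THEN iffD2] cst_0)
  next
    case False
    have "XW m 0 b = (\<Sum>k\<le>degree b. sc (coeff b k) (XW m 0 (monom 1 k)))"
    proof -
      have "(\<Sum>k\<in>K. sc (coeff b k) (XW m 0 (monom 1 k))) = XW m 0 (\<Sum>k\<in>K. monom (coeff b k) k)" for K
        by (induction K rule: infinite_finite_induct) (simp_all add: XW_eq_0_iff[THEN iffD2] XW_sc XW_add smult_monom)
      thus ?thesis by (simp add: poly_as_sum_of_monoms)
    qed
    also have "\<dots> \<in> {f. am m f}"
      by (intro pv.subspace_sum[OF am_subspace]) (use assms False 2 am_sc in \<open>auto simp: LL_def\<close>)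
    finally show ?thesis by simp
  qed
  moreover have "XW m a b = XW m a 0 + XW m 0 b" by (simp add: XW_add)
  ultimately show ?thesis using am_add[OF A] by metis
qed

text \<open>\<open>v i ^ m\<close> has a zero of order \<open>2 * m\<close> at the pole of t and
  poles of order \<open>m\<close> at the other two points at infinity. Pole order at most
  \<open>m\<close> at all three points is therefore pole order at most \<open>3 * m\<close> of a + b
  w.\<close>

lemma am_iff_XW: "am m f \<longleftrightarrow> (\<exists>a b. LL (3 * m) a b \<and> f = XW m a b)"
  using am_imp_XW XW_imp_am by blast

lemma XW_Af: "XW m a b \<in> Af"
proof -
  define k where "k = 2 * (degree a + degree b) + 3"
  have "degree (monom 1 k * a) \<le> k + degree a" "degree (monom 1 k * b) \<le> k + degree b"
    using degree_mult_le[of "monom 1 k" a] degree_mult_le[of "monom 1 k" b] by (simp_all add: degree_monom_eq)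
  hence "LL (3 * (m + k)) (monom 1 k * a) (monom 1 k * b)" by (auto simp: LL_def k_def)
  hence "am (m + k) (XW (m + k) (monom 1 k * a) (monom 1 k * b))" by (rule XW_imp_am)
  thus ?thesis unfolding XW_shift[symmetric] by (auto simp: Af_def)
qed

lemma Af_XW: "f \<in> Af \<Longrightarrow> \<exists>m a b. f = XW m a b"
  unfolding Af_def using am_imp_XW by blast

end

section \<open>Invertible ideals and principal divisors\<close>

context cubic_coordinates
begin

text \<open>The involution w -> - w of the double cover; \<open>cj\<close> and \<open>swm\<close>
  are its actions on functions and divisors.\<close>

definition sw :: "(3 \<Rightarrow> 'a) \<Rightarrow> 3 \<Rightarrow> 'a" where
  "sw v b = (if b = j then v l else if b = l then v j else v b)"

definition cj :: "'a pfun \<Rightarrow> 'a pfun" where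
  "cj f = Pf (\<lambda>v. apf f (sw v))"

definition swm :: "(3 \<Rightarrow> 'a) multiset \<Rightarrow> (3 \<Rightarrow> 'a) multiset" where
  "swm D = image_mset sw D"

lemma sw_simps [simp]: "sw v i = v i" "sw v j = v l" "sw v l = v j" "sw (sw v) = v"
  using ij il jl by (auto simp: sw_def fun_eq_iff)

lemma sw_C [simp]: "sw v \<in> C \<longleftrightarrow> v \<in> C"
  by (simp add: C_iff ac_simps)

lemma apf_cj [simp]: "apf (cj f) v = apf f (sw v)"
  by (simp add: cj_def)

lemma cj_XW: "cj (XW m a b) = XW m a (- b)"
  by (rule pfun_eqI) (simp add: XW_def wc_def field_simps)

lemma cj_Af: "f \<in> Af \<Longrightarrow> cj f \<in> Af"
  using Af_XW XW_Af cj_XW by metis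

lemma cj_mult: "cj (f * g) = cj f * cj g" and cj_add: "cj (f + g) = cj f + cj g"
  and cj_sc: "cj (sc c f) = sc c (cj f)" and cj_cj: "cj (cj f) = f"
  by (rule pfun_eqI, simp)+

lemma cj_span: "f \<in> pv.span A \<Longrightarrow> cj f \<in> pv.span (cj ` A)"
proof (induction rule: pv.span_induct_alt)
  case base
  have "cj 0 = 0" by (rule pfun_eqI) simp
  thus ?case by (simp add: pv.span_zero)
next
  case (step c a f)
  thus ?case by (simp add: cj_add cj_sc pv.span_add pv.span_scale pv.span_base)
qed

lemma cj_ID: "f \<in> ID D \<Longrightarrow> cj f \<in> ID (swm D)"
proof (induction D arbitrary: f)
  case empty
  thus ?case by (simp add: swm_def ID_empty cj_Af)
next
  case (add P D)
  let ?S = "{a * b |a b. a \<in> MP P \<and> b \<in> ID D}"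
  have "cj f \<in> pv.span (cj ` ?S)" using add.prems by (intro cj_span) (simp add: ID_add IM_def)
  moreover have "cj ` ?S \<subseteq> {a * b |a b. a \<in> MP (sw P) \<and> b \<in> ID (swm D)}"
  proof safe
    fix a b assume ab: "a \<in> MP P" "b \<in> ID D"
    have "cj a \<in> MP (sw P)" using ab by (simp add: MP_def cj_Af)
    thus "\<exists>a' b'. cj (a * b) = a' * b' \<and> a' \<in> MP (sw P) \<and> b' \<in> ID (swm D)"
      using add.IH[OF ab(2)] cj_mult by blast
  qed
  ultimately have "cj f \<in> pv.span {a * b |a b. a \<in> MP (sw P) \<and> b \<in> ID (swm D)}"
    using pv.span_mono by blast
  thus ?case by (simp add: swm_def ID_add IM_def)
qed

abbreviation norm_poly :: "'a poly \<Rightarrow> 'a poly \<Rightarrow> 'a poly" where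
  "norm_poly a b \<equiv> a * a - b * b * \<delta>"

lemma XW_cj: "XW m a b * cj (XW m a b) = XW (m + m) (norm_poly a b) 0"
  by (simp add: cj_XW XW_mult)

text \<open>The two summands have degrees of different parity, so their leading terms cannot
  cancel.\<close>

lemma norm_poly_degree:
  assumes "a \<noteq> 0 \<or> b \<noteq> 0"
  shows "norm_poly a b \<noteq> 0" "degree (norm_poly a b) = max (2 * degree a) (if b = 0 then 0 else 2 * degree b + 3)"
proof -
  have da: "degree (a * a) = 2 * degree a" by (cases "a = 0") (simp_all add: degree_mult_eq)
  have *: "norm_poly a b \<noteq> 0 \<and> degree (norm_poly a b) = max (2 * degree a) (if b = 0 then 0 else 2 * degree b + 3)"
  proof (cases "b = 0")
    case True
    thus ?thesis using assms da by simp
  next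
    case False
    have db: "degree (- (b * b * \<delta>)) = 2 * degree b + 3"
      using False degree_\<delta> by (simp add: degree_mult_eq)
    have eq: "norm_poly a b = a * a + - (b * b * \<delta>)" by simp
    have d: "degree (norm_poly a b) = max (2 * degree a) (2 * degree b + 3)"
    proof (cases "2 * degree a < 2 * degree b + 3")
      case True
      thus ?thesis unfolding eq using da db by (subst degree_add_eq_right) auto
    next
      case False
      hence "2 * degree b + 3 < 2 * degree a" by presburger
      thus ?thesis unfolding eq using da db by (subst degree_add_eq_left) auto
    qed
    hence "degree (norm_poly a b) > 0" by simp
    thus ?thesis using d False by auto
  qed
  thus "norm_poly a b \<noteq> 0" "degree (norm_poly a b) = max (2 * degree a) (if b = 0 then 0 else 2 * degree b + 3)"
    by blast+
qed

text \<open>Multiplication by the conjugate replaces \<open>f\<close> by its norm, a nonzero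
  polynomial in t up to a power of \<open>v i\<close>.\<close>

lemma Af_no_zero_divisors:
  assumes "f \<in> Af" "g \<in> Af" "f * g = 0" "f \<noteq> 0"
  shows "g = 0"
proof -
  obtain m a b where f: "f = XW m a b" using Af_XW[OF assms(1)] by blast
  obtain m' c d where g: "g = XW m' c d" using Af_XW[OF assms(2)] by blast
  have ab: "a \<noteq> 0 \<or> b \<noteq> 0" using assms(4) unfolding f XW_eq_0_iff by blast
  have "(f * cj f) * g = 0" using assms(3) by (metis mult.assoc mult.commute mult_zero_left)
  hence "XW (m + m + m') (norm_poly a b * c) (norm_poly a b * d) = 0" unfolding f g XW_cj XW_mult by simp
  hence "c = 0" "d = 0" using norm_poly_degree(1)[OF ab] by (simp_all add: XW_eq_0_iff)
  thus ?thesis by (simp add: g XW_eq_0_iff)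
qed

lemma Af_cancel:
  assumes "f \<in> Af" "g \<in> Af" "h \<in> Af" "f \<noteq> 0" "f * g = f * h"
  shows "g = h"
proof -
  have "f * (g - h) = 0" using assms(5) by (simp add: right_diff_distrib)
  hence "g - h = 0" using Af_no_zero_divisors assms(1-4) Af_diff by blast
  thus ?thesis by simp
qed

definition lin :: "3 \<Rightarrow> (3 \<Rightarrow> 'a) \<Rightarrow> 'a pfun" where
  "lin b P = co b - cst (P b)"

lemma lin_Af: "lin b P \<in> Af"
  by (simp add: lin_def Af_diff Af_co Af_cst)

lemma lin_MP: "P \<in> C \<Longrightarrow> R b = P b \<Longrightarrow> lin b R \<in> MP P"
  using lin_Af by (simp add: MP_def lin_def at_co at_cst)

lemma apf_lin: "v \<in> C \<Longrightarrow> apf (lin b P) v = v b - P b"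
  by (simp add: lin_def at_co at_cst)

text \<open>Two linear functions generate the maximal ideal of a point, since the third is minus
  their sum on the curve.\<close>

lemma MP_generators:
  assumes "P \<in> C" "f \<in> Af"
  shows "\<exists>u\<in>Af. \<exists>v\<in>Af. f - cst (apf f P) = lin i P * u + lin j P * v"
proof -
  have "\<exists>u\<in>Af. \<exists>v\<in>Af. f - cst (apf f P) = lin i P * u + lin j P * v" if "am m f" for m
    using that
  proof (induction rule: am.induct)
    case (am_cst m c)
    show ?case by (intro bexI[of _ 0]) (use assms(1) in \<open>simp_all add: at_cst pv.subspace_0[OF Af_subspace]\<close>)
  next
    case (am_add m f g)
    then obtain u v u' v' where "u \<in> Af" "v \<in> Af" "u' \<in> Af" "v' \<in> Af"
      "f - cst (apf f P) = lin i P * u + lin j P * v" "g - cst (apf g P) = lin i P * u' + lin j P * v'" by blast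
    moreover have "f + g - cst (apf (f + g) P) = (f - cst (apf f P)) + (g - cst (apf g P))"
      by (simp flip: cst_add)
    ultimately have "f + g - cst (apf (f + g) P) = lin i P * (u + u') + lin j P * (v + v')"
      and "u + u' \<in> Af" "v + v' \<in> Af"
      by (simp_all add: distrib_left Af_add add_ac)
    thus ?case by blast
  next
    case (am_co m f k)
    then obtain u v where uv: "u \<in> Af" "v \<in> Af" "f - cst (apf f P) = lin i P * u + lin j P * v" by blast
    have "\<exists>d\<in>Af. \<exists>e\<in>Af. lin k P = lin i P * d + lin j P * e"
    proof -
      have lin1: "lin b P * cst c = sc c (lin b P)" for b c
        by (rule pfun_eqI) (simp add: lin_def at_co at_cst)
      have "lin l P = lin i P * cst (- 1) + lin j P * cst (- 1)"
      proof (rule Af_eqI)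
        fix v assume v: "v \<in> C"
        have "v i + v j + v l = P i + P j + P l" using v assms(1) by (simp add: C_iff)
        thus "apf (lin l P) v = apf (lin i P * cst (- 1) + lin j P * cst (- 1)) v"
          using v by (simp add: apf_lin at_cst) (simp add: algebra_simps)
      qed (simp_all add: lin_Af Af_add Af_mult Af_cst)
      moreover have "lin i P = lin i P * cst 1 + lin j P * cst 0" "lin j P = lin i P * cst 0 + lin j P * cst 1"
        by (simp_all add: lin1)
      ultimately show ?thesis using index_cases[of k] Af_cst by metis
    qed
    then obtain d e where de: "d \<in> Af" "e \<in> Af" "lin k P = lin i P * d + lin j P * e" by blast
    have "f * co k - cst (apf (f * co k) P) = (f - cst (apf f P)) * co k + sc (apf f P) (lin k P)"
      by (rule pfun_eqI) (use assms(1) in \<open>simp add: at_cst at_co lin_def algebra_simps\<close>)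
    also have "\<dots> = lin i P * (u * co k + sc (apf f P) d) + lin j P * (v * co k + sc (apf f P) e)"
      unfolding uv(3) de(3) by (simp add: algebra_simps pv.scale_right_distrib sc_mult_left sc_mult_right)
    finally have "f * co k - cst (apf (f * co k) P)
        = lin i P * (u * co k + sc (apf f P) d) + lin j P * (v * co k + sc (apf f P) e)" .
    moreover have "u * co k + sc (apf f P) d \<in> Af" "v * co k + sc (apf f P) e \<in> Af"
      using uv de by (simp_all add: Af_add Af_mult Af_co Af_sc)
    ultimately show ?case by blast
  qed
  thus ?thesis using assms(2) by (auto simp: Af_def)
qed

text \<open>The cofactor of \<open>lin i P\<close> in the product of the two linear functions in
  \<open>j\<close> at \<open>P\<close> and at its conjugate.\<close>

definition kp :: "(3 \<Rightarrow> 'a) \<Rightarrow> 'a pfun" where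
  "kp P = sc (1 / P i) (co j * co l) - co j"

lemma kp_Af: "kp P \<in> Af"
  by (simp add: kp_def Af_diff Af_sc Af_mult Af_co)

lemma lin_j_mult:
  assumes "P \<in> C"
  shows "lin j P * lin j (sw P) = lin i P * kp P"
proof (rule Af_eqI)
  fix v assume v: "v \<in> C"
  have nz: "P i \<noteq> 0" by (rule C_nz[OF assms])
  have v1: "v l = s - v i - v j" and P1: "P l = s - P i - P j" using v assms by (auto simp: C_iff algebra_simps)
  have v2: "v i * (v j * (s - v i - v j)) = n" and P2: "P i * (P j * (s - P i - P j)) = n"
    using v assms by (simp_all add: C_iff mult.assoc flip: v1 P1)
  have "P i * ((v j - P j) * (v j - P l)) = (v i - P i) * (v j * v l - P i * v j)"
  proof -
    have "P i * ((v j - P j) * (v j - P l)) - P i * (P j * (s - P i - P j))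
        = (v i - P i) * (v j * v l - P i * v j) - v i * (v j * (s - v i - v j))"
      unfolding v1 P1 by (simp add: algebra_simps)
    thus ?thesis using v2 P2 by simp
  qed
  hence "(v j - P j) * (v j - P l) = (v i - P i) * (1 / P i * (v j * v l) - v j)"
    using nz by (simp add: field_simps)
  thus "apf (lin j P * lin j (sw P)) v = apf (lin i P * kp P) v"
    using v by (simp add: apf_lin kp_def at_co)
qed (simp_all add: Af_mult lin_Af kp_Af)

text \<open>Among the products of generators only the one of the two functions in \<open>j\<close>
  lacks the factor \<open>lin i P\<close>, and \<open>lin_j_mult\<close> supplies it.\<close>

lemma MP_mult:
  assumes P: "P \<in> C" and f: "f \<in> MP P" and g: "g \<in> MP (sw P)"
  shows "\<exists>h\<in>Af. f * g = lin i P * h"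
proof -
  have "apf f P = 0" "apf g (sw P) = 0" "f \<in> Af" "g \<in> Af" using f g by (auto simp: MP_def)
  then obtain u v u' v' where uv: "u \<in> Af" "v \<in> Af" "f = lin i P * u + lin j P * v"
    and uv': "u' \<in> Af" "v' \<in> Af" "g = lin i (sw P) * u' + lin j (sw P) * v'"
    using MP_generators[OF P, of f] MP_generators[of "sw P" g] P by (auto simp: cst_0)
  have lsw: "lin i (sw P) = lin i P" by (simp add: lin_def)
  have "f * g = lin i P * (u * g + u' * (lin j P * v)) + (lin j P * lin j (sw P)) * (v * v')"
    unfolding uv(3) uv'(3) lsw by (simp add: algebra_simps)
  also have "\<dots> = lin i P * (u * g + u' * (lin j P * v) + kp P * (v * v'))"
    unfolding lin_j_mult[OF P] by (simp add: algebra_simps)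
  finally show ?thesis using uv uv' \<open>g \<in> Af\<close>
    by (intro bexI[of _ "u * g + u' * (lin j P * v) + kp P * (v * v')"]) (simp_all add: Af_add Af_mult lin_Af kp_Af)
qed

lemma IM_MP_ideal: "f \<in> IM (MP P) (MP R) \<Longrightarrow> g \<in> Af \<Longrightarrow> f * g \<in> IM (MP P) (MP R)"
  unfolding IM_def
proof (rule span_mult_in_subspace[OF _ pv.span_base[of g "{g}"] pv.subspace_span])
  fix a b assume "g \<in> Af" "a \<in> {a * b |a b. a \<in> MP P \<and> b \<in> MP R}" "b \<in> {g}"
  then obtain c d where cd: "a = c * d" "c \<in> MP P" "d \<in> MP R" "b = g" by auto
  have "d * g \<in> MP R" using cd \<open>g \<in> Af\<close> by (simp add: MP_def Af_mult)
  thus "a * b \<in> pv.span {a * b |a b. a \<in> MP P \<and> b \<in> MP R}"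
    using IM_I[OF cd(2)] by (simp add: cd IM_def mult.assoc)
qed simp_all

text \<open>Together with \<open>MP_mult\<close>: the ideals of \<open>P\<close> and
  \<open>sw P\<close> have a principal product, so point ideals are invertible. If
  \<open>P j\<close> and \<open>P l\<close> differ, a difference of linear functions is a nonzero
  constant; at a branch point the cofactor \<open>kp P\<close> does not vanish because the curve is
  smooth.\<close>

lemma lin_in_IM:
  assumes P: "P \<in> C"
  shows "lin i P \<in> IM (MP P) (MP (sw P))"
proof -
  let ?I = "IM (MP P) (MP (sw P))"
  have sp: "pv.subspace ?I" by (rule IM_subspace)
  have 1: "lin i P * lin i P \<in> ?I" by (intro IM_I lin_MP) (use P in auto)
  have 2: "lin i P * lin j (sw P) \<in> ?I" by (intro IM_I lin_MP) (use P in auto)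
  have 3: "lin i P * lin j P \<in> ?I"
    using IM_I[of "lin j P" "MP P" "lin i P" "MP (sw P)"] P by (simp add: lin_MP mult.commute)
  have 4: "lin i P * kp P \<in> ?I"
    unfolding lin_j_mult[OF P, symmetric] by (intro IM_I lin_MP) (use P in auto)
  show ?thesis
  proof (cases "P j = P l")
    case False
    have "lin i P = sc (1 / (P l - P j)) (lin i P * lin j P - lin i P * lin j (sw P))"
    proof (rule Af_eqI)
      fix v assume "v \<in> C"
      thus "apf (lin i P) v = apf (sc (1 / (P l - P j)) (lin i P * lin j P - lin i P * lin j (sw P))) v"
        using False by (simp add: apf_lin flip: right_diff_distrib)
    qed (simp_all add: lin_Af Af_sc Af_diff Af_mult)
    thus ?thesis using 2 3 pv.subspace_scale[OF sp] pv.subspace_diff[OF sp] by metis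
  next
    case True
    define c where "c = apf (kp P) P"
    have nz: "P i \<noteq> 0" "P j \<noteq> 0" using C_nz[OF P] by auto
    have "c = P j * (P j - P i) / P i" using P True nz by (simp add: c_def kp_def at_co field_simps)
    \<comment> \<open>Equality would make all three coordinates equal, hence
      \<open>s ^ 3 = 27 * n\<close>.\<close>
    moreover have "P j \<noteq> P i"
    proof
      assume e: "P j = P i"
      have "s = 3 * P i" "n = P i ^ 3" using P True e by (auto simp: C_iff power3_eq_cube)
      thus False using s_cond by (simp add: power_mult_distrib)
    qed
    ultimately have c: "c \<noteq> 0" using nz by simp
    obtain u v where uv: "u \<in> Af" "v \<in> Af" "kp P - cst c = lin i P * u + lin j P * v"
      using MP_generators[OF P kp_Af] unfolding c_def by blast
    have "lin i P * cst c = lin i P * kp P - (lin i P * lin i P) * u - (lin i P * lin j P) * v"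
      using arg_cong[OF uv(3), of "\<lambda>f. lin i P * f"] by (simp add: algebra_simps)
    also have "\<dots> \<in> ?I"
      by (intro pv.subspace_diff[OF sp] 4 IM_MP_ideal 1 3 uv)
    finally have "sc (1 / c) (lin i P * cst c) \<in> ?I" by (rule pv.subspace_scale[OF sp])
    moreover have "sc (1 / c) (lin i P * cst c) = lin i P"
      using c by (intro pfun_eqI) (simp add: lin_def at_co at_cst)
    ultimately show ?thesis by simp
  qed
qed


end

section \<open>Ideals of divisors: invertibility and codimension\<close>

context cubic_coordinates
begin

definition pt :: "(3 \<Rightarrow> 'a) multiset \<Rightarrow> 'a poly" where
  "pt D = (\<Prod>P\<in>#D. [:1, - P i:])"

text \<open>The normal form of the product of the functions \<open>lin i P\<close> over
  \<open>D\<close>; it generates the product of \<open>ID D\<close> with its conjugate.\<close>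

definition pD :: "(3 \<Rightarrow> 'a) multiset \<Rightarrow> 'a pfun" where
  "pD D = XW (size D) (pt D) 0"

lemma pt_add: "pt (add_mset P D) = [:1, - P i:] * pt D"
  by (simp add: pt_def)

lemma pt_props: "poly (pt D) 0 = 1" "pt D \<noteq> 0" "coprime (pt D) [:0, 1:]"
proof -
  show p0: "poly (pt D) 0 = 1" by (induction D) (simp_all add: pt_def)
  thus "pt D \<noteq> 0" by auto
  show "coprime (pt D) [:0, 1:]"
  proof (induction D)
    case (add P D)
    have "coprime [:1, - P i:] [:0, 1:]"
    proof (rule coprimeI)
      fix d assume "d dvd [:1, - P i:]" "d dvd [:0, 1:]"
      hence "d dvd [:1, - P i:] + [:P i:] * [:0, 1:]" by (intro dvd_add dvd_mult)
      thus "d dvd 1" by (simp add: one_pCons)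
    qed
    thus ?case using add by (simp add: pt_add coprime_mult_left_iff del: mult_pCons_left)
  qed (simp add: pt_def)
qed

lemma degree_pt: "set_mset D \<subseteq> C \<Longrightarrow> degree (pt D) = size D"
proof (induction D)
  case (add P D)
  have "P i \<noteq> 0" using add.prems C_nz by auto
  thus ?case using add pt_props(2)[of D] by (simp add: pt_add degree_mult_eq del: mult_pCons_left)
qed (simp add: pt_def)

lemma pD_empty: "pD {#} = cst 1"
  using XW_cst[of 1 0] by (simp add: pD_def pt_def monom_0 one_pCons)

lemma pD_add: "P \<in> C \<Longrightarrow> pD (add_mset P D) = lin i P * pD D"
proof (rule pfun_eqI)
  fix v assume P: "P \<in> C"
  show "apf (pD (add_mset P D)) v = apf (lin i P * pD D) v"
  proof (cases "v \<in> C")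
    case True
    thus ?thesis using C_nz[OF True] by (simp add: pD_def apf_XW pt_add apf_lin field_simps)
  qed (simp add: pD_def apf_XW_out)
qed

lemma pD_Af: "pD D \<in> Af" and pD_nz: "pD D \<noteq> 0"
  using XW_Af pt_props by (simp_all add: pD_def XW_eq_0_iff)

lemma Af_cst_1: "f \<in> Af \<Longrightarrow> cst 1 * f = f"
  by (auto simp: Af_def cst_1_mult)

lemma mult_subspace:
  assumes "pv.subspace V"
  shows "pv.subspace {p * h |h. h \<in> V}"
proof (rule pv.subspaceI)
  show "0 \<in> {p * h |h. h \<in> V}" using pv.subspace_0[OF assms] by force
  fix x y assume "x \<in> {p * h |h. h \<in> V}" "y \<in> {p * h |h. h \<in> V}"
  then obtain a b where "x + y = p * (a + b)" "a \<in> V" "b \<in> V" by (auto simp: distrib_left)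
  thus "x + y \<in> {p * h |h. h \<in> V}" using pv.subspace_add[OF assms] by blast
next
  fix c x assume "x \<in> {p * h |h. h \<in> V}"
  then obtain a where "sc c x = p * sc c a" "a \<in> V" by (auto simp: sc_mult_right)
  thus "sc c x \<in> {p * h |h. h \<in> V}" using pv.subspace_scale[OF assms] by blast
qed

text \<open>With \<open>pD_in_IM\<close> this says that \<open>ID (swm D)\<close> inverts
  \<open>ID D\<close> up to the principal factor \<open>pD D\<close>, which takes the place of
  fractional ideals.\<close>

lemma ID_mult_swm:
  assumes "set_mset D \<subseteq> C" "f \<in> ID D" "g \<in> ID (swm D)"
  shows "\<exists>h\<in>Af. f * g = pD D * h"
  using assms
proof (induction D arbitrary: f g)
  case empty
  have "f * g \<in> Af" using empty by (simp add: ID_empty swm_def Af_mult)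
  moreover from this have "f * g = pD {#} * (f * g)" unfolding pD_empty Af_def by (auto simp: cst_1_mult)
  ultimately show ?case by blast
next
  case (add P D)
  have P: "P \<in> C" using add.prems by simp
  have "f * g \<in> {pD (add_mset P D) * h |h. h \<in> Af}"
  proof (rule span_mult_in_subspace[OF _ _ mult_subspace[OF Af_subspace]])
    show "f \<in> pv.span {a * b |a b. a \<in> MP P \<and> b \<in> ID D}" using add.prems by (simp add: ID_add IM_def)
    show "g \<in> pv.span {a * b |a b. a \<in> MP (sw P) \<and> b \<in> ID (swm D)}"
      using add.prems by (simp add: swm_def ID_add IM_def)
    fix x y assume "x \<in> {a * b |a b. a \<in> MP P \<and> b \<in> ID D}" "y \<in> {a * b |a b. a \<in> MP (sw P) \<and> b \<in> ID (swm D)}"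
    then obtain a b c d where x: "x = a * b" "a \<in> MP P" "b \<in> ID D"
      and y: "y = c * d" "c \<in> MP (sw P)" "d \<in> ID (swm D)" by blast
    obtain h where h: "h \<in> Af" "a * c = lin i P * h" using MP_mult[OF P x(2) y(2)] by blast
    have "set_mset D \<subseteq> C" using add.prems(1) by simp
    then obtain k where k: "k \<in> Af" "b * d = pD D * k" using add.IH[OF _ x(3) y(3)] by blast
    have "x * y = (a * c) * (b * d)" by (simp add: x(1) y(1) mult_ac)
    also have "\<dots> = pD (add_mset P D) * (h * k)" unfolding h k pD_add[OF P] by (simp add: mult_ac)
    finally show "x * y \<in> {pD (add_mset P D) * h |h. h \<in> Af}" using Af_mult[OF h(1) k(1)] by blast
  qed
  thus ?case by blast
qed

lemma pD_in_IM: "set_mset D \<subseteq> C \<Longrightarrow> pD D \<in> IM (ID D) (ID (swm D))"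
proof (induction D)
  case empty
  have "cst 1 * cst 1 \<in> IM Af Af" by (intro IM_I Af_cst)
  thus ?case by (simp add: pD_empty swm_def ID_empty cst_mult)
next
  case (add P D)
  have P: "P \<in> C" using add.prems by simp
  have "lin i P * pD D \<in> IM (ID (add_mset P D)) (ID (swm (add_mset P D)))"
  proof (rule span_mult_in_subspace[OF _ _ IM_subspace])
    show "lin i P \<in> pv.span {a * b |a b. a \<in> MP P \<and> b \<in> MP (sw P)}"
      using lin_in_IM[OF P] by (simp add: IM_def)
    show "pD D \<in> pv.span {a * b |a b. a \<in> ID D \<and> b \<in> ID (swm D)}" using add by (simp add: IM_def)
    fix x y assume "x \<in> {a * b |a b. a \<in> MP P \<and> b \<in> MP (sw P)}" "y \<in> {a * b |a b. a \<in> ID D \<and> b \<in> ID (swm D)}"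
    then obtain a b c d where x: "x = a * b" "a \<in> MP P" "b \<in> MP (sw P)"
      and y: "y = c * d" "c \<in> ID D" "d \<in> ID (swm D)" by blast
    have "(a * c) * (b * d) \<in> IM (ID (add_mset P D)) (ID (swm (add_mset P D)))"
      using x y by (intro IM_I) (simp_all add: swm_def ID_add IM_I)
    thus "x * y \<in> IM (ID (add_mset P D)) (ID (swm (add_mset P D)))" by (simp add: x(1) y(1) mult_ac)
  qed
  thus ?case by (simp add: pD_add[OF P])
qed

text \<open>\<open>pt D\<close> has constant term 1 and is coprime to the powers of t by which two
  normal forms of a function may differ.\<close>

lemma pt_dvd:
  assumes "XW m a b = pD D * h" "h \<in> Af"
  shows "pt D dvd a" "pt D dvd b"
proof -
  obtain r c d where "h = XW r c d" using Af_XW[OF assms(2)] by blast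
  hence "XW m a b = XW (size D + r) (pt D * c) (pt D * d)" using assms(1) by (simp add: pD_def XW_mult)
  note e = XW_eq_shift[OF this]
  have "coprime (pt D) (monom 1 k)" for k
    using pt_props(3)[of D] by (simp add: monom_altdef coprime_power_right_iff)
  moreover have "pt D dvd monom 1 (size D + r) * a" "pt D dvd monom 1 (size D + r) * b"
    unfolding e by simp_all
  ultimately show "pt D dvd a" "pt D dvd b" by (metis coprime_dvd_mult_right_iff)+
qed

lemma pt_dvd_norm:
  assumes "set_mset D \<subseteq> C" "XW m a b \<in> ID D"
  shows "pt D dvd norm_poly a b"
proof -
  obtain h where "h \<in> Af" "XW m a b * cj (XW m a b) = pD D * h"
    using ID_mult_swm[OF assms(1,2) cj_ID[OF assms(2)]] by blast
  thus ?thesis unfolding XW_cj using pt_dvd(1) by blast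
qed

lemma x_unit: "XW k 1 0 * XW 0 (monom 1 k) 0 = cst 1"
proof -
  have "XW k 1 0 * XW 0 (monom 1 k) 0 = XW k (monom 1 k) 0" by (simp add: XW_mult)
  thus ?thesis by (simp flip: XW_cst)
qed

text \<open>The norm of the function is then a nonzero constant times \<open>pt D\<close>. So
  dividing \<open>g\<close> times the conjugate by \<open>pD D\<close> amounts, up to units, to
  dividing \<open>g\<close> by the function itself.\<close>

lemma generator_dvd:
  assumes D: "set_mset D \<subseteq> C" and f: "XW m a b \<in> ID D" and nz: "a \<noteq> 0 \<or> b \<noteq> 0"
    and deg: "degree (norm_poly a b) = size D" and g: "g \<in> ID D"
  shows "\<exists>h\<in>Af. g = XW m a b * h"
proof -
  let ?f = "XW m a b"
  obtain w where w: "norm_poly a b = pt D * w" using pt_dvd_norm[OF D f] by (elim dvdE)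
  have "w \<noteq> 0" using norm_poly_degree(1)[OF nz] w by auto
  hence "degree w = 0"
    using deg degree_pt[OF D] pt_props(2)[of D] unfolding w by (simp add: degree_mult_eq)
  then obtain c where c: "w = [:c:]" by (rule degree_eq_zeroE)
  have c0: "c \<noteq> 0" using \<open>w \<noteq> 0\<close> c by auto
  obtain h where h: "h \<in> Af" "g * cj ?f = pD D * h" using ID_mult_swm[OF D g cj_ID[OF f]] by blast
  have gA: "g \<in> Af" by (rule ID_Af[OF g])
  have fA: "?f \<in> Af" by (rule XW_Af)
  define k where "k = size D"
  have N: "XW k 1 0 * (?f * cj ?f) = pD D * sc c (XW (m + m) 1 0)"
    unfolding XW_cj w c by (simp add: XW_mult pD_def XW_sc k_def add_ac)
  have "pD D * (XW k 1 0 * (?f * h)) = XW k 1 0 * (?f * (pD D * h))" by (simp only: mult_ac)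
  also have "\<dots> = XW k 1 0 * (?f * (g * cj ?f))" by (simp only: h(2))
  also have "\<dots> = (XW k 1 0 * (?f * cj ?f)) * g" by (simp only: mult_ac)
  also have "\<dots> = pD D * (sc c (XW (m + m) 1 0) * g)" unfolding N by (simp only: mult_ac)
  finally have eq: "pD D * (XW k 1 0 * (?f * h)) = pD D * (sc c (XW (m + m) 1 0) * g)" .
  have "XW k 1 0 * (?f * h) = sc c (XW (m + m) 1 0) * g"
    by (rule Af_cancel[OF pD_Af _ _ pD_nz eq]) (simp_all add: Af_mult XW_Af h(1) gA Af_sc fA)
  hence "XW k 1 0 * (?f * h) * XW 0 (monom 1 (m + m)) 0 = sc c (XW (m + m) 1 0) * g * XW 0 (monom 1 (m + m)) 0"
    by simp
  also have "\<dots> = sc c ((XW (m + m) 1 0 * XW 0 (monom 1 (m + m)) 0) * g)"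
    by (simp only: sc_mult_left sc_mult_right mult_ac)
  also have "\<dots> = sc c g" unfolding x_unit by (simp only: Af_cst_1[OF gA])
  finally have e: "XW k 1 0 * (?f * h) * XW 0 (monom 1 (m + m)) 0 = sc c g" .
  have "g = sc (1 / c) (sc c g)" using c0 by simp
  also have "\<dots> = sc (1 / c) (XW k 1 0 * (?f * h) * XW 0 (monom 1 (m + m)) 0)" by (simp only: e)
  also have "\<dots> = ?f * sc (1 / c) (XW k 1 0 * h * XW 0 (monom 1 (m + m)) 0)"
    by (simp only: sc_mult_right mult_ac)
  finally have "g = ?f * sc (1 / c) (XW k 1 0 * h * XW 0 (monom 1 (m + m)) 0)" .
  moreover have "sc (1 / c) (XW k 1 0 * h * XW 0 (monom 1 (m + m)) 0) \<in> Af"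
    by (intro Af_sc Af_mult XW_Af h)
  ultimately show ?thesis by blast
qed

text \<open>The quotient \<open>g\<close> of \<open>f * t\<close> by \<open>pD D\<close> is nonzero
  at \<open>P\<close>, so \<open>f\<close> generates \<open>ID D\<close> near \<open>P\<close>. If
  all such quotients vanished at \<open>P\<close>, the expansion of \<open>pD D\<close> given by
  \<open>pD_in_IM\<close> would put \<open>f\<close> into \<open>ID (add_mset P D)\<close>.\<close>

lemma local_generator:
  assumes D: "set_mset D \<subseteq> C" and f: "f \<in> ID D" and P: "P \<in> C" and nf: "f \<notin> ID (add_mset P D)"
  shows "\<exists>t\<in>ID (swm D). \<exists>g\<in>Af. pD D * g = f * t \<and> apf g P = 1"
proof (rule ccontr)
  assume neg: "\<not> ?thesis"
  have fA: "f \<in> Af" by (rule ID_Af[OF f])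
  have van: "apf h P = 0" if "t \<in> ID (swm D)" "h \<in> Af" "f * t = pD D * h" for t h
  proof (rule ccontr)
    assume nz: "apf h P \<noteq> 0"
    have "sc (1 / apf h P) t \<in> ID (swm D)" using that pv.subspace_scale[OF ID_subspace] by blast
    moreover have "sc (1 / apf h P) h \<in> Af" using that by (intro Af_sc)
    moreover have "pD D * sc (1 / apf h P) h = f * sc (1 / apf h P) t"
      using that(3) by (simp add: sc_mult_right)
    moreover have "apf (sc (1 / apf h P) h) P = 1" using nz by simp
    ultimately show False using neg by blast
  qed
  have "f * pD D \<in> {pD D * h |h. h \<in> ID (add_mset P D)}"
  proof -
    have sub: "pv.subspace {pD D * h |h. h \<in> ID (add_mset P D)}" by (rule mult_subspace[OF ID_subspace])
    show ?thesis
    proof (rule span_mult_in_subspace[OF pv.span_base[of f "{f}"] _ sub])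
      show "pD D \<in> pv.span {a * b |a b. a \<in> ID D \<and> b \<in> ID (swm D)}"
        using pD_in_IM[OF D] by (simp add: IM_def)
      fix f' y assume "f' \<in> {f}" "y \<in> {a * b |a b. a \<in> ID D \<and> b \<in> ID (swm D)}"
      then obtain c t where ct: "f' = f" "y = c * t" "c \<in> ID D" "t \<in> ID (swm D)" by blast
      obtain h where h: "h \<in> Af" "f * t = pD D * h" using ID_mult_swm[OF D f ct(4)] by blast
      have "h \<in> MP P" using van[OF ct(4) h] h(1) by (simp add: MP_def)
      hence "h * c \<in> ID (add_mset P D)" unfolding ID_add using ct(3) by (intro IM_I)
      moreover have "f' * y = pD D * (h * c)"
      proof -
        have "f' * y = c * (f * t)" unfolding ct by (simp only: mult_ac)
        also have "\<dots> = pD D * (h * c)" unfolding h(2) by (simp only: mult_ac)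
        finally show ?thesis .
      qed
      ultimately show "f' * y \<in> {pD D * h |h. h \<in> ID (add_mset P D)}" by blast
    qed simp
  qed
  then obtain h where h: "f * pD D = pD D * h" "h \<in> ID (add_mset P D)" by blast
  hence "pD D * f = pD D * h" by (simp add: mult.commute)
  hence "f = h" by (rule Af_cancel[OF pD_Af fA ID_Af[OF h(2)] pD_nz])
  thus False using h(2) nf by simp
qed

lemma ID_codim_1:
  assumes D: "set_mset D \<subseteq> C" and f: "f \<in> ID D" and P: "P \<in> C" and nf: "f \<notin> ID (add_mset P D)"
    and b: "b \<in> ID D"
  shows "\<exists>c. b - sc c f \<in> ID (add_mset P D)"
proof -
  obtain t g where t: "t \<in> ID (swm D)" "g \<in> Af" "pD D * g = f * t" "apf g P = 1"
    using local_generator[OF D f P nf] by blast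
  obtain h where h: "h \<in> Af" "b * t = pD D * h" using ID_mult_swm[OF D b t(1)] by blast
  have bA: "b \<in> Af" and fA: "f \<in> Af" using ID_Af b f by blast+
  have "pD D * (b * g) = b * (pD D * g)" by (simp only: mult_ac)
  also have "\<dots> = f * (b * t)" unfolding t(3) by (simp only: mult_ac)
  also have "\<dots> = pD D * (f * h)" unfolding h(2) by (simp only: mult_ac)
  finally have eq: "pD D * (b * g) = pD D * (f * h)" .
  have bg: "b * g = f * h"
    by (rule Af_cancel[OF pD_Af _ _ pD_nz eq]) (simp_all add: Af_mult bA fA t h)
  define c where "c = apf h P"
  \<comment> \<open>By \<open>b * g = f * h\<close>; both coefficients vanish at \<open>P\<close>,
    as \<open>g\<close> has value 1 there and \<open>c\<close> is the value of
    \<open>h\<close>.\<close>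
  have "b - sc c f = (h - cst c) * f + (cst 1 - g) * b"
  proof -
    have "cst 1 * b = b" "cst c * f = sc c f"
      using Af_cst_1[OF bA] Af_outside[OF fA] by (auto intro: pfun_eqI simp: at_cst)
    thus ?thesis using bg by (simp add: algebra_simps)
  qed
  moreover have "(h - cst c) \<in> MP P" "cst 1 - g \<in> MP P"
    using P t h by (simp_all add: MP_def Af_diff Af_cst at_cst c_def)
  hence "(h - cst c) * f + (cst 1 - g) * b \<in> ID (add_mset P D)"
    unfolding ID_add using f b by (intro pv.subspace_add[OF IM_subspace] IM_I)
  ultimately show ?thesis by metis
qed

end

section \<open>Riemann-Roch on the cubic\<close>

context cubic_coordinates
begin

definition Ln :: "nat \<Rightarrow> nat \<Rightarrow> 'a pfun set" where
  "Ln m k = {f. \<exists>a b. LL k a b \<and> f = XW m a b}"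

lemma Ln_subspace: "pv.subspace (Ln m k)"
proof (rule pv.subspaceI)
  have "LL k 0 0" "XW m 0 0 = 0" by (simp_all add: LL_def XW_eq_0_iff)
  thus "0 \<in> Ln m k" unfolding Ln_def by force
  fix f g assume "f \<in> Ln m k" "g \<in> Ln m k"
  thus "f + g \<in> Ln m k" unfolding Ln_def using XW_add LL_add by blast
next
  fix c f assume "f \<in> Ln m k"
  thus "sc c f \<in> Ln m k" unfolding Ln_def using XW_sc LL_smult by blast
qed

lemma Ln_Af: "Ln m k \<subseteq> Af"
  using XW_Af by (auto simp: Ln_def)

text \<open>\<open>Suc k\<close> enters \<open>Ln\<close> with exactly one new pole order at the point at infinity.\<close>

lemma Ln_codim_1:
  assumes "f \<in> Ln m (Suc k)" "f \<notin> Ln m k" "g \<in> Ln m (Suc k)"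
  shows "\<exists>c. g - sc c f \<in> Ln m k"
proof -
  obtain a b where f: "LL (Suc k) a b" "f = XW m a b" using assms(1) by (auto simp: Ln_def)
  obtain a' b' where g: "LL (Suc k) a' b'" "g = XW m a' b'" using assms(3) by (auto simp: Ln_def)
  have nL: "\<not> LL k a b" using assms(2) f(2) by (auto simp: Ln_def)
  have eq: "g - sc c f = XW m (a' - smult c a) (b' - smult c b)" for c
    by (simp add: f g XW_sc XW_diff)
  have red: "degree (u - smult (coeff u d / coeff w d) w) \<le> d - 1"
    if "degree u \<le> d" "degree w \<le> d" "coeff w d \<noteq> 0" for u w :: "'a poly" and d
  proof (rule degree_le, intro allI impI)
    fix e assume e: "e > d - 1"
    show "coeff (u - smult (coeff u d / coeff w d) w) e = 0"
    proof (cases "e = d")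
      case False
      hence "e > d" using e by simp
      thus ?thesis using that by (simp add: coeff_eq_0)
    qed (use that in simp)
  qed
  have "\<exists>c. LL k (a' - smult c a) (b' - smult c b)"
  proof (cases "even (Suc k)")
    case True
    then obtain d where d: "Suc k = 2 * d" by (elim evenE)
    have "degree a \<le> d" "degree a' \<le> d" using f g d by (auto simp: LL_def)
    have B: "u = 0 \<or> 2 * degree u + 3 \<le> k" if "u = 0 \<or> 2 * degree u + 3 \<le> Suc k" for u :: "'a poly"
    proof (cases "u = 0")
      case False
      have "2 * x + 3 \<le> k" if "2 * x + 3 \<le> Suc k" for x using that d by presburger
      thus ?thesis using that False by blast
    qed simp
    have bb: "b = 0 \<or> 2 * degree b + 3 \<le> k" "b' = 0 \<or> 2 * degree b' + 3 \<le> k"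
      using B f g by (auto simp: LL_def)
    hence "\<not> 2 * degree a \<le> k" using nL by (simp add: LL_def)
    hence "degree a = d" using \<open>degree a \<le> d\<close> d by linarith
    hence "coeff a d \<noteq> 0" using d by auto
    define c where "c = coeff a' d / coeff a d"
    have "degree (a' - smult c a) \<le> d - 1"
      unfolding c_def by (rule red) (use \<open>degree a \<le> d\<close> \<open>degree a' \<le> d\<close> \<open>coeff a d \<noteq> 0\<close> in auto)
    hence "2 * degree (a' - smult c a) \<le> k" using d by linarith
    moreover have "LL k 0 (b' - smult c b)"
      using LL_add[of k 0 b' 0 "smult (- c) b"] bb by (auto simp: LL_def)
    ultimately show ?thesis by (auto simp: LL_def intro!: exI[of _ c])
  next
    case False
    then obtain e where e: "Suc k = 2 * e + 1" by (elim oddE)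
    have aa: "2 * degree a \<le> k" "2 * degree a' \<le> k" using f g e by (auto simp: LL_def)
    hence nb: "b \<noteq> 0" "\<not> 2 * degree b + 3 \<le> k" using nL by (auto simp: LL_def)
    hence db: "2 * degree b + 3 = Suc k" using f by (auto simp: LL_def)
    define d where "d = degree b"
    have "coeff b d \<noteq> 0" using nb by (simp add: d_def)
    have "degree b' \<le> d" using g db by (cases "b' = 0") (auto simp: LL_def d_def)
    define c where "c = coeff b' d / coeff b d"
    have "degree (b' - smult c b) \<le> d - 1"
      unfolding c_def by (rule red) (use \<open>degree b' \<le> d\<close> \<open>coeff b d \<noteq> 0\<close> in \<open>auto simp: d_def\<close>)
    moreover have "b' - smult c b = 0" if "d = 0"
    proof -
      have "coeff (b' - smult c b) 0 = 0" using \<open>coeff b d \<noteq> 0\<close> by (simp add: c_def that)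
      moreover have "degree (b' - smult c b) = 0" using calculation that \<open>degree (b' - smult c b) \<le> d - 1\<close> by simp
      ultimately show ?thesis by (metis degree_eq_zeroE coeff_pCons_0 pCons_0_0)
    qed
    ultimately have "b' - smult c b = 0 \<or> 2 * degree (b' - smult c b) + 3 \<le> k"
      using db d_def by (cases "d = 0") auto
    moreover have "2 * degree (a' - smult c a) \<le> k"
      using LL_add[of k a' 0 "smult (- c) a" 0] aa by (auto simp: LL_def)
    ultimately show ?thesis by (auto simp: LL_def intro!: exI[of _ c])
  qed
  thus ?thesis using eq by (auto simp: Ln_def)
qed

text \<open>Norm degrees are even, or odd and at least 3. The gap at 1 is where genus one
  enters.\<close>

lemma no_degree_1:
  assumes "LL k a b" "degree (norm_poly a b) \<le> 1"
  shows "\<exists>c. a = [:c:] \<and> b = 0"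
proof (cases "a = 0 \<and> b = 0")
  case True
  thus ?thesis by (auto intro!: exI[of _ 0])
next
  case False
  hence "max (2 * degree a) (if b = 0 then 0 else 2 * degree b + 3) \<le> 1"
    using assms norm_poly_degree(2)[of a b] by auto
  hence "degree a = 0" "b = 0" by (auto split: if_splits)
  thus ?thesis by (metis degree_eq_zeroE)
qed

text \<open>The degree one case: after subtracting the zeros, one pole order remains. If
  \<open>f\<close> lies already in \<open>Ln m k\<close>, its norm has exactly the zeros of
  \<open>D\<close>, so \<open>f\<close> generates \<open>ID D\<close> and the quotient of
  \<open>g\<close> by \<open>f\<close> has norm degree at most 1; by \<open>no_degree_1\<close> it
  is constant.\<close>

lemma dim_one:
  assumes D: "set_mset D \<subseteq> C" and n: "size D = k"
    and f: "f \<in> Ln m (Suc k) \<inter> ID D" and g: "g \<in> Ln m (Suc k) \<inter> ID D" and f0: "f \<noteq> 0"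
  shows "\<exists>c. g = sc c f"
proof -
  have key: "\<exists>c. g = sc c f" if f: "f \<in> Ln m k \<inter> ID D" "f \<noteq> 0" and g: "g \<in> Ln m (Suc k) \<inter> ID D" for f g
  proof -
    obtain a b where ab: "LL k a b" "f = XW m a b" using f by (auto simp: Ln_def)
    obtain a' b' where ab': "LL (Suc k) a' b'" "g = XW m a' b'" using g by (auto simp: Ln_def)
    have nz: "a \<noteq> 0 \<or> b \<noteq> 0" using f(2) ab(2) by (auto simp: XW_eq_0_iff)
    have "pt D dvd norm_poly a b" using pt_dvd_norm[OF D, of m a b] f ab by simp
    hence "k \<le> degree (norm_poly a b)"
      using dvd_imp_degree_le norm_poly_degree(1)[OF nz] degree_pt[OF D] n by metis
    moreover have "degree (norm_poly a b) \<le> k"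
      using norm_poly_degree(2)[OF nz] ab(1) by (auto simp: LL_def)
    ultimately have dk: "degree (norm_poly a b) = k" by simp
    obtain h where h: "h \<in> Af" "g = f * h"
      using generator_dvd[OF D _ nz, of m g] f g dk n ab by auto
    obtain w where w: "norm_poly a b = pt D * w" using \<open>pt D dvd norm_poly a b\<close> by (elim dvdE)
    have "w \<noteq> 0" using norm_poly_degree(1)[OF nz] w by auto
    hence "degree w = 0" using dk degree_pt[OF D] pt_props(2)[of D] n unfolding w by (simp add: degree_mult_eq)
    then obtain c where c: "w = [:c:]" by (rule degree_eq_zeroE)
    have c0: "c \<noteq> 0" using \<open>w \<noteq> 0\<close> c by auto
    define u v where "u = a' * a - b' * b * \<delta>" and "v = b' * a - a' * b"
    have gf: "g * cj f = XW (m + m) u v" unfolding ab ab' cj_XW XW_mult u_def v_def by (simp add: algebra_simps)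
    obtain r where "r \<in> Af" "g * cj f = pD D * r" using ID_mult_swm[OF D _ cj_ID] f g by blast
    hence "pt D dvd u" "pt D dvd v" using pt_dvd[of "m + m" u v D r] gf by auto
    then obtain u' v' where uv: "u = pt D * u'" "v = pt D * v'" by (elim dvdE)
    have "(f * cj f) * h = XW (m + m) u v" using gf h(2) by (simp add: mult_ac)
    moreover have "f * cj f = XW (m + m) (norm_poly a b) 0" unfolding ab by (simp add: XW_cj)
    moreover have "XW (m + m) (norm_poly a b) 0 * XW 0 (smult (1/c) u') (smult (1/c) v') = XW (m + m) u v"
      unfolding w c XW_mult uv using c0 by simp
    ultimately have "XW (m + m) (norm_poly a b) 0 * h = XW (m + m) (norm_poly a b) 0 * XW 0 (smult (1/c) u') (smult (1/c) v')"
      by (simp only:)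
    moreover have "XW (m + m) (norm_poly a b) 0 \<noteq> 0" using norm_poly_degree(1)[OF nz] by (simp add: XW_eq_0_iff)
    ultimately have hW: "h = XW 0 (smult (1/c) u') (smult (1/c) v')"
      using Af_cancel XW_Af h(1) by blast
    define p r where "p = smult (1/c) u'" and "r = smult (1/c) v'"
    have "g = XW m (a * p + b * r * \<delta>) (a * r + b * p)"
      unfolding h(2) hW ab(2) XW_mult p_def r_def by simp
    hence "a' = a * p + b * r * \<delta>" "b' = a * r + b * p" using ab'(2) by (simp_all add: XW_eq_iff)
    hence mul: "norm_poly a' b' = norm_poly a b * norm_poly p r" by (simp add: algebra_simps)
    have "degree (norm_poly p r) \<le> 1"
    proof (cases "p = 0 \<and> r = 0")
      case False
      hence nzpr: "p \<noteq> 0 \<or> r \<noteq> 0" by blast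
      hence "norm_poly a' b' \<noteq> 0" unfolding mul using norm_poly_degree(1) nz by simp
      hence nz': "a' \<noteq> 0 \<or> b' \<noteq> 0" by auto
      have "degree (norm_poly a' b') \<le> Suc k" using norm_poly_degree(2)[OF nz'] ab'(1) by (auto simp: LL_def)
      thus ?thesis unfolding mul using norm_poly_degree(1)[OF nz] norm_poly_degree(1)[OF nzpr] dk
        by (simp add: degree_mult_eq)
    qed simp
    moreover have "LL (2 * degree p + 2 * degree r + 3) p r" by (simp add: LL_def)
    ultimately obtain d where "p = [:d:]" "r = 0" using no_degree_1 by blast
    hence "g = sc d f" unfolding h(2) hW p_def[symmetric] r_def[symmetric] ab(2) by (simp add: XW_mult XW_sc)
    thus ?thesis by blast
  qed
  show ?thesis
  proof (cases "f \<in> Ln m k")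
    case True
    thus ?thesis using key f f0 g by blast
  next
    case False
    \<comment> \<open>A nonzero difference would, by the first case with it in the role of
      \<open>f\<close>, force \<open>f\<close> into \<open>Ln m k\<close>.\<close>
    obtain c where c: "g - sc c f \<in> Ln m k" using Ln_codim_1 False f g by blast
    have I: "g - sc c f \<in> ID D"
      using f g pv.subspace_diff[OF ID_subspace] pv.subspace_scale[OF ID_subspace] by blast
    show ?thesis
    proof (cases "g - sc c f = 0")
      case True
      thus ?thesis by (metis eq_iff_diff_eq_0)
    next
      case False
      then obtain d where d: "f = sc d (g - sc c f)" using key[of "g - sc c f" f] c I f by blast
      have "sc d (g - sc c f) \<in> Ln m k" using c pv.subspace_scale[OF Ln_subspace] by blast
      thus ?thesis using d \<open>f \<notin> Ln m k\<close> by metis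
    qed
  qed
qed

end

context vector_space
begin

lemma finite_basis:
  assumes "V \<subseteq> span F" "finite F"
  obtains B where "B \<subseteq> V" "independent B" "V \<subseteq> span B" "card B = dim V" "finite B"
proof -
  obtain B where B: "B \<subseteq> V" "independent B" "V \<subseteq> span B" "card B = dim V" by (rule basis_exists)
  have "finite B" using independent_span_bound[OF assms(2) B(2)] B(1) assms(1) by blast
  thus thesis using that B by blast
qed

lemma dim_codim_1:
  assumes "V' \<subseteq> V" "V \<subseteq> span F" "finite F"
    and "\<And>f g. f \<in> V \<Longrightarrow> f \<notin> V' \<Longrightarrow> g \<in> V \<Longrightarrow> \<exists>c. g - scale c f \<in> V'"
  shows "dim V \<le> Suc (dim V')"
proof (cases "V = V'")
  case False
  then obtain f where f: "f \<in> V" "f \<notin> V'" using assms(1) by blast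
  have "V' \<subseteq> span F" using assms by blast
  then obtain B where B: "V' \<subseteq> span B" "card B = dim V'" "finite B" using finite_basis[OF _ assms(3)] by metis
  have "V \<subseteq> span (insert f B)"
  proof
    fix g assume "g \<in> V"
    then obtain c where "g - scale c f \<in> V'" using assms(4) f by blast
    hence "g - scale c f \<in> span (insert f B)" using B(1) span_mono[of B "insert f B"] by blast
    moreover have "scale c f \<in> span (insert f B)" by (intro span_scale span_base) simp
    ultimately have "(g - scale c f) + scale c f \<in> span (insert f B)" by (rule span_add)
    thus "g \<in> span (insert f B)" by simp
  qed
  hence "dim V \<le> card (insert f B)" using B(3) by (intro dim_le_card) auto
  also have "\<dots> \<le> Suc (card B)" by (rule card_insert_le_m1) simp_all
  finally show ?thesis using B by simp
qed simp

lemma dim_strict_finite: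
  assumes "V \<subseteq> W" "f \<in> W" "f \<notin> V" "subspace V" "W \<subseteq> span F" "finite F"
  shows "dim V < dim W"
proof -
  have "V \<subseteq> span F" using assms by blast
  then obtain B where B: "B \<subseteq> V" "independent B" "V \<subseteq> span B" "card B = dim V" "finite B"
    using finite_basis[OF _ assms(6)] by metis
  obtain B' where B': "W \<subseteq> span B'" "card B' = dim W" "finite B'" using finite_basis[OF assms(5,6)] by metis
  have "span B \<subseteq> V" using B(1) assms(4) by (rule span_minimal)
  hence "f \<notin> span B" using assms(3) by blast
  hence "independent (insert f B)" "f \<notin> B" using B(2) span_base by (auto simp: independent_insert)
  moreover have "insert f B \<subseteq> span B'" using B(1) assms(1,2) B'(1) by blast
  ultimately have "card (insert f B) \<le> card B'" using independent_span_bound[OF B'(3)] by blast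
  thus ?thesis using B B' \<open>f \<notin> B\<close> by simp
qed

end

context cubic_coordinates
begin

lemma C_nonempty: "\<exists>P. P \<in> C"
proof -
  obtain \<omega> where "\<omega> ^ 2 = poly \<delta> 1" using nth_root_exists[of 2 "poly \<delta> 1"] by auto
  thus ?thesis using point_exists[of 1 \<omega>] by (auto simp: power2_eq_square)
qed

lemma Ln_mono_Suc: "Ln m k \<subseteq> Ln m (Suc k)"
proof
  fix f assume "f \<in> Ln m k"
  then obtain a b where "LL k a b" "f = XW m a b" by (auto simp: Ln_def)
  moreover from this have "LL (Suc k) a b" by (auto simp: LL_def)
  ultimately show "f \<in> Ln m (Suc k)" by (auto simp: Ln_def)
qed

lemma Ln_finite: "\<exists>F. finite F \<and> Ln m k \<subseteq> pv.span F"
proof (induction k)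
  case 0
  have "f \<in> pv.span {XW m 1 0}" if f0: "f \<in> Ln m 0" for f
  proof -
    obtain a where a: "degree a = 0" "f = XW m a 0" using f0 by (auto simp: Ln_def LL_def)
    then obtain c where "a = [:c:]" by (metis degree_eq_zeroE)
    hence "f = sc c (XW m 1 0)" using a by (simp add: XW_sc)
    thus ?thesis by (simp add: pv.span_scale pv.span_base)
  qed
  thus ?case by (intro exI[of _ "{XW m 1 0}"]) auto
next
  case (Suc k)
  then obtain F where F: "finite F" "Ln m k \<subseteq> pv.span F" by blast
  show ?case
  proof (cases "Ln m (Suc k) \<subseteq> Ln m k")
    case False
    then obtain f where f: "f \<in> Ln m (Suc k)" "f \<notin> Ln m k" by blast
    have "Ln m (Suc k) \<subseteq> pv.span (insert f F)"
    proof
      fix g assume "g \<in> Ln m (Suc k)"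
      then obtain c where "g - sc c f \<in> Ln m k" using Ln_codim_1 f by blast
      hence "g - sc c f \<in> pv.span (insert f F)" using F(2) pv.span_mono[of F "insert f F"] by blast
      moreover have "sc c f \<in> pv.span (insert f F)" by (intro pv.span_scale pv.span_base) simp
      ultimately have "(g - sc c f) + sc c f \<in> pv.span (insert f F)" by (rule pv.span_add)
      thus "g \<in> pv.span (insert f F)" by simp
    qed
    thus ?thesis using F(1) by blast
  qed (use F in blast)
qed

text \<open>Every pole order from 2 on occurs, as that of a power of t or of a power of t times
  w.\<close>

lemma dim_Ln_ge: "Suc k \<le> pv.dim (Ln m (Suc k))"
proof (induction k)
  case 0
  obtain F where F: "finite F" "Ln m 1 \<subseteq> pv.span F" using Ln_finite by blast
  have 1: "XW m 1 0 \<in> Ln m 1" unfolding Ln_def by (auto simp: LL_def intro: exI[of _ 1])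
  have 2: "XW m 1 0 \<notin> {0 :: 'a pfun}" by (simp add: XW_eq_0_iff)
  have "pv.dim {0 :: 'a pfun} < pv.dim (Ln m 1)"
    by (rule pv.dim_strict_finite[OF _ 1 2 _ F(2,1)]) (use pv.subspace_0[OF Ln_subspace] in auto)
  thus ?case by simp
next
  case (Suc k)
  obtain F where F: "finite F" "Ln m (Suc (Suc k)) \<subseteq> pv.span F" using Ln_finite by blast
  have "\<exists>h. h \<in> Ln m (Suc (Suc k)) \<and> h \<notin> Ln m (Suc k)"
  proof (cases "even k")
    case True
    then obtain d where d: "k = 2 * d" by (elim evenE)
    have "LL (Suc (Suc k)) (monom 1 (Suc d)) 0" by (simp add: LL_def degree_monom_eq d)
    moreover have "\<not> LL (Suc k) (monom 1 (Suc d)) 0" by (simp add: LL_def degree_monom_eq d)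
    ultimately show ?thesis unfolding Ln_def
      by (intro exI[of _ "XW m (monom 1 (Suc d)) 0"]) (auto simp: XW_eq_iff)
  next
    case False
    then obtain d where d: "k = 2 * d + 1" by (elim oddE)
    have "LL (Suc (Suc k)) 0 (monom 1 d)" by (simp add: LL_def degree_monom_eq d)
    moreover have "\<not> LL (Suc k) 0 (monom 1 d)" by (simp add: LL_def degree_monom_eq d monom_eq_0_iff)
    ultimately show ?thesis unfolding Ln_def
      by (intro exI[of _ "XW m 0 (monom 1 d)"]) (auto simp: XW_eq_iff)
  qed
  then obtain h where h: "h \<in> Ln m (Suc (Suc k))" "h \<notin> Ln m (Suc k)" by blast
  have "pv.dim (Ln m (Suc k)) < pv.dim (Ln m (Suc (Suc k)))"
    by (rule pv.dim_strict_finite[OF Ln_mono_Suc h Ln_subspace F(2,1)])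
  thus ?case using Suc by simp
qed

lemma dim_Int_ID_ge:
  assumes D: "set_mset D \<subseteq> C" and V: "V \<subseteq> pv.span F" "finite F" "pv.subspace V" and E: "set_mset E \<subseteq> C"
  shows "pv.dim (V \<inter> ID D) \<le> pv.dim (V \<inter> ID (D + E)) + size E"
  using E
proof (induction E)
  case (add P E)
  have DE: "set_mset (D + E) \<subseteq> C" using add.prems D by auto
  have P: "P \<in> C" using add.prems by simp
  have "pv.dim (V \<inter> ID (D + E)) \<le> Suc (pv.dim (V \<inter> ID (D + add_mset P E)))"
  proof (rule pv.dim_codim_1[of _ _ F])
    show "V \<inter> ID (D + add_mset P E) \<subseteq> V \<inter> ID (D + E)" using ID_add_subset[of P "D + E"] by auto
    fix f g assume fg: "f \<in> V \<inter> ID (D + E)" "f \<notin> V \<inter> ID (D + add_mset P E)" "g \<in> V \<inter> ID (D + E)"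
    then obtain c where c: "g - sc c f \<in> ID (add_mset P (D + E))"
      using ID_codim_1[OF DE _ P, of f g] by auto
    have "g - sc c f \<in> V" using fg pv.subspace_diff[OF V(3)] pv.subspace_scale[OF V(3)] by blast
    thus "\<exists>c. g - sc c f \<in> V \<inter> ID (D + add_mset P E)" using c by auto
  qed (use V in auto)
  thus ?case using add by simp
qed simp

text \<open>Enlarge \<open>D\<close> to degree \<open>k - 1\<close>. Each new point lowers the
  dimension by at most one, and at the end \<open>dim_one\<close> leaves dimension at most
  one.\<close>

lemma dim_Ln_ID_le:
  assumes D: "set_mset D \<subseteq> C" and k: "size D < k"
  shows "pv.dim (Ln m k \<inter> ID D) + size D \<le> k"
proof -
  obtain P where P: "P \<in> C" using C_nonempty by blast
  obtain F where F: "finite F" "Ln m k \<subseteq> pv.span F" using Ln_finite by blast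
  define r where "r = k - 1 - size D"
  define E where "E = D + replicate_mset r P"
  have E: "set_mset E \<subseteq> C" "Suc (size E) = k" using D P k by (auto simp: E_def r_def)
  have "set_mset (replicate_mset r P) \<subseteq> C" using P by simp
  hence "pv.dim (Ln m k \<inter> ID D) \<le> pv.dim (Ln m k \<inter> ID E) + r"
    using dim_Int_ID_ge[OF D F(2,1) Ln_subspace, of "replicate_mset r P"] by (simp add: E_def)
  moreover have "pv.dim (Ln m k \<inter> ID E) \<le> 1"
  proof (cases "Ln m k \<inter> ID E \<subseteq> {0}")
    case True
    hence "pv.dim (Ln m k \<inter> ID E) \<le> card ({} :: 'a pfun set)" by (intro pv.dim_le_card) auto
    thus ?thesis by simp
  next
    case False
    then obtain f where f: "f \<in> Ln m k \<inter> ID E" "f \<noteq> 0" by blast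
    have "g \<in> pv.span {f}" if "g \<in> Ln m k \<inter> ID E" for g
      using dim_one[OF E(1) refl, of f m g] f that E(2) pv.span_scale[OF pv.span_base[of f "{f}"]] by auto
    hence "pv.dim (Ln m k \<inter> ID E) \<le> card {f}" by (intro pv.dim_le_card) auto
    thus ?thesis by simp
  qed
  ultimately show ?thesis using k by (simp add: r_def)
qed

lemma am_eq_Ln: "{f. am m f} = Ln m (3 * m)"
  using am_iff_XW by (auto simp: Ln_def)

text \<open>The lower bound is that each point imposes at most one condition;
  \<open>dim_Ln_ID_le\<close> is the upper bound. On genus one the two meet as soon as the degree
  \<open>3 * m - size D\<close> is positive.\<close>

theorem riemann_roch:
  assumes D: "set_mset D \<subseteq> C" and m: "size D < 3 * m"
  shows "pv.dim ({f. am m f} \<inter> ID D) + size D = 3 * m"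
proof -
  obtain F where F: "finite F" "Ln m (3 * m) \<subseteq> pv.span F" using Ln_finite by blast
  have "pv.dim (Ln m (3 * m) \<inter> ID {#}) \<le> pv.dim (Ln m (3 * m) \<inter> ID D) + size D"
    using dim_Int_ID_ge[OF _ F(2,1) Ln_subspace D, of "{#}"] by simp
  moreover have "Ln m (3 * m) \<inter> ID {#} = Ln m (3 * m)" using Ln_Af by (auto simp: ID_empty)
  moreover have "3 * m \<le> pv.dim (Ln m (3 * m))" using dim_Ln_ge[of "3 * m - 1" m] m by simp
  ultimately show ?thesis using dim_Ln_ID_le[OF D m, of m] unfolding am_eq_Ln by simp
qed

end

section \<open>Normalised functions and their divisors\<close>

context twisted_cubic
begin

definition ee :: "'k pfun" where
  "ee = co 1 * co 2 + co 2 * co 3 + co 1 * co 3"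

text \<open>\<open>ee\<close> is invariant under permutations of the coordinates and has a pole of
  order 2 at each point at infinity. Functions in \<open>Mo m\<close> share the leading terms of
  \<open>ee ^ m\<close> in all three branches, the condition of being trivial modulo the points at
  infinity.\<close>

definition Mo :: "nat \<Rightarrow> 'k pfun set" where
  "Mo m = {f. \<exists>g. am (2 * m - 1) g \<and> f = ee ^ m + g}"

end

context cubic_coordinates
begin

text \<open>From v i (s - v i) + n / v i, the second symmetric function in terms of
  \<open>v i\<close> alone.\<close>

definition \<theta> :: "'a poly" where "\<theta> = [:- 1, s, 0, n:]"

lemma ee_eq: "ee = XW 2 \<theta> 0"
proof (rule pfun_eqI)
  fix v
  show "apf ee v = apf (XW 2 \<theta> 0) v"
  proof (cases "v \<in> C")
    case True
    have nz: "v i \<noteq> 0" by (rule C_nz[OF True])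
    have sum: "v i + v j + v l = s" and pr: "v i * v j * v l = n" using True by (auto simp: C_iff)
    have "v 1 * v 2 + v 2 * v 3 + v 1 * v 3 = v i * v j + v j * v l + v i * v l"
      using ij il jl exhaust_3[of i] exhaust_3[of j] exhaust_3[of l] by (elim disjE) (simp_all add: ac_simps)
    also have "\<dots> = v i * (s - v i) + n / v i"
      unfolding sum[symmetric] pr[symmetric] using nz by (simp add: field_simps)
    also have "\<dots> = (v i)\<^sup>2 * poly \<theta> (1 / v i)"
      using nz by (simp add: \<theta>_def field_simps power2_eq_square)
    finally show ?thesis using True by (simp add: ee_def at_co apf_XW)
  qed (simp add: ee_def at_co apf_XW_out)
qed

lemma ee_power: "k > 0 \<Longrightarrow> ee ^ k = XW (2 * k) (\<theta> ^ k) 0"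
proof (induction k rule: nat_induct_non_zero)
  case (Suc k)
  thus ?case by (simp add: XW_mult ee_eq)
qed (simp add: ee_eq)

text \<open>Constant term and leading coefficient of the norm carry the leading terms at infinity,
  at t = 0 and at the pole of t; the normalisation fixes both.\<close>

lemma Mo_XW:
  assumes m: "m > 0" and f: "f \<in> Mo m"
  obtains a b where "f = XW (2 * m) a b" "a \<noteq> 0" "degree (norm_poly a b) = 6 * m"
    "poly (norm_poly a b) 0 = 1" "lead_coeff (norm_poly a b) = n ^ (2 * m)"
proof -
  obtain g where g: "am (2 * m - 1) g" "f = ee ^ m + g" using f by (auto simp: Mo_def)
  obtain a' b' where ab': "LL (3 * (2 * m - 1)) a' b'" "g = XW (2 * m - 1) a' b'" using am_imp_XW[OF g(1)] by blast
  define x where "x = [:0, 1 :: 'a:]"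
  \<comment> \<open>Writing the lower order part with the exponent \<open>2 * m\<close> produces a
    factor t, so it contributes nothing at t = 0.\<close>
  have "g = XW (2 * m - 1 + 1) (monom 1 1 * a') (monom 1 1 * b')" unfolding ab'(2) by (rule XW_shift)
  moreover have "2 * m - 1 + 1 = 2 * m" using m by simp
  moreover have "monom 1 1 = x" by (simp add: x_def monom_altdef)
  ultimately have g': "g = XW (2 * m) (x * a') (x * b')" by simp
  define a b where "a = \<theta> ^ m + x * a'" and "b = x * b'"
  have fab: "f = XW (2 * m) a b" unfolding g(2) ee_power[OF m] g' XW_add a_def b_def by simp
  have d\<theta>: "degree \<theta> = 3" "lead_coeff \<theta> = n" "\<theta> \<noteq> 0" using n_nz by (simp_all add: \<theta>_def)
  have l\<theta>m: "lead_coeff (\<theta> ^ m) = n ^ m" by (simp only: lead_coeff_power d\<theta>(2))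
  have d\<theta>m: "degree (\<theta> ^ m) = 3 * m" using degree_power_eq[OF d\<theta>(3), of m] d\<theta> by simp
  have "degree (x * a') \<le> 1 + degree a'" using degree_mult_le[of x a'] by (simp add: x_def)
  hence dxa: "degree (x * a') < 3 * m" using ab'(1) m by (auto simp: LL_def)
  have da: "degree a = 3 * m" unfolding a_def using dxa d\<theta>m by (subst degree_add_eq_left) auto
  have la: "lead_coeff a = n ^ m"
    unfolding da unfolding a_def using d\<theta>m l\<theta>m coeff_eq_0[OF dxa] by simp
  have a0: "a \<noteq> 0" using da m by auto
  have b': "b = 0 \<or> 2 * degree b + 3 < 6 * m"
  proof (cases "b' = 0")
    case False
    have "degree b \<le> 1 + degree b'" unfolding b_def using degree_mult_le[of x b'] by (simp add: x_def)
    thus ?thesis using ab'(1) False m by (auto simp: LL_def)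
  qed (simp add: b_def)
  have dN: "degree (norm_poly a b) = 6 * m"
    using norm_poly_degree(2)[of a b] a0 da b' by auto
  have "degree (b * b * \<delta>) < 6 * m"
  proof (cases "b = 0")
    case False
    thus ?thesis using b' degree_\<delta> by (simp add: degree_mult_eq)
  qed (use m in simp)
  hence "coeff (norm_poly a b) (6 * m) = coeff (a * a) (6 * m)" by (simp add: coeff_eq_0)
  also have "\<dots> = lead_coeff (a * a)" using da a0 by (simp add: degree_mult_eq)
  also have "\<dots> = n ^ (2 * m)" unfolding lead_coeff_mult la by (simp add: mult_2 power_add)
  finally have lN: "lead_coeff (norm_poly a b) = n ^ (2 * m)" unfolding dN .
  have "poly a 0 = (- 1) ^ m" "poly b 0 = 0" by (simp_all add: a_def b_def x_def \<theta>_def poly_power)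
  hence "poly (norm_poly a b) 0 = 1" by (simp flip: power_mult_distrib)
  thus thesis using that[OF fab a0 dN _ lN] by blast
qed

lemma Mo_Af: "m > 0 \<Longrightarrow> f \<in> Mo m \<Longrightarrow> f \<in> Af"
  using Mo_XW XW_Af by metis

lemma swm_C: "set_mset D \<subseteq> C \<Longrightarrow> set_mset (swm D) \<subseteq> C"
  by (auto simp: swm_def)

lemma swm_swm: "swm (swm D) = D"
  by (simp add: swm_def image_mset.compositionality o_def)

text \<open>A root of the cofactor of \<open>pt E\<close> in the norm lies under points
  \<open>P\<close> and \<open>sw P\<close>. If \<open>f\<close> had a further zero at neither, the
  local quotients at both would combine to a function nonzero at \<open>P\<close> but divisible by
  the cofactor.\<close>

lemma extend_divisor:
  assumes m: "m > 0" and f: "f \<in> Mo m" "f \<in> ID E" and E: "set_mset E \<subseteq> C"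
  shows "size E \<le> 6 * m" "size E < 6 * m \<Longrightarrow> \<exists>P\<in>C. f \<in> ID (add_mset P E)"
proof -
  obtain a b where ab: "f = XW (2 * m) a b" "a \<noteq> 0" "degree (norm_poly a b) = 6 * m"
    "poly (norm_poly a b) 0 = 1" "lead_coeff (norm_poly a b) = n ^ (2 * m)" by (rule Mo_XW[OF m f(1)])
  obtain w where w: "norm_poly a b = pt E * w" using pt_dvd_norm[OF E, of "2 * m" a b] f(2) ab(1) by (auto elim: dvdE)
  have Nnz: "norm_poly a b \<noteq> 0" using norm_poly_degree(1) ab(2) by blast
  hence w0: "w \<noteq> 0" using w by auto
  have deg: "size E + degree w = 6 * m"
    using ab(3) w0 pt_props(2)[of E] degree_pt[OF E] unfolding w by (simp add: degree_mult_eq)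
  thus "size E \<le> 6 * m" by simp
  assume "size E < 6 * m"
  hence "degree w > 0" using deg by simp
  then obtain t where t: "poly w t = 0" using alg_closed_imp_poly_has_root by blast
  have "t \<noteq> 0" using t ab(4) unfolding w by auto
  obtain \<omega> where "\<omega> ^ 2 = poly \<delta> t" using nth_root_exists[of 2 "poly \<delta> t"] by auto
  then obtain P where P: "P \<in> C" "P i = 1 / t" using point_exists[OF \<open>t \<noteq> 0\<close>, of \<omega>] by (auto simp: power2_eq_square)
  show "\<exists>P\<in>C. f \<in> ID (add_mset P E)"
  proof (rule ccontr)
    assume neg: "\<not> ?thesis"
    hence n1: "f \<notin> ID (add_mset P E)" "f \<notin> ID (add_mset (sw P) E)" using P by auto
    obtain u g where u: "u \<in> ID (swm E)" "g \<in> Af" "pD E * g = f * u" "apf g P = 1"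
      using local_generator[OF E f(2) P(1) n1(1)] by blast
    obtain u' g' where u': "u' \<in> ID (swm E)" "g' \<in> Af" "pD E * g' = f * u'" "apf g' (sw P) = 1"
      using local_generator[OF E f(2) _ n1(2)] P(1) by auto
    have cu: "cj u' \<in> ID E" using cj_ID[OF u'(1)] by (simp add: swm_swm)
    obtain r where r: "r \<in> Af" "cj u' * u = pD E * r" using ID_mult_swm[OF E cu u(1)] by blast
    have cjp: "cj (pD E) = pD E" by (simp add: pD_def cj_XW)
    define k where "k = size E"
    define W where "W = XW (2 * m + 2 * m) w 0"
    have N: "XW k 1 0 * (f * cj f) = pD E * W"
      unfolding ab(1) XW_cj w by (simp add: XW_mult pD_def k_def W_def)
    \<comment> \<open>The local equation at \<open>P\<close> times the conjugate of the one at
      \<open>sw P\<close>; then \<open>f * cj f\<close> is replaced by the norm.\<close>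
    have "pD E * (pD E * (XW k 1 0 * (g * cj g'))) = XW k 1 0 * ((pD E * g) * cj (pD E * g'))"
      unfolding cj_mult cjp by (simp only: mult_ac)
    also have "\<dots> = (XW k 1 0 * (f * cj f)) * (cj u' * u)"
      unfolding u(3) u'(3) cj_mult by (simp only: mult_ac)
    also have "\<dots> = pD E * (pD E * (W * r))" unfolding N r(2) by (simp only: mult_ac)
    finally have e2: "pD E * (pD E * (XW k 1 0 * (g * cj g'))) = pD E * (pD E * (W * r))" .
    have mem: "XW k 1 0 * (g * cj g') \<in> Af" "W * r \<in> Af"
      using u u' r by (simp_all add: W_def Af_mult XW_Af cj_Af)
    have e1: "pD E * (XW k 1 0 * (g * cj g')) = pD E * (W * r)"
      by (rule Af_cancel[OF pD_Af _ _ pD_nz e2]) (simp_all add: Af_mult pD_Af mem)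
    have "XW k 1 0 * (g * cj g') = W * r" by (rule Af_cancel[OF pD_Af mem pD_nz e1])
    hence "apf (XW k 1 0 * (g * cj g')) P = apf (W * r) P" by simp
    hence "P i ^ k = 0" using P t \<open>t \<noteq> 0\<close> u(4) u'(4) by (simp add: apf_XW W_def)
    thus False using C_nz[OF P(1)] by simp
  qed
qed

lemma divisor_exists:
  assumes m: "m > 0" and f: "f \<in> Mo m" "f \<in> ID E" and E: "set_mset E \<subseteq> C"
  shows "\<exists>D. E \<subseteq># D \<and> set_mset D \<subseteq> C \<and> size D = 6 * m \<and> f \<in> ID D"
  using f(2) E
proof (induction "6 * m - size E" arbitrary: E)
  case 0
  hence "size E = 6 * m" using extend_divisor(1)[OF m f(1)] by fastforce
  thus ?case using 0 by blast
next
  case (Suc k)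
  hence "size E < 6 * m" by simp
  then obtain P where P: "P \<in> C" "f \<in> ID (add_mset P E)" using extend_divisor(2)[OF m f(1) Suc.prems] by blast
  have "\<exists>D. add_mset P E \<subseteq># D \<and> set_mset D \<subseteq> C \<and> size D = 6 * m \<and> f \<in> ID D"
    by (rule Suc.hyps(1)) (use P Suc in auto)
  thus ?case by (meson mset_subset_eq_insertD subset_mset.less_imp_le)
qed

text \<open>Cancellation of a common point: the conjugate maximal ideal turns \<open>MP P\<close>
  into the principal ideal of \<open>lin i P\<close>, which is not a zero divisor.\<close>

lemma ID_inj:
  assumes "ID D = ID E" "set_mset D \<subseteq> C" "set_mset E \<subseteq> C"
  shows "D = E"
  using assms
proof (induction D arbitrary: E)
  case empty
  show ?case
  proof (rule ccontr)
    assume "{#} \<noteq> E"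
    then obtain P where P: "P \<in># E" by (metis multiset_nonemptyE)
    hence "cst 1 \<in> MP P" using ID_MP[OF P] empty.prems(1) Af_cst by (auto simp: ID_empty)
    thus False using P empty.prems(3) by (auto simp: MP_def at_cst)
  qed
next
  case (add P D)
  have P: "P \<in> C" using add.prems by simp
  have "ID E \<subseteq> MP P" using ID_MP[of P "add_mset P D"] add.prems by simp
  hence "P \<in># E" by (rule prime_ID[OF _ P add.prems(3)])
  then obtain F where F: "E = add_mset P F" by (rule mset_add)
  have sub: "ID D \<subseteq> ID F" if eq: "ID (add_mset P D) = ID (add_mset P F)" for D F
  proof
    fix f assume f: "f \<in> ID D"
    have "lin i P * f \<in> {lin i P * h |h. h \<in> ID F}"
    proof (rule span_mult_in_subspace[OF _ pv.span_base[of f "{f}"] mult_subspace[OF ID_subspace]])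
      show "lin i P \<in> pv.span {a * b |a b. a \<in> MP P \<and> b \<in> MP (sw P)}" using lin_in_IM[OF P] by (simp add: IM_def)
      fix x y assume "x \<in> {a * b |a b. a \<in> MP P \<and> b \<in> MP (sw P)}" "y \<in> {f}"
      then obtain a b where ab: "x = a * b" "y = f" "a \<in> MP P" "b \<in> MP (sw P)" by blast
      have "a * f \<in> ID (add_mset P D)" unfolding ID_add using ab f by (intro IM_I)
      hence "a * f \<in> ID (add_mset P F)" by (simp only: eq)
      hence af: "a * f \<in> pv.span {a * b |a b. a \<in> MP P \<and> b \<in> ID F}" by (simp add: ID_add IM_def)
      have "b * (a * f) \<in> {lin i P * h |h. h \<in> ID F}"
      proof (rule span_mult_in_subspace[OF pv.span_base[of b "{b}"] af mult_subspace[OF ID_subspace]])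
        fix b' y assume "b' \<in> {b}" "y \<in> {a * b |a b. a \<in> MP P \<and> b \<in> ID F}"
        then obtain c d where cd: "b' = b" "y = c * d" "c \<in> MP P" "d \<in> ID F" by blast
        obtain h where h: "h \<in> Af" "c * b = lin i P * h" using MP_mult[OF P cd(3) ab(4)] by blast
        have "b' * y = (c * b) * d" unfolding cd by (simp only: mult_ac)
        also have "\<dots> = lin i P * (d * h)" unfolding h by (simp only: mult_ac)
        finally show "b' * y \<in> {lin i P * h |h. h \<in> ID F}" using ID_ideal[OF h(1) cd(4)] by blast
      qed simp
      moreover have "x * y = b * (a * f)" unfolding ab by (simp only: mult_ac)
      ultimately show "x * y \<in> {lin i P * h |h. h \<in> ID F}" by (simp only:)
    qed simp
    then obtain h where h: "lin i P * f = lin i P * h" "h \<in> ID F" by blast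
    have "lin i P = pD {#P#}" using pD_add[OF P, of "{#}"] by (simp add: pD_empty) (metis Af_cst_1 lin_Af mult.commute)
    hence "lin i P \<noteq> 0" using pD_nz by metis
    hence "f = h" using Af_cancel[OF lin_Af ID_Af[OF f] ID_Af[OF h(2)] _ h(1)] by blast
    thus "f \<in> ID F" using h(2) by simp
  qed
  have "ID D = ID F" using sub[of D F] sub[of F D] add.prems(1) F by auto
  hence "D = F" using add.IH add.prems F by auto
  thus ?case by (simp add: F)
qed

text \<open>By \<open>generator_dvd\<close> the function generates the ideal of either divisor, so
  the ideals agree.\<close>

lemma divisor_unique:
  assumes m: "m > 0" and f: "f \<in> Mo m" and D: "f \<in> ID D" "set_mset D \<subseteq> C" "size D = 6 * m"
    and E: "f \<in> ID E" "set_mset E \<subseteq> C" "size E = 6 * m"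
  shows "D = E"
proof -
  obtain a b where ab: "f = XW (2 * m) a b" "a \<noteq> 0" "degree (norm_poly a b) = 6 * m"
    "poly (norm_poly a b) 0 = 1" "lead_coeff (norm_poly a b) = n ^ (2 * m)" by (rule Mo_XW[OF m f])
  have sub: "ID D \<subseteq> ID E" if H: "f \<in> ID D" "set_mset D \<subseteq> C" "size D = 6 * m" "f \<in> ID E" for D E
  proof
    fix g assume "g \<in> ID D"
    then obtain h where "h \<in> Af" "g = f * h"
      using generator_dvd[OF H(2), of "2 * m" a b g] H ab by auto
    thus "g \<in> ID E" using ID_ideal H(4) by simp
  qed
  have "ID D = ID E" using sub[OF D E(1)] sub[OF E D(1)] by blast
  thus ?thesis using ID_inj D E by blast
qed

text \<open>Weil reciprocity for \<open>f\<close> and the coordinate \<open>i\<close>. Norm and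
  \<open>pt D\<close> agree because both have constant term 1; the leading coefficient of
  \<open>pt D\<close> is the product of the \<open>- P i\<close>, and \<open>6 * m\<close> is
  even.\<close>

lemma divisor_product:
  assumes m: "m > 0" and f: "f \<in> Mo m" and D: "f \<in> ID D" "set_mset D \<subseteq> C" "size D = 6 * m"
  shows "(\<Prod>P\<in>#D. P i) = n ^ (2 * m)"
proof -
  obtain a b where ab: "f = XW (2 * m) a b" "a \<noteq> 0" "degree (norm_poly a b) = 6 * m"
    "poly (norm_poly a b) 0 = 1" "lead_coeff (norm_poly a b) = n ^ (2 * m)" by (rule Mo_XW[OF m f])
  obtain w where w: "norm_poly a b = pt D * w" using pt_dvd_norm[OF D(2), of "2 * m" a b] D(1) ab(1) by (auto elim: dvdE)
  have "norm_poly a b \<noteq> 0" using norm_poly_degree(1) ab(2) by blast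
  hence "w \<noteq> 0" using w by auto
  hence "degree w = 0"
    using ab(3) pt_props(2)[of D] degree_pt[OF D(2)] D(3) unfolding w by (simp add: degree_mult_eq)
  then obtain c where c: "w = [:c:]" by (rule degree_eq_zeroE)
  have "c = 1" using ab(4) pt_props(1)[of D] unfolding w c by simp
  hence "lead_coeff (pt D) = n ^ (2 * m)" using ab(5) unfolding w c by (simp flip: one_pCons)
  moreover have "lead_coeff (pt D) = (\<Prod>P\<in>#D. - P i)" using D(2)
  proof (induction D)
    case (add P D)
    have "P i \<noteq> 0" using add.prems C_nz by auto
    thus ?case using add by (simp add: pt_add lead_coeff_mult del: mult_pCons_left)
  qed (simp add: pt_def)
  moreover have "(\<Prod>P\<in>#D. - P i) = (- 1) ^ size D * (\<Prod>P\<in>#D. P i)" by (induction D) (simp_all add: ac_simps)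
  ultimately show ?thesis using D(3) by (simp add: power_mult)
qed

end

section \<open>Galois descent\<close>

context twisted_cubic
begin

lemma Fr_surj: "\<exists>u. Fr u = v"
proof -
  have "q > 0" using q_gt_1 by simp
  hence "\<exists>y. y ^ q = x" for x :: 'k by (rule nth_root_exists)
  then obtain rt where rt: "\<And>x::'k. rt x ^ q = x" by metis
  have "Fr (\<lambda>b. rt (v (SOME a. \<rho> a = b))) = v"
  proof
    fix a
    have "(SOME c. \<rho> c = \<rho> a) = a" using bij by (auto simp: bij_def inj_eq)
    thus "Fr (\<lambda>b. rt (v (SOME a. \<rho> a = b))) a = v a" by (simp add: Fr_def rt)
  qed
  thus ?thesis by blast
qed

definition iF :: "(3 \<Rightarrow> 'k) \<Rightarrow> 3 \<Rightarrow> 'k" where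
  "iF v = (SOME u. Fr u = v)"

lemma Fr_iF [simp]: "Fr (iF v) = v"
  unfolding iF_def by (rule someI_ex[OF Fr_surj])

lemma iF_Fr [simp]: "iF (Fr u) = u"
  by (rule Fr_inj) simp

lemma Fr_C_iff: "Fr v \<in> C \<longleftrightarrow> v \<in> C"
proof
  assume "Fr v \<in> C"
  hence 1: "sum (Fr v) UNIV = s" "prod (Fr v) UNIV = n" by (auto simp: C_def)
  have "sum (Fr v) UNIV = (\<Sum>i\<in>UNIV. v (\<rho> i)) ^ q"
    using frob_sum[of "\<lambda>i. v (\<rho> i)" UNIV 1] by (simp add: Fr_def)
  also have "(\<Sum>i\<in>UNIV. v (\<rho> i)) = sum v UNIV" using bij by (rule sum.reindex_bij_betw)
  finally have "(sum v UNIV) ^ q ^ 1 = s ^ q ^ 1" using 1 s_fix by simp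
  hence "sum v UNIV = s" by (rule frob_inj)
  have "prod (Fr v) UNIV = (\<Prod>i\<in>UNIV. v (\<rho> i)) ^ q" by (simp add: Fr_def prod_power_distrib)
  also have "(\<Prod>i\<in>UNIV. v (\<rho> i)) = prod v UNIV" using bij by (rule prod.reindex_bij_betw)
  finally have "(prod v UNIV) ^ q ^ 1 = n ^ q ^ 1" using 1 n_fix by simp
  hence "prod v UNIV = n" by (rule frob_inj)
  thus "v \<in> C" using \<open>sum v UNIV = s\<close> by (simp add: C_def)
qed (rule Fr_in_C)

lemma iF_C_iff: "iF v \<in> C \<longleftrightarrow> v \<in> C"
  using Fr_C_iff[of "iF v"] by simp

text \<open>Frobenius on coefficients: moving the point back and raising the value to the power
  \<open>q\<close> is semilinear and maps regular functions to regular functions.\<close>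

definition sig :: "'k pfun \<Rightarrow> 'k pfun" where
  "sig f = Pf (\<lambda>v. apf f (iF v) ^ q)"

lemma apf_sig [simp]: "apf (sig f) v = apf f (iF v) ^ q"
  by (simp add: sig_def)

lemma sig_add: "sig (f + g) = sig f + sig g" and sig_mult: "sig (f * g) = sig f * sig g"
  and sig_sc: "sig (sc c f) = sc (c ^ q) (sig f)" and sig_diff: "sig (f - g) = sig f - sig g"
  and sig_0: "sig 0 = 0" and sig_1: "sig 1 = 1"
  using frob_add[of _ _ 1] frob_diff[of _ _ 1] q_gt_1
  by (auto intro!: pfun_eqI simp: power_mult_distrib power_0_left)

lemma sig_power: "sig (f ^ m) = sig f ^ m"
  by (induction m) (simp_all add: sig_1 sig_mult)

lemma sig_sum: "sig (sum f A) = (\<Sum>x\<in>A. sig (f x))"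
  by (induction A rule: infinite_finite_induct) (simp_all add: sig_0 sig_add)

lemma sig_cst: "sig (cst c) = cst (c ^ q)"
  using q_gt_1 by (intro pfun_eqI) (simp add: at_cst iF_C_iff power_0_left)

lemma sig_co: "sig (co (\<rho> b)) = co b"
proof (rule pfun_eqI)
  fix v
  have "iF v (\<rho> b) ^ q = v b" by (metis Fr_def Fr_iF)
  thus "apf (sig (co (\<rho> b))) v = apf (co b) v"
    using q_gt_1 by (simp add: at_co iF_C_iff power_0_left)
qed

lemma am_sig: "am m f \<Longrightarrow> am m (sig f)"
proof (induction rule: am.induct)
  case (am_co m f b)
  obtain a where "\<rho> a = b" using bij by (metis bij_pointE)
  hence "sig (co b) = co a" using sig_co by blast
  thus ?case using am_co am.am_co by (simp add: sig_mult)
qed (auto simp: sig_cst sig_add intro: am.intros)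

lemma sig_ee: "sig ee = ee"
proof -
  have d: "\<rho> 1 \<noteq> \<rho> 2" "\<rho> 1 \<noteq> \<rho> 3" "\<rho> 2 \<noteq> \<rho> 3" using bij by (auto simp: bij_def inj_eq)
  have "ee = co (\<rho> 1) * co (\<rho> 2) + co (\<rho> 2) * co (\<rho> 3) + co (\<rho> 1) * co (\<rho> 3)"
    using d exhaust_3[of "\<rho> 1"] exhaust_3[of "\<rho> 2"] exhaust_3[of "\<rho> 3"]
    by (elim disjE) (simp_all add: ee_def ac_simps)
  hence "sig ee = co 1 * co 2 + co 2 * co 3 + co 1 * co 3" by (simp add: sig_add sig_mult sig_co)
  thus ?thesis by (simp add: ee_def)
qed

lemma sig_ID: "f \<in> ID D \<Longrightarrow> sig f \<in> ID (image_mset Fr D)"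
proof (induction D arbitrary: f)
  case empty
  thus ?case using am_sig by (auto simp: ID_empty Af_def)
next
  case (add P D)
  have "f \<in> pv.span {a * b |a b. a \<in> MP P \<and> b \<in> ID D}" using add.prems by (simp add: ID_add IM_def)
  hence "sig f \<in> ID (add_mset (Fr P) (image_mset Fr D))"
  proof (induction rule: pv.span_induct_alt)
    case base
    show ?case by (simp add: sig_0 pv.subspace_0[OF ID_subspace])
  next
    case (step c x y)
    then obtain a b where ab: "x = a * b" "a \<in> MP P" "b \<in> ID D" by blast
    have "sig a \<in> MP (Fr P)" using ab(2) am_sig q_gt_1 by (auto simp: MP_def Af_def power_0_left)
    hence "sig x \<in> ID (add_mset (Fr P) (image_mset Fr D))"
      unfolding ab(1) sig_mult ID_add using add.IH[OF ab(3)] by (intro IM_I)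
    thus ?case using step pv.subspace_add[OF ID_subspace] pv.subspace_scale[OF ID_subspace]
      by (simp add: sig_add sig_sc)
  qed
  thus ?case by simp
qed

lemma sig_funpow_periodic: "(sig ^^ N) f = f \<Longrightarrow> (sig ^^ (k * N)) f = f"
  by (induction k) (simp_all add: funpow_add)

lemma sig_funpow_mult: "(sig ^^ N) (f * g) = (sig ^^ N) f * (sig ^^ N) g"
  and sig_funpow_add: "(sig ^^ N) (f + g) = (sig ^^ N) f + (sig ^^ N) g"
  by (induction N) (simp_all add: sig_mult sig_add)

text \<open>A regular function involves finitely many scalars, all in finite fields.\<close>

lemma sig_periodic: "am m f \<Longrightarrow> \<exists>N>0. (sig ^^ N) f = f"
proof (induction rule: am.induct)
  case (am_cst m c)
  obtain N where N: "N > 0" "c ^ (q ^ N) = c" using algebraic by blast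
  have "(sig ^^ N) (cst c) = cst (c ^ (q ^ N))" for N
    by (induction N) (simp_all add: sig_cst mult.commute flip: power_mult)
  thus ?case using N by auto
next
  case (am_co m f b)
  then obtain N where N: "N > 0" "(sig ^^ N) f = f" by blast
  have k: "(sig ^^ k) (co ((\<rho> ^^ k) b)) = co b" for k b
  proof (induction k arbitrary: b)
    case (Suc k)
    have "(sig ^^ Suc k) (co ((\<rho> ^^ Suc k) b)) = (sig ^^ k) (sig (co (\<rho> ((\<rho> ^^ k) b))))"
      by (simp add: funpow_swap1)
    also have "\<dots> = co b" using Suc by (simp add: sig_co)
    finally show ?case .
  qed simp
  have "(sig ^^ (6 * N)) (co b) = co b" using k[of "6 * N" b] by (simp add: rho_6)
  moreover have "(sig ^^ (6 * N)) f = f" by (rule sig_funpow_periodic[OF N(2)])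
  ultimately have "(sig ^^ (6 * N)) (f * co b) = f * co b" by (simp add: sig_funpow_mult)
  thus ?case using N(1) by (intro exI[of _ "6 * N"]) simp
next
  case (am_add m f g)
  then obtain N M where N: "N > 0" "(sig ^^ N) f = f" "M > 0" "(sig ^^ M) g = g" by blast
  have "(sig ^^ (M * N)) (f + g) = f + g"
    using sig_funpow_periodic[OF N(2), of M] sig_funpow_periodic[OF N(4), of N]
    by (simp add: sig_funpow_add mult.commute)
  thus ?case using N by (intro exI[of _ "M * N"]) simp
qed

text \<open>If some nonzero element has \<open>d\<close>-th power different from 1, multiplication
  by it rescales the sum; otherwise each of the \<open>q ^ N - 1\<close> nonzero terms is 1.\<close>

lemma power_sum_frobenius_field:
  assumes N: "N > 0" and d: "d > 0"
  shows "(\<Sum>c\<in>{c::'k. c ^ (q ^ N) = c}. c ^ d) = (if (q ^ N - 1) dvd d then - 1 else 0)"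
proof -
  define Q where "Q = q ^ N"
  define Fq where "Fq = {c::'k. c ^ Q = c}"
  have Q1: "Q > 1" unfolding Q_def using q_gt_1 N by (intro one_less_power)
  have cF: "card Fq = Q" unfolding Fq_def
    by (rule card_frobenius_fixed[OF char_prime, of _ "fe * N"]) (use N a_pos in \<open>auto simp: Q_def q_power\<close>)
  have fF: "finite Fq" using cF Q1 by (intro card_ge_0_finite) simp
  have Q0: "of_nat Q = (0::'k)" using N a_pos by (simp add: Q_def q_power of_nat_eq_0_iff_char_dvd)
  have pow: "c ^ (Q - 1) = 1" if "c \<in> Fq" "c \<noteq> 0" for c
    using that frob_fixed_pow_pred[of c N] by (simp add: Fq_def Q_def)
  have "(\<Sum>c\<in>Fq. c ^ d) = (if (Q - 1) dvd d then - 1 else 0)"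
  proof (cases "(Q - 1) dvd d")
    case True
    then obtain k where k: "d = (Q - 1) * k" by (elim dvdE)
    have "(\<Sum>c\<in>Fq. c ^ d) = (\<Sum>c\<in>Fq - {0}. 1)"
      using fF d pow by (intro sum.mono_neutral_cong_right) (auto simp: k power_mult)
    also have "\<dots> = of_nat (Q - 1)" using fF cF Q1 by (simp add: Fq_def)
    also have "\<dots> = - 1" using Q0 Q1 by (simp add: of_nat_diff)
    finally show ?thesis using True by simp
  next
    case False
    have "of_nat (Q - 1) \<noteq> (0::'k)" using Q0 Q1 by (simp add: of_nat_diff)
    then obtain z :: 'k where z: "z ^ (Q - 1) = 1" "z ^ d \<noteq> 1" using root_of_unity_separates[OF _ False] by blast
    have z0: "z \<noteq> 0" using z Q1 by (auto simp: power_0_left)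
    have zF: "z ^ Q = z" using frob_fixed_pow_pred[OF z0, of N] z by (simp add: Q_def)
    have "(\<Sum>c\<in>Fq. c ^ d) = (\<Sum>c\<in>Fq. (z * c) ^ d)"
      by (rule sum.reindex_bij_witness[where i = "\<lambda>c. z * c" and j = "\<lambda>c. c / z"])
         (use z0 zF in \<open>auto simp: Fq_def power_mult_distrib power_divide\<close>)
    also have "\<dots> = z ^ d * (\<Sum>c\<in>Fq. c ^ d)" by (simp add: power_mult_distrib sum_distrib_left)
    finally have "(\<Sum>c\<in>Fq. c ^ d) = 0" using z(2) by simp
    thus ?thesis using False by simp
  qed
  thus ?thesis by (simp add: Fq_def Q_def)
qed

text \<open>The coefficients \<open>- c\<^sup>Q\<^sup>-\<^sup>2\<close> invert the Moore matrix \<open>(c\<^sup>q\<^sup>^\<^sup>j)\<close> on its first column.\<close>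

lemma in_span_fixed:
  assumes V: "pv.subspace V" "\<And>f. f \<in> V \<Longrightarrow> sig f \<in> V" and u: "u \<in> V" "N > 0" "(sig ^^ N) u = u"
  shows "u \<in> pv.span {f \<in> V. sig f = f}"
proof -
  define Q where "Q = q ^ N"
  define Fq where "Fq = {c::'k. c ^ Q = c}"
  have Q2: "Q > 2"
  proof -
    have "Q > 1" unfolding Q_def using q_gt_1 u(2) by (intro one_less_power)
    moreover have "Q \<noteq> 2" using odd_q_power[of N] even_numeral unfolding Q_def by metis
    ultimately show ?thesis by simp
  qed
  have uV: "(sig ^^ k) u \<in> V" for k using V(2) u(1) by (induction k) auto
  \<comment> \<open>The trace of \<open>sc c u\<close> along the iterates of \<open>sig\<close>,
    fixed by \<open>sig\<close> for \<open>c\<close> in \<open>Fq\<close>.\<close>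
  define t where "t c = (\<Sum>k<N. sc (c ^ (q ^ k)) ((sig ^^ k) u))" for c
  have t: "t c \<in> {f \<in> V. sig f = f}" if c: "c \<in> Fq" for c
  proof -
    have "sig (t c) = (\<Sum>k<N. sc (c ^ (q ^ Suc k)) ((sig ^^ Suc k) u))"
      by (simp add: t_def sig_sum sig_sc mult.commute flip: power_mult)
    moreover have "(\<Sum>k<N. sc (c ^ (q ^ Suc k)) ((sig ^^ Suc k) u)) + sc c u = t c + sc (c ^ Q) ((sig ^^ N) u)"
    proof -
      have "(\<Sum>k<Suc N. sc (c ^ (q ^ k)) ((sig ^^ k) u)) = sc c u + (\<Sum>k<N. sc (c ^ (q ^ Suc k)) ((sig ^^ Suc k) u))"
        by (subst sum.lessThan_Suc_shift) simp
      moreover have "(\<Sum>k<Suc N. sc (c ^ (q ^ k)) ((sig ^^ k) u)) = t c + sc (c ^ Q) ((sig ^^ N) u)"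
        by (simp add: t_def Q_def)
      ultimately show ?thesis by (simp only: add.commute)
    qed
    ultimately have "sig (t c) = t c" using c u(3) by (simp add: Fq_def)
    moreover have "t c \<in> V" unfolding t_def
      by (intro pv.subspace_sum[OF V(1)] pv.subspace_scale[OF V(1)] uV)
    ultimately show ?thesis by simp
  qed
  have coeff: "(\<Sum>c\<in>Fq. - (c ^ (Q - 2)) * c ^ (q ^ k)) = (if k = 0 then 1 else 0)" if "k < N" for k
  proof -
    have "(\<Sum>c\<in>Fq. - (c ^ (Q - 2)) * c ^ (q ^ k)) = - (\<Sum>c\<in>Fq. c ^ (Q - 2 + q ^ k))"
      by (simp add: power_add sum_negf)
    also have "\<dots> = - (if (Q - 1) dvd (Q - 2 + q ^ k) then - 1 else 0)"
      using power_sum_frobenius_field[OF u(2), of "Q - 2 + q ^ k"] Q2 by (simp add: Fq_def Q_def)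
    also have "(Q - 1) dvd (Q - 2 + q ^ k) \<longleftrightarrow> k = 0"
    proof (cases "k = 0")
      case True
      thus ?thesis using Q2 by (simp add: Suc_diff_Suc numeral_2_eq_2)
    next
      case False
      have lt: "q ^ k < Q" unfolding Q_def using q_gt_1 that by (rule power_strict_increasing[rotated])
      have gt: "q ^ k > 1" using q_gt_1 False by (intro one_less_power) auto
      have "Q - 2 + q ^ k = (Q - 1) + (q ^ k - 1)" using Q2 gt by simp
      hence "(Q - 1) dvd (Q - 2 + q ^ k) \<longleftrightarrow> (Q - 1) dvd (q ^ k - 1)" by simp
      also have "\<dots> \<longleftrightarrow> False" using lt gt by (auto dest: dvd_imp_le)
      finally show ?thesis using False by simp
    qed
    finally show ?thesis by simp
  qed
  have "(\<Sum>c\<in>Fq. sc (- (c ^ (Q - 2))) (t c)) = (\<Sum>c\<in>Fq. \<Sum>k<N. sc (- (c ^ (Q - 2)) * c ^ (q ^ k)) ((sig ^^ k) u))"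
    by (simp add: t_def pv.scale_sum_right)
  also have "\<dots> = (\<Sum>k<N. \<Sum>c\<in>Fq. sc (- (c ^ (Q - 2)) * c ^ (q ^ k)) ((sig ^^ k) u))" by (rule sum.swap)
  also have "\<dots> = (\<Sum>k<N. sc (if k = 0 then 1 else 0) ((sig ^^ k) u))"
    by (intro sum.cong refl) (simp only: pv.scale_sum_left[symmetric] coeff lessThan_iff)
  also have "\<dots> = (\<Sum>k<N. if k = 0 then u else 0)" by (intro sum.cong) auto
  also have "\<dots> = u" using u(2) by simp
  finally have "u = (\<Sum>c\<in>Fq. sc (- (c ^ (Q - 2))) (t c))" by simp
  also have "\<dots> \<in> pv.span {f \<in> V. sig f = f}"
    by (intro pv.span_sum pv.span_scale pv.span_base t)
  finally show ?thesis .
qed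

text \<open>In a basis of fixed functions \<open>sig\<close> is the \<open>q\<close>-th power of the
  coordinates. Fixed vectors have coordinates in the field with \<open>q\<close> elements, and the
  last claim is the solvability of \<open>d ^ q - d = x\<close>.\<close>

lemma descent:
  assumes V: "pv.subspace V" "\<And>f. f \<in> V \<Longrightarrow> sig f \<in> V" "V \<subseteq> pv.span F" "finite F" "V \<subseteq> Af"
  shows "card {f \<in> V. sig f = f} = q ^ pv.dim V" "finite {f \<in> V. sig f = f}"
    and "g \<in> V \<Longrightarrow> \<exists>f\<in>V. sig f - f = g"
proof -
  define S where "S = {f \<in> V. sig f = f}"
  have VS: "V \<subseteq> pv.span S"
  proof
    fix u assume u: "u \<in> V"
    then obtain m where "am m u" using V(5) by (auto simp: Af_def)
    then obtain N where "N > 0" "(sig ^^ N) u = u" using sig_periodic by blast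
    thus "u \<in> pv.span S" unfolding S_def using in_span_fixed V(1,2) u by blast
  qed
  obtain B where B: "B \<subseteq> S" "pv.independent B" "S \<subseteq> pv.span B" by (rule pv.maximal_independent_subset)
  have VB: "V \<subseteq> pv.span B" using VS pv.span_minimal[OF B(3) pv.subspace_span] by blast
  have BV: "B \<subseteq> V" and Bs: "\<And>b. b \<in> B \<Longrightarrow> sig b = b" using B(1) by (auto simp: S_def)
  have fB: "finite B" using pv.independent_span_bound[OF V(4) B(2)] BV V(3) by blast
  have dimB: "pv.dim V = card B" using pv.dim_unique[OF BV VB B(2) refl] .
  define L where "L c = (\<Sum>b\<in>B. sc (c b) b)" for c
  have LV: "L c \<in> V" for c
    unfolding L_def using BV by (intro pv.subspace_sum[OF V(1)] pv.subspace_scale[OF V(1)]) auto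
  have L_sig: "sig (L c) = L (\<lambda>b. c b ^ q)" for c
    unfolding L_def sig_sum sig_sc using Bs by (intro sum.cong) auto
  have L_diff: "L c - L d = L (\<lambda>b. c b - d b)" for c d
    by (simp add: L_def sum_subtractf pv.scale_left_diff_distrib)
  have L_eq_0: "c b = 0" if "L c = 0" "b \<in> B" for c b
    using pv.independentD[OF B(2) fB order_refl, of c b] that by (simp add: L_def)
  have L_ex: "\<exists>c. f = L c" if "f \<in> V" for f
    using that VB pv.span_finite[OF fB] by (auto simp: L_def)
  show "\<exists>f\<in>V. sig f - f = g" if g: "g \<in> V"
  proof -
    obtain c where c: "g = L c" using L_ex[OF g] by blast
    have "\<exists>d. d ^ q - d = x" for x :: 'k
    proof -
      define p where "p = monom 1 q - monom 1 1 - [:x:]"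
      have "coeff p q = 1" using q_gt_1 by (simp add: p_def coeff_pCons split: nat.split)
      hence "degree p > 0" using q_gt_1 le_degree[of p q] by simp
      then obtain d where "poly p d = 0" using alg_closed_imp_poly_has_root by blast
      thus ?thesis by (auto simp: p_def poly_monom)
    qed
    then obtain r where r: "\<And>x::'k. r x ^ q - r x = x" by metis
    have "sig (L (\<lambda>b. r (c b))) - L (\<lambda>b. r (c b)) = g" unfolding L_sig L_diff c by (simp add: r)
    thus ?thesis using LV by blast
  qed
  define Fq where "Fq = {c::'k. c ^ q = c}"
  have cF: "card Fq = q" unfolding Fq_def by (rule card_frobenius_fixed[OF char_prime q_eq a_pos])
  have fF: "finite Fq" using cF q_gt_1 by (intro card_ge_0_finite) simp
  have bij: "bij_betw L (PiE B (\<lambda>_. Fq)) S"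
  proof (rule bij_betw_imageI)
    show "inj_on L (PiE B (\<lambda>_. Fq))"
    proof (rule inj_onI)
      fix c d assume cd: "c \<in> PiE B (\<lambda>_. Fq)" "d \<in> PiE B (\<lambda>_. Fq)" "L c = L d"
      have "L (\<lambda>b. c b - d b) = 0" using cd(3) L_diff by (metis right_minus_eq)
      hence "c b = d b" if "b \<in> B" for b using L_eq_0[of "\<lambda>b. c b - d b" b] that by simp
      thus "c = d" using cd by (intro PiE_ext)
    qed
    show "L ` PiE B (\<lambda>_. Fq) = S"
    proof safe
      fix c assume c: "c \<in> PiE B (\<lambda>_. Fq)"
      have "L (\<lambda>b. c b ^ q) = L c" unfolding L_def using c by (intro sum.cong) (auto simp: Fq_def PiE_iff)
      thus "L c \<in> S" using LV L_sig by (simp add: S_def)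
    next
      fix f assume f: "f \<in> S"
      then obtain c where c: "f = L c" using L_ex by (auto simp: S_def)
      have "L (\<lambda>b. c b ^ q - c b) = 0" using f L_sig[of c] L_diff[of "\<lambda>b. c b ^ q" c] by (simp add: S_def c)
      hence "c b \<in> Fq" if "b \<in> B" for b using L_eq_0[of "\<lambda>b. c b ^ q - c b" b] that by (simp add: Fq_def)
      hence "restrict c B \<in> PiE B (\<lambda>_. Fq)" by auto
      moreover have "f = L (restrict c B)" by (simp add: c L_def)
      ultimately show "f \<in> L ` PiE B (\<lambda>_. Fq)" by blast
    qed
  qed
  show "card {f \<in> V. sig f = f} = q ^ pv.dim V"
    using bij_betw_same_card[OF bij] cF fB by (simp add: S_def dimB card_PiE)
  have "finite (PiE B (\<lambda>_. Fq))" using fB fF by (intro finite_PiE) auto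
  thus "finite {f \<in> V. sig f = f}" using bij_betw_finite[OF bij] by (simp add: S_def)
qed

end

section \<open>The L-function\<close>

context twisted_cubic
begin

definition stable :: "(3 \<Rightarrow> 'k) multiset \<Rightarrow> bool" where
  "stable D \<longleftrightarrow> set_mset D \<subseteq> C \<and> image_mset Fr D = D"

lemma coords: "cubic_coordinates q fe \<rho> s n 1 2 3" "cubic_coordinates q fe \<rho> s n 2 1 3"
  "cubic_coordinates q fe \<rho> s n 3 1 2"
  by unfold_locales auto

text \<open>Adjoining multiples of \<open>ee ^ m\<close> raises the dimension by one, and vanishing
  on \<open>E\<close> costs at most \<open>size E\<close> there but exactly \<open>size E\<close>
  among the lower order functions. Hence a function with nonzero leading part survives. The 4
  ensures \<open>size E < 3 * (2 * m - 1)\<close>.\<close>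

lemma Mo_nonempty:
  assumes m: "m > 0" and E: "set_mset E \<subseteq> C" "size E + 4 \<le> 6 * m"
  shows "\<exists>f\<in>Mo m. f \<in> ID E"
proof -
  interpret cubic_coordinates q fe \<rho> s n 1 2 3 by (rule coords)
  define A where "A = {f. am (2 * m - 1) f}"
  define W where "W = {f. \<exists>c g. am (2 * m - 1) g \<and> f = sc c (ee ^ m) + g}"
  obtain F where F: "finite F" "A \<subseteq> pv.span F"
    using Ln_finite[of "2 * m - 1" "3 * (2 * m - 1)"] by (auto simp: A_def am_eq_Ln)
  have subA: "pv.subspace A" unfolding A_def by (rule am_subspace)
  have subW: "pv.subspace W"
  proof (rule pv.subspaceI)
    have "am (2 * m - 1) 0" using am_cst[of _ 0] by (simp add: cst_0)
    thus "0 \<in> W" unfolding W_def by (auto intro!: exI[of _ 0])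
    fix f g assume "f \<in> W" "g \<in> W"
    then obtain c d u v where "am (2 * m - 1) u" "f = sc c (ee ^ m) + u" "am (2 * m - 1) v" "g = sc d (ee ^ m) + v"
      unfolding W_def by blast
    hence "f + g = sc (c + d) (ee ^ m) + (u + v)" "am (2 * m - 1) (u + v)"
      by (simp_all add: pv.scale_left_distrib add_ac am_add)
    thus "f + g \<in> W" unfolding W_def by blast
  next
    fix c f assume "f \<in> W"
    then obtain d u where "am (2 * m - 1) u" "f = sc d (ee ^ m) + u" unfolding W_def by blast
    hence "sc c f = sc (c * d) (ee ^ m) + sc c u" "am (2 * m - 1) (sc c u)"
      by (simp_all add: pv.scale_right_distrib am_sc)
    thus "sc c f \<in> W" unfolding W_def by blast
  qed
  have WF: "W \<subseteq> pv.span (insert (ee ^ m) F)"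
  proof
    fix f assume "f \<in> W"
    then obtain c g where g: "g \<in> A" "f = sc c (ee ^ m) + g" by (auto simp: W_def A_def)
    have "g \<in> pv.span (insert (ee ^ m) F)" using g(1) F(2) pv.span_mono[of F "insert (ee ^ m) F"] by blast
    moreover have "sc c (ee ^ m) \<in> pv.span (insert (ee ^ m) F)" by (intro pv.span_scale pv.span_base) simp
    ultimately show "f \<in> pv.span (insert (ee ^ m) F)" unfolding g(2) by (intro pv.span_add)
  qed
  have AW: "A \<subseteq> W"
  proof
    fix f assume "f \<in> A"
    moreover have "f = sc 0 (ee ^ m) + f" by simp
    ultimately show "f \<in> W" unfolding W_def A_def by blast
  qed
  have "am (2 * m - 1) 0" using am_cst[of "2 * m - 1" 0] by (simp add: cst_0)
  moreover have "ee ^ m = sc 1 (ee ^ m) + 0" by simp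
  ultimately have eW: "ee ^ m \<in> W" unfolding W_def by blast
  have eA: "ee ^ m \<notin> A"
  proof
    assume "ee ^ m \<in> A"
    hence "am (2 * m - 1) (sc (- 1) (ee ^ m))" by (simp only: A_def mem_Collect_eq am_sc)
    hence "0 \<in> Mo m" unfolding Mo_def by (auto intro!: exI[of _ "sc (- 1) (ee ^ m)"] pfun_eqI)
    thus False using Mo_XW[OF m, of 0] XW_eq_0_iff by metis
  qed
  have "pv.dim A < pv.dim W" by (rule pv.dim_strict_finite[OF AW eW eA subA WF]) (use F in simp)
  have RR: "pv.dim (A \<inter> ID E) + size E = 3 * (2 * m - 1)" and RR0: "pv.dim (A \<inter> ID {#}) = 3 * (2 * m - 1)"
    unfolding A_def using riemann_roch[of E "2 * m - 1"] riemann_roch[of "{#}" "2 * m - 1"] E m by auto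
  have Aempty: "A \<inter> ID {#} = A" by (auto simp: A_def ID_empty Af_def)
  have "ee ^ m \<in> Af" unfolding ee_power[OF m] by (rule XW_Af)
  hence "W \<subseteq> Af" by (auto simp: W_def intro!: Af_add Af_sc) (auto simp: Af_def)
  hence "W \<inter> ID {#} = W" by (auto simp: ID_empty)
  hence "pv.dim W \<le> pv.dim (W \<inter> ID E) + size E"
    using dim_Int_ID_ge[of "{#}" W, OF _ WF _ subW E(1)] F(1) by simp
  hence lt: "pv.dim (A \<inter> ID E) < pv.dim (W \<inter> ID E)"
    using \<open>pv.dim A < pv.dim W\<close> RR RR0 Aempty by simp
  have "\<not> W \<inter> ID E \<subseteq> A \<inter> ID E"
  proof
    assume "W \<inter> ID E \<subseteq> A \<inter> ID E"
    hence "W \<inter> ID E = A \<inter> ID E" using AW by blast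
    thus False using lt by simp
  qed
  then obtain f where f: "f \<in> W" "f \<in> ID E" "f \<notin> A" by blast
  then obtain c g where g: "am (2 * m - 1) g" "f = sc c (ee ^ m) + g" by (auto simp: W_def)
  have "c \<noteq> 0" using f(3) g by (auto simp: A_def)
  hence "sc (1 / c) f = ee ^ m + sc (1 / c) g" by (simp add: g(2) pv.scale_right_distrib)
  hence "sc (1 / c) f \<in> Mo m" unfolding Mo_def using am_sc[OF g(1)] by blast
  moreover have "sc (1 / c) f \<in> ID E" using f(2) by (rule pv.subspace_scale[OF ID_subspace])
  ultimately show ?thesis by blast
qed

definition Mf :: "nat \<Rightarrow> 'k pfun set" where
  "Mf m = {f \<in> Mo m. sig f = f}"

text \<open>Differences of normalised functions form a space of dimension
  \<open>3 * (2 * m - 1) - size E\<close>. By the surjectivity part of \<open>descent\<close> one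
  normalised function can be corrected to a fixed one, so the set is a translate of the fixed
  vectors.\<close>

lemma card_Mf:
  assumes m: "m > 0" and E: "stable E" "size E + 4 \<le> 6 * m"
  shows "card {f \<in> Mf m. f \<in> ID E} = q ^ (6 * m - 3 - size E)" "finite {f \<in> Mf m. f \<in> ID E}"
proof -
  interpret cubic_coordinates q fe \<rho> s n 1 2 3 by (rule coords)
  have EC: "set_mset E \<subseteq> C" and EF: "image_mset Fr E = E" using E(1) by (auto simp: stable_def)
  define V where "V = {f. am (2 * m - 1) f} \<inter> ID E"
  obtain F where F: "finite F" "V \<subseteq> pv.span F"
    using Ln_finite[of "2 * m - 1" "3 * (2 * m - 1)"] by (auto simp: V_def am_eq_Ln)
  have subV: "pv.subspace V" unfolding V_def by (intro pv.subspace_inter am_subspace ID_subspace)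
  have sigV: "sig f \<in> V" if "f \<in> V" for f
    using that am_sig sig_ID[of f E] EF by (auto simp: V_def)
  have VA: "V \<subseteq> Af" using ID_Af by (auto simp: V_def)
  have dimV: "pv.dim V = 6 * m - 3 - size E"
  proof -
    have sz: "3 * (2 * m - 1) = 6 * m - 3" "size E < 3 * (2 * m - 1)" using E(2) m by auto
    show ?thesis using riemann_roch[OF EC sz(2)] sz(1) unfolding V_def by linarith
  qed
  note desc = descent[OF subV sigV F(2,1) VA]
  obtain f0 where f0: "f0 \<in> Mo m" "f0 \<in> ID E" using Mo_nonempty[OF m EC E(2)] by blast
  have diff: "f - g \<in> V" if H: "f \<in> Mo m" "g \<in> Mo m" "f \<in> ID E" "g \<in> ID E" for f g
  proof -
    obtain u v where uv: "am (2 * m - 1) u" "f = ee ^ m + u" "am (2 * m - 1) v" "g = ee ^ m + v"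
      using H by (auto simp: Mo_def)
    hence "am (2 * m - 1) (f - g)" using pv.subspace_diff[OF am_subspace, of u "2 * m - 1" v] by simp
    thus ?thesis using that pv.subspace_diff[OF ID_subspace] by (simp add: V_def)
  qed
  have add: "f + u \<in> Mo m \<and> f + u \<in> ID E" if H: "f \<in> Mo m" "f \<in> ID E" "u \<in> V" for f u
  proof -
    obtain v where v: "am (2 * m - 1) v" "f = ee ^ m + v" using H(1) by (auto simp: Mo_def)
    have "am (2 * m - 1) (v + u)" using v(1) that(3) by (auto simp: V_def intro: am_add)
    hence "f + u \<in> Mo m" unfolding Mo_def v(2) by (auto simp: add.assoc)
    thus ?thesis using that pv.subspace_add[OF ID_subspace] by (auto simp: V_def)
  qed
  have sigM: "sig f0 \<in> Mo m" "sig f0 \<in> ID E"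
  proof -
    obtain v where v: "am (2 * m - 1) v" "f0 = ee ^ m + v" using f0(1) by (auto simp: Mo_def)
    have "sig f0 = ee ^ m + sig v" by (simp add: v(2) sig_add sig_power sig_ee)
    thus "sig f0 \<in> Mo m" unfolding Mo_def using am_sig[OF v(1)] by blast
    show "sig f0 \<in> ID E" using sig_ID[OF f0(2)] EF by simp
  qed
  have "sig f0 - f0 \<in> V" by (rule diff[OF sigM(1) f0(1) sigM(2) f0(2)])
  then obtain v where v: "v \<in> V" "sig v - v = sig f0 - f0" using desc(3) by blast
  define f1 where "f1 = f0 + (- v)"
  have "- v \<in> V" using v(1) by (rule pv.subspace_neg[OF subV])
  hence f1: "f1 \<in> Mo m" "f1 \<in> ID E" using add[OF f0] unfolding f1_def by blast+
  have "sig f1 = sig f0 - sig v" by (simp add: f1_def sig_diff flip: diff_conv_add_uminus)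
  also have "\<dots> = f1" using v(2) by (simp add: f1_def algebra_simps)
  finally have s1: "sig f1 = f1" .
  have bij: "bij_betw (\<lambda>u. f1 + u) {f \<in> V. sig f = f} {f \<in> Mf m. f \<in> ID E}"
  proof (rule bij_betw_imageI)
    show "(\<lambda>u. f1 + u) ` {f \<in> V. sig f = f} = {f \<in> Mf m. f \<in> ID E}"
    proof safe
      fix u assume "u \<in> V" "sig u = u"
      thus "f1 + u \<in> Mf m" "f1 + u \<in> ID E" using add[OF f1] s1 by (auto simp: Mf_def sig_add)
    next
      fix f assume f: "f \<in> Mf m" "f \<in> ID E"
      have "f - f1 \<in> V" using f f1 by (intro diff) (auto simp: Mf_def)
      moreover have "sig (f - f1) = f - f1" using f s1 by (simp add: Mf_def sig_diff)
      ultimately show "f \<in> (\<lambda>u. f1 + u) ` {f \<in> V. sig f = f}" by (intro image_eqI[of _ _ "f - f1"]) auto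
    qed
  qed (simp add: inj_on_def)
  show "card {f \<in> Mf m. f \<in> ID E} = q ^ (6 * m - 3 - size E)"
    using bij_betw_same_card[OF bij] desc(1) dimV by simp
  show "finite {f \<in> Mf m. f \<in> ID E}" using bij_betw_finite[OF bij] desc(2) by simp
qed

definition dv :: "nat \<Rightarrow> 'k pfun \<Rightarrow> (3 \<Rightarrow> 'k) multiset" where
  "dv m f = (THE D. set_mset D \<subseteq> C \<and> size D = 6 * m \<and> f \<in> ID D)"

lemma dv_props:
  assumes m: "m > 0" and f: "f \<in> Mo m"
  shows "set_mset (dv m f) \<subseteq> C" "size (dv m f) = 6 * m" "f \<in> ID (dv m f)"
proof -
  interpret cubic_coordinates q fe \<rho> s n 1 2 3 by (rule coords)
  have "f \<in> ID {#}" using Mo_Af[OF m f] by (simp add: ID_empty)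
  then obtain D where D: "set_mset D \<subseteq> C \<and> size D = 6 * m \<and> f \<in> ID D"
    using divisor_exists[OF m f, of "{#}"] by auto
  have "\<exists>!D. set_mset D \<subseteq> C \<and> size D = 6 * m \<and> f \<in> ID D"
    by (rule ex1I[of _ D], rule D) (rule divisor_unique[OF m f], use D in auto)
  hence "set_mset (dv m f) \<subseteq> C \<and> size (dv m f) = 6 * m \<and> f \<in> ID (dv m f)"
    unfolding dv_def by (rule theI')
  thus "set_mset (dv m f) \<subseteq> C" "size (dv m f) = 6 * m" "f \<in> ID (dv m f)" by auto
qed

lemma dv_unique: "m > 0 \<Longrightarrow> f \<in> Mo m \<Longrightarrow> set_mset D \<subseteq> C \<Longrightarrow> size D = 6 * m \<Longrightarrow> f \<in> ID D \<Longrightarrow> dv m f = D"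
  by (rule cubic_coordinates.divisor_unique[OF coords(1), of m f]) (simp_all add: dv_props)

lemma dv_stable:
  assumes m: "m > 0" and f: "f \<in> Mf m"
  shows "stable (dv m f)"
proof -
  have fM: "f \<in> Mo m" "sig f = f" using f by (auto simp: Mf_def)
  note d = dv_props[OF m fM(1)]
  have "dv m f = image_mset Fr (dv m f)"
  proof (rule dv_unique[OF m fM(1)])
    show "set_mset (image_mset Fr (dv m f)) \<subseteq> C" using d(1) Fr_in_C by auto
    show "f \<in> ID (image_mset Fr (dv m f))" using sig_ID[OF d(3)] fM(2) by simp
  qed (simp add: d)
  thus ?thesis using d by (simp add: stable_def)
qed

lemma dv_ge_iff:
  assumes m: "m > 0" and f: "f \<in> Mo m" and E: "set_mset E \<subseteq> C"
  shows "E \<subseteq># dv m f \<longleftrightarrow> f \<in> ID E"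
proof
  assume "E \<subseteq># dv m f"
  thus "f \<in> ID E" using ID_mono dv_props(3)[OF m f] by blast
next
  assume "f \<in> ID E"
  then obtain D where "E \<subseteq># D" "set_mset D \<subseteq> C" "size D = 6 * m" "f \<in> ID D"
    using cubic_coordinates.divisor_exists[OF coords(1) m f _ E] by blast
  thus "E \<subseteq># dv m f" using dv_unique[OF m f, of D] by simp
qed

lemma dv_product: "m > 0 \<Longrightarrow> f \<in> Mo m \<Longrightarrow> (\<Prod>P\<in>#dv m f. P b) = n ^ (2 * m)"
  using exhaust_3[of b]
  by (elim disjE) (simp_all only: dv_props cubic_coordinates.divisor_product[OF coords(1), of m f "dv m f"]
    cubic_coordinates.divisor_product[OF coords(2), of m f "dv m f"]
    cubic_coordinates.divisor_product[OF coords(3), of m f "dv m f"])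

text \<open>The leading terms cancel in the difference, which then has at most
  \<open>3 * (2 * m - 1)\<close> zeros but vanishes on a divisor of degree
  \<open>6 * m\<close>.\<close>

lemma dv_inj:
  assumes m: "m > 0" and f: "f \<in> Mo m" "g \<in> Mo m" "dv m f = dv m g"
  shows "f = g"
proof -
  interpret cubic_coordinates q fe \<rho> s n 1 2 3 by (rule coords)
  obtain a b where ab: "f = XW (2 * m) a b" "a \<noteq> 0" "degree (norm_poly a b) = 6 * m"
    by (rule Mo_XW[OF m f(1)])
  note d = dv_props[OF m f(1)]
  have gI: "g \<in> ID (dv m f)" using dv_props(3)[OF m f(2)] f(3) by simp
  obtain u v where uv: "am (2 * m - 1) u" "f = ee ^ m + u" "am (2 * m - 1) v" "g = ee ^ m + v"
    using f by (auto simp: Mo_def)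
  define h where "h = g - f"
  have "am (2 * m - 1) h" unfolding h_def uv using pv.subspace_diff[OF am_subspace, of v "2 * m - 1" u] uv by simp
  then obtain a' b' where h: "LL (3 * (2 * m - 1)) a' b'" "h = XW (2 * m - 1) a' b'" using am_imp_XW by blast
  have "h \<in> ID (dv m f)" unfolding h_def using gI d(3) by (rule pv.subspace_diff[OF ID_subspace])
  hence dvd: "pt (dv m f) dvd norm_poly a' b'" using pt_dvd_norm[OF d(1)] h by simp
  have "a' = 0 \<and> b' = 0"
  proof (rule ccontr)
    assume neg: "\<not> (a' = 0 \<and> b' = 0)"
    hence "norm_poly a' b' \<noteq> 0" "degree (norm_poly a' b') \<le> 3 * (2 * m - 1)"
      using norm_poly_degree[of a' b'] h(1) by (auto simp: LL_def)
    moreover have "6 * m \<le> degree (norm_poly a' b')"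
      using dvd_imp_degree_le[OF dvd] calculation degree_pt[OF d(1)] d(2) by simp
    ultimately show False using m by linarith
  qed
  hence "h = 0" using h(2) by (simp add: XW_eq_0_iff)
  thus ?thesis by (simp add: h_def)
qed

end

section \<open>Coefficients of the L-function and their vanishing\<close>

context twisted_character
begin

definition pr :: "(3 \<Rightarrow> 'a) multiset \<Rightarrow> 3 \<Rightarrow> 'a" where
  "pr D b = (\<Prod>P\<in>#D. P b)"

definition St :: "nat \<Rightarrow> (3 \<Rightarrow> 'a) multiset set" where
  "St d = {D. stable D \<and> size D = d}"

text \<open>The coefficient of degree \<open>d\<close> of the L-function, a sum over effective
  divisors rational over the base field.\<close>

definition ad :: "nat \<Rightarrow> complex" where
  "ad d = (\<Sum>D\<in>St d. ch (pr D))"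

text \<open>The divisor traced by \<open>k\<close> Frobenius steps; for a point of
  \<open>Ck k\<close> it is a multiple of a closed point, repeated according to the period.\<close>

definition orb :: "nat \<Rightarrow> (3 \<Rightarrow> 'a) \<Rightarrow> (3 \<Rightarrow> 'a) multiset" where
  "orb k v = image_mset (\<lambda>t. (Fr ^^ t) v) (mset_set {..<k})"

lemma inj_Fr: "inj Fr"
  by (rule injI) (rule Fr_inj)

lemma count_Fr:
  assumes "stable D"
  shows "count D ((Fr ^^ k) v) = count D v"
proof (induction k)
  case (Suc k)
  have "count D (Fr u) = count D u" for u
  proof -
    have "Fr -` {Fr u} \<inter> set_mset D = {u} \<inter> set_mset D" using inj_Fr by (auto simp: inj_eq)
    hence "count (image_mset Fr D) (Fr u) = count D u"
      by (cases "u \<in># D") (auto simp: count_image_mset not_in_iff)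
    thus ?thesis using assms by (simp add: stable_def)
  qed
  thus ?case using Suc by simp
qed simp

lemma Fr_funpow_cancel:
  assumes "(Fr ^^ k) v = (Fr ^^ (k + r)) v"
  shows "(Fr ^^ r) v = v"
proof -
  have "(Fr ^^ k) v = (Fr ^^ k) ((Fr ^^ r) v)" using assms by (simp add: funpow_add)
  thus ?thesis using inj_fn[OF inj_Fr, of k] by (simp add: inj_eq)
qed

text \<open>The iterates of \<open>v\<close> stay in \<open>D\<close>, which has at most
  \<open>size D\<close> points; this makes \<open>St d\<close> finite.\<close>

lemma stable_period:
  assumes "stable D" "v \<in># D"
  shows "\<exists>r>0. r \<le> size D \<and> (Fr ^^ r) v = v"
proof -
  have mem: "(Fr ^^ k) v \<in> set_mset D" for k using count_Fr[OF assms(1), of k v] assms(2) by (simp flip: count_greater_zero_iff)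
  have "\<not> inj_on (\<lambda>k. (Fr ^^ k) v) {..size D}"
  proof
    assume "inj_on (\<lambda>k. (Fr ^^ k) v) {..size D}"
    hence "card {..size D} \<le> card (set_mset D)" by (rule card_inj_on_le) (use mem in auto)
    also have "\<dots> \<le> size D" using size_mset_mono[OF mset_set_set_mset_msubset[of D]] by simp
    finally show False by simp
  qed
  then obtain i k where "i < k" "k \<le> size D" "(Fr ^^ i) v = (Fr ^^ k) v"
    unfolding inj_on_def by (metis atMost_iff linorder_neqE_nat)
  thus ?thesis using Fr_funpow_cancel[of i v "k - i"] by (intro exI[of _ "k - i"]) auto
qed

lemma finite_St: "finite (St d)"
proof -
  define Fx where "Fx = (\<Union>k\<in>{1..d}. {v. (Fr ^^ k) v = v})"
  have "finite Fx" unfolding Fx_def by (intro finite_UN_I finite_fixed) auto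
  hence "finite (mset ` {xs. set xs \<subseteq> Fx \<and> length xs = d})" by (intro finite_imageI finite_lists_length_eq)
  moreover have "St d \<subseteq> mset ` {xs. set xs \<subseteq> Fx \<and> length xs = d}"
  proof
    fix D assume D: "D \<in> St d"
    obtain xs where xs: "mset xs = D" using ex_mset by blast
    have "v \<in> Fx" if "v \<in> set xs" for v
    proof -
      have "v \<in># D" using that xs by auto
      then obtain r where "r > 0" "r \<le> size D" "(Fr ^^ r) v = v" using stable_period D by (auto simp: St_def)
      thus ?thesis using D by (auto simp: Fx_def St_def intro!: bexI[of _ r])
    qed
    moreover have "length xs = d" using D xs by (auto simp: St_def)
    ultimately show "D \<in> mset ` {xs. set xs \<subseteq> Fx \<and> length xs = d}" using xs by blast
  qed
  ultimately show ?thesis by (rule rev_finite_subset)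
qed

lemma pr_in_U: "stable D \<Longrightarrow> pr D \<in> U"
proof -
  assume D: "stable D"
  have "Fr (pr D) b = pr D b" for b
  proof -
    have "Fr (pr D) b = (\<Prod>P\<in>#D. P (\<rho> b)) ^ q" by (simp add: Fr_def pr_def)
    also have "\<dots> = (\<Prod>P\<in>#D. Fr P b)" unfolding Fr_def by (induction D) (simp_all add: power_mult_distrib)
    also have "\<dots> = pr (image_mset Fr D) b" by (simp add: pr_def image_mset.compositionality o_def)
    finally show ?thesis using D by (simp add: stable_def)
  qed
  moreover have "pr D b \<noteq> 0" for b using D C_nz by (fastforce simp: pr_def stable_def prod_mset_zero_iff)
  ultimately show ?thesis by (auto simp: U_def)
qed

lemma pr_add: "pr (D + E) = vm (pr D) (pr E)"
  by (rule ext) (simp add: pr_def vm_def)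

lemma stable_add: "stable D \<Longrightarrow> stable E \<Longrightarrow> stable (D + E)"
  by (auto simp: stable_def)

lemma stable_diff: "stable D \<Longrightarrow> stable E \<Longrightarrow> E \<subseteq># D \<Longrightarrow> stable (D - E)"
  by (auto simp: stable_def image_mset_Diff dest: in_diffD)

lemma ch_pr_add: "stable D \<Longrightarrow> stable E \<Longrightarrow> ch (pr (D + E)) = ch (pr D) * ch (pr E)"
  by (simp add: pr_add ch_vm pr_in_U)

lemma St_0: "St 0 = {{#}}" "ad 0 = 1"
proof -
  show 1: "St 0 = {{#}}" by (auto simp: St_def stable_def)
  have "pr {#} = (\<lambda>_. 1)" by (simp add: pr_def fun_eq_iff)
  thus "ad 0 = 1" by (simp add: ad_def 1 ch_one)
qed

lemma size_orb: "size (orb k v) = k"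
  by (simp add: orb_def)

lemma orb_Suc: "orb (Suc k) v = add_mset v (orb k (Fr v))"
proof -
  have "orb (Suc k) v = image_mset (\<lambda>t. (Fr ^^ t) v) (mset_set (insert 0 (Suc ` {..<k})))"
    by (simp add: orb_def lessThan_Suc_eq_insert_0)
  also have "\<dots> = add_mset v (image_mset (\<lambda>t. (Fr ^^ t) v) (image_mset Suc (mset_set {..<k})))"
    by (subst mset_set.insert) (auto simp: image_mset_mset_set)
  finally show ?thesis by (simp add: orb_def image_mset.compositionality o_def funpow_swap1)
qed

lemma orb_add: "orb (k + r) v = orb k v + orb r ((Fr ^^ k) v)"
proof (induction k arbitrary: v)
  case (Suc k)
  thus ?case by (simp add: orb_Suc funpow_swap1)
qed (simp add: orb_def)

lemma image_Fr_orb: "image_mset Fr (orb k v) = orb k (Fr v)"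
  by (simp add: orb_def image_mset.compositionality o_def funpow_swap1)

lemma stable_orb:
  assumes "v \<in> Ck k"
  shows "stable (orb k v)"
proof -
  have v: "v \<in> C" "(Fr ^^ k) v = v" using assms by (auto simp: Ck_def)
  have "add_mset v (orb k (Fr v)) = orb (Suc k) v" by (simp add: orb_Suc)
  also have "\<dots> = orb (k + 1) v" by simp
  also have "\<dots> = orb k v + {#v#}" unfolding orb_add v(2) by (simp add: orb_def lessThan_Suc)
  finally have "orb k (Fr v) = orb k v" by simp
  moreover have "set_mset (orb k v) \<subseteq> C" using Frk_in_C[OF v(1)] by (auto simp: orb_def)
  ultimately show ?thesis by (simp add: stable_def image_Fr_orb)
qed

lemma pr_orb: "pr (orb k v) = Nm k v"
  by (rule ext) (simp add: pr_def Nm_def orb_def prod_unfold_prod_mset image_mset.compositionality o_def)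

lemma orb_in_St: "v \<in> Ck k \<Longrightarrow> orb k v \<in> St k"
  by (simp add: St_def stable_orb size_orb)

text \<open>The completions of \<open>D\<close> to principal divisors are the
  \<open>dv m f - D\<close>; their number depends on the degree of \<open>D\<close> only.\<close>

lemma count_principal:
  assumes m: "m > 0" and D: "stable D" "size D + 4 \<le> 6 * m" "size D + r = 6 * m"
  shows "card {E \<in> St r. D + E \<in> dv m ` Mf m} = q ^ (6 * m - 3 - size D)"
proof -
  have DC: "set_mset D \<subseteq> C" using D by (simp add: stable_def)
  have MM: "f \<in> Mo m" if "f \<in> Mf m" for f using that by (simp add: Mf_def)
  have "bij_betw (\<lambda>f. dv m f - D) {f \<in> Mf m. f \<in> ID D} {E \<in> St r. D + E \<in> dv m ` Mf m}"
  proof (rule bij_betw_imageI)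
    show "inj_on (\<lambda>f. dv m f - D) {f \<in> Mf m. f \<in> ID D}"
    proof (rule inj_onI)
      fix f g assume fg: "f \<in> {f \<in> Mf m. f \<in> ID D}" "g \<in> {f \<in> Mf m. f \<in> ID D}" "dv m f - D = dv m g - D"
      have fg': "f \<in> Mf m" "f \<in> ID D" "g \<in> Mf m" "g \<in> ID D" using fg(1,2) by simp_all
      have "D \<subseteq># dv m f" "D \<subseteq># dv m g" by (simp_all only: dv_ge_iff[OF m MM[OF fg'(1)] DC] dv_ge_iff[OF m MM[OF fg'(3)] DC] fg')
      hence "dv m f - D + D = dv m f" "dv m g - D + D = dv m g" by (simp_all only: subset_mset.diff_add)
      hence "dv m f = dv m g" using fg(3) by metis
      thus "f = g" by (rule dv_inj[OF m MM[OF fg'(1)] MM[OF fg'(3)]])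
    qed
    show "(\<lambda>f. dv m f - D) ` {f \<in> Mf m. f \<in> ID D} = {E \<in> St r. D + E \<in> dv m ` Mf m}"
    proof (intro equalityI subsetI)
      fix E assume "E \<in> (\<lambda>f. dv m f - D) ` {f \<in> Mf m. f \<in> ID D}"
      then obtain f where f: "f \<in> Mf m" "f \<in> ID D" and Ef: "E = dv m f - D" by blast
      have sub: "D \<subseteq># dv m f" by (simp only: dv_ge_iff[OF m MM[OF f(1)] DC] f(2))
      have "size (dv m f - D) = r" using size_Diff_submset[OF sub] dv_props(2)[OF m MM[OF f(1)]] D(3) by simp
      hence "dv m f - D \<in> St r" using stable_diff[OF dv_stable[OF m f(1)] D(1) sub] by (simp add: St_def)
      moreover have "D + (dv m f - D) \<in> dv m ` Mf m"
        unfolding subset_mset.add_diff_inverse[OF sub] by (rule imageI[OF f(1)])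
      ultimately show "E \<in> {E \<in> St r. D + E \<in> dv m ` Mf m}" unfolding Ef by (intro CollectI conjI)
    next
      fix E assume "E \<in> {E \<in> St r. D + E \<in> dv m ` Mf m}"
      then obtain f where E: "E \<in> St r" "D + E = dv m f" "f \<in> Mf m" by blast
      have "D \<subseteq># dv m f" unfolding E(2)[symmetric] by simp
      hence "f \<in> ID D" by (simp only: dv_ge_iff[OF m MM[OF E(3)] DC])
      moreover have "E = dv m f - D" unfolding E(2)[symmetric] by simp
      ultimately show "E \<in> (\<lambda>f. dv m f - D) ` {f \<in> Mf m. f \<in> ID D}" using E(3) by (intro image_eqI[of _ _ f] CollectI conjI)
    qed
  qed
  from bij_betw_same_card[OF this] show ?thesis using card_Mf(1)[OF m D(1,2)] by simp
qed

text \<open>The functional equation \<open>D \<mapsto> D'\<close>, \<open>D + D' + E\<close> principal, holds with the same constants for every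
  auxiliary divisor \<open>E\<close> of given degree, although the left side is multiplied by the value of
  the character at \<open>E\<close>.\<close>

lemma ad_eq_0:
  assumes E: "E1 \<in> St e" "E2 \<in> St e" "ch (pr E1) \<noteq> ch (pr E2)" and d: "d \<ge> 4"
  shows "ad d = 0"
proof -
  define m where "m = d + e + 1"
  define r where "r = 6 * m - d - e"
  have m: "m > 0" by (simp add: m_def)
  define Rm where "Rm = dv m ` Mf m"
  define \<kappa> where "\<kappa> = ch (\<lambda>_. n ^ (2 * m))"
  have key: "of_nat (q ^ (6 * m - 3 - (d + e))) * (ch (pr E) * ad d)
      = of_nat (q ^ (6 * m - 3 - (r + e))) * (\<Sum>D'\<in>St r. \<kappa> / ch (pr D'))" if E: "E \<in> St e" for E
  proof -
    have sE: "stable E" "size E = e" using E by (auto simp: St_def)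
    have "of_nat (q ^ (6 * m - 3 - (d + e))) * (ch (pr E) * ad d)
        = (\<Sum>D\<in>St d. \<Sum>D'\<in>{D' \<in> St r. D + E + D' \<in> Rm}. ch (pr D) * ch (pr E))"
    proof -
      have "card {D' \<in> St r. D + E + D' \<in> Rm} = q ^ (6 * m - 3 - (d + e))" if "D \<in> St d" for D
        using count_principal[OF m stable_add[of D E], of r] that sE by (simp add: St_def Rm_def m_def r_def)
      thus ?thesis by (simp add: ad_def sum_distrib_left sum_distrib_right mult.assoc mult.commute[of "ch (pr E)"])
    qed
    also have "\<dots> = (\<Sum>D'\<in>St r. \<Sum>D\<in>{D \<in> St d. D + E + D' \<in> Rm}. ch (pr D) * ch (pr E))"
      by (rule sum.swap_restrict[OF finite_St finite_St])
    also have "\<dots> = (\<Sum>D'\<in>St r. \<Sum>D\<in>{D \<in> St d. D' + E + D \<in> Rm}. \<kappa> / ch (pr D'))"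
    proof (intro sum.cong refl)
      fix D' assume "D' \<in> St r"
      show "{D \<in> St d. D + E + D' \<in> Rm} = {D \<in> St d. D' + E + D \<in> Rm}" by (simp add: add_ac)
    next
      fix D' D assume D': "D' \<in> St r" and D: "D \<in> {D \<in> St d. D' + E + D \<in> Rm}"
      have st: "stable D" "stable D'" using D D' by (auto simp: St_def)
      obtain f where f: "f \<in> Mf m" "D' + E + D = dv m f" using D by (auto simp: Rm_def)
      have "pr (D' + E + D) = (\<lambda>_. n ^ (2 * m))"
        unfolding f(2) using dv_product[OF m] f(1) by (auto simp: pr_def Mf_def)
      hence "\<kappa> = ch (pr D') * ch (pr E) * ch (pr D)"
        unfolding \<kappa>_def using ch_pr_add[OF stable_add[OF st(2) sE(1)] st(1)] ch_pr_add[OF st(2) sE(1)] by simp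
      moreover have "ch (pr D') \<noteq> 0" using ch_norm[OF pr_in_U[OF st(2)]] by auto
      ultimately show "ch (pr D) * ch (pr E) = \<kappa> / ch (pr D')" by simp
    qed
    also have "\<dots> = of_nat (q ^ (6 * m - 3 - (r + e))) * (\<Sum>D'\<in>St r. \<kappa> / ch (pr D'))"
    proof -
      \<comment> \<open>\<open>D' + E\<close> has degree \<open>6 * m - d\<close>, and the count
        requires a degree of at most \<open>6 * m - 4\<close>: this is where
        \<open>d \<ge> 4\<close> enters.\<close>
      have "card {D \<in> St d. D' + E + D \<in> Rm} = q ^ (6 * m - 3 - (r + e))" if "D' \<in> St r" for D'
        using count_principal[OF m stable_add[of D' E], of d] that sE d by (simp add: St_def Rm_def m_def r_def)
      thus ?thesis by (simp add: sum_distrib_left)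
    qed
    finally show ?thesis .
  qed
  have "of_nat (q ^ (6 * m - 3 - (d + e))) * (ch (pr E1) * ad d)
      = of_nat (q ^ (6 * m - 3 - (d + e))) * (ch (pr E2) * ad d)"
    unfolding key[OF E(1)] key[OF E(2)] ..
  moreover have "of_nat (q ^ (6 * m - 3 - (d + e))) \<noteq> (0::complex)" using q_gt_1 by simp
  ultimately have "ch (pr E1) * ad d = ch (pr E2) * ad d" by (subst (asm) mult_left_cancel)
  thus ?thesis using E(3) by simp
qed

end

section \<open>Bounded power sums and Newton's identities\<close>

lemma norm_le_1_of_bounded_powers:
  fixes x :: complex
  assumes "c \<noteq> 0" and bd: "\<And>j. j \<ge> j0 \<Longrightarrow> norm (c * x ^ j) \<le> K"
  shows "norm x \<le> 1"
proof (rule ccontr)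
  assume "\<not> norm x \<le> 1"
  then obtain j where j: "K / norm c < norm x ^ j" using real_arch_pow[of "norm x" "K / norm c"] by auto
  have "norm x ^ j \<le> norm x ^ (j + j0)" using \<open>\<not> norm x \<le> 1\<close> by (intro power_increasing) auto
  hence "K / norm c < norm x ^ (j + j0)" using j by linarith
  hence "K < norm c * norm x ^ (j + j0)" using assms(1) by (simp add: divide_less_eq mult.commute)
  thus False using bd[of "j + j0"] by (simp add: norm_mult norm_power)
qed

text \<open>Applying shift minus \<open>y\<close> and shift minus \<open>z\<close> to the bounded
  sequence isolates a nonzero multiple of \<open>x ^ j\<close>; when numbers coincide, fewer
  operators are applied and a multiplicity appears as factor.\<close>

lemma norm_le_1_of_bounded_power_sums:
  fixes x y z :: complex
  assumes bd: "\<And>j. j \<ge> j0 \<Longrightarrow> norm (x ^ j + y ^ j + z ^ j) \<le> K"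
  shows "norm x \<le> 1"
proof -
  define p where "p j = x ^ j + y ^ j + z ^ j" for j
  have p: "norm (p j) \<le> K" if "j \<ge> j0" for j using bd[OF that] by (simp add: p_def)
  have diff: "norm (p (Suc j) - w * p j) \<le> K + norm w * K" if "j \<ge> j0" for j w
    using norm_triangle_ineq4[of "p (Suc j)" "w * p j"] p[of j] p[of "Suc j"] that
      mult_left_mono[OF p[OF that], of "norm w"] by (simp add: norm_mult)
  consider "x = y" "x = z" | "x = y" "x \<noteq> z" | "x \<noteq> y" "x = z" | "x \<noteq> y" "x \<noteq> z" by blast
  thus ?thesis
  proof cases
    case 1
    have "norm (3 * x ^ j) \<le> K" if "j \<ge> j0" for j using p[OF that] 1 by (simp add: p_def)
    thus ?thesis by (rule norm_le_1_of_bounded_powers[rotated]) auto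
  next
    case 2
    have "norm (2 * (x - z) * x ^ j) \<le> K + norm z * K" if "j \<ge> j0" for j
      using diff[OF that, of z] 2 by (simp add: p_def algebra_simps)
    thus ?thesis by (rule norm_le_1_of_bounded_powers[rotated]) (use 2 in auto)
  next
    case 3
    have "norm (2 * (x - y) * x ^ j) \<le> K + norm y * K" if "j \<ge> j0" for j
      using diff[OF that, of y] 3 by (simp add: p_def algebra_simps)
    thus ?thesis by (rule norm_le_1_of_bounded_powers[rotated]) (use 3 in auto)
  next
    case 4
    define L where "L = K + norm y * K"
    define u where "u j = p (Suc j) - y * p j" for j
    have u: "norm (u j) \<le> L" if "j \<ge> j0" for j using diff[OF that, of y] by (simp add: L_def u_def)
    have "norm ((x - y) * (x - z) * x ^ j) \<le> L + norm z * L" if "j \<ge> j0" for j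
    proof -
      have "(x - y) * (x - z) * x ^ j = u (Suc j) - z * u j" by (simp add: u_def p_def algebra_simps)
      moreover have "norm (u (Suc j) - z * u j) \<le> L + norm z * L"
        using norm_triangle_ineq4[of "u (Suc j)" "z * u j"] u[of j] u[of "Suc j"] that
          mult_left_mono[OF u[OF that], of "norm z"] by (simp add: norm_mult)
      ultimately show ?thesis by simp
    qed
    thus ?thesis by (rule norm_le_1_of_bounded_powers[rotated]) (use 4 in auto)
  qed
qed

lemma cubic_roots:
  obtains a b c :: complex where "e1 = - (a + b + c)" "e2 = a * b + b * c + c * a" "e3 = - (a * b * c)"
proof -
  obtain a where a: "poly [:e3, e2, e1, 1:] a = 0" using alg_closed_imp_poly_has_root[of "[:e3, e2, e1, 1:]"] by auto
  define p r where "p = e1 + a" and "r = e2 + a * p"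
  obtain b where b: "poly [:r, p, 1:] b = 0" using alg_closed_imp_poly_has_root[of "[:r, p, 1:]"] by auto
  define c where "c = - (p + b)"
  have "r = - (b * (p + b))" using b by (simp add: eq_neg_iff_add_eq_0)
  hence r: "b * c = r" unfolding c_def mult_minus_right by (rule sym)
  have "e3 = - (a * (e2 + a * (e1 + a)))" using a by (simp add: eq_neg_iff_add_eq_0)
  hence e3: "e3 = - (a * r)" by (simp add: r_def p_def)
  show thesis
  proof (rule that[of a b c])
    show "e1 = - (a + b + c)" by (simp add: c_def p_def)
    have "e2 = r - a * p" and p: "p = - (b + c)" by (simp_all add: r_def c_def)
    thus "e2 = a * b + b * c + c * a" unfolding r p by (simp add: algebra_simps)
    show "e3 = - (a * b * c)" using r e3 by (simp add: mult.assoc)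
  qed
qed

lemma newton_step:
  fixes e1 :: complex
  assumes "A4 = e1 * A3 - e2 * A2 + e3 * A1" "B4 = e1 * B3 - e2 * B2 + e3 * B1" "C4 = e1 * C3 - e2 * C2 + e3 * C1"
    "S4 = - (S3 * - e1 + S2 * e2 + S1 * - e3)" "S3 = - (A3 + B3 + C3)" "S2 = - (A2 + B2 + C2)" "S1 = - (A1 + B1 + C1)"
  shows "S4 = - (A4 + B4 + C4)"
  unfolding assms by (simp add: algebra_simps)

section \<open>Inverse roots and the Weil bound\<close>

context twisted_character
begin

text \<open>Otherwise the character would be constant on all \<open>orb k v\<close> for fixed
  \<open>k\<close>, and the character sum would have absolute value \<open>card (Ck k)\<close>,
  against \<open>character_sum_bound\<close>.\<close>

lemma character_not_constant:
  "\<exists>e E1 E2. E1 \<in> St e \<and> E2 \<in> St e \<and> ch (pr E1) \<noteq> ch (pr E2)"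
proof (rule ccontr)
  assume none: "\<not> ?thesis"
  define e where "e = q ^ 6 - 1"
  define K where "K = 3 * ((3 * e) * (3 * e)) + 31"
  \<comment> \<open>Then \<open>R \<ge> K + 40\<close>, so \<open>R * R - 28 * R - 2\<close>, a
    lower bound for the number of points, exceeds \<open>K * R\<close>.\<close>
  define j where "j = K + 40"
  define R where "R = q ^ (3 * j)"
  have "3 * j < R" unfolding R_def by (rule power_gt_expt[OF q_gt_1[unfolded One_nat_def]])
  hence RK: "K + 40 \<le> R" by (simp add: j_def)
  hence "2 * ((3 * e) * (3 * e)) + 5 \<le> q ^ (3 * j)" by (simp add: K_def R_def)
  hence le: "norm (S (6 * j)) \<le> real K * R"
    using character_sum_bound[of j] unfolding K_def R_def e_def by simp
  have QR: "q ^ (6 * j) = R * R" by (simp add: R_def flip: power_add)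
  have "23 \<le> q ^ (3 * j)" using RK by (simp add: R_def)
  hence ge: "R * R \<le> card (Ck (6 * j)) + 28 * R + 2" using card_Ck_ge[of j] by (simp add: QR R_def[symmetric])
  have Kge: "(K + 40) * R \<le> R * R" using RK by (rule mult_right_mono) simp
  have R1: "R \<ge> 40" using RK by simp
  have "card (Ck (6 * j)) > K * R" using ge Kge R1 by (simp add: algebra_simps)
  have j0: "6 * j > 0" by (simp add: j_def)
  have "Ck (6 * j) \<noteq> {}" using \<open>card (Ck (6 * j)) > K * R\<close> by auto
  then obtain w where w: "w \<in> Ck (6 * j)" by blast
  have eq: "ch (Nm (6 * j) v) = ch (Nm (6 * j) w)" if "v \<in> Ck (6 * j)" for v
    using none orb_in_St[OF w] orb_in_St[OF that] by (metis pr_orb)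
  have "S (6 * j) = of_nat (card (Ck (6 * j))) * ch (Nm (6 * j) w)"
    unfolding S_def using eq by simp
  moreover have "norm (ch (Nm (6 * j) w)) = 1" using ch_norm[OF pr_in_U[OF stable_orb[OF w]]] by (simp add: pr_orb)
  ultimately have "norm (S (6 * j)) = real (card (Ck (6 * j)))" by (simp add: norm_mult)
  hence "real (card (Ck (6 * j))) \<le> real (K * R)" using le by simp
  thus False using \<open>card (Ck (6 * j)) > K * R\<close> by linarith
qed

lemma ad_eq_0': "d \<ge> 4 \<Longrightarrow> ad d = 0"
  using character_not_constant ad_eq_0 by blast

definition per :: "(3 \<Rightarrow> 'a) \<Rightarrow> nat" where
  "per v = (LEAST r. r > 0 \<and> (Fr ^^ r) v = v)"

lemma per:
  assumes "k > 0" "(Fr ^^ k) v = v"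
  shows "per v > 0" "(Fr ^^ per v) v = v" "per v dvd k" "inj_on (\<lambda>i. (Fr ^^ i) v) {..<per v}"
proof -
  have L: "per v > 0 \<and> (Fr ^^ per v) v = v" unfolding per_def by (rule LeastI[of "\<lambda>r. r > 0 \<and> (Fr ^^ r) v = v" k]) (simp add: assms)
  thus "per v > 0" and pv: "(Fr ^^ per v) v = v" by auto
  have not: "\<not> (r > 0 \<and> (Fr ^^ r) v = v)" if "r < per v" for r
    using not_less_Least[of r "\<lambda>r. r > 0 \<and> (Fr ^^ r) v = v"] that by (simp add: per_def)
  have "(Fr ^^ (k mod per v)) v = v" using funpow_mod_eq[OF pv, of k] assms(2) by simp
  moreover have "k mod per v < per v" using L by simp
  ultimately have "k mod per v = 0" using not[of "k mod per v"] by simp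
  thus "per v dvd k" by (simp add: dvd_eq_mod_eq_0)
  have ne: "(Fr ^^ i) v \<noteq> (Fr ^^ k) v" if "i < k" "k < per v" for i k
  proof
    assume H: "(Fr ^^ i) v = (Fr ^^ k) v"
    have "(Fr ^^ (k - i)) v = v" by (rule Fr_funpow_cancel[of i]) (use H that in simp)
    moreover have "k - i < per v" "k - i > 0" using that by auto
    ultimately show False using not[of "k - i"] by blast
  qed
  show "inj_on (\<lambda>i. (Fr ^^ i) v) {..<per v}"
  proof (rule inj_onI)
    fix i k assume H: "i \<in> {..<per v}" "k \<in> {..<per v}" "(Fr ^^ i) v = (Fr ^^ k) v"
    show "i = k" using ne[of i k] ne[of k i] H by (cases i k rule: linorder_cases) auto
  qed
qed

lemma orb_mult:
  assumes "(Fr ^^ r) v = v"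
  shows "orb (r * t) v = repeat_mset t (orb r v)"
proof (induction t)
  case 0 show ?case by (simp add: orb_def)
next
  case (Suc t)
  have "orb (r * Suc t) v = orb r v + orb (r * t) v" using orb_add[of r "r * t" v] assms by simp
  thus ?case by (simp add: Suc)
qed

lemma orb_subset_iff:
  assumes D: "stable D" and v: "per v > 0" "(Fr ^^ per v) v = v" "inj_on (\<lambda>i. (Fr ^^ i) v) {..<per v}"
  shows "orb (per v * t) v \<subseteq># D \<longleftrightarrow> t \<le> count D v"
proof -
  have c: "count (orb (per v) v) w = (if w \<in> (\<lambda>i. (Fr ^^ i) v) ` {..<per v} then 1 else 0)" for w
    unfolding orb_def image_mset_mset_set[OF v(3)] by simp
  have v0: "v \<in> (\<lambda>i. (Fr ^^ i) v) ` {..<per v}" using v(1) by (intro image_eqI[of _ _ 0]) auto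
  have "orb (per v * t) v \<subseteq># D \<longleftrightarrow> (\<forall>w\<in>(\<lambda>i. (Fr ^^ i) v) ` {..<per v}. t \<le> count D w)"
    unfolding orb_mult[OF v(2)] subseteq_mset_def by (auto simp: c)
  also have "\<dots> \<longleftrightarrow> t \<le> count D v"
    using v0 by (auto simp: count_Fr[OF D])
  finally show ?thesis .
qed

text \<open>A point of period r and multiplicity c in \<open>D\<close> contributes the lengths r t
  with t from 1 to c, so multiplicities are added up.\<close>

lemma card_orb_subset:
  assumes D: "D \<in> St d"
  shows "card {(k, v). k \<in> {1..d} \<and> v \<in> Ck k \<and> orb k v \<subseteq># D} = d"
proof -
  have sD: "stable D" "size D = d" using D by (auto simp: St_def)
  have perD: "per v > 0 \<and> (Fr ^^ per v) v = v \<and> inj_on (\<lambda>i. (Fr ^^ i) v) {..<per v}" if vD: "v \<in># D" for v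
  proof -
    obtain r where "r > 0" "(Fr ^^ r) v = v" using stable_period[OF sD(1) vD] by blast
    thus ?thesis using per[of r v] by simp
  qed
  have sub: "orb (per v * t) v \<subseteq># D \<longleftrightarrow> t \<le> count D v" if "v \<in># D" for v t
    using orb_subset_iff[OF sD(1), of v t] perD[OF that] by simp
  have "bij_betw (\<lambda>(v, t). (per v * t, v)) (SIGMA v:set_mset D. {1..count D v})
      {(k, v). k \<in> {1..d} \<and> v \<in> Ck k \<and> orb k v \<subseteq># D}"
  proof (rule bij_betw_imageI)
    show "inj_on (\<lambda>(v, t). (per v * t, v)) (SIGMA v:set_mset D. {1..count D v})"
    proof (rule inj_onI, clarify)
      fix v t u assume "v \<in># D" "per v * t = per v * u"
      thus "v = v \<and> t = u" using perD[of v] by simp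
    qed
    show "(\<lambda>(v, t). (per v * t, v)) ` (SIGMA v:set_mset D. {1..count D v})
        = {(k, v). k \<in> {1..d} \<and> v \<in> Ck k \<and> orb k v \<subseteq># D}"
    proof (intro equalityI subsetI)
      fix z assume "z \<in> (\<lambda>(v, t). (per v * t, v)) ` (SIGMA v:set_mset D. {1..count D v})"
      then obtain y where y: "y \<in> (SIGMA v:set_mset D. {1..count D v})" "z = (\<lambda>(v, t). (per v * t, v)) y" by (rule imageE)
      obtain v t where vt: "y = (v, t)" by (cases y)
      have z: "z = (per v * t, v)" "v \<in># D" "1 \<le> t" "t \<le> count D v" using y by (simp_all add: vt)
      have o: "orb (per v * t) v \<subseteq># D" using sub z by simp
      have "per v * t \<le> d" using size_mset_mono[OF o] sD(2) by (simp add: size_orb)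
      moreover have "per v * t \<ge> 1" using perD[OF z(2)] z(3) by simp
      moreover have "(Fr ^^ (per v * t)) v = v"
        using funpow_mod_eq[where f = Fr and n = "per v" and x = v and m = "per v * t"] perD[OF z(2)] by simp
      moreover have "v \<in> C" using z(2) sD(1) by (auto simp: stable_def)
      ultimately show "z \<in> {(k, v). k \<in> {1..d} \<and> v \<in> Ck k \<and> orb k v \<subseteq># D}"
        unfolding z(1) using o by (simp add: Ck_def)
    next
      fix z assume "z \<in> {(k, v). k \<in> {1..d} \<and> v \<in> Ck k \<and> orb k v \<subseteq># D}"
      then obtain k v where z: "z = (k, v)" "k \<ge> 1" "v \<in> Ck k" "orb k v \<subseteq># D" by auto
      have "orb k v = add_mset v (orb (k - 1) (Fr v))" using orb_Suc[of "k - 1" v] z(2) by simp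
      hence "v \<in># orb k v" by simp
      hence vD: "v \<in># D" by (rule mset_subset_eqD[OF z(4)])
      have "per v dvd k" by (rule per(3)) (use z in \<open>simp_all add: Ck_def\<close>)
      then obtain t where t: "k = per v * t" by (rule dvdE)
      have "t \<ge> 1" using t z(2) by (cases t) auto
      moreover have "t \<le> count D v" using sub[OF vD] z(4) t by simp
      ultimately show "z \<in> (\<lambda>(v, t). (per v * t, v)) ` (SIGMA v:set_mset D. {1..count D v})"
        using vD by (intro image_eqI[of _ _ "(v, t)"]) (simp_all add: t z(1))
    qed
  qed
  hence "card {(k, v). k \<in> {1..d} \<and> v \<in> Ck k \<and> orb k v \<subseteq># D} = card (SIGMA v:set_mset D. {1..count D v})"
    by (rule bij_betw_same_card[symmetric])
  also have "\<dots> = size D" by (simp add: size_multiset_overloaded_eq)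
  finally show ?thesis using sD by simp
qed

text \<open>The logarithmic derivative of the L-function, coefficientwise:
  \<open>card_orb_subset\<close> weights a divisor by its degree, and splitting off an orbit factors
  the character.\<close>

lemma ad_newton: "of_nat d * ad d = (\<Sum>k\<in>{1..d}. S k * ad (d - k))"
proof -
  define A where "A = (SIGMA k:{1..d}. Ck k)"
  have fA: "finite A" unfolding A_def by (intro finite_SigmaI finite_Ck) auto
  have "(\<Sum>k\<in>{1..d}. S k * ad (d - k)) = (\<Sum>k\<in>{1..d}. \<Sum>v\<in>Ck k. ch (Nm k v) * ad (d - k))"
    by (simp add: S_def sum_distrib_right)
  also have "\<dots> = (\<Sum>z\<in>A. ch (Nm (fst z) (snd z)) * ad (d - fst z))"
    unfolding A_def by (subst sum.Sigma) (auto intro: finite_Ck simp: case_prod_beta)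
  also have "\<dots> = (\<Sum>z\<in>A. \<Sum>D\<in>{D \<in> St d. orb (fst z) (snd z) \<subseteq># D}. ch (pr D))"
  proof (rule sum.cong[OF refl])
    fix z assume "z \<in> A"
    then obtain k v where z: "z = (k, v)" "1 \<le> k" "k \<le> d" "v \<in> Ck k" by (auto simp: A_def)
    have so: "stable (orb k v)" by (rule stable_orb[OF z(4)])
    have b: "bij_betw (\<lambda>E. orb k v + E) (St (d - k)) {D \<in> St d. orb k v \<subseteq># D}"
    proof (rule bij_betw_imageI)
      show "inj_on (\<lambda>E. orb k v + E) (St (d - k))" by (auto simp: inj_on_def)
      show "(\<lambda>E. orb k v + E) ` St (d - k) = {D \<in> St d. orb k v \<subseteq># D}"
      proof (intro equalityI subsetI)
        fix D assume "D \<in> (\<lambda>E. orb k v + E) ` St (d - k)"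
        thus "D \<in> {D \<in> St d. orb k v \<subseteq># D}" using stable_add[OF so] z by (auto simp: St_def size_orb)
      next
        fix D assume D: "D \<in> {D \<in> St d. orb k v \<subseteq># D}"
        hence "D - orb k v \<in> St (d - k)" using stable_diff[OF _ so] by (auto simp: St_def size_orb size_Diff_submset)
        moreover have "D = orb k v + (D - orb k v)" using D by simp
        ultimately show "D \<in> (\<lambda>E. orb k v + E) ` St (d - k)" by blast
      qed
    qed
    have "(\<Sum>D\<in>{D \<in> St d. orb k v \<subseteq># D}. ch (pr D)) = (\<Sum>E\<in>St (d - k). ch (pr (orb k v + E)))"
      by (rule sum.reindex_bij_betw[OF b, symmetric])
    also have "\<dots> = (\<Sum>E\<in>St (d - k). ch (Nm k v) * ch (pr E))"
      by (intro sum.cong refl) (use so in \<open>auto simp: St_def ch_pr_add pr_orb\<close>)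
    also have "\<dots> = ch (Nm k v) * ad (d - k)" by (simp add: ad_def sum_distrib_left)
    finally show "ch (Nm (fst z) (snd z)) * ad (d - fst z) = (\<Sum>D\<in>{D \<in> St d. orb (fst z) (snd z) \<subseteq># D}. ch (pr D))"
      using z(1) by simp
  qed
  also have "\<dots> = (\<Sum>D\<in>St d. \<Sum>z\<in>{z \<in> A. orb (fst z) (snd z) \<subseteq># D}. ch (pr D))"
    by (rule sum.swap_restrict[OF fA finite_St])
  also have "\<dots> = (\<Sum>D\<in>St d. of_nat d * ch (pr D))"
  proof (rule sum.cong[OF refl])
    fix D assume "D \<in> St d"
    moreover have "{z \<in> A. orb (fst z) (snd z) \<subseteq># D} = {(k, v). k \<in> {1..d} \<and> v \<in> Ck k \<and> orb k v \<subseteq># D}"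
      by (auto simp: A_def)
    ultimately show "(\<Sum>z\<in>{z \<in> A. orb (fst z) (snd z) \<subseteq># D}. ch (pr D)) = of_nat d * ch (pr D)"
      using card_orb_subset by simp
  qed
  also have "\<dots> = of_nat d * ad d" by (simp add: ad_def sum_distrib_left)
  finally show ?thesis by simp
qed

text \<open>The L-function is (1 - aT)(1 - bT)(1 - cT), so Newton's identities give the sums as
  negative power sums.\<close>

lemma S_eq_power_sum:
  assumes e: "ad 1 = - (a + b + c)" "ad 2 = a * b + b * c + c * a" "ad 3 = - (a * b * c)" and k: "k > 0"
  shows "S k = - (a ^ k + b ^ k + c ^ k)"
proof -
  have N1: "S 1 = ad 1" using ad_newton[of 1] St_0 by simp
  have "{1..2::nat} = {1, 2}" "{1..3::nat} = {1, 2, 3}" by auto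
  hence N2: "2 * ad 2 = S 1 * ad 1 + S 2" and N3: "3 * ad 3 = S 1 * ad 2 + S 2 * ad 1 + S 3"
    using ad_newton[of 2] ad_newton[of 3] St_0(2) by simp_all
  \<comment> \<open>From index 4 on the left side of \<open>ad_newton\<close> is zero, and on the
    right only the coefficients of degree at most 3 survive.\<close>
  have N4: "S (k + 4) + S (k + 3) * ad 1 + S (k + 2) * ad 2 + S (k + 1) * ad 3 = 0" for k
  proof -
    have "0 = (\<Sum>j\<in>{1..k+4}. S j * ad (k + 4 - j))" using ad_newton[of "k + 4"] ad_eq_0'[of "k + 4"] by simp
    also have "\<dots> = (\<Sum>j\<in>{k+1,k+2,k+3,k+4}. S j * ad (k + 4 - j))"
      by (rule sum.mono_neutral_right) (auto intro!: ad_eq_0')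
    also have "\<dots> = S (k + 4) + S (k + 3) * ad 1 + S (k + 2) * ad 2 + S (k + 1) * ad 3"
      using St_0(2) by simp
    finally show ?thesis by simp
  qed
  show ?thesis using k
  proof (induction k rule: less_induct)
    case (less k)
    have S1: "S 1 = - (a + b + c)" using N1 e by simp
    have "S 2 = 2 * ad 2 - S 1 * ad 1" using N2 by simp
    also have "\<dots> = - (a\<^sup>2 + b\<^sup>2 + c\<^sup>2)" unfolding S1 e by (simp add: power2_eq_square algebra_simps)
    finally have S2: "S 2 = - (a\<^sup>2 + b\<^sup>2 + c\<^sup>2)" .
    have "S 3 = 3 * ad 3 - S 1 * ad 2 - S 2 * ad 1" using N3 by simp
    also have "\<dots> = - (a ^ 3 + b ^ 3 + c ^ 3)" unfolding S1 S2 e by (simp add: power2_eq_square power3_eq_cube algebra_simps)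
    finally have S3: "S 3 = - (a ^ 3 + b ^ 3 + c ^ 3)" .
    consider "k = 1" | "k = 2" | "k = 3" | j where "k = j + 4"
    proof -
      have "k \<in> {1,2,3} \<or> k = (k - 4) + 4" using less.prems by auto
      thus thesis using that by blast
    qed
    thus ?case
    proof cases
      case (4 j)
      have "S (j + 4) = - (S (j + 3) * ad 1 + S (j + 2) * ad 2 + S (j + 1) * ad 3)"
        using N4[of j] by (simp only: eq_neg_iff_add_eq_0 add.assoc)
      moreover have "S (j + 3) = - (a ^ (j + 3) + b ^ (j + 3) + c ^ (j + 3))" by (rule less.IH) (simp_all add: 4)
      moreover have "S (j + 2) = - (a ^ (j + 2) + b ^ (j + 2) + c ^ (j + 2))" by (rule less.IH) (simp_all add: 4)
      moreover have "S (j + 1) = - (a ^ (j + 1) + b ^ (j + 1) + c ^ (j + 1))" by (rule less.IH) (simp_all add: 4)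
      moreover have "x ^ (j + 4) = (a + b + c) * x ^ (j + 3) - (a * b + b * c + c * a) * x ^ (j + 2) + a * b * c * x ^ (j + 1)"
        if "x = a \<or> x = b \<or> x = c" for x
      proof -
        have "x ^ 4 = (a + b + c) * x ^ 3 - (a * b + b * c + c * a) * x ^ 2 + a * b * c * x" using that
          by (elim disjE) (simp_all add: power2_eq_square power3_eq_cube power4_eq_xxxx algebra_simps)
        hence "x ^ j * x ^ 4 = x ^ j * ((a + b + c) * x ^ 3 - (a * b + b * c + c * a) * x ^ 2 + a * b * c * x)" by (rule arg_cong)
        thus ?thesis unfolding power_add power_one_right by (simp only: distrib_left right_diff_distrib mult_ac)
      qed
      ultimately have "S (j + 4) = - (a ^ (j + 4) + b ^ (j + 4) + c ^ (j + 4))"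
        unfolding e by (intro newton_step[of "a ^ (j + 4)" "a + b + c" "a ^ (j + 3)" "a * b + b * c + c * a" "a ^ (j + 2)" "a * b * c" "a ^ (j + 1)"
          "b ^ (j + 4)" "b ^ (j + 3)" "b ^ (j + 2)" "b ^ (j + 1)" "c ^ (j + 4)" "c ^ (j + 3)" "c ^ (j + 2)" "c ^ (j + 1)"]) blast+
      thus ?thesis unfolding 4 .
    qed (use S1 S2 S3 in simp_all)
  qed
qed

text \<open>Sixth powers of the inverse roots, divided by \<open>q ^ 3\<close>, have bounded power
  sums, so their absolute values are at most 1; the constant of the point counts disappears in this
  passage.\<close>

theorem character_sum_weil_bound: "norm (\<Sum>v\<in>Ck 1. ch v) \<le> 3 * sqrt q"
proof -
  obtain a b c where e: "ad 1 = - (a + b + c)" "ad 2 = a * b + b * c + c * a" "ad 3 = - (a * b * c)"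
    by (rule cubic_roots)
  define e where "e = q ^ 6 - 1"
  define j0 where "j0 = 2 * ((3 * e) * (3 * e)) + 5"
  define K where "K = real (3 * ((3 * e) * (3 * e)) + 31)"
  have bd: "norm (a ^ (6 * j) + b ^ (6 * j) + c ^ (6 * j)) \<le> K * real q ^ (3 * j)" if j: "j \<ge> j0" for j
  proof -
    have "3 * j < q ^ (3 * j)" by (rule power_gt_expt[OF q_gt_1[unfolded One_nat_def]])
    hence "j0 \<le> q ^ (3 * j)" using j by linarith
    hence "norm (S (6 * j)) \<le> K * real q ^ (3 * j)"
      using character_sum_bound[of j] unfolding j0_def K_def e_def by simp
    moreover have "S (6 * j) = - (a ^ (6 * j) + b ^ (6 * j) + c ^ (6 * j))"
      by (rule S_eq_power_sum[OF e]) (use j in \<open>simp add: j0_def\<close>)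
    ultimately show ?thesis by (simp only: norm_minus_cancel)
  qed
  define Q where "Q = complex_of_real (real q ^ 3)"
  have nQ: "norm Q = real q ^ 3" by (simp add: Q_def norm_power)
  have q0: "real q > 0" using q_gt_1 by simp
  have bd': "norm ((a ^ 6 / Q) ^ j + (b ^ 6 / Q) ^ j + (c ^ 6 / Q) ^ j) \<le> K" if "j \<ge> j0" for j
  proof -
    have "(a ^ 6 / Q) ^ j + (b ^ 6 / Q) ^ j + (c ^ 6 / Q) ^ j = (a ^ (6 * j) + b ^ (6 * j) + c ^ (6 * j)) / Q ^ j"
      by (simp add: power_divide add_divide_distrib power_mult)
    moreover have "norm (Q ^ j) = real q ^ (3 * j)" by (simp add: norm_power nQ power_mult)
    ultimately show ?thesis using bd[OF that] q0 by (simp add: norm_divide divide_le_eq)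
  qed
  have root: "norm x \<le> sqrt q" if "norm (x ^ 6 / Q) \<le> 1" for x
  proof -
    have "norm x ^ 6 \<le> real q ^ 3" using that q0 by (simp add: norm_divide nQ norm_power divide_le_eq)
    also have "\<dots> = sqrt q ^ 6" using q0 power_mult[of "sqrt q" 2 3] by simp
    finally show ?thesis by (rule power_le_imp_le_base[of _ 5, simplified]) (use q0 in auto)
  qed
  have "norm a \<le> sqrt q" using norm_le_1_of_bounded_power_sums[of j0 "a ^ 6 / Q" "b ^ 6 / Q" "c ^ 6 / Q" K] bd' root by blast
  moreover have "norm b \<le> sqrt q"
    using norm_le_1_of_bounded_power_sums[of j0 "b ^ 6 / Q" "a ^ 6 / Q" "c ^ 6 / Q" K] bd' root by (simp add: add_ac)
  moreover have "norm c \<le> sqrt q"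
    using norm_le_1_of_bounded_power_sums[of j0 "c ^ 6 / Q" "a ^ 6 / Q" "b ^ 6 / Q" K] bd' root by (simp add: add_ac)
  moreover have "norm (S 1) \<le> norm a + norm b + norm c"
    using S_eq_power_sum[OF e, of 1] norm_triangle_ineq[of "a + b" c] norm_triangle_ineq[of a b]
    by (simp del: minus_add_distrib add: norm_minus_cancel)
  moreover have "Nm 1 v = v" for v by (simp add: Nm_def fun_eq_iff)
  ultimately show ?thesis by (simp add: S_def)
qed

end

section \<open>Finite fields, Frobenius and Dedekind independence\<close>

lemma finite_field_power_card: "(x :: 'f::{field,finite}) ^ CARD('f) = x"
proof (cases "x = 0")
  case False
  define P where "P = (\<Prod>y\<in>-{0::'f}. y)"
  have "P \<noteq> 0" by (simp add: P_def)
  have "bij_betw (\<lambda>y. x * y) (-{0}) (-{0})"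
    using False by (intro bij_betwI[of _ _ _ "\<lambda>y. y / x"]) auto
  hence "P = (\<Prod>y\<in>-{0::'f}. x * y)" unfolding P_def by (rule prod.reindex_bij_betw[symmetric])
  also have "\<dots> = x ^ card (-{0::'f}) * P" by (simp add: prod.distrib P_def)
  finally have "x ^ card (-{0::'f}) = 1" using \<open>P \<noteq> 0\<close> by simp
  moreover have "CARD('f) = Suc (card (-{0::'f}))" using card_Suc_Diff1[of "UNIV::'f set" 0] by (simp add: Compl_eq_Diff_UNIV)
  ultimately show ?thesis by simp
qed (simp add: power_0_left)

lemma prime_CHAR_finite: "prime CHAR('f::{field,finite})"
  using finite_imp_CHAR_pos[OF finite_class.finite_UNIV] by (rule prime_CHAR_semidom)

text \<open>(1 + X)^q - X^q - 1 has degree below q and q roots, so it is zero and the characteristic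
  divides all inner binomial coefficients. That fails if q has a factor greater than 1 prime to the
  characteristic.\<close>

lemma card_finite_field: "\<exists>e>0. CARD('f::{field,finite}) = CHAR('f) ^ e"
proof -
  define q p where "q = CARD('f)" and "p = CHAR('f)"
  have p: "prime p" unfolding p_def by (rule prime_CHAR_finite)
  have "card {0, 1::'f} \<le> q" unfolding q_def by (rule card_mono) auto
  hence q1: "q > 1" by simp
  define P :: "'f poly" where "P = [:1, 1:] ^ q - monom 1 q - 1"
  have "P = 0"
  proof (rule ccontr)
    assume P0: "P \<noteq> 0"
    have "degree P \<le> q" unfolding P_def using q1
      by (intro degree_diff_le) (auto simp: degree_linear_power degree_monom_eq)
    moreover have "coeff P q = 0" unfolding P_def using q1 by (simp add: coeff_linear_power)
    ultimately have deg: "degree P < q" using P0 by (metis le_neq_implies_less leading_coeff_0_iff)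
    have "poly P x = 0" for x
    proof -
      have "poly P x = (1 + x) ^ q - x ^ q - 1" by (simp add: P_def poly_monom)
      thus ?thesis unfolding q_def by (simp add: finite_field_power_card)
    qed
    hence "CARD('f) \<le> degree P" using card_poly_roots_bound[OF P0] by simp
    thus False using deg by (simp add: q_def)
  qed
  have ch: "p dvd (q choose i)" if i: "0 < i" "i < q" for i
  proof -
    have "0 = coeff P i" by (simp add: \<open>P = 0\<close>)
    also have "\<dots> = of_nat (q choose i)" unfolding P_def using i by (simp add: coeff_linear_poly_power)
    finally show ?thesis by (simp add: p_def of_nat_eq_0_iff_char_dvd)
  qed
  define a where "a = multiplicity p q"
  have "q \<noteq> 0" "\<not> is_unit p" using q1 prime_gt_1_nat[OF p] by simp_all
  then obtain r where "q = p ^ multiplicity p q * r" "\<not> p dvd r" by (rule multiplicity_decompose')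
  hence r: "q = p ^ a * r" "\<not> p dvd r" unfolding a_def .
  have "r > 0" using r q1 by (cases r) auto
  have "r = 1"
  proof (rule ccontr)
    assume "r \<noteq> 1"
    hence "p ^ a * 1 < p ^ a * r" using \<open>r > 0\<close> prime_gt_0_nat[OF p] by (intro mult_strict_left_mono) auto
    hence "p ^ a < q" using r(1) by simp
    \<comment> \<open>This binomial coefficient has the same multiplicity of \<open>p\<close> as
      \<open>r\<close>, namely 0.\<close>
    hence "p dvd (p ^ a * r choose p ^ a)" using ch[of "p ^ a"] r prime_gt_0_nat[OF p] by simp
    moreover have "(p ^ a * r choose p ^ a) \<noteq> 0" using \<open>p ^ a < q\<close> r by simp
    ultimately have "multiplicity p (p ^ a * r choose p ^ a) \<noteq> 0"
      using p prime_multiplicity_gt_zero_iff[of p] by simp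
    hence "multiplicity p r \<noteq> 0" using const_p_fac[OF \<open>r > 0\<close> p] by simp
    thus False using not_dvd_imp_multiplicity_0[OF r(2)] by simp
  qed
  hence "q = p ^ a" using r(1) by (simp only: mult_1_right)
  moreover have "a > 0" using calculation q1 by (cases a) auto
  ultimately show ?thesis unfolding q_def p_def by blast
qed

lemma frobenius_inj:
  fixes x y :: "'k::field"
  assumes "prime CHAR('k)" "Q = CHAR('k) ^ m" "x ^ Q = y ^ Q"
  shows "x = y"
proof -
  have "(x - y) ^ Q + y ^ Q = (x - y + y) ^ Q" by (rule freshmans_dream'[OF assms(1,2), symmetric])
  also have "\<dots> = y ^ Q" using assms(3) by simp
  finally have "(x - y) ^ Q = 0" by simp
  hence "x - y = 0" unfolding power_eq_0_iff by blast
  thus ?thesis by simp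
qed

text \<open>Dedekind's independence of characters.\<close>

lemma multiplicative_maps_independent:
  fixes c :: "('b::comm_monoid_mult \<Rightarrow> 'k::field) \<Rightarrow> 'k"
  assumes "finite A" "\<And>\<psi>. \<psi> \<in> A \<Longrightarrow> \<psi> 1 = 1" "\<And>\<psi> x y. \<psi> \<in> A \<Longrightarrow> \<psi> (x * y) = \<psi> x * \<psi> y"
    "\<And>x. (\<Sum>\<psi>\<in>A. c \<psi> * \<psi> x) = 0"
  shows "\<forall>\<psi>\<in>A. c \<psi> = 0"
  using assms
proof (induction A arbitrary: c rule: finite_induct)
  case (insert \<psi>0 A)
  have z: "c \<psi> = 0" if \<psi>: "\<psi> \<in> A" for \<psi>
  proof -
    have ne: "\<psi> \<noteq> \<psi>0" using \<psi> insert.hyps by auto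
    then obtain y where y: "\<psi> y \<noteq> \<psi>0 y" by auto
    have "(\<Sum>\<psi>\<in>A. (c \<psi> * (\<psi> y - \<psi>0 y)) * \<psi> x) = 0" for x
    proof -
      have "(\<Sum>\<psi>\<in>A. (c \<psi> * (\<psi> y - \<psi>0 y)) * \<psi> x) = (\<Sum>\<psi>\<in>insert \<psi>0 A. (c \<psi> * (\<psi> y - \<psi>0 y)) * \<psi> x)"
        using insert.hyps by simp
      also have "\<dots> = (\<Sum>\<psi>\<in>insert \<psi>0 A. c \<psi> * \<psi> (y * x) - \<psi>0 y * (c \<psi> * \<psi> x))"
        by (intro sum.cong refl) (simp add: insert.prems(2) algebra_simps)
      also have "\<dots> = 0" unfolding sum_subtractf sum_distrib_left[symmetric] insert.prems(3) by simp
      finally show ?thesis .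
    qed
    hence "\<forall>\<psi>\<in>A. c \<psi> * (\<psi> y - \<psi>0 y) = 0" by (intro insert.IH) (auto simp: insert.prems)
    thus ?thesis using \<psi> y by auto
  qed
  have "c \<psi>0 = 0" using insert.prems(3)[of 1] insert.prems(1)[of \<psi>0] insert.hyps z by simp
  thus ?case using z by simp
qed simp

text \<open>The iterates stay among the finitely many roots of one polynomial, and injectivity of
  Frobenius turns a repetition into a period.\<close>

lemma alg_closure_frobenius_periodic:
  fixes c :: "'f::{field,finite} alg_closure"
  shows "\<exists>N>0. c ^ (CARD('f) ^ N) = c"
proof -
  define q where "q = CARD('f)"
  obtain e where e: "e > 0" "q = CHAR('f) ^ e" using card_finite_field[where ?'f = 'f] by (auto simp: q_def)
  have pr: "prime CHAR('f alg_closure)" using prime_CHAR_finite[where ?'f = 'f] by simp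
  have qN: "q ^ N = CHAR('f alg_closure) ^ (e * N)" for N by (simp add: e power_mult)
  obtain p :: "'f poly" where p: "p \<noteq> 0" "poly (map_poly to_ac p) c = 0" by (rule alg_closure_algebraic)
  have root: "poly (map_poly to_ac p) (c ^ (q ^ i)) = 0" for i
  proof -
    have "to_ac (x::'f) ^ (q ^ i) = to_ac x" for x
    proof (induction i)
      case (Suc i)
      have "to_ac x ^ q ^ Suc i = (to_ac x ^ (q ^ i)) ^ q" by (simp flip: power_mult add: mult.commute)
      also have "\<dots> = to_ac (x ^ q)" unfolding Suc by simp
      finally show ?case by (simp add: q_def finite_field_power_card)
    qed simp
    hence "poly (map_poly to_ac p) (c ^ (q ^ i)) = poly (map_poly to_ac p) c ^ (q ^ i)"
      unfolding poly_altdef freshmans_dream_sum'[OF pr qN]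
      by (intro sum.cong refl) (simp add: power_mult_distrib coeff_map_poly mult.commute flip: power_mult)
    thus ?thesis using p q_def by (simp add: power_0_left)
  qed
  have "map_poly to_ac p \<noteq> 0" using p(1) by (auto simp: poly_eq_iff coeff_map_poly)
  hence fin: "finite {x. poly (map_poly to_ac p) x = 0}" by (rule poly_roots_finite)
  have "\<not> inj (\<lambda>i. c ^ (q ^ i))"
  proof
    assume "inj (\<lambda>i. c ^ (q ^ i))"
    hence "infinite (range (\<lambda>i. c ^ (q ^ i)))" using range_inj_infinite by blast
    moreover have "range (\<lambda>i. c ^ (q ^ i)) \<subseteq> {x. poly (map_poly to_ac p) x = 0}" using root by auto
    ultimately show False using fin finite_subset by blast
  qed
  then obtain i j where ij: "i < j" "c ^ (q ^ i) = c ^ (q ^ j)"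
    using linorder_injI[of "\<lambda>i. c ^ (q ^ i)"] by blast
  have F: "(c ^ (q ^ (j - i))) ^ (q ^ i) = c ^ (q ^ j)" using ij(1) by (simp flip: power_mult power_add)
  have "(c ^ (q ^ (j - i))) ^ (q ^ i) = c ^ (q ^ i)" unfolding F by (rule ij(2)[symmetric])
  hence "c ^ (q ^ (j - i)) = c" by (rule frobenius_inj[OF pr qN])
  thus ?thesis using ij(1) by (intro exI[of _ "j - i"]) (simp add: q_def)
qed

text \<open>The base field alone already supplies all roots of X^q - X.\<close>

lemma fixed_by_frobenius_in_range:
  fixes c :: "'f::{field,finite} alg_closure"
  assumes "c ^ CARD('f) = c"
  shows "c \<in> range to_ac"
proof -
  obtain e where e: "e > 0" "CARD('f) = CHAR('f) ^ e" using card_finite_field[where ?'f = 'f] by auto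
  have pr: "prime CHAR('f alg_closure)" using prime_CHAR_finite[where ?'f = 'f] by simp
  define Z where "Z = {x::'f alg_closure. x ^ CARD('f) = x}"
  have cZ: "card Z = CARD('f)" unfolding Z_def by (rule card_frobenius_fixed[OF pr _ e(1)]) (simp add: e)
  have fZ: "finite Z" by (rule card_ge_0_finite) (simp add: cZ)
  have "range (to_ac :: 'f \<Rightarrow> _) \<subseteq> Z" unfolding Z_def by (auto simp: finite_field_power_card simp flip: to_ac_power)
  moreover have "card (range (to_ac :: 'f \<Rightarrow> _)) = CARD('f)" by (rule card_image) (simp add: inj_def)
  ultimately have "range (to_ac :: 'f \<Rightarrow> _) = Z" using fZ cZ by (intro card_subset_eq) simp_all
  thus ?thesis using assms by (auto simp: Z_def)
qed

section \<open>Etale cubic algebras over a finite field\<close>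

locale etale_cubic =
  fixes smul :: "'f::{field,finite} \<Rightarrow> 'b::comm_ring_1 \<Rightarrow> 'b"
  assumes etale: "finite_etale_cubic_algebra smul"
begin

sublocale field_algebra smul
  using etale by (simp add: finite_etale_cubic_algebra_def finite_etale_algebra_def)

definition alg_hom :: "('b \<Rightarrow> 'f alg_closure) \<Rightarrow> bool" where
  "alg_hom \<psi> \<longleftrightarrow> \<psi> 1 = 1 \<and> (\<forall>x y. \<psi> (x + y) = \<psi> x + \<psi> y) \<and> (\<forall>x y. \<psi> (x * y) = \<psi> x * \<psi> y)
    \<and> (\<forall>c x. \<psi> (smul c x) = to_ac c * \<psi> x)"

lemma alg_hom_frobenius:
  assumes "alg_hom \<psi>"
  shows "alg_hom (\<lambda>x. \<psi> x ^ (CARD('f) ^ j))"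
proof -
  obtain e where e: "CARD('f) = CHAR('f) ^ e" using card_finite_field[where ?'f = 'f] by auto
  have pr: "prime CHAR('f alg_closure)" using prime_CHAR_finite[where ?'f = 'f] by simp
  have qN: "CARD('f) ^ j = CHAR('f alg_closure) ^ (e * j)" by (simp add: e power_mult)
  have "c ^ (CARD('f) ^ j) = c" for c :: 'f
    by (induction j) (simp_all add: finite_field_power_card power_mult)
  thus ?thesis using assms unfolding alg_hom_def
    by (auto simp: power_mult_distrib freshmans_dream'[OF pr qN] simp flip: to_ac_power)
qed

lemma alg_hom_sum: "alg_hom \<psi> \<Longrightarrow> \<psi> (\<Sum>i\<in>A. smul (c i) (w i)) = (\<Sum>i\<in>A. to_ac (c i) * \<psi> (w i))"
proof (induction A rule: infinite_finite_induct)
  case (insert x A)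
  thus ?case by (simp add: alg_hom_def)
next
  case empty
  have "\<psi> (smul 0 0) = to_ac 0 * \<psi> 0" using empty unfolding alg_hom_def by blast
  thus ?case by simp
next
  case (infinite A)
  have "\<psi> (smul 0 0) = to_ac 0 * \<psi> 0" using infinite unfolding alg_hom_def by blast
  thus ?case using infinite by simp
qed

lemma card_algebra:
  assumes "indexed_basis smul (v :: 3 \<Rightarrow> 'b)"
  shows "CARD('b) = CARD('f) ^ 3" "finite (UNIV :: 'b set)"
proof -
  have "bij (\<lambda>c :: 3 \<Rightarrow> 'f. \<Sum>i\<in>UNIV. smul (c i) (v i))"
  proof (rule bijI)
    show "inj (\<lambda>c :: 3 \<Rightarrow> 'f. \<Sum>i\<in>UNIV. smul (c i) (v i))"
    proof (rule injI, rule ext)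
      fix c d :: "3 \<Rightarrow> 'f" and i assume "(\<Sum>i\<in>UNIV. smul (c i) (v i)) = (\<Sum>i\<in>UNIV. smul (d i) (v i))"
      thus "c i = d i" using basis_coeff_unique[OF assms refl, of c i] basis_coeff_unique[OF assms refl, of d i] by simp
    qed
    show "surj (\<lambda>c :: 3 \<Rightarrow> 'f. \<Sum>i\<in>UNIV. smul (c i) (v i))"
      by (rule surjI) (rule basis_expansion[OF assms])
  qed
  from bij_betw_same_card[OF this] bij_betw_finite[OF this]
  show "CARD('b) = CARD('f) ^ 3" "finite (UNIV :: 'b set)" by (simp_all add: card_fun)
qed

text \<open>Frobenius powers of the projections to the factors are distinct homomorphisms,
  \<open>d i\<close> of them for factor \<open>i\<close>. The \<open>d i\<close> add up to at least
  3, since the algebra has q^3 elements and factor \<open>i\<close> at most q^(d i).\<close>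

lemma three_alg_homs: "\<exists>\<psi> :: 3 \<Rightarrow> 'b \<Rightarrow> 'f alg_closure. inj \<psi> \<and> (\<forall>a. alg_hom (\<psi> a))"
proof -
  obtain e where e: "e > 0" "CARD('f) = CHAR('f) ^ e" using card_finite_field[where ?'f = 'f] by auto
  have pr: "prime CHAR('f alg_closure)" using prime_CHAR_finite[where ?'f = 'f] by simp
  have qN: "CARD('f) ^ N = CHAR('f alg_closure) ^ (e * N)" for N by (simp add: e power_mult)
  have q1: "CARD('f) > 1" unfolding e using prime_gt_1_nat[OF prime_CHAR_finite] e(1) by (intro one_less_power)
  obtain v :: "3 \<Rightarrow> 'b" where v: "indexed_basis smul v"
    using indexed_basis_exists etale unfolding finite_etale_cubic_algebra_def by blast
  have "\<exists>n K (\<phi> :: 'b \<Rightarrow> nat \<Rightarrow> 'f alg_closure).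
      (\<forall>i<n. finite_separable_extension (K i)) \<and> bij_betw \<phi> UNIV (PiE {..<n} K) \<and> (\<forall>i<n. alg_hom (\<lambda>x. \<phi> x i))"
    using etale unfolding finite_etale_cubic_algebra_def finite_etale_algebra_def alg_hom_def by (elim conjE)
  then obtain n K and \<phi> :: "'b \<Rightarrow> nat \<Rightarrow> 'f alg_closure"
    where sep: "\<forall>i<n. finite_separable_extension (K i)" and bij: "bij_betw \<phi> UNIV (PiE {..<n} K)"
      and homs: "\<forall>i<n. alg_hom (\<lambda>x. \<phi> x i)" by (elim exE conjE)
  have K: "range to_ac \<subseteq> K i" if "i < n" for i using sep that by (simp add: finite_separable_extension_def)
  have hom: "alg_hom (\<lambda>x. \<phi> x i)" if "i < n" for i using homs that by simp
  have K0: "0 \<in> K i" "1 \<in> K i" if "i < n" for i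
    using subsetD[OF K[OF that] rangeI[of to_ac 0]] subsetD[OF K[OF that] rangeI[of to_ac 1]] by simp_all
  have onto: "\<exists>x. \<forall>i<n. \<phi> x i = f i" if "\<And>i. i < n \<Longrightarrow> f i \<in> K i" for f
  proof -
    have "restrict f {..<n} \<in> PiE {..<n} K" using that by auto
    then obtain x where "\<phi> x = restrict f {..<n}" unfolding bij_betw_imp_surj_on[OF bij, symmetric] by (elim imageE) simp
    thus ?thesis by (intro exI[of _ x]) simp
  qed
  have onto1: "\<exists>x. \<phi> x i = y" if "i < n" "y \<in> K i" for i y
  proof -
    have "\<exists>x. \<forall>j<n. \<phi> x j = (if j = i then y else 0)" by (rule onto) (use that K0 in simp)
    then obtain x where "\<forall>j<n. \<phi> x j = (if j = i then y else 0)" by blast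
    hence "\<phi> x i = y" using that(1) by simp
    thus ?thesis by blast
  qed
  have inK: "\<phi> x i \<in> K i" if "i < n" for x i using bij that by (auto simp: bij_betw_def PiE_iff image_def)
  have finK: "finite (K i)" if "i < n" for i
  proof (rule finite_subset)
    show "K i \<subseteq> range (\<lambda>x. \<phi> x i)" using onto1[OF that] by blast
    show "finite (range (\<lambda>x. \<phi> x i))" using card_algebra(2)[OF v] by simp
  qed
  \<comment> \<open>The Frobenius period stands for the degree of \<open>K i\<close>: minimality
    separates the Frobenius powers, periodicity bounds the size.\<close>
  define d where "d i = (LEAST d. d > 0 \<and> (\<forall>y\<in>K i. y ^ (CARD('f) ^ d) = y))" for i
  have d: "d i > 0" "\<And>y. y \<in> K i \<Longrightarrow> y ^ (CARD('f) ^ d i) = y" if i: "i < n" for i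
  proof -
    obtain N where N: "N y > 0" "y ^ (CARD('f) ^ N y) = y" for y :: "'f alg_closure"
      using alg_closure_frobenius_periodic by metis
    have pw: "y ^ (CARD('f) ^ (N y * t)) = y" for y t
    proof (induction t)
      case (Suc t)
      have "y ^ (CARD('f) ^ (N y * Suc t)) = (y ^ (CARD('f) ^ N y)) ^ (CARD('f) ^ (N y * t))" by (simp add: power_add flip: power_mult)
      thus ?case using Suc N by simp
    qed simp
    define D where "D = (\<Prod>y\<in>K i. N y)"
    have "D > 0" unfolding D_def using N by (intro prod_pos) auto
    moreover have "y ^ (CARD('f) ^ D) = y" if "y \<in> K i" for y
    proof -
      have "N y dvd D" unfolding D_def using finK[OF i] that by (intro dvd_prodI)
      thus ?thesis using pw[of y] by (elim dvdE) simp
    qed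
    ultimately have "D > 0 \<and> (\<forall>y\<in>K i. y ^ (CARD('f) ^ D) = y)" by blast
    hence "d i > 0 \<and> (\<forall>y\<in>K i. y ^ (CARD('f) ^ d i) = y)"
      unfolding d_def by (rule LeastI[of "\<lambda>d. d > 0 \<and> (\<forall>y\<in>K i. y ^ (CARD('f) ^ d) = y)"])
    thus "d i > 0" "\<And>y. y \<in> K i \<Longrightarrow> y ^ (CARD('f) ^ d i) = y" by auto
  qed
  have dmin: "\<exists>y\<in>K i. y ^ (CARD('f) ^ j) \<noteq> y" if "j < d i" "j > 0" for i j
    using not_less_Least[of j "\<lambda>d. d > 0 \<and> (\<forall>y\<in>K i. y ^ (CARD('f) ^ d) = y)"] that by (auto simp: d_def)
  define I where "I = (SIGMA i:{..<n}. {..<d i})"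
  define \<theta> where "\<theta> z x = \<phi> x (fst z) ^ (CARD('f) ^ snd z)" for z :: "nat \<times> nat" and x
  have less: "\<theta> (i, j) \<noteq> \<theta> (i, j')" if "i < n" "j < j'" "j' < d i" for i j j'
  proof
    assume H: "\<theta> (i, j) = \<theta> (i, j')"
    obtain y where y: "y \<in> K i" "y ^ (CARD('f) ^ (j' - j)) \<noteq> y" using dmin[of "j' - j" i] less_imp_diff_less[OF \<open>j' < d i\<close>, of j] \<open>j < j'\<close> by auto
    obtain x where x: "\<phi> x i = y" using onto1[OF \<open>i < n\<close> y(1)] by blast
    have "y ^ (CARD('f) ^ j) = y ^ (CARD('f) ^ j')" using fun_cong[OF H, of x] x by (simp add: \<theta>_def)
    also have "\<dots> = (y ^ (CARD('f) ^ (j' - j))) ^ (CARD('f) ^ j)" using \<open>j < j'\<close> by (simp flip: power_mult power_add)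
    finally have "y = y ^ (CARD('f) ^ (j' - j))" by (rule frobenius_inj[OF pr qN])
    thus False using y(2) by simp
  qed
  have inj: "inj_on \<theta> I"
  proof (rule inj_onI)
    fix z w assume zw: "z \<in> I" "w \<in> I" "\<theta> z = \<theta> w"
    obtain i j where z: "z = (i, j)" "i < n" "j < d i" using zw(1) by (auto simp: I_def)
    obtain i' j' where w: "w = (i', j')" "i' < n" "j' < d i'" using zw(2) by (auto simp: I_def)
    have "i = i'"
    proof (rule ccontr)
      assume ne: "i \<noteq> i'"
      have "\<exists>x. \<forall>l<n. \<phi> x l = (if l = i then 1 else 0)" by (rule onto) (use K0 in simp)
      then obtain x where x: "\<forall>l<n. \<phi> x l = (if l = i then 1 else 0)" by blast
      have "\<theta> z x = 1" "\<theta> w x = 0" using x z w ne q1 by (auto simp: \<theta>_def power_0_left)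
      thus False using zw(3) by simp
    qed
    moreover have "j = j'" using less[of i j j'] less[of i j' j] zw(3) z w \<open>i = i'\<close> by (cases j j' rule: linorder_cases) auto
    ultimately show "z = w" using z w by simp
  qed
  have "CARD('f) ^ 3 = card (PiE {..<n} K)" using card_algebra(1)[OF v] bij_betw_same_card[OF bij] by simp
  also have "\<dots> = (\<Prod>i<n. card (K i))" by (simp add: card_PiE)
  also have "\<dots> \<le> (\<Prod>i<n. CARD('f) ^ d i)"
  proof (rule prod_mono, intro conjI)
    fix i assume "i \<in> {..<n}"
    hence i: "i < n" by simp
    have c: "card {x::'f alg_closure. x ^ (CARD('f) ^ d i) = x} = CARD('f) ^ d i"
      using card_frobenius_fixed[OF pr qN, of "d i"] e(1) d(1)[OF i] by simp
    moreover have "finite {x::'f alg_closure. x ^ (CARD('f) ^ d i) = x}" using c q1 by (intro card_ge_0_finite) simp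
    ultimately show "card (K i) \<le> CARD('f) ^ d i" using card_mono[of "{x. x ^ (CARD('f) ^ d i) = x}" "K i"] d(2)[OF i] by auto
  qed simp
  also have "\<dots> = CARD('f) ^ card I" by (simp add: I_def power_sum)
  finally have "3 \<le> card I" using q1 by (rule power_le_imp_le_exp[rotated])
  then obtain J where J: "J \<subseteq> I" "card J = 3" "finite J" using obtain_subset_with_card_n by metis
  have "CARD(3) = card (\<theta> ` J)" using card_image[OF inj_on_subset[OF inj J(1)]] J(2) by simp
  then obtain \<psi> :: "3 \<Rightarrow> 'b \<Rightarrow> 'f alg_closure" where \<psi>: "bij_betw \<psi> UNIV (\<theta> ` J)"
    using finite_same_card_bij[of "UNIV :: 3 set" "\<theta> ` J"] J(3) by auto
  have "alg_hom (\<psi> a)" for a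
  proof -
    have "\<psi> a \<in> \<theta> ` J" using \<psi> by (auto simp: bij_betw_def)
    then obtain z where z: "z \<in> I" "\<psi> a = \<theta> z" using J(1) by auto
    thus ?thesis using alg_hom_frobenius[OF hom, of "fst z" "snd z"] unfolding z(2) \<theta>_def by (auto simp: I_def)
  qed
  thus ?thesis using \<psi> by (auto simp: bij_betw_def)
qed

end

section \<open>Characters of finite abelian groups\<close>

text \<open>A finite abelian group inside a commutative monoid: a set closed under multiplication that
  contains \<open>1\<close> and whose elements satisfy \<open>x\<^sup>N = 1\<close>.\<close>

definition torsion_group :: "nat \<Rightarrow> 'b::comm_monoid_mult set \<Rightarrow> bool" where
  "torsion_group N G \<longleftrightarrow> N > 0 \<and> 1 \<in> G \<and> (\<forall>x\<in>G. \<forall>y\<in>G. x * y \<in> G) \<and> (\<forall>x\<in>G. x ^ N = 1)"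

definition hom_on :: "'b::comm_monoid_mult set \<Rightarrow> ('b \<Rightarrow> complex) \<Rightarrow> bool" where
  "hom_on G \<chi> \<longleftrightarrow> \<chi> 1 = 1 \<and> (\<forall>x\<in>G. \<forall>y\<in>G. \<chi> (x * y) = \<chi> x * \<chi> y)"

lemma torsion_group_power: "torsion_group N G \<Longrightarrow> x \<in> G \<Longrightarrow> x ^ i \<in> G"
  by (induction i) (auto simp: torsion_group_def)

lemma hom_on_power:
  assumes "torsion_group N G" "hom_on G \<chi>" "x \<in> G"
  shows "\<chi> (x ^ i) = \<chi> x ^ i"
  using assms torsion_group_power[OF assms(1,3)] by (induction i) (auto simp: hom_on_def)

lemma torsion_cancel:
  fixes a b u :: "'b::comm_monoid_mult"
  assumes "u ^ N = 1" "N > 0" "a * u = b * u"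
  shows "a = b"
proof -
  have u: "u * u ^ (N - 1) = 1" using assms by (simp flip: power_Suc)
  have "a = a * u * u ^ (N - 1)" by (simp only: mult.assoc u mult_1_right)
  also have "\<dots> = b" unfolding assms(3) by (simp only: mult.assoc u mult_1_right)
  finally show ?thesis .
qed

lemma torsion_group_quotient:
  assumes G: "torsion_group N G" and K: "torsion_group N K" and "k * u \<in> K" "k \<in> K"
  shows "u \<in> K"
proof -
  have N: "N > 0" "k ^ N = 1" using K assms(4) by (auto simp: torsion_group_def)
  have "k ^ (N - 1) * (k * u) = k ^ Suc (N - 1) * u" by (simp add: mult_ac)
  also have "\<dots> = u" using N by simp
  finally show ?thesis using K torsion_group_power[OF K assms(4), of "N - 1"] assms(3) by (metis torsion_group_def)
qed

text \<open>\<open>u ^ r\<close> is the first power of \<open>u\<close> in \<open>K\<close>, so the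
  only constraint on the value at \<open>u\<close> is its \<open>r\<close>-th power.\<close>

lemma hom_on_extend:
  fixes u :: "'b::comm_monoid_mult"
  assumes G: "torsion_group N G" and K: "torsion_group N K" "K \<subseteq> G" and \<chi>: "hom_on K \<chi>" and u: "u \<in> G"
    and r: "r > 0" "u ^ r \<in> K" "\<forall>i. 0 < i \<longrightarrow> i < r \<longrightarrow> u ^ i \<notin> K" and z: "z ^ r = \<chi> (u ^ r)"
  obtains K' \<chi>' where "torsion_group N K'" "K' \<subseteq> G" "K \<subseteq> K'" "u \<in> K'" "hom_on K' \<chi>'"
    "\<forall>k\<in>K. \<chi>' k = \<chi> k" "\<chi>' u = z"
proof -
  have uN: "u ^ N = 1" "N > 0" using u G by (auto simp: torsion_group_def)
  have K1: "1 \<in> K" and Km: "\<And>x y. x \<in> K \<Longrightarrow> y \<in> K \<Longrightarrow> x * y \<in> K" using K by (auto simp: torsion_group_def)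
  have \<chi>m: "\<And>x y. x \<in> K \<Longrightarrow> y \<in> K \<Longrightarrow> \<chi> (x * y) = \<chi> x * \<chi> y" and \<chi>1: "\<chi> 1 = 1" using \<chi> by (auto simp: hom_on_def)
  have pw: "\<chi> (u ^ i) = z ^ i" if "u ^ i \<in> K" for i
  proof -
    have rt: "(u ^ r) ^ (i div r) \<in> K" by (rule torsion_group_power[OF K(1) r(2)])
    have split: "u ^ i = (u ^ r) ^ (i div r) * u ^ (i mod r)" by (simp flip: power_mult power_add)
    have "u ^ (i mod r) \<in> K"
      by (rule torsion_group_quotient[OF G K(1) _ rt]) (use that split in simp)
    hence "i mod r = 0" using r(3) r(1) mod_less_divisor[of r i] by blast
    hence i: "i = r * (i div r)" using mult_div_mod_eq[of r i] by simp
    have "\<chi> (u ^ i) = \<chi> ((u ^ r) ^ (i div r))" using split \<open>i mod r = 0\<close> by simp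
    also have "\<dots> = z ^ (r * (i div r))" by (simp add: hom_on_power[OF K(1) \<chi> r(2)] power_mult z)
    finally show ?thesis using i by simp
  qed
  have wd: "\<chi> k * z ^ i = \<chi> k' * z ^ j" if H: "k \<in> K" "k' \<in> K" "k * u ^ i = k' * u ^ j" "i \<le> j" for k k' i j
  proof -
    have "(u ^ i) ^ N = 1" by (metis mult.commute power_mult power_one uN(1))
    moreover have "k * u ^ i = (k' * u ^ (j - i)) * u ^ i" using H by (simp add: mult.assoc flip: power_add)
    ultimately have k: "k = k' * u ^ (j - i)" using torsion_cancel uN(2) by blast
    have "u ^ (j - i) \<in> K" by (rule torsion_group_quotient[OF G K(1) _ H(2)]) (use k H(1) in simp)
    hence "\<chi> k = \<chi> k' * z ^ (j - i)" using \<chi>m[OF H(2)] pw k by simp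
    thus ?thesis using H(4) by (simp add: mult.assoc flip: power_add)
  qed
  define K' where "K' = {k * u ^ i | k i. k \<in> K}"
  \<comment> \<open>Well defined by \<open>wd\<close>, since a product \<open>k * u ^ i\<close> may
    be written in several ways.\<close>
  define \<chi>' where "\<chi>' w = (THE c. \<exists>k i. k \<in> K \<and> w = k * u ^ i \<and> c = \<chi> k * z ^ i)" for w
  have val: "\<chi>' (k * u ^ i) = \<chi> k * z ^ i" if k: "k \<in> K" for k i
    unfolding \<chi>'_def
  proof (rule the_equality)
    show "\<exists>k' j. k' \<in> K \<and> k * u ^ i = k' * u ^ j \<and> \<chi> k * z ^ i = \<chi> k' * z ^ j" using k by blast
  next
    fix c assume "\<exists>k' j. k' \<in> K \<and> k * u ^ i = k' * u ^ j \<and> c = \<chi> k' * z ^ j"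
    then obtain k' j where H: "k' \<in> K" "k * u ^ i = k' * u ^ j" "c = \<chi> k' * z ^ j" by blast
    show "c = \<chi> k * z ^ i"
    proof (cases "i \<le> j")
      case True thus ?thesis using wd[OF k H(1,2)] H(3) by simp
    next
      case False thus ?thesis using wd[OF H(1) k H(2)[symmetric]] H(3) by simp
    qed
  qed
  have prod: "(k * u ^ i) * (k' * u ^ j) = (k * k') * u ^ (i + j)" for k k' i j by (simp add: power_add mult_ac)
  show thesis
  proof (rule that[of K' \<chi>'])
    show "K' \<subseteq> G" using K(2) G torsion_group_power[OF G u] by (auto simp: K'_def torsion_group_def)
    show sub: "K \<subseteq> K'"
    proof
      fix k assume "k \<in> K"
      moreover have "k = k * u ^ 0" by simp
      ultimately show "k \<in> K'" unfolding K'_def by blast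
    qed
    show "u \<in> K'"
    proof -
      have "u = 1 * u ^ 1" by simp
      thus ?thesis unfolding K'_def using K1 by blast
    qed
    have "x * y \<in> K'" if xy: "x \<in> K'" "y \<in> K'" for x y
    proof -
      obtain k i k' j where "x = k * u ^ i" "y = k' * u ^ j" "k \<in> K" "k' \<in> K" using xy by (auto simp: K'_def)
      thus ?thesis using prod[of k i k' j] Km[of k k'] by (auto simp: K'_def)
    qed
    thus "torsion_group N K'" using sub K1 uN(2) \<open>K' \<subseteq> G\<close> G by (auto simp: torsion_group_def)
    have "\<chi>' (x * y) = \<chi>' x * \<chi>' y" if xy: "x \<in> K'" "y \<in> K'" for x y
    proof -
      obtain k i k' j where H: "x = k * u ^ i" "y = k' * u ^ j" "k \<in> K" "k' \<in> K" using xy by (auto simp: K'_def)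
      show ?thesis unfolding H prod val[OF H(3)] val[OF H(4)] val[OF Km[OF H(3,4)]] \<chi>m[OF H(3,4)]
        by (simp add: power_add)
    qed
    moreover have \<chi>'K: "\<chi>' k = \<chi> k" if "k \<in> K" for k using val[OF that, of 0] by simp
    ultimately show "hom_on K' \<chi>'" using \<chi>1 K1 by (simp add: hom_on_def)
    show "\<forall>k\<in>K. \<chi>' k = \<chi> k" using \<chi>'K by blast
    show "\<chi>' u = z" using val[OF K1, of 1] \<chi>1 by simp
  qed
qed

lemma least_power_in:
  assumes "torsion_group N G" "torsion_group N K" "u \<in> G"
  obtains r where "r > 0" "u ^ r \<in> K" "\<forall>i. 0 < i \<longrightarrow> i < r \<longrightarrow> u ^ i \<notin> K"
proof -
  define r where "r = (LEAST r. r > 0 \<and> u ^ r \<in> K)"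
  have "N > 0 \<and> u ^ N \<in> K" using assms by (auto simp: torsion_group_def)
  hence "r > 0 \<and> u ^ r \<in> K" unfolding r_def by (rule LeastI[of "\<lambda>r. r > 0 \<and> u ^ r \<in> K"])
  moreover have "u ^ i \<notin> K" if "0 < i" "i < r" for i
    using not_less_Least[of i "\<lambda>r. r > 0 \<and> u ^ r \<in> K"] that by (auto simp: r_def)
  ultimately show thesis using that by blast
qed

lemma hom_on_extend_all:
  assumes G: "torsion_group N G" "finite G" and "torsion_group N K" "K \<subseteq> G" "hom_on K \<chi>"
  shows "\<exists>\<chi>'. hom_on G \<chi>' \<and> (\<forall>k\<in>K. \<chi>' k = \<chi> k)"
  using assms(3-)
proof (induction "card G - card K" arbitrary: K \<chi> rule: less_induct)
  case (less K \<chi>)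
  show ?case
  proof (cases "K = G")
    case True
    thus ?thesis using less.prems by blast
  next
    case False
    then obtain u where u: "u \<in> G" "u \<notin> K" using less.prems by blast
    obtain r where r: "r > 0" "u ^ r \<in> K" "\<forall>i. 0 < i \<longrightarrow> i < r \<longrightarrow> u ^ i \<notin> K"
      by (rule least_power_in[OF G(1) less.prems(1) u(1)])
    obtain z where z: "z ^ r = \<chi> (u ^ r)" using nth_root_exists[OF r(1)] by blast
    obtain K' \<chi>' where K': "torsion_group N K'" "K' \<subseteq> G" "K \<subseteq> K'" "u \<in> K'" "hom_on K' \<chi>'"
      "\<forall>k\<in>K. \<chi>' k = \<chi> k" "\<chi>' u = z"
      by (rule hom_on_extend[OF G(1) less.prems u(1) r z])
    have "card K < card K'" using K' u G(2) by (intro psubset_card_mono) (auto intro: finite_subset)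
    moreover have "card K' \<le> card G" using K'(2) G(2) by (rule card_mono[rotated])
    ultimately have "card G - card K' < card G - card K" by linarith
    from less.hyps[OF this K'(1,2,5)] obtain \<chi>2 where \<chi>2: "hom_on G \<chi>2" "\<forall>k\<in>K'. \<chi>2 k = \<chi>' k" by blast
    have "\<forall>k\<in>K. \<chi>2 k = \<chi> k" using \<chi>2(2) K'(3,6) by auto
    thus ?thesis using \<chi>2(1) by blast
  qed
qed

text \<open>With \<open>r\<close> the order of \<open>u\<close> modulo \<open>H\<close>, send
  \<open>u\<close> to a primitive \<open>r\<close>-th root of unity and extend.\<close>

lemma hom_on_separates:
  assumes G: "torsion_group N G" "finite G" and H: "torsion_group N H" "H \<subseteq> G" and u: "u \<in> G" "u \<notin> H"
  shows "\<exists>\<chi>. hom_on G \<chi> \<and> (\<forall>h\<in>H. \<chi> h = 1) \<and> \<chi> u \<noteq> 1"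
proof -
  obtain r where r: "r > 0" "u ^ r \<in> H" "\<forall>i. 0 < i \<longrightarrow> i < r \<longrightarrow> u ^ i \<notin> H"
    by (rule least_power_in[OF G(1) H(1) u(1)])
  have r1: "r > 1" using r(1,2) u(2) by (cases "r = 1") auto
  define z where "z = cis (2 * pi / real r)"
  have z: "z ^ r = 1" using r(1) by (simp add: z_def Complex.DeMoivre)
  have "z \<noteq> 1"
  proof
    assume "z = 1"
    hence "cos (2 * pi / real r) = 1" by (simp add: z_def complex_eq_iff)
    then obtain x :: int where x: "2 * pi / real r = of_int x * 2 * pi" using cos_one_2pi_int by blast
    hence "(2 * pi) * (1 / real r) = (2 * pi) * of_int x" by (simp add: mult_ac)
    hence "1 / real r = of_int x" by (rule mult_left_cancel[THEN iffD1, rotated]) simp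
    moreover have "0 < 1 / real r" "1 / real r < 1" using r1 by auto
    ultimately have "0 < x" "x < 1" by (simp_all only: of_int_0_less_iff of_int_less_1_iff)
    thus False by simp
  qed
  have one: "hom_on H (\<lambda>_. 1)" by (simp add: hom_on_def)
  obtain K' \<chi>' where K': "torsion_group N K'" "K' \<subseteq> G" "H \<subseteq> K'" "u \<in> K'" "hom_on K' \<chi>'"
    "\<forall>k\<in>H. \<chi>' k = 1" "\<chi>' u = z"
    by (rule hom_on_extend[OF G(1) H one u(1) r z])
  obtain \<chi>2 where "hom_on G \<chi>2" "\<forall>k\<in>K'. \<chi>2 k = \<chi>' k" using hom_on_extend_all[OF G K'(1,2,5)] by blast
  thus ?thesis using K' \<open>z \<noteq> 1\<close> by (intro exI[of _ \<chi>2]) auto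
qed

text \<open>The value 0 off \<open>G\<close> makes each character a single function, so that the set
  is finite and can be summed over.\<close>

definition dual_group :: "'b::comm_monoid_mult set \<Rightarrow> 'b set \<Rightarrow> ('b \<Rightarrow> complex) set" where
  "dual_group G H = {\<chi>. hom_on G \<chi> \<and> (\<forall>h\<in>H. \<chi> h = 1) \<and> (\<forall>x. x \<notin> G \<longrightarrow> \<chi> x = 0)}"

lemma hom_on_norm:
  assumes "torsion_group N G" "hom_on G \<chi>" "x \<in> G"
  shows "\<chi> x ^ N = 1" "norm (\<chi> x) = 1"
proof -
  have N: "N > 0" "x ^ N = 1" using assms by (auto simp: torsion_group_def)
  show p: "\<chi> x ^ N = 1" using hom_on_power[OF assms, of N] N(2) assms(2) by (simp add: hom_on_def)
  hence "norm (\<chi> x) ^ N = 1 ^ N" by (metis norm_one norm_power power_one)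
  thus "norm (\<chi> x) = 1" using N(1) power_eq_iff_eq_base[of N "norm (\<chi> x)" 1] by simp
qed

lemma finite_dual_group:
  assumes G: "torsion_group N G" "finite G"
  shows "finite (dual_group G H)"
proof (rule finite_subset)
  have "N > 0" using G by (simp add: torsion_group_def)
  hence "finite {z::complex. z ^ N = 1}" by (simp add: finite_roots_unity)
  thus "finite {\<chi>. \<forall>x. (x \<in> G \<longrightarrow> \<chi> x \<in> {z::complex. z ^ N = 1}) \<and> (x \<notin> G \<longrightarrow> \<chi> x = 0)}"
    by (rule finite_set_of_finite_funs[OF G(2)])
  show "dual_group G H \<subseteq> {\<chi>. \<forall>x. (x \<in> G \<longrightarrow> \<chi> x \<in> {z::complex. z ^ N = 1}) \<and> (x \<notin> G \<longrightarrow> \<chi> x = 0)}"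
    using hom_on_norm(1)[OF G(1)] by (auto simp: dual_group_def)
qed

text \<open>For \<open>u\<close> outside \<open>H\<close>, multiplication by a character that does
  not kill \<open>u\<close> permutes the set and rescales the sum.\<close>

lemma dual_group_sum:
  assumes G: "torsion_group N G" "finite G" and H: "torsion_group N H" "H \<subseteq> G" and u: "u \<in> G"
  shows "(\<Sum>\<chi>\<in>dual_group G H. \<chi> u) = (if u \<in> H then of_nat (card (dual_group G H)) else 0)"
proof (cases "u \<in> H")
  case True
  hence "(\<Sum>\<chi>\<in>dual_group G H. \<chi> u) = (\<Sum>\<chi>\<in>dual_group G H. 1)" by (intro sum.cong) (auto simp: dual_group_def)
  thus ?thesis using True by simp
next
  case False
  obtain \<chi>1 where \<chi>1: "hom_on G \<chi>1" "\<forall>h\<in>H. \<chi>1 h = 1" "\<chi>1 u \<noteq> 1"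
    using hom_on_separates[OF G H u False] by blast
  define t where "t \<chi> x = \<chi>1 x * \<chi> x" for \<chi> :: "'a \<Rightarrow> complex" and x
  have nz: "\<chi>1 x \<noteq> 0" if "x \<in> G" for x using hom_on_norm(2)[OF G(1) \<chi>1(1) that] by auto
  have tin: "t \<chi> \<in> dual_group G H" if "\<chi> \<in> dual_group G H" for \<chi>
    using that \<chi>1 by (auto simp: dual_group_def hom_on_def t_def)
  have "inj_on t (dual_group G H)"
  proof (rule inj_onI, rule ext)
    fix \<chi> \<chi>' x assume D: "\<chi> \<in> dual_group G H" "\<chi>' \<in> dual_group G H" "t \<chi> = t \<chi>'"
    show "\<chi> x = \<chi>' x"
      using fun_cong[OF D(3), of x] nz[of x] D(1,2) by (cases "x \<in> G") (auto simp: t_def dual_group_def)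
  qed
  hence "bij_betw t (dual_group G H) (dual_group G H)"
    using endo_inj_surj[OF finite_dual_group[OF G], of t H] tin by (auto simp: bij_betw_def)
  hence "(\<Sum>\<chi>\<in>dual_group G H. \<chi> u) = (\<Sum>\<chi>\<in>dual_group G H. t \<chi> u)"
    by (rule sum.reindex_bij_betw[symmetric])
  also have "\<dots> = \<chi>1 u * (\<Sum>\<chi>\<in>dual_group G H. \<chi> u)" by (simp add: t_def sum_distrib_left)
  finally have "(1 - \<chi>1 u) * (\<Sum>\<chi>\<in>dual_group G H. \<chi> u) = 0" by (simp add: algebra_simps)
  thus ?thesis using \<chi>1(3) False by simp
qed

lemma torsion_group_translate:
  assumes G: "torsion_group N G" "finite G" and g: "g \<in> G"
  shows "bij_betw (\<lambda>x. g * x) G G"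
proof -
  have "inj_on (\<lambda>x. g * x) G"
    using torsion_cancel[of g N] G g by (auto simp: inj_on_def torsion_group_def mult.commute)
  moreover have "(\<lambda>x. g * x) ` G \<subseteq> G" using G g by (auto simp: torsion_group_def)
  ultimately show ?thesis using endo_inj_surj[OF G(2)] by (simp add: bij_betw_def)
qed

text \<open>Both orthogonality relations evaluate the sum of all characters over all of
  \<open>G\<close>.\<close>

lemma card_dual_group:
  assumes G: "torsion_group N G" "finite G" and H: "torsion_group N H" "H \<subseteq> G"
  shows "card (dual_group G H) * card H = card G"
proof -
  define D where "D = dual_group G H"
  define \<chi>0 :: "'a \<Rightarrow> complex" where "\<chi>0 x = (if x \<in> G then 1 else 0)" for x
  have G1: "1 \<in> G" and Gm: "\<And>x y. x \<in> G \<Longrightarrow> y \<in> G \<Longrightarrow> x * y \<in> G" using G by (auto simp: torsion_group_def)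
  have \<chi>0: "\<chi>0 \<in> D" using G1 Gm H(2) by (auto simp: D_def dual_group_def \<chi>0_def hom_on_def)
  have "(\<Sum>u\<in>G. \<Sum>\<chi>\<in>D. \<chi> u) = (\<Sum>u\<in>G. if u \<in> H then of_nat (card D) else 0)"
    unfolding D_def by (intro sum.cong refl dual_group_sum[OF G H])
  also have "\<dots> = of_nat (card D * card H)"
    using H(2) G(2) by (simp add: sum.If_cases Int_absorb1)
  finally have 1: "(\<Sum>u\<in>G. \<Sum>\<chi>\<in>D. \<chi> u) = of_nat (card D * card H)" .
  have "(\<Sum>u\<in>G. \<chi> u) = (if \<chi> = \<chi>0 then of_nat (card G) else 0)" if \<chi>: "\<chi> \<in> D" for \<chi>
  proof (cases "\<chi> = \<chi>0")
    case True thus ?thesis by (simp add: \<chi>0_def)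
  next
    case False
    then obtain g where g: "g \<in> G" "\<chi> g \<noteq> 1" using \<chi> by (fastforce simp: D_def dual_group_def \<chi>0_def)
    have "(\<Sum>u\<in>G. \<chi> u) = (\<Sum>u\<in>G. \<chi> (g * u))"
      by (rule sum.reindex_bij_betw[OF torsion_group_translate[OF G g(1)], symmetric])
    also have "\<dots> = \<chi> g * (\<Sum>u\<in>G. \<chi> u)" unfolding sum_distrib_left
      using \<chi> g(1) by (intro sum.cong refl) (auto simp: D_def dual_group_def hom_on_def)
    finally have "(1 - \<chi> g) * (\<Sum>u\<in>G. \<chi> u) = 0" by (simp add: algebra_simps)
    thus ?thesis using g(2) False by simp
  qed
  hence "(\<Sum>\<chi>\<in>D. \<Sum>u\<in>G. \<chi> u) = (\<Sum>\<chi>\<in>D. if \<chi> = \<chi>0 then of_nat (card G) else 0)" by (rule sum.cong[OF refl])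
  also have "\<dots> = of_nat (card G)" using finite_dual_group[OF G] \<chi>0 by (simp add: D_def)
  finally have "(of_nat (card D * card H) :: complex) = of_nat (card G)"
    using 1 sum.swap[of "\<lambda>u \<chi>. \<chi> u" D G] by simp
  thus ?thesis unfolding D_def by (simp only: of_nat_eq_iff)
qed

text \<open>Detecting the coset \<open>aH\<close> by the characters of \<open>G\<close> trivial on \<open>H\<close>; those trivial on \<open>T\<close> give the
  main term.\<close>

lemma card_coset_error:
  assumes G: "torsion_group N G" "finite G" and T: "torsion_group N T" "T \<subseteq> G" and H: "torsion_group N H" "H \<subseteq> T"
    and a: "a \<in> G" and Y: "\<And>x. x \<in> Y \<Longrightarrow> x \<in> (\<lambda>t. a * t) ` T"
    and bound: "\<And>\<chi>. hom_on G \<chi> \<Longrightarrow> \<exists>t\<in>T. \<chi> t \<noteq> 1 \<Longrightarrow> norm (\<Sum>x\<in>Y. \<chi> x) \<le> M"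
    and m: "card T = m * card H"
  shows "\<bar>real (card (Y \<inter> (\<lambda>h. a * h) ` H)) - 1 / real m * real (card Y)\<bar> \<le> (1 - 1 / real m) * M"
proof -
  define D E where "D = dual_group G H" and "E = dual_group G T"
  have HG: "H \<subseteq> G" using H T by auto
  have fT: "finite T" "finite H" using T HG G finite_subset by auto
  have H0: "card H > 0" using H fT(2) by (auto simp: torsion_group_def card_gt_0_iff)
  have T0: "card T > 0" using T fT(1) by (auto simp: torsion_group_def card_gt_0_iff)
  have G0: "card G > 0" using G by (auto simp: torsion_group_def card_gt_0_iff)
  have m0: "m > 0" using m T0 by (cases m) auto
  have "card D * card H = card G" "card E * card T = card G"
    unfolding D_def E_def using card_dual_group[OF G H(1) HG] card_dual_group[OF G T] by auto
  hence "card D * card H = (card E * m) * card H" by (simp add: m mult.assoc)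
  hence DE: "card D = card E * m" using H0 by simp
  have D0: "card D > 0" using \<open>card D * card H = card G\<close> G0 by (cases "card D") auto
  have E0: "card E > 0" using DE D0 by (cases "card E") auto
  have ED: "E \<subseteq> D" using H(2) by (auto simp: E_def D_def dual_group_def)
  have fD: "finite D" unfolding D_def by (rule finite_dual_group[OF G])
  have aN: "a ^ N = 1" "N > 0" using a G by (auto simp: torsion_group_def)
  \<comment> \<open>The inverse of \<open>a\<close>.\<close>
  define b where "b = a ^ (N - 1)"
  have ab: "b * a = 1" using aN by (simp add: b_def mult.commute[of _ a] flip: power_Suc)
  have b: "b \<in> G" unfolding b_def by (rule torsion_group_power[OF G(1) a])
  have XT: "b * x \<in> T" if "x \<in> Y" for x
    using Y[OF that] ab by (auto simp: mult.assoc[symmetric])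
  have XG: "x \<in> G" if "x \<in> Y" for x using Y[OF that] a T G by (auto simp: torsion_group_def)
  have inH: "b * x \<in> H \<longleftrightarrow> x \<in> (\<lambda>h. a * h) ` H" for x
  proof
    assume "b * x \<in> H"
    moreover have "x = a * (b * x)" using ab by (simp add: mult.assoc[symmetric] mult.commute)
    ultimately show "x \<in> (\<lambda>h. a * h) ` H" by blast
  qed (use ab in \<open>auto simp: mult.assoc[symmetric]\<close>)
  have fX: "finite Y" by (rule finite_subset[OF _ G(2)]) (use XG in blast)
  have \<chi>m: "\<chi> (b * x) = \<chi> b * \<chi> x" if "\<chi> \<in> D" "x \<in> Y" for \<chi> x
    using that b XG by (auto simp: D_def dual_group_def hom_on_def)
  have "(\<Sum>x\<in>Y. \<Sum>\<chi>\<in>D. \<chi> (b * x)) = (\<Sum>x\<in>Y. if x \<in> (\<lambda>h. a * h) ` H then of_nat (card D) else 0)"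
  proof (rule sum.cong[OF refl])
    fix x assume "x \<in> Y"
    hence "b * x \<in> G" using XT T(2) by blast
    from dual_group_sum[OF G H(1) HG this]
    show "(\<Sum>\<chi>\<in>D. \<chi> (b * x)) = (if x \<in> (\<lambda>h. a * h) ` H then of_nat (card D) else 0)"
      unfolding D_def inH .
  qed
  also have "\<dots> = of_nat (card D) * of_nat (card (Y \<inter> (\<lambda>h. a * h) ` H))"
    using fX by (simp add: sum.If_cases)
  finally have A: "of_nat (card D) * of_nat (card (Y \<inter> (\<lambda>h. a * h) ` H)) = (\<Sum>\<chi>\<in>D. \<Sum>x\<in>Y. \<chi> (b * x))"
    by (simp only: sum.swap[of _ D Y])
  also have "\<dots> = (\<Sum>\<chi>\<in>D - E. \<Sum>x\<in>Y. \<chi> (b * x)) + (\<Sum>\<chi>\<in>E. \<Sum>x\<in>Y. \<chi> (b * x))"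
    by (rule sum.subset_diff[OF ED fD])
  \<comment> \<open>\<open>Y\<close> lies in the single coset \<open>a T\<close>, so characters
    trivial on \<open>T\<close> give 1 at every point.\<close>
  also have "(\<Sum>\<chi>\<in>E. \<Sum>x\<in>Y. \<chi> (b * x)) = (\<Sum>\<chi>\<in>E. \<Sum>x\<in>Y. 1)"
    using XT by (intro sum.cong refl) (auto simp: E_def dual_group_def)
  finally have B: "of_nat (card D) * of_nat (card (Y \<inter> (\<lambda>h. a * h) ` H)) - of_nat (card E) * of_nat (card Y)
      = (\<Sum>\<chi>\<in>D - E. \<Sum>x\<in>Y. \<chi> (b * x))" by simp
  have "norm (\<Sum>\<chi>\<in>D - E. \<Sum>x\<in>Y. \<chi> (b * x)) \<le> (\<Sum>\<chi>\<in>D - E. M)"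
  proof (rule sum_norm_le)
    fix \<chi> assume \<chi>: "\<chi> \<in> D - E"
    have h: "hom_on G \<chi>" using \<chi> by (simp add: D_def dual_group_def)
    have "\<exists>t\<in>T. \<chi> t \<noteq> 1" using \<chi> by (auto simp: D_def E_def dual_group_def)
    moreover have "(\<Sum>x\<in>Y. \<chi> (b * x)) = \<chi> b * (\<Sum>x\<in>Y. \<chi> x)" using \<chi>m \<chi> by (simp add: sum_distrib_left)
    ultimately show "norm (\<Sum>x\<in>Y. \<chi> (b * x)) \<le> M"
      using bound[OF h] hom_on_norm(2)[OF G(1) h b] by (simp add: norm_mult)
  qed
  \<comment> \<open>Only \<open>card D - card E\<close> characters contribute to the error; with
    \<open>card D = card E * m\<close> this becomes the factor 1 - 1/m.\<close>
  also have "\<dots> = (real (card D) - real (card E)) * M"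
    using card_Diff_subset[OF finite_subset[OF ED fD] ED] card_mono[OF fD ED] by (simp add: of_nat_diff)
  finally have C: "norm (of_nat (card D) * of_nat (card (Y \<inter> (\<lambda>h. a * h) ` H)) - of_nat (card E) * of_nat (card Y) :: complex)
      \<le> (real (card D) - real (card E)) * M" unfolding B .
  have "(of_nat (card D) * of_nat (card (Y \<inter> (\<lambda>h. a * h) ` H)) - of_nat (card E) * of_nat (card Y) :: complex)
      = complex_of_real (real (card D) * real (card (Y \<inter> (\<lambda>h. a * h) ` H)) - real (card E) * real (card Y))" by simp
  hence C': "\<bar>real (card D) * real (card (Y \<inter> (\<lambda>h. a * h) ` H)) - real (card E) * real (card Y)\<bar>
      \<le> (real (card D) - real (card E)) * M" using C by (simp only: norm_of_real)
  define d w where "d = real (card D)" and "w = real (card (Y \<inter> (\<lambda>h. a * h) ` H))"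
  have Ed: "real (card E) = d / real m" using DE m0 by (simp add: d_def)
  have d0: "d > 0" using D0 by (simp add: d_def)
  have "\<bar>d * (w - 1 / real m * real (card Y))\<bar> \<le> d * ((1 - 1 / real m) * M)"
    using C' unfolding Ed d_def[symmetric] w_def[symmetric] by (simp add: algebra_simps)
  hence "d * \<bar>w - 1 / real m * real (card Y)\<bar> \<le> d * ((1 - 1 / real m) * M)" using d0 by (simp add: abs_mult)
  thus ?thesis using d0 unfolding w_def by simp
qed

unbundle no fps_syntax and vec_syntax

section \<open>Geometric coordinates of the algebra and transfer of the bound\<close>

context etale_cubic
begin

lemma alg_homs_independent:
  assumes "finite A" "\<And>\<psi>. \<psi> \<in> A \<Longrightarrow> alg_hom \<psi>" "\<And>x. (\<Sum>\<psi>\<in>A. c \<psi> * \<psi> x) = 0"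
  shows "\<forall>\<psi>\<in>A. c \<psi> = 0"
  using assms by (intro multiplicative_maps_independent) (auto simp: alg_hom_def)

text \<open>The three homomorphisms diagonalise multiplication over the closure, which gives trace
  and norm. Frobenius permutes them because there are no others, and triples compatible with this
  permutation descend to the algebra.\<close>

lemma coordinates_exist:
  "\<exists>(\<psi> :: 3 \<Rightarrow> 'b \<Rightarrow> 'f alg_closure) \<rho>. (\<forall>a. alg_hom (\<psi> a)) \<and> bij \<rho> \<and> (\<forall>a x. \<psi> a x = \<psi> (\<rho> a) x ^ CARD('f))
    \<and> (\<forall>x. (\<forall>a. \<psi> a x = 0) \<longrightarrow> x = 0)
    \<and> (\<forall>v. (\<forall>a. v a = v (\<rho> a) ^ CARD('f)) \<longrightarrow> (\<exists>x. \<forall>a. \<psi> a x = v a))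
    \<and> (\<forall>x. to_ac (cubic_trace smul x) = (\<Sum>a\<in>UNIV. \<psi> a x))
    \<and> (\<forall>x. to_ac (cubic_norm smul x) = (\<Prod>a\<in>UNIV. \<psi> a x))"
proof -
  obtain e where e: "e > 0" "CARD('f) = CHAR('f) ^ e" using card_finite_field[where ?'f = 'f] by auto
  have pr: "prime CHAR('f alg_closure)" using prime_CHAR_finite[where ?'f = 'f] by simp
  have qe: "CARD('f) = CHAR('f alg_closure) ^ e" using e by simp
  obtain \<psi> :: "3 \<Rightarrow> 'b \<Rightarrow> 'f alg_closure" where inj: "inj \<psi>" and hom: "\<And>a. alg_hom (\<psi> a)"
    using three_alg_homs by blast
  obtain v :: "3 \<Rightarrow> 'b" where v: "indexed_basis smul v"
    using indexed_basis_exists etale unfolding finite_etale_cubic_algebra_def by blast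
  have ex: "\<exists>c. x = (\<Sum>j\<in>UNIV. smul (c j) (v j))" for x using basis_expansion[OF v, of x] by metis
  define M :: "'f alg_closure ^ 3 ^ 3" where "M = (\<chi> a j. \<psi> a (v j))"
  \<comment> \<open>A relation between the rows extends linearly from the basis to all of the
    algebra, where Dedekind's theorem excludes it.\<close>
  have "\<forall>i. c i = 0" if c: "(\<Sum>i\<in>UNIV. c i *s row i M) = 0" for c
  proof -
    have col: "(\<Sum>a\<in>UNIV. c a * \<psi> a (v j)) = 0" for j
    proof -
      have "(\<Sum>i\<in>UNIV. c i *s row i M) $ j = 0" by (simp add: c)
      thus ?thesis by (simp add: row_def M_def)
    qed
    have lin: "(\<Sum>a\<in>UNIV. c a * \<psi> a x) = 0" for x
    proof -
      obtain d where d: "x = (\<Sum>j\<in>UNIV. smul (d j) (v j))" using ex by blast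
      have "(\<Sum>a\<in>UNIV. c a * \<psi> a x) = (\<Sum>a\<in>UNIV. \<Sum>j\<in>UNIV. to_ac (d j) * (c a * \<psi> a (v j)))"
        unfolding d alg_hom_sum[OF hom] sum_distrib_left by (intro sum.cong refl) (simp add: mult_ac)
      also have "\<dots> = (\<Sum>j\<in>UNIV. to_ac (d j) * (\<Sum>a\<in>UNIV. c a * \<psi> a (v j)))"
        unfolding sum_distrib_left by (rule sum.swap)
      also have "\<dots> = 0" by (simp add: col)
      finally show ?thesis .
    qed
    define c' where "c' \<theta> = c (inv_into UNIV \<psi> \<theta>)" for \<theta>
    have "\<forall>\<theta>\<in>range \<psi>. c' \<theta> = 0"
    proof (rule alg_homs_independent)
      show "alg_hom \<theta>" if "\<theta> \<in> range \<psi>" for \<theta> using that hom by auto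
      show "(\<Sum>\<theta>\<in>range \<psi>. c' \<theta> * \<theta> x) = 0" for x
        using lin[of x] by (simp add: sum.reindex[OF inj] c'_def inv_into_f_f[OF inj])
    qed simp
    thus ?thesis by (simp add: c'_def inv_into_f_f[OF inj])
  qed
  hence "\<exists>B. M ** B = mat 1" unfolding matrix_right_invertible_independent_rows by blast
  then obtain M' where MM': "M ** M' = mat 1" by blast
  hence M'M: "M' ** M = mat 1" by (simp add: matrix_left_right_inverse)
  \<comment> \<open>The three homomorphisms span the linear maps to the closure, so a fourth would
    be a combination of them, against independence.\<close>
  have all_homs: "\<theta> \<in> range \<psi>" if \<theta>: "alg_hom \<theta>" for \<theta>
  proof (rule ccontr)
    assume notin: "\<theta> \<notin> range \<psi>"
    define r :: "'f alg_closure ^ 3" where "r = (\<chi> j. \<theta> (v j))"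
    define c where "c = r v* M'"
    have rc: "c v* M = r" unfolding c_def by (simp add: vector_matrix_mul_assoc M'M)
    have vj: "(\<Sum>a\<in>UNIV. c $ a * \<psi> a (v j)) = \<theta> (v j)" for j
    proof -
      have "(c v* M) $ j = \<theta> (v j)" unfolding rc by (simp add: r_def)
      thus ?thesis by (simp add: vector_matrix_mult_def M_def mult.commute)
    qed
    have lin: "(\<Sum>a\<in>UNIV. c $ a * \<psi> a x) = \<theta> x" for x
    proof -
      obtain d where d: "x = (\<Sum>j\<in>UNIV. smul (d j) (v j))" using ex by blast
      have "(\<Sum>a\<in>UNIV. c $ a * \<psi> a x) = (\<Sum>a\<in>UNIV. \<Sum>j\<in>UNIV. to_ac (d j) * (c $ a * \<psi> a (v j)))"
        unfolding d alg_hom_sum[OF hom] sum_distrib_left by (intro sum.cong refl) (simp add: mult_ac)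
      also have "\<dots> = (\<Sum>j\<in>UNIV. to_ac (d j) * (\<Sum>a\<in>UNIV. c $ a * \<psi> a (v j)))"
        unfolding sum_distrib_left by (rule sum.swap)
      also have "\<dots> = \<theta> x" unfolding vj d alg_hom_sum[OF \<theta>] ..
      finally show ?thesis .
    qed
    define c' where "c' \<eta> = (if \<eta> = \<theta> then - 1 else c $ (inv_into UNIV \<psi> \<eta>))" for \<eta>
    have "\<forall>\<eta>\<in>insert \<theta> (range \<psi>). c' \<eta> = 0"
    proof (rule alg_homs_independent)
      show "alg_hom \<eta>" if "\<eta> \<in> insert \<theta> (range \<psi>)" for \<eta> using that hom \<theta> by auto
      show "(\<Sum>\<eta>\<in>insert \<theta> (range \<psi>). c' \<eta> * \<eta> x) = 0" for x
      proof -
        have ne: "\<psi> a \<noteq> \<theta>" for a using notin by auto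
        have "(\<Sum>\<eta>\<in>insert \<theta> (range \<psi>). c' \<eta> * \<eta> x) = - \<theta> x + (\<Sum>a\<in>UNIV. c $ a * \<psi> a x)"
          using notin by (simp add: sum.reindex[OF inj] c'_def ne inv_into_f_f[OF inj])
        thus ?thesis by (simp add: lin)
      qed
    qed simp
    thus False by (simp add: c'_def)
  qed
  have "\<forall>a. \<exists>b. (\<lambda>x. \<psi> a x ^ CARD('f)) = \<psi> b"
  proof
    fix a
    have "(\<lambda>x. \<psi> a x ^ CARD('f)) \<in> range \<psi>"
      using all_homs[OF alg_hom_frobenius[OF hom[of a], of 1]] by (simp only: power_one_right)
    thus "\<exists>b. (\<lambda>x. \<psi> a x ^ CARD('f)) = \<psi> b" by (elim rangeE) (rule exI)
  qed
  from choice[OF this] obtain \<tau> where "\<forall>a. (\<lambda>x. \<psi> a x ^ CARD('f)) = \<psi> (\<tau> a)" by (elim exE)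
  hence \<tau>: "(\<lambda>x. \<psi> a x ^ CARD('f)) = \<psi> (\<tau> a)" for a by (rule spec)
  have "inj \<tau>"
  proof (rule injI)
    fix a b assume "\<tau> a = \<tau> b"
    hence "\<psi> a x ^ CARD('f) = \<psi> b x ^ CARD('f)" for x using fun_cong[OF \<tau>[of a], of x] fun_cong[OF \<tau>[of b], of x] by (simp only:)
    hence "\<psi> a x = \<psi> b x" for x by (rule frobenius_inj[OF pr qe])
    hence "\<psi> a = \<psi> b" by (rule ext)
    thus "a = b" using inj by (simp add: inj_eq)
  qed
  hence bij: "bij \<tau>" by (simp add: bij_def finite_UNIV_inj_surj)
  \<comment> \<open>The inverse permutation, so that each coordinate is the q-th power of another
    one, as in the definition of \<open>Fr\<close>.\<close>
  define \<rho> where "\<rho> = inv_into UNIV \<tau>"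
  have b\<rho>: "bij \<rho>" unfolding \<rho>_def by (rule bij_imp_bij_inv[OF bij])
  have \<tau>\<rho>: "\<tau> (\<rho> a) = a" for a unfolding \<rho>_def by (rule surj_f_inv_f[OF bij_is_surj[OF bij]])
  have \<rho>: "\<psi> a x = \<psi> (\<rho> a) x ^ CARD('f)" for a x
    using fun_cong[OF \<tau>[of "\<rho> a"], of x] unfolding \<tau>\<rho> by (rule sym)
  have val: "\<psi> a (\<Sum>j\<in>UNIV. smul (c j) (v j)) = (M *v (\<chi> j. to_ac (c j))) $ a" for a c
    by (simp add: alg_hom_sum[OF hom] matrix_vector_mult_def M_def mult.commute)
  have inj0: "x = 0" if z: "\<And>a. \<psi> a x = 0" for x
  proof -
    obtain d where d: "x = (\<Sum>j\<in>UNIV. smul (d j) (v j))" using ex by blast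
    have "M *v (\<chi> j. to_ac (d j)) = 0" using z val[of _ d] by (simp add: vec_eq_iff d)
    hence "M' *v (M *v (\<chi> j. to_ac (d j))) = 0" by simp
    hence "(\<chi> j. to_ac (d j)) = (0 :: 'f alg_closure ^ 3)" by (simp add: matrix_vector_mul_assoc M'M)
    hence "d j = 0" for j by (simp add: vec_eq_iff)
    thus ?thesis by (simp add: d)
  qed
  have onto: "\<exists>x. \<forall>a. \<psi> a x = w a" if w: "\<And>a. w a = w (\<rho> a) ^ CARD('f)" for w
  proof -
    define W :: "'f alg_closure ^ 3" where "W = (\<chi> a. w a)"
    define c where "c = M' *v W"
    have Mc: "M *v c = W" by (simp add: c_def matrix_vector_mul_assoc MM')
    \<comment> \<open>The q-th powers of the coefficients solve the same linear system, so the
      coefficients are fixed by Frobenius and lie in the base field.\<close>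
    define c2 :: "'f alg_closure ^ 3" where "c2 = (\<chi> j. c $ j ^ CARD('f))"
    have "(M *v c2) $ a = W $ a" for a
    proof -
      have "W $ a = ((M *v c) $ \<rho> a) ^ CARD('f)" unfolding Mc using w[of a] by (simp add: W_def)
      also have "\<dots> = (\<Sum>j\<in>UNIV. (\<psi> (\<rho> a) (v j) * c $ j) ^ CARD('f))"
        unfolding matrix_vector_mult_def by (simp add: M_def freshmans_dream_sum'[OF pr qe])
      also have "\<dots> = (\<Sum>j\<in>UNIV. \<psi> a (v j) * c $ j ^ CARD('f))" by (simp add: power_mult_distrib flip: \<rho>)
      finally show ?thesis by (simp add: matrix_vector_mult_def M_def c2_def)
    qed
    hence "M *v c2 = W" by (simp add: vec_eq_iff)
    hence "M' *v (M *v c2) = M' *v (M *v c)" by (simp add: Mc)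
    hence "c2 = c" by (simp add: matrix_vector_mul_assoc M'M)
    hence "c $ j ^ CARD('f) = c $ j" for j unfolding c2_def vec_eq_iff by simp
    hence "\<exists>d. c $ j = to_ac d" for j using fixed_by_frobenius_in_range by blast
    then obtain d where d: "\<And>j. c $ j = to_ac (d j)" by metis
    have "(\<chi> j. to_ac (d j)) = c" by (simp add: vec_eq_iff d)
    hence "\<psi> a (\<Sum>j\<in>UNIV. smul (d j) (v j)) = w a" for a unfolding val by (simp add: Mc W_def)
    thus ?thesis by blast
  qed
  have tn: "to_ac (cubic_trace smul x) = (\<Sum>a\<in>UNIV. \<psi> a x) \<and> to_ac (cubic_norm smul x) = (\<Prod>a\<in>UNIV. \<psi> a x)" for x
  proof -
    define B where "B = mult_matrix smul v x"
    define A :: "'f alg_closure ^ 3 ^ 3" where "A = (\<chi> i j. to_ac (B $ i $ j))"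
    define D :: "'f alg_closure ^ 3 ^ 3" where "D = (\<chi> a b. if a = b then \<psi> a x else 0)"
    have "(M ** A) $ a $ j = (D ** M) $ a $ j" for a j
    proof -
      have "(M ** A) $ a $ j = (\<Sum>i\<in>UNIV. to_ac (B $ i $ j) * \<psi> a (v i))"
        by (simp add: matrix_matrix_mult_def M_def A_def mult.commute)
      also have "\<dots> = \<psi> a (\<Sum>i\<in>UNIV. smul (B $ i $ j) (v i))" by (simp add: alg_hom_sum[OF hom])
      also have "(\<Sum>i\<in>UNIV. smul (B $ i $ j) (v i)) = x * v j"
        using basis_expansion[OF v, of "x * v j"] by (simp add: B_def mult_matrix_def)
      also have "\<psi> a (x * v j) = \<psi> a x * \<psi> a (v j)" using hom[of a] by (simp add: alg_hom_def)
      also have "\<dots> = (D ** M) $ a $ j"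
        by (simp add: matrix_matrix_mult_def D_def M_def if_distrib[of "\<lambda>y. y * _"] sum.delta cong: if_cong)
      finally show ?thesis .
    qed
    hence MA: "M ** A = D ** M" by (simp add: vec_eq_iff)
    have "A = (M' ** M) ** A" by (simp add: M'M)
    hence A: "A = M' ** (D ** M)" by (simp only: matrix_mul_assoc[symmetric] MA)
    have "trace A = trace ((D ** M) ** M')" unfolding A by (rule trace_mul_sym)
    also have "(D ** M) ** M' = D" by (simp only: matrix_mul_assoc[symmetric] MM' matrix_mul_rid)
    also have "trace D = (\<Sum>a\<in>UNIV. \<psi> a x)" by (simp add: trace_def D_def)
    finally have tr: "trace A = (\<Sum>a\<in>UNIV. \<psi> a x)" .
    have "det M' * det M = 1" using det_mul[of M' M] by (simp add: M'M)
    hence "det A = det D" unfolding A det_mul by (simp add: algebra_simps)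
    also have "\<dots> = (\<Prod>a\<in>UNIV. \<psi> a x)" by (subst det_diagonal) (simp_all add: D_def)
    finally have dt: "det A = (\<Prod>a\<in>UNIV. \<psi> a x)" .
    have "to_ac (trace B) = trace A" by (simp add: trace_def A_def to_ac_sum)
    moreover have "to_ac (det B) = det A" by (simp add: det_def A_def to_ac_sum to_ac_prod)
    ultimately show ?thesis using tr dt cubic_trace_eq[OF v] cubic_norm_eq[OF v] by (simp add: B_def)
  qed
  show ?thesis
  proof (intro exI[of _ \<psi>] exI[of _ \<rho>] conjI allI impI)
    show "alg_hom (\<psi> a)" for a by (rule hom)
    show "bij \<rho>" by (rule b\<rho>)
    show "\<psi> a x = \<psi> (\<rho> a) x ^ CARD('f)" for a x by (rule \<rho>)
    show "x = 0" if "\<forall>a. \<psi> a x = 0" for x by (rule inj0) (rule spec[OF that])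
    show "\<exists>x. \<forall>a. \<psi> a x = w a" if "\<forall>a. w a = w (\<rho> a) ^ CARD('f)" for w by (rule onto) (rule spec[OF that])
    show "to_ac (cubic_trace smul x) = (\<Sum>a\<in>UNIV. \<psi> a x)" for x by (rule conjunct1[OF tn])
    show "to_ac (cubic_norm smul x) = (\<Prod>a\<in>UNIV. \<psi> a x)" for x by (rule conjunct2[OF tn])
  qed
qed

end

unbundle no vec_syntax

locale etale_coordinates = etale_cubic smul
  for smul :: "'f::{field,finite} \<Rightarrow> 'b::comm_ring_1 \<Rightarrow> 'b" +
  fixes \<psi> :: "3 \<Rightarrow> 'b \<Rightarrow> 'f alg_closure" and \<rho> :: "3 \<Rightarrow> 3"
  assumes hom: "alg_hom (\<psi> a)" and bij: "bij \<rho>" and frob: "\<psi> a x = \<psi> (\<rho> a) x ^ CARD('f)"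
    and kernel: "(\<And>a. \<psi> a x = 0) \<Longrightarrow> x = 0"
    and onto: "(\<And>a. v a = v (\<rho> a) ^ CARD('f)) \<Longrightarrow> \<exists>x. \<forall>a. \<psi> a x = v a"
    and trace: "to_ac (cubic_trace smul x) = (\<Sum>a\<in>UNIV. \<psi> a x)"
    and norm: "to_ac (cubic_norm smul x) = (\<Prod>a\<in>UNIV. \<psi> a x)"
begin

abbreviation units :: "'b set" where "units \<equiv> {x. x dvd 1}"

abbreviation nm :: "'b \<Rightarrow> 'f" where "nm \<equiv> cubic_norm smul"

lemma psi: "\<psi> a 1 = 1" "\<psi> a (x + y) = \<psi> a x + \<psi> a y" "\<psi> a (x * y) = \<psi> a x * \<psi> a y"
  using hom[of a] by (auto simp: alg_hom_def)

lemma psi_power: "\<psi> a (x ^ k) = \<psi> a x ^ k"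
  by (induction k) (simp_all add: psi)

lemma coordinates_eqD: "(\<And>a. \<psi> a x = \<psi> a y) \<Longrightarrow> x = y"
proof -
  assume "\<And>a. \<psi> a x = \<psi> a y"
  moreover have "\<psi> a x = \<psi> a (x - y) + \<psi> a y" for a using psi(2)[of a "x - y" y] by simp
  ultimately have "x - y = 0" by (intro kernel) simp
  thus ?thesis by simp
qed

lemma unit_iff: "x dvd 1 \<longleftrightarrow> (\<forall>a. \<psi> a x \<noteq> 0)"
proof
  assume "x dvd 1"
  then obtain y where "1 = x * y" by (rule dvdE)
  hence "\<psi> a x * \<psi> a y = 1" for a using psi(1,3) by metis
  thus "\<forall>a. \<psi> a x \<noteq> 0" by (metis mult_zero_left zero_neq_one)
next
  assume nz: "\<forall>a. \<psi> a x \<noteq> 0"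
  have "\<exists>y. \<forall>a. \<psi> a y = inverse (\<psi> a x)"
    by (rule onto) (simp add: power_inverse flip: frob)
  then obtain y where y: "\<And>a. \<psi> a y = inverse (\<psi> a x)" by blast
  have "x * y = 1" by (rule coordinates_eqD) (use nz in \<open>simp add: psi y\<close>)
  thus "x dvd 1" by (metis dvd_triv_left)
qed

lemma nm_mult: "nm (x * y) = nm x * nm y"
proof -
  have "to_ac (nm (x * y)) = to_ac (nm x * nm y)" by (simp add: norm psi prod.distrib)
  thus ?thesis by (simp only: to_ac_eq_iff)
qed

lemma nm_1: "nm 1 = 1"
proof -
  have "to_ac (nm 1) = to_ac 1" by (simp add: norm psi)
  thus ?thesis by (simp only: to_ac_eq_iff)
qed

lemma nm_unit: "x dvd 1 \<longleftrightarrow> nm x \<noteq> 0"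
proof -
  have "nm x \<noteq> 0 \<longleftrightarrow> to_ac (nm x) \<noteq> 0" by simp
  thus ?thesis by (simp add: norm unit_iff del: to_ac_eq_0_iff)
qed

definition crd :: "'b \<Rightarrow> 3 \<Rightarrow> 'f alg_closure" where
  "crd x a = \<psi> a x"

lemma inj_crd: "inj crd"
  by (rule injI, rule coordinates_eqD) (simp add: crd_def fun_eq_iff)

lemma twisted_cubic_coordinates:
  fixes n s :: 'f
  assumes ch: "CHAR('f) \<noteq> 2" "CHAR('f) \<noteq> 3" and n: "n \<noteq> 0" "s ^ 3 \<noteq> 27 * n"
  obtains e where "twisted_cubic CARD('f) e \<rho> (to_ac s) (to_ac n)"
proof -
  obtain e where e: "e > 0" "CARD('f) = CHAR('f) ^ e" using card_finite_field[where ?'f = 'f] by auto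
  have pr: "prime CHAR('f)" by (rule prime_CHAR_finite)
  have chp: "prime CHAR('f alg_closure)" using pr by simp
  have qe: "CARD('f) = CHAR('f alg_closure) ^ e" using e by simp
  have two: "(2 :: 'f alg_closure) \<noteq> 0"
  proof
    assume "(2 :: 'f alg_closure) = 0"
    hence "of_nat 2 = (0 :: 'f alg_closure)" by simp
    hence "CHAR('f) dvd 2" unfolding of_nat_eq_0_iff_char_dvd by simp
    thus False using ch(1) primes_dvd_imp_eq[OF pr two_is_prime_nat] by simp
  qed
  have three: "(3 :: 'f alg_closure) \<noteq> 0"
  proof
    assume "(3 :: 'f alg_closure) = 0"
    hence "of_nat 3 = (0 :: 'f alg_closure)" by simp
    hence "CHAR('f) dvd 3" unfolding of_nat_eq_0_iff_char_dvd by simp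
    moreover have "prime (3::nat)" by simp
    ultimately show False using ch(2) primes_dvd_imp_eq[OF pr, of 3] by simp
  qed
  have "to_ac (s ^ 3) \<noteq> to_ac (27 * n)" using n(2) by (simp only: to_ac_eq_iff not_False_eq_True)
  hence sn: "to_ac s ^ 3 \<noteq> 27 * to_ac n" by simp
  have n0: "to_ac n \<noteq> 0" using n(1) by simp
  have fx: "to_ac c ^ CARD('f) = to_ac c" for c :: 'f by (simp add: finite_field_power_card flip: to_ac_power)
  have "twisted_cubic CARD('f) e \<rho> (to_ac s) (to_ac n)"
    by (rule twisted_cubic.intro[OF chp qe e(1) bij two three n0 sn fx fx alg_closure_frobenius_periodic])
  thus thesis by (rule that)
qed

lemma finite_units: "finite units"
proof -
  obtain v :: "3 \<Rightarrow> 'b" where "indexed_basis smul v"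
    using indexed_basis_exists etale unfolding finite_etale_cubic_algebra_def by blast
  from card_algebra(2)[OF this] show ?thesis by (rule finite_subset[rotated]) simp
qed

lemma units_torsion:
  obtains N where "torsion_group N units"
proof -
  have "\<exists>N>0. \<forall>x\<in>units. x ^ N = 1"
  proof -
    have "\<exists>N>0. x ^ N = 1" if x: "x \<in> units" for x
    proof -
      have "x ^ k \<in> units" for k using x by (simp add: unit_iff psi_power)
      hence "\<not> inj (\<lambda>k. x ^ k)" using finite_units range_inj_infinite[of "\<lambda>k. x ^ k"] finite_subset[of "range (\<lambda>k. x ^ k)" units] by blast
      then obtain i j where ij: "i < j" "x ^ i = x ^ j" using linorder_injI[of "\<lambda>k. x ^ k"] by blast
      have "\<psi> a (x ^ (j - i)) = \<psi> a 1" for a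
      proof -
        have "\<psi> a x ^ i * \<psi> a x ^ (j - i) = \<psi> a x ^ j" using ij(1) by (simp flip: power_add)
        also have "\<dots> = \<psi> a x ^ i" using arg_cong[OF ij(2), of "\<psi> a"] by (simp only: psi_power)
        finally have "\<psi> a x ^ i * \<psi> a x ^ (j - i) = \<psi> a x ^ i" .
        moreover have "\<psi> a x \<noteq> 0" using x by (simp add: unit_iff)
        ultimately show ?thesis by (simp add: psi_power psi)
      qed
      hence "x ^ (j - i) = 1" by (rule coordinates_eqD)
      thus ?thesis using ij(1) by (intro exI[of _ "j - i"]) simp
    qed
    then obtain f where f: "\<And>x. x \<in> units \<Longrightarrow> f x > 0 \<and> x ^ f x = 1" by metis
    define N where "N = (\<Prod>x\<in>units. f x)"
    have "N > 0" unfolding N_def by (rule prod_pos) (use f in blast)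
    moreover have "x ^ N = 1" if "x \<in> units" for x
    proof -
      have "f x dvd N" unfolding N_def by (rule dvd_prodI[OF finite_units that])
      then obtain t where "N = f x * t" by (rule dvdE)
      thus ?thesis using f[OF that] by (simp add: power_mult)
    qed
    ultimately show ?thesis by blast
  qed
  then obtain N where "N > 0" "\<forall>x\<in>units. x ^ N = 1" by blast
  hence "torsion_group N units" by (simp add: torsion_group_def unit_iff psi)
  thus thesis by (rule that)
qed

text \<open>\<open>crd\<close> identifies the units with the Frobenius fixed points of the torus,
  and the elements of trace \<open>s\<close> and norm \<open>n\<close> with the rational points of
  the cubic.\<close>

lemma algebra_character_bound:
  assumes "CHAR('f) \<noteq> 2" "CHAR('f) \<noteq> 3" "n \<noteq> 0" "s ^ 3 \<noteq> 27 * n"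
    and \<chi>: "hom_on units \<chi>" and t: "t dvd 1" "nm t = 1" "\<chi> t \<noteq> 1"
  shows "norm (\<Sum>x\<in>{x. x dvd 1 \<and> cubic_trace smul x = s \<and> nm x = n}. \<chi> x) \<le> 3 * sqrt (real CARD('f))"
proof -
  obtain e where "twisted_cubic CARD('f) e \<rho> (to_ac s) (to_ac n)"
    by (rule twisted_cubic_coordinates[OF assms(1-4)])
  then interpret T: twisted_cubic "CARD('f)" e \<rho> "to_ac s" "to_ac n" .
  have Fr: "T.Fr (crd x) = crd x" for x by (rule ext) (simp add: T.Fr_def crd_def flip: frob)
  have FrD: "\<exists>x. crd x = v" if "T.Fr v = v" for v
  proof -
    have "v a = v (\<rho> a) ^ CARD('f)" for a using fun_cong[OF that, of a] by (simp add: T.Fr_def)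
    hence "\<exists>x. \<forall>a. \<psi> a x = v a" by (rule onto)
    thus ?thesis by (simp add: crd_def fun_eq_iff)
  qed
  have UE: "\<exists>x\<in>units. v = crd x" if v: "v \<in> T.U" for v
  proof -
    obtain x where x: "crd x = v" using FrD[of v] v by (auto simp: T.U_def)
    hence "x dvd 1" using v by (auto simp: T.U_def unit_iff crd_def)
    thus ?thesis using x by auto
  qed
  define ch where "ch v = \<chi> (inv_into UNIV crd v)" for v
  have ch: "ch (crd x) = \<chi> x" for x by (simp add: ch_def inv_into_f_f[OF inj_crd])
  have one: "crd 1 = (\<lambda>_. 1)" by (simp add: crd_def fun_eq_iff psi)
  have vm: "crd (x * y) = T.vm (crd x) (crd y)" for x y by (simp add: crd_def fun_eq_iff psi T.vm_def)
  have "twisted_character CARD('f) e \<rho> (to_ac s) (to_ac n) ch"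
  proof (intro twisted_character.intro twisted_character_axioms.intro)
    show "twisted_cubic CARD('f) e \<rho> (to_ac s) (to_ac n)" by (rule T.twisted_cubic_axioms)
    show "ch (\<lambda>_. 1) = 1" using \<chi> ch[of 1] by (simp add: one hom_on_def)
    show "ch (T.vm u v) = ch u * ch v" if uv: "u \<in> T.U" "v \<in> T.U" for u v
    proof -
      obtain x y where xy: "x \<in> units" "u = crd x" "y \<in> units" "v = crd y" using UE[OF uv(1)] UE[OF uv(2)] by blast
      show ?thesis using \<chi> xy(1,3) unfolding xy(2,4) vm[symmetric] ch hom_on_def by blast
    qed
    have "crd t \<in> T.U" using t(1) Fr[of t] by (simp add: T.U_def unit_iff) (simp add: crd_def)
    moreover have "prod (crd t) UNIV = 1" using norm[of t] t(2) by (simp add: crd_def)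
    ultimately show "\<exists>t\<in>T.U. prod t UNIV = 1 \<and> ch t \<noteq> 1" using t(3) ch[of t] by auto
  qed
  then interpret W: twisted_character "CARD('f)" e \<rho> "to_ac s" "to_ac n" ch .
  define Y where "Y = {x. x dvd 1 \<and> cubic_trace smul x = s \<and> nm x = n}"
  have "bij_betw crd Y (T.Ck 1)"
  proof (rule bij_betw_imageI)
    show "inj_on crd Y" using inj_crd by (rule inj_on_subset) simp
    show "crd ` Y = T.Ck 1"
    proof (intro equalityI subsetI)
      fix v assume "v \<in> crd ` Y"
      then obtain x where x: "v = crd x" "cubic_trace smul x = s" "nm x = n" by (auto simp: Y_def)
      have "sum (crd x) UNIV = to_ac s" "prod (crd x) UNIV = to_ac n"
        using trace[of x] norm[of x] x by (simp_all add: crd_def)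
      thus "v \<in> T.Ck 1" using Fr[of x] by (simp add: T.Ck_def T.C_def x(1))
    next
      fix v assume v: "v \<in> T.Ck 1"
      obtain x where x: "crd x = v" using FrD[of v] v by (auto simp: T.Ck_def)
      have "sum (crd x) UNIV = to_ac s" "prod (crd x) UNIV = to_ac n" using v by (simp_all add: x T.Ck_def T.C_def)
      hence "to_ac (cubic_trace smul x) = to_ac s" "to_ac (nm x) = to_ac n" by (simp_all add: trace norm crd_def[abs_def])
      hence "cubic_trace smul x = s" "nm x = n" by (simp_all only: to_ac_eq_iff)
      hence "x \<in> Y" using assms(3) by (simp add: Y_def nm_unit)
      thus "v \<in> crd ` Y" using x by blast
    qed
  qed
  hence "(\<Sum>x\<in>Y. ch (crd x)) = (\<Sum>v\<in>T.Ck 1. ch v)" by (rule sum.reindex_bij_betw)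
  thus ?thesis using W.character_sum_weil_bound by (simp add: ch Y_def)
qed

lemma group_norm_one: "group (norm_one_group smul)"
proof (rule groupI)
  obtain N where N: "torsion_group N units" by (rule units_torsion)
  fix x assume x: "x \<in> carrier (norm_one_group smul)"
  have xu: "x \<in> units" "nm x = 1" using x by (auto simp: norm_one_group_def)
  have xN: "x ^ N = 1" "N > 0" using N xu(1) by (auto simp: torsion_group_def)
  have xinv: "x ^ (N - 1) * x = 1" using xN by (simp add: mult.commute[of _ x] flip: power_Suc)
  have "nm (x ^ (N - 1)) * nm x = 1" by (simp only: nm_mult[symmetric] xinv nm_1)
  hence "nm (x ^ (N - 1)) = 1" by (simp add: xu)
  hence "x ^ (N - 1) \<in> carrier (norm_one_group smul)" by (simp add: norm_one_group_def nm_unit)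
  thus "\<exists>y\<in>carrier (norm_one_group smul). y \<otimes>\<^bsub>norm_one_group smul\<^esub> x = \<one>\<^bsub>norm_one_group smul\<^esub>"
    using xinv by (auto simp: norm_one_group_def)
qed (auto simp: norm_one_group_def nm_unit nm_mult nm_1 mult.assoc)

text \<open>Multiplication by \<gamma> carries \<open>g H\<close> to \<open>a H\<close> with
  \<open>a = \<gamma> * g\<close>, inside the fibre of norm \<open>nm \<gamma>\<close>, which is the
  coset \<open>a T\<close>; so \<open>card_coset_error\<close> applies to the elements of trace
  \<open>s\<close> in that fibre.\<close>

theorem coset_error_bound:
  assumes ch: "CHAR('f) \<noteq> 2" "CHAR('f) \<noteq> 3" and H: "subgroup H (norm_one_group smul)"
    and m: "card (rcosets\<^bsub>norm_one_group smul\<^esub> H) = m"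
    and g: "g \<in> carrier (norm_one_group smul)" and \<gamma>: "\<gamma> dvd 1" and s: "s ^ 3 \<noteq> 27 * nm \<gamma>"
  shows "\<bar>coset_trace_error smul g H s \<gamma>\<bar> \<le> (1 - 1 / real m) * (3 * sqrt (real CARD('f)))" "m > 0"
proof -
  define T where "T = carrier (norm_one_group smul)"
  have Tiff: "x \<in> T \<longleftrightarrow> nm x = 1" for x by (auto simp: T_def norm_one_group_def nm_unit)
  obtain N where N: "torsion_group N units" by (rule units_torsion)
  have TU: "T \<subseteq> units" by (auto simp: Tiff nm_unit)
  have Tt: "torsion_group N T" using N TU by (auto simp: torsion_group_def Tiff nm_mult nm_1)
  have HT: "H \<subseteq> T" using subgroup.subset[OF H] by (simp add: T_def)
  have H1: "1 \<in> H" using subgroup.one_closed[OF H] by (simp add: norm_one_group_def)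
  have Hm: "x * y \<in> H" if "x \<in> H" "y \<in> H" for x y
    using subgroup.m_closed[OF H that] by (simp add: norm_one_group_def)
  have Ht: "torsion_group N H" using Tt HT H1 Hm by (auto simp: torsion_group_def)
  have fT: "finite T" using TU finite_units by (rule finite_subset)
  have lag: "card T = m * card H" using group.lagrange[OF group_norm_one H] m by (simp add: order_def T_def)
  have "card T > 0" using fT Tiff nm_1 by (auto simp: card_gt_0_iff)
  thus "m > 0" using lag by (cases m) auto
  define a where "a = \<gamma> * g"
  have gT: "nm g = 1" using g Tiff by (simp add: T_def)
  have na: "nm a = nm \<gamma>" by (simp add: a_def nm_mult gT)
  have n0: "nm \<gamma> \<noteq> 0" using \<gamma> by (simp add: nm_unit)
  have aU: "a \<in> units" using n0 na by (simp add: nm_unit)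
  define Y where "Y = {x. x dvd 1 \<and> cubic_trace smul x = s \<and> nm x = nm \<gamma>}"
  have YT: "x \<in> (\<lambda>t. a * t) ` T" if "x \<in> Y" for x
  proof -
    have aN: "a ^ N = 1" "N > 0" using N aU by (auto simp: torsion_group_def)
    have "a * (a ^ (N - 1) * x) = a ^ Suc (N - 1) * x" by (simp add: mult.assoc)
    hence x: "x = a * (a ^ (N - 1) * x)" using aN by simp
    have "nm \<gamma> * nm (a ^ (N - 1) * x) = nm (a * (a ^ (N - 1) * x))" by (simp only: nm_mult na)
    also have "\<dots> = nm \<gamma> * 1" unfolding x[symmetric] using that by (simp add: Y_def)
    finally have "nm \<gamma> * nm (a ^ (N - 1) * x) = nm \<gamma> * 1" .
    hence "nm (a ^ (N - 1) * x) = 1" by (rule mult_left_cancel[OF n0, THEN iffD1])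
    thus ?thesis using x Tiff by blast
  qed
  have bound: "norm (\<Sum>x\<in>Y. \<chi> x) \<le> 3 * sqrt (real CARD('f))" if \<chi>: "hom_on units \<chi>" "\<exists>t\<in>T. \<chi> t \<noteq> 1" for \<chi>
  proof -
    obtain t where "t \<in> T" "\<chi> t \<noteq> 1" using \<chi>(2) by blast
    thus ?thesis unfolding Y_def using algebra_character_bound[OF ch n0 s \<chi>(1), of t] TU Tiff by auto
  qed
  have main: "\<bar>real (card (Y \<inter> (\<lambda>h. a * h) ` H)) - 1 / real m * real (card Y)\<bar> \<le> (1 - 1 / real m) * (3 * sqrt (real CARD('f)))"
    by (rule card_coset_error[OF N finite_units Tt TU Ht HT aU YT bound lag])
  have lc: "g <#\<^bsub>norm_one_group smul\<^esub> H = (\<lambda>h. g * h) ` H" by (auto simp: l_coset_def norm_one_group_def)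
  have "bij_betw (\<lambda>h. \<gamma> * h) {h \<in> (\<lambda>h. g * h) ` H. cubic_trace smul (\<gamma> * h) = s} (Y \<inter> (\<lambda>h. a * h) ` H)"
  proof (rule bij_betw_imageI)
    show "inj_on (\<lambda>h. \<gamma> * h) {h \<in> (\<lambda>h. g * h) ` H. cubic_trace smul (\<gamma> * h) = s}"
    proof (rule inj_onI)
      fix x y assume "\<gamma> * x = \<gamma> * y"
      hence "x * \<gamma> = y * \<gamma>" by (simp add: mult.commute)
      moreover have "\<gamma> ^ N = 1" "N > 0" using N \<gamma> by (auto simp: torsion_group_def)
      ultimately show "x = y" using torsion_cancel by blast
    qed
    show "(\<lambda>h. \<gamma> * h) ` {h \<in> (\<lambda>h. g * h) ` H. cubic_trace smul (\<gamma> * h) = s} = Y \<inter> (\<lambda>h. a * h) ` H"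
    proof (intro equalityI subsetI)
      fix x assume "x \<in> (\<lambda>h. \<gamma> * h) ` {h \<in> (\<lambda>h. g * h) ` H. cubic_trace smul (\<gamma> * h) = s}"
      then obtain h where h: "h \<in> H" "x = \<gamma> * (g * h)" "cubic_trace smul x = s" by blast
      have x: "x = a * h" by (simp only: h(2) a_def mult.assoc)
      have "nm h = 1" using h(1) HT Tiff by blast
      hence "nm x = nm \<gamma>" by (simp add: x nm_mult na)
      hence "x \<in> Y" using h(3) n0 by (simp add: Y_def nm_unit)
      thus "x \<in> Y \<inter> (\<lambda>h. a * h) ` H" using x h(1) by blast
    next
      fix x assume "x \<in> Y \<inter> (\<lambda>h. a * h) ` H"
      then obtain h where h: "h \<in> H" "x = a * h" "x \<in> Y" by blast
      have x: "x = \<gamma> * (g * h)" by (simp only: h(2) a_def mult.assoc)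
      have "cubic_trace smul (\<gamma> * (g * h)) = s" using h(3) unfolding x by (simp add: Y_def)
      thus "x \<in> (\<lambda>h. \<gamma> * h) ` {h \<in> (\<lambda>h. g * h) ` H. cubic_trace smul (\<gamma> * h) = s}" using x h(1) by blast
    qed
  qed
  hence "card {h \<in> (\<lambda>h. g * h) ` H. cubic_trace smul (\<gamma> * h) = s} = card (Y \<inter> (\<lambda>h. a * h) ` H)"
    by (rule bij_betw_same_card)
  thus "\<bar>coset_trace_error smul g H s \<gamma>\<bar> \<le> (1 - 1 / real m) * (3 * sqrt (real CARD('f)))"
    using main unfolding coset_trace_error_def coset_trace_count_def trace_norm_count_def lc m Y_def by simp
qed

end

lemma (in etale_cubic) etale_coordinates_exist: "\<exists>\<psi> \<rho>. etale_coordinates smul \<psi> \<rho>"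
  unfolding etale_coordinates_def etale_coordinates_axioms_def using coordinates_exist etale_cubic_axioms
  by (elim exE conjE) (intro exI conjI, assumption+)

theorem theorem5p8:
  fixes smul :: "'f::{field,finite} \<Rightarrow> 'b::comm_ring_1 \<Rightarrow> 'b"
    and H :: "'b set" and m :: nat and g \<gamma> :: 'b and s :: 'f
  assumes "CHAR('f) \<noteq> 2" and "CHAR('f) \<noteq> 3"
    and "finite_etale_cubic_algebra smul"
    and "subgroup H (norm_one_group smul)"
    and "card (rcosets\<^bsub>norm_one_group smul\<^esub> H) = m"
    and "g \<in> carrier (norm_one_group smul)"
    and "\<gamma> dvd 1"
    and "s ^ 3 \<noteq> 27 * cubic_norm smul \<gamma>"
  shows "real (coset_trace_count smul (g <#\<^bsub>norm_one_group smul\<^esub> H) s \<gamma>)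
        = 1 / real m * real (trace_norm_count smul s (cubic_norm smul \<gamma>))
          + coset_trace_error smul g H s \<gamma>
      \<and> \<bar>coset_trace_error smul g H s \<gamma>\<bar> \<le> 3 * (1 - 1 / real m) * sqrt (real CARD('f))
      \<and> 3 * (1 - 1 / real m) * sqrt (real CARD('f)) < 3 * sqrt (real CARD('f))"
proof -
  interpret etale_cubic smul by (rule etale_cubic.intro[OF assms(3)])
  obtain \<psi> \<rho> where "etale_coordinates smul \<psi> \<rho>" using etale_coordinates_exist by blast
  then interpret etale_coordinates smul \<psi> \<rho> .
  note E = coset_error_bound[OF assms(1,2,4-8)]
  show ?thesis
  proof (intro conjI)
    show "real (coset_trace_count smul (g <#\<^bsub>norm_one_group smul\<^esub> H) s \<gamma>)
        = 1 / real m * real (trace_norm_count smul s (cubic_norm smul \<gamma>)) + coset_trace_error smul g H s \<gamma>"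
      unfolding coset_trace_error_def assms(5) by simp
    show "\<bar>coset_trace_error smul g H s \<gamma>\<bar> \<le> 3 * (1 - 1 / real m) * sqrt (real CARD('f))"
      using E(1) by (simp only: mult_ac)
    \<comment> \<open>Strictness rests on \<open>m > 0\<close>: for \<open>m = 0\<close> the value
      of \<open>1 / real m\<close> is 0 and both sides coincide.\<close>
    show "3 * (1 - 1 / real m) * sqrt (real CARD('f)) < 3 * sqrt (real CARD('f))"
      using E(2) by (simp add: field_simps)
  qed
qed

end
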